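(* Let $d>2n-3$ and let $p_t\in\mathscr{C}^{d-1,1}(I,H_{n,d})$, $I=[0,1]$, be a curve with $p_t\neq0$ and $[p_t]\notin F_{n,d}$ for every $t\in I$. Then for every $1\le q<d/(d-1)$, the curve $\mu_t:=\mu([p_t])$ belongs to $AC^q(I;(\mathscr{P}(\mathbb{C}\mathrm{P}^n),W_q))$.
   Context: $H_{n,d}$: complex homogeneous polynomials of degree $d$ in $z_0,\dots,z_n$; $P_{n,d}$ its projectivization. $\mathscr{C}^{k,1}(I,H_{n,d})$: $k$ times differentiable curves with Lipschitz $k$-th derivative. $\mathbb{G}(1,n)=G(2,n+1)$ is the Grassmannian of projective lines in $\mathbb{C}\mathrm{P}^n$; $\tau$ its tautological rank-2 bundle and $E=\mathrm{Sym}^d(\tau^* )$, whose fiber over $L$ is the space of degree-$d$ homogeneous polynomials on $L$. Each $p\in H_{n,d}$ gives a section $\sigma_p(L)=p|_L$ of $E$. The Fano discriminant $F_{n,d}\subset P_{n,d}$ is the set of $[p]$ such that $\sigma_p$ is not transverse to the zero section of $E$. $\mu:P_{n,d}\to\mathscr{P}(\mathbb{C}\mathrm{P}^n)$ is given by $\int f\,\mathrm{d}\mu(p)=\frac1d\int_{\mathbb{G}(1,n)}\sum_{z\in Z(p)\cap\ell}m_z(p|_\ell)f(z)\,\mathrm{vol}_{\mathbb{G}(1,n)}(\mathrm{d}\ell)$ ($U(n+1)$-invariant probability on $\mathbb{G}(1,n)$, $m_z$ the multiplicity of $z$ as zero of $p|_\ell$). $W_q$ is the $q$-Wasserstein distance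 with Fubini–Study cost. A curve in a metric space $(X,\mathsf d)$ is in $AC^q(I;X)$ if there is $m\in L^q(I)$ with $\mathsf d(x_s,x_t)\le\int_s^tm(\tau)\,\mathrm{d}\tau$ for all $s\le t$. *)

theory Defs
  imports "HOL-Probability.Probability" "HOL-Computational_Algebra.Polynomial"
begin

text \<open>Points of C^(n+1) are vectors of type complex^'n, with n+1 = CARD('n).
  A homogeneous polynomial of degree d is given by its coefficients on the
  monomials z^alpha with |alpha| = d.\<close>

definition monoms :: "nat \<Rightarrow> ('n::finite \<Rightarrow> nat) set" where
  "monoms d = {\<alpha>. (\<Sum>i\<in>UNIV. \<alpha> i) = d}"

definition hpoly :: "nat \<Rightarrow> (('n::finite \<Rightarrow> nat) \<Rightarrow> complex) \<Rightarrow> complex^'n \<Rightarrow> complex" where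
  "hpoly d c z = (\<Sum>\<alpha>\<in>monoms d. c \<alpha> * (\<Prod>i\<in>UNIV. (z$i) ^ (\<alpha> i)))"

definition dir_deriv :: "nat \<Rightarrow> (('n::finite \<Rightarrow> nat) \<Rightarrow> complex) \<Rightarrow> complex^'n \<Rightarrow> complex^'n \<Rightarrow> complex" where
  "dir_deriv d c x w = deriv (\<lambda>e. hpoly d c (x + e *s w)) 0"

definition lin_indep2 :: "complex^'n \<Rightarrow> complex^'n \<Rightarrow> bool" where
  "lin_indep2 a b \<longleftrightarrow> (\<forall>\<alpha> \<beta>. \<alpha> *s a + \<beta> *s b = 0 \<longrightarrow> \<alpha> = 0 \<and> \<beta> = 0)"

text \<open>Fano discriminant: the section L \<mapsto> p|_L of Sym^d(tau^*) is not transverse to the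
  zero section, i.e. there is a line L = span(a,b) with p|_L = 0 at which the differential
  (u,v) \<mapsto> ((s,t) \<mapsto> Dp(sa+tb)[su+tv]) (tangent vectors of G(2,n+1) at L being represented
  by the motions (a,b) \<mapsto> (a+eu,b+ev)) does not hit every binary form of degree d.\<close>
definition fano_disc :: "nat \<Rightarrow> (('n::finite \<Rightarrow> nat) \<Rightarrow> complex) \<Rightarrow> bool" where
  "fano_disc d c \<longleftrightarrow> (\<exists>a b::complex^'n. lin_indep2 a b \<and>
     (\<forall>s t. hpoly d c (s *s a + t *s b) = 0) \<and>
     \<not> (\<forall>k\<le>d. \<exists>u v. \<forall>s t. dir_deriv d c (s *s a + t *s b) (s *s u + t *s v) = s ^ k * t ^ (d - k)))"

text \<open>Embedding of CP^n into complex matrices: [v] \<mapsto> orthogonal projector onto C v.\<close>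
definition proj :: "complex^'n \<Rightarrow> complex^'n^'n" where
  "proj v = (\<chi> i j. v$i * cnj (v$j) / of_real ((norm v)\<^sup>2))"

text \<open>Fubini--Study distance: arccos(|<u,v>|/(|u||v|)) expressed on projectors.\<close>
definition fs_dist :: "complex^'n^'n \<Rightarrow> complex^'n^'n \<Rightarrow> real" where
  "fs_dist P Q = arccos (sqrt (Re (\<Sum>i\<in>UNIV. \<Sum>j\<in>UNIV. P$i$j * Q$j$i)))"

definition line_poly :: "nat \<Rightarrow> (('n::finite \<Rightarrow> nat) \<Rightarrow> complex) \<Rightarrow> complex^'n \<Rightarrow> complex^'n \<Rightarrow> complex poly" where
  "line_poly d c a b = (THE h. \<forall>s. poly h s = hpoly d c (s *s a + b))"

text \<open>Sum over zeros z of p on the line span(a,b), with multiplicity, of f(z); the point at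
  infinity [a] of the chart has multiplicity d - degree.\<close>
definition zsum :: "nat \<Rightarrow> (('n::finite \<Rightarrow> nat) \<Rightarrow> complex) \<Rightarrow> complex^'n \<Rightarrow> complex^'n
    \<Rightarrow> (complex^'n^'n \<Rightarrow> ennreal) \<Rightarrow> ennreal" where
  "zsum d c a b f = (let h = line_poly d c a b in
     if h = 0 then 0 else
       (\<Sum>s0\<in>{x. poly h x = 0}. of_nat (order s0 h) * f (proj (s0 *s a + b)))
       + of_nat (d - degree h) * f (proj a))"

text \<open>Standard complex Gaussian on C^(n+1); the law of span(a,b) for a,b independent
  Gaussians is the U(n+1)-invariant probability on the Grassmannian.\<close>
definition gauss :: "(complex^'n::finite) measure" where
  "gauss = density lborel (\<lambda>v. ennreal (exp (- (norm v)\<^sup>2) / pi ^ CARD('n)))"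

definition mu_p :: "nat \<Rightarrow> (('n::finite \<Rightarrow> nat) \<Rightarrow> complex) \<Rightarrow> (complex^'n^'n) measure" where
  "mu_p d c = measure_of UNIV (sets borel)
     (\<lambda>A. ennreal (1 / real d) * (\<integral>\<^sup>+ ab. zsum d c (fst ab) (snd ab) (indicator A) \<partial>(gauss \<Otimes>\<^sub>M gauss)))"

definition couplings :: "'a::topological_space measure \<Rightarrow> 'a measure \<Rightarrow> ('a \<times> 'a) measure set" where
  "couplings \<mu> \<nu> = {\<gamma>. prob_space \<gamma> \<and> sets \<gamma> = sets (borel \<Otimes>\<^sub>M borel)
      \<and> distr \<gamma> borel fst = \<mu> \<and> distr \<gamma> borel snd = \<nu>}"

definition Wq :: "real \<Rightarrow> (complex^'n^'n) measure \<Rightarrow> (complex^'n^'n) measure \<Rightarrow> real" where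
  "Wq q \<mu> \<nu> = (enn2real (INF \<gamma>\<in>couplings \<mu> \<nu>.
      \<integral>\<^sup>+ xy. ennreal (fs_dist (fst xy) (snd xy) powr q) \<partial>\<gamma>)) powr (1 / q)"

definition AC_q :: "real \<Rightarrow> ('a \<Rightarrow> 'a \<Rightarrow> real) \<Rightarrow> (real \<Rightarrow> 'a) \<Rightarrow> bool" where
  "AC_q q dist' x \<longleftrightarrow> (\<exists>m::real \<Rightarrow> real. m \<in> borel_measurable lborel
     \<and> set_integrable lborel {0..1} (\<lambda>t. \<bar>m t\<bar> powr q)
     \<and> (\<forall>s t. 0 \<le> s \<longrightarrow> s \<le> t \<longrightarrow> t \<le> 1 \<longrightarrow> dist' (x s) (x t) \<le> (LBINT \<tau>=s..t. m \<tau>)))"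

definition Ck1_on :: "nat \<Rightarrow> real set \<Rightarrow> (real \<Rightarrow> complex) \<Rightarrow> bool" where
  "Ck1_on k I f \<longleftrightarrow> (\<exists>D::nat \<Rightarrow> real \<Rightarrow> complex. (\<forall>t\<in>I. D 0 t = f t)
     \<and> (\<forall>j<k. \<forall>t\<in>I. (D j has_vector_derivative D (Suc j) t) (at t within I))
     \<and> (\<exists>L. \<forall>s\<in>I. \<forall>t\<in>I. norm (D k s - D k t) \<le> L * \<bar>s - t\<bar>))"

end

theory Submission
  imports Defs "HOL-Computational_Algebra.Computational_Algebra"
begin

text \<open>Idea. The core is a bound for the roots of monic polynomials of degree m whose coefficients are
  of class C^(m-1,1) in time: if q(m - 1) < m, the sum over i < k of the q-th powers of the matching
  distances between the roots at times i/k and (i+1)/k is O(k^(1-q)), with constants depending on the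
  coefficients only through their norms. It is proved by induction on m and, for fixed m, on k. After
  centring the roots and rescaling, time is cut into N windows. On a window where at each time some
  coefficient is large, the roots fall into two separated clusters; their polynomials inherit the
  regularity of the coefficients by Hensel lifting, so smaller m applies. The other windows number at
  most 5m, and on each of them division of the roots by zeta ~ N^(-1/m) leads back to a normalised
  problem with fewer samples. Their total contribution is the bound itself times O(N^(q-1-q/m)),
  which is at most 1/2 for large N precisely because q(m - 1) < m.

  Since d > 2n - 3, a form outside the Fano discriminant vanishes on no line. By compactness every
  line then has an affine chart, taken from a finite family, in which the leading coefficient of the
  restricted form is bounded below; hence the root bound is uniform over all lines and times.
  Matching the zeros on each line optimally, in a measurable way, couples the measures, and
  integration over lines bounds the energies of the curve at dyadic times for some exponent q1 > q.
  A dyadic maximal function turns such a bound into absolute continuity with a speed in L^q.\<close>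

section \<open>The matching distance of finite multisets\<close>

text \<open>No continuous labelling of the roots is chosen; only unordered matchings of successive
  samples occur. Samples also make the descent finite: zooming into windows where all coefficients
  are small need not stop for a curve, but each window has fewer samples than the whole. The scale
  zeta comes from the weights. On a window of length 1/N every coefficient varies by O(1/N), and
  this is at most zeta^j for all weights j \<le> m once zeta^m has that order. The smoothness class
  survives the zoom because restriction gains the m-th power of the window length in the Taylor
  error, which pays for the division by zeta^j. Bad windows are few because a coefficient that is
  large somewhere is close to a polynomial in time of degree below m, which is small only near its
  roots. The target k^(1-q) is what a curve with speed in L^q produces: k steps of size about 1/k.
  For d > 2n - 3 the rank d + 1 of Sym^d exceeds dim G(1,n) = 2n - 2, so the section cannot be
  transverse at a line contained in the hypersurface. The exponent q1 > q is needed since the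
  maximal function of a q1-energy is controlled in weak L^(q1) only.\<close>

abbreviation matched :: "real \<Rightarrow> 'a::metric_space multiset \<Rightarrow> 'a multiset \<Rightarrow> bool" where
  "matched r \<equiv> rel_mset (\<lambda>x y. dist x y \<le> r)"

text \<open>The bottleneck (infinity-Wasserstein) distance between unlabelled points. For different
  sizes the set is empty and its \<open>Inf\<close> carries no information, whence the size
  hypotheses throughout.\<close>

definition matchd :: "'a::metric_space multiset \<Rightarrow> 'a multiset \<Rightarrow> real" where
  "matchd A B = Inf {r. 0 \<le> r \<and> matched r A B}"

lemma rel_mset_add:
  assumes "rel_mset R A B" "rel_mset R A' B'"
  shows "rel_mset R (A + A') (B + B')"
  using assms
proof (induction A arbitrary: B)
  case empty
  then show ?case by simp
next
  case (add x A)
  from msed_rel_invL[OF add.prems(1)] obtain B1 b where "B = add_mset b B1" "R x b" "rel_mset R A B1"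
    by blast
  with add show ?case by (auto intro: rel_mset_Plus)
qed

text \<open>Serves to carry a decomposition of the roots into clusters from one time to a nearby
  one.\<close>

lemma rel_mset_splitL:
  assumes "rel_mset R (A + A') C"
  shows "\<exists>B B'. C = B + B' \<and> rel_mset R A B \<and> rel_mset R A' B'"
  using assms
proof (induction A arbitrary: C)
  case empty
  then show ?case by (intro exI[of _ "{#}"] exI[of _ C]) (auto simp: rel_mset_Zero)
next
  case (add x A)
  then have "rel_mset R (add_mset x (A + A')) C" by simp
  from msed_rel_invL[OF this] obtain C1 b where C: "C = add_mset b C1" "R x b" "rel_mset R (A + A') C1"
    by blast
  from add.IH[OF C(3)] obtain B B' where "C1 = B + B'" "rel_mset R A B" "rel_mset R A' B'"
    by blast
  with C show ?case
    by (intro exI[of _ "add_mset b B"] exI[of _ B']) (auto intro: rel_mset_Plus)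
qed

lemma rel_mset_all:
  assumes "size A = size B" "\<And>x y. x \<in># A \<Longrightarrow> y \<in># B \<Longrightarrow> R x y"
  shows "rel_mset R A B"
proof -
  obtain xs ys where xs: "mset xs = A" and ys: "mset ys = B" using ex_mset by metis
  have "list_all2 R xs ys"
    unfolding list_all2_conv_all_nth using assms xs ys by (auto simp flip: size_mset)
  with xs ys show ?thesis unfolding rel_mset_def by blast
qed

lemma rel_mset_strengthen:
  assumes "rel_mset R A B" "\<And>x y. x \<in># A \<Longrightarrow> y \<in># B \<Longrightarrow> R x y \<Longrightarrow> S x y"
  shows "rel_mset S A B"
  using assms multiset.rel_mono_strong by blast

lemma matched_mono: "matched r A B \<Longrightarrow> r \<le> s \<Longrightarrow> matched s A B"
  by (erule rel_mset_strengthen) auto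

lemma matched_trans:
  assumes "matched r A B" "matched s B C"
  shows "matched (r + s) A C"
proof -
  have "rel_mset ((\<lambda>x y. dist x y \<le> r) OO (\<lambda>x y. dist x y \<le> s)) A C"
    using assms unfolding multiset.rel_compp by blast
  then show ?thesis
    by (rule rel_mset_strengthen) (auto simp: OO_def, smt (verit) dist_triangle)
qed

lemma matched_exists:
  assumes "size A = size B"
  shows "\<exists>r\<ge>0. matched r A B"
proof -
  define S where "S = (\<lambda>(x,y). dist x y) ` (set_mset A \<times> set_mset B)"
  have fin: "finite (insert 0 S)" unfolding S_def by auto
  have "matched (Max (insert 0 S)) A B"
    using assms by (intro rel_mset_all Max_ge[OF fin]) (auto simp: S_def)
  moreover have "0 \<le> Max (insert 0 S)" by (rule Max_ge[OF fin]) auto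
  ultimately show ?thesis by blast
qed

lemma matchd_nonneg: "size A = size B \<Longrightarrow> 0 \<le> matchd A B"
  unfolding matchd_def by (rule cInf_greatest) (use matched_exists[of A B] in auto)

lemma matchd_le: "0 \<le> r \<Longrightarrow> matched r A B \<Longrightarrow> matchd A B \<le> r"
  unfolding matchd_def by (rule cInf_lower) (auto intro: bdd_belowI[of _ 0])

lemma matchd_matched:
  assumes "size A = size B" "matchd A B < r"
  shows "matched r A B"
proof -
  have "{r. 0 \<le> r \<and> matched r A B} \<noteq> {}" using matched_exists[OF assms(1)] by auto
  from cInf_lessD[OF this assms(2)[unfolded matchd_def]] show ?thesis
    by (auto intro: matched_mono)
qed

lemma matchd_le_all:
  assumes "size A = size B" "0 \<le> r" "\<And>x y. x \<in># A \<Longrightarrow> y \<in># B \<Longrightarrow> dist x y \<le> r"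
  shows "matchd A B \<le> r"
  using assms by (intro matchd_le rel_mset_all) auto

lemma matchd_triangle:
  assumes "size A = size B" "size B = size C"
  shows "matchd A C \<le> matchd A B + matchd B C"
proof (rule field_le_epsilon)
  fix e :: real assume e: "0 < e"
  have "matched (matchd A B + e/2) A B" "matched (matchd B C + e/2) B C"
    using assms e by (auto intro!: matchd_matched)
  from matched_trans[OF this] have "matched (matchd A B + matchd B C + e) A C"
    by (simp add: algebra_simps)
  then show "matchd A C \<le> matchd A B + matchd B C + e"
    using matchd_nonneg[OF assms(1)] matchd_nonneg[OF assms(2)] e by (intro matchd_le) auto
qed

lemma matchd_image:
  assumes "size A = size B" "0 \<le> c" "0 \<le> e"
    and "\<And>x y. x \<in># A \<Longrightarrow> y \<in># B \<Longrightarrow> dist (f x) (g y) \<le> c * dist x y + e"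
  shows "matchd (image_mset f A) (image_mset g B) \<le> c * matchd A B + e"
proof (rule field_le_epsilon)
  fix d :: real assume d: "0 < d"
  \<comment> \<open>The denominator is \<open>c + 1\<close> because \<open>c\<close> may vanish;
    multiplied by \<open>c\<close>, the excess is still at most \<open>d\<close>.\<close>
  define r where "r = matchd A B + d / (c + 1)"
  have "d / (c + 1) > 0" using d assms(2) by simp
  then have "matched r A B" and r0: "0 \<le> r" using matchd_nonneg[OF assms(1)] assms(1)
    by (auto intro!: matchd_matched simp: r_def)
  have "matched (c * r + e) (image_mset f A) (image_mset g B)"
    unfolding multiset.rel_map
    by (rule rel_mset_strengthen[OF \<open>matched r A B\<close>])
      (use assms(4) in \<open>smt (verit) assms(2) mult_left_mono\<close>)
  then have "matchd (image_mset f A) (image_mset g B) \<le> c * r + e"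
    using r0 assms by (intro matchd_le) auto
  also have "c * r \<le> c * matchd A B + d"
    using d assms(2) by (simp add: r_def field_simps)
  finally show "matchd (image_mset f A) (image_mset g B) \<le> c * matchd A B + e + d" by simp
qed

lemma matchd_scale:
  fixes A B :: "'a::real_normed_field multiset"
  assumes "size A = size B"
  shows "matchd (image_mset ((*) c) A) (image_mset ((*) c) B) \<le> norm c * matchd A B"
  using matchd_image[OF assms, of "norm c" 0 "(*) c" "(*) c"]
  by (simp add: dist_norm flip: right_diff_distrib norm_mult)

lemma matchd_union:
  assumes "size A = size B" "size A' = size B'"
  shows "matchd (A + A') (B + B') \<le> max (matchd A B) (matchd A' B')"
proof (rule field_le_epsilon)
  fix e :: real assume e: "0 < e"
  let ?r = "max (matchd A B) (matchd A' B') + e"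
  have "matched ?r A B" "matched ?r A' B'"
    using assms e by (auto intro!: matchd_matched)
  from rel_mset_add[OF this] show "matchd (A + A') (B + B') \<le> ?r"
    using matchd_nonneg[OF assms(1)] e by (intro matchd_le) auto
qed

section \<open>Coefficient norm and polynomials with prescribed roots\<close>

text \<open>The l1 norm of the coefficients: it is submultiplicative and dominates the values on the
  closed unit disc.\<close>

definition pnorm :: "complex poly \<Rightarrow> real" where
  "pnorm p = (\<Sum>i\<le>degree p. norm (coeff p i))"

lemma pnorm_eq: "degree p \<le> n \<Longrightarrow> pnorm p = (\<Sum>i\<le>n. norm (coeff p i))"
  unfolding pnorm_def by (rule sum.mono_neutral_left) (auto intro: coeff_eq_0)

lemma pnorm_nonneg [simp]: "0 \<le> pnorm p"
  unfolding pnorm_def by (simp add: sum_nonneg)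

lemma pnorm_0 [simp]: "pnorm 0 = 0"
  by (simp add: pnorm_def)

lemma coeff_le_pnorm: "norm (coeff p i) \<le> pnorm p"
  unfolding pnorm_eq[of p "max i (degree p)", OF max.cobounded2]
  by (rule member_le_sum) auto

lemma pnorm_le:
  assumes "degree p \<le> n" "\<And>i. i \<le> n \<Longrightarrow> norm (coeff p i) \<le> c"
  shows "pnorm p \<le> (n + 1) * c"
  unfolding pnorm_eq[OF assms(1)] using sum_bounded_above[of "{..n}" "\<lambda>i. norm (coeff p i)" c] assms(2)
  by (simp add: add.commute)

lemma pnorm_add: "pnorm (p + q) \<le> pnorm p + pnorm q"
proof -
  let ?n = "max (degree p) (degree q)"
  have "pnorm (p + q) = (\<Sum>i\<le>?n. norm (coeff p i + coeff q i))"
    by (subst pnorm_eq[OF degree_add_le_max]) simp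
  also have "\<dots> \<le> (\<Sum>i\<le>?n. norm (coeff p i) + norm (coeff q i))"
    by (intro sum_mono norm_triangle_ineq)
  also have "\<dots> = pnorm p + pnorm q"
    by (simp add: sum.distrib pnorm_eq[of p ?n] pnorm_eq[of q ?n])
  finally show ?thesis .
qed

lemma pnorm_minus [simp]: "pnorm (- p) = pnorm p"
  by (simp add: pnorm_def)

lemma pnorm_diff: "pnorm (p - q) \<le> pnorm p + pnorm q"
  using pnorm_add[of p "- q"] by simp

lemma pnorm_diff_commute: "pnorm (p - q) = pnorm (q - p)"
  using pnorm_minus[of "p - q"] by simp

lemma pnorm_smult: "pnorm (smult c p) = norm c * pnorm p"
  by (simp add: pnorm_eq[OF degree_smult_le] pnorm_def norm_mult sum_distrib_left)

lemma pnorm_pCons: "pnorm (pCons a p) = norm a + pnorm p"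
  by (simp add: pnorm_eq[OF degree_pCons_le] pnorm_def sum.atMost_Suc_shift del: sum.atMost_Suc)

lemma pnorm_mult: "pnorm (p * q) \<le> pnorm p * pnorm q"
proof (induction p)
  case 0
  then show ?case by simp
next
  case (pCons a p)
  have "pnorm (pCons a p * q) \<le> pnorm (smult a q) + pnorm (pCons 0 (p * q))"
    by (simp add: pnorm_add)
  also have "\<dots> \<le> pnorm (pCons a p) * pnorm q"
    using pCons by (simp add: pnorm_smult pnorm_pCons algebra_simps)
  finally show ?case .
qed

lemma pnorm_1 [simp]: "pnorm 1 = 1"
  by (simp add: pnorm_def)

lemma pnorm_sum: "pnorm (sum f S) \<le> (\<Sum>i\<in>S. pnorm (f i))"
  by (induction S rule: infinite_finite_induct)
    (auto intro: order_trans[OF pnorm_add])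

lemma norm_poly_le:
  assumes "norm x \<le> B" "1 \<le> B" "degree p \<le> n"
  shows "norm (poly p x) \<le> pnorm p * B ^ n"
proof -
  have "norm (poly p x) \<le> (\<Sum>i\<le>n. norm (coeff p i * x ^ i))"
    unfolding poly_altdef
    by (rule order_trans[OF norm_sum sum_mono2]) (use assms in auto)
  also have "\<dots> \<le> (\<Sum>i\<le>n. norm (coeff p i) * B ^ n)"
    using assms
    by (intro sum_mono) (auto simp: norm_mult norm_power intro!: mult_left_mono
        order_trans[OF power_mono[of "norm x" B] power_increasing])
  also have "\<dots> = pnorm p * B ^ n"
    by (simp add: pnorm_eq[OF assms(3)] sum_distrib_right)
  finally show ?thesis .
qed

lemma norm_poly_le_pnorm: "norm x \<le> 1 \<Longrightarrow> norm (poly p x) \<le> pnorm p"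
  using norm_poly_le[of x 1 p "degree p"] by simp

text \<open>Synthetic division read from the top: a coefficient of \<open>s\<close> is one of
  \<open>p\<close> plus \<open>b\<close> times the next higher one of \<open>s\<close>, so each step
  multiplies the bound by at most \<open>1 + B\<close>.\<close>

lemma pnorm_div_root:
  assumes p: "p = [:- b, 1:] * s" and b: "norm b \<le> B" and n: "degree p \<le> n"
  shows "pnorm s \<le> (n + 1) * (1 + B) ^ n * pnorm p"
proof -
  have B: "0 \<le> B" using b norm_ge_zero order_trans by blast
  have rec: "coeff s i = coeff p (Suc i) + b * coeff s (Suc i)" for i
    by (simp add: p)
  have ind: "degree s \<le> i + j \<Longrightarrow> norm (coeff s i) \<le> pnorm p * (1 + B) ^ j" for i j
  proof (induction j arbitrary: i)
    case 0
    then have "coeff s (Suc i) = 0" by (intro coeff_eq_0) auto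
    then show ?case using coeff_le_pnorm[of p "Suc i"] by (subst rec) simp
  next
    case (Suc j)
    have "norm (coeff s i) \<le> norm (coeff p (Suc i)) + norm b * norm (coeff s (Suc i))"
      by (subst rec) (metis norm_mult norm_triangle_ineq)
    also have "\<dots> \<le> pnorm p * (1 + B) ^ j + B * (pnorm p * (1 + B) ^ j)"
    proof (intro add_mono mult_mono)
      show "norm (coeff p (Suc i)) \<le> pnorm p * (1 + B) ^ j"
        using coeff_le_pnorm[of p "Suc i"] mult_left_mono[of 1 "(1+B)^j" "pnorm p"] one_le_power[of "1+B" j] B
        by simp
      show "norm (coeff s (Suc i)) \<le> pnorm p * (1 + B) ^ j" by (rule Suc.IH) (use Suc.prems in simp)
    qed (use b B in auto)
    also have "\<dots> = pnorm p * (1 + B) ^ Suc j" by (simp add: algebra_simps)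
    finally show ?case .
  qed
  have "degree s \<le> n"
  proof (cases "s = 0")
    case False
    then have "degree p = Suc (degree s)" unfolding p by (subst degree_mult_eq) auto
    with n show ?thesis by simp
  qed simp
  then have "pnorm s \<le> (n + 1) * (pnorm p * (1 + B) ^ n)"
    using pnorm_le[of s n "pnorm p * (1 + B) ^ n"] ind[of _ n] by (simp add: add.commute)
  then show ?thesis by (simp add: algebra_simps)
qed

section \<open>Monic polynomials with prescribed roots, root bounds, Bezout identities\<close>

definition rpoly :: "complex multiset \<Rightarrow> complex poly" where
  "rpoly A = (\<Prod>x\<in>#A. [:- x, 1:])"

lemma rpoly_empty [simp]: "rpoly {#} = 1"
  by (simp add: rpoly_def)

lemma rpoly_add_mset [simp]: "rpoly (add_mset x A) = [:- x, 1:] * rpoly A"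
  by (simp add: rpoly_def)

lemma rpoly_union: "rpoly (A + B) = rpoly A * rpoly B"
  by (simp add: rpoly_def)

lemma rpoly_nz [simp]: "rpoly A \<noteq> 0"
  by (auto simp: rpoly_def prod_mset_zero_iff)

lemma degree_rpoly [simp]: "degree (rpoly A) = size A"
  by (induction A) (auto simp: degree_mult_eq simp del: mult_pCons_left)

lemma coeff_rpoly_size [simp]: "coeff (rpoly A) (size A) = 1"
proof -
  have "lead_coeff (rpoly A) = 1"
    by (induction A) (auto simp: lead_coeff_mult simp del: mult_pCons_left degree_rpoly)
  then show ?thesis by simp
qed

lemma poly_rpoly_eq_0_iff [simp]: "poly (rpoly A) x = 0 \<longleftrightarrow> x \<in># A"
  by (induction A) auto

lemma proots_rpoly [simp]: "proots (rpoly A) = A"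
proof (induction A)
  case (add x A)
  have "proots (rpoly (add_mset x A)) = proots [:- x, 1:] + proots (rpoly A)"
    unfolding rpoly_add_mset by (rule proots_mult) auto
  with add show ?case by simp
qed simp

lemma smult_rpoly_proots: "p = smult (lead_coeff p) (rpoly (proots p))"
proof (cases "p = 0")
  case False
  have "\<exists>A. size A = degree p \<and> p = smult (lead_coeff p) (\<Prod>x\<in>#A. [:- x, 1:])"
    using alg_closed_imp_factorization[OF False] by blast
  then obtain A where A: "p = smult (lead_coeff p) (rpoly A)" unfolding rpoly_def by blast
  have "proots p = A"
    using False by (subst A) simp
  with A show ?thesis by simp
qed simp

lemma pnorm_rpoly:
  assumes "\<And>x. x \<in># A \<Longrightarrow> norm x \<le> B"
  shows "pnorm (rpoly A) \<le> (1 + B) ^ size A"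
  using assms
proof (induction A)
  case (add x A)
  have "pnorm (rpoly (add_mset x A)) \<le> pnorm [:- x, 1:] * pnorm (rpoly A)"
    unfolding rpoly_add_mset by (rule pnorm_mult)
  also have "\<dots> \<le> (1 + B) * (1 + B) ^ size A"
    using add.IH add.prems[of x] add.prems order_trans[OF norm_ge_zero add.prems[of x]]
    by (intro mult_mono) (auto simp: pnorm_pCons)
  finally show ?case by simp
qed simp

lemma norm_poly_rpoly_ge:
  assumes "\<And>y. y \<in># A \<Longrightarrow> d \<le> dist x y" "0 \<le> d"
  shows "d ^ size A \<le> norm (poly (rpoly A) x)"
  using assms
proof (induction A)
  case (add y A)
  have "d * d ^ size A \<le> dist x y * norm (poly (rpoly A) x)"
    using add by (intro mult_mono) auto
  then show ?case by (simp add: norm_mult dist_norm flip: left_diff_distrib)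
qed simp

lemma coeff_rpoly_add_mset:
  "coeff (rpoly (add_mset x A)) i = (case i of 0 \<Rightarrow> 0 | Suc j \<Rightarrow> coeff (rpoly A) j) - x * coeff (rpoly A) i"
  by (simp add: coeff_pCons split: nat.splits)

lemma coeff_rpoly_scale:
  assumes "i \<le> size A"
  shows "coeff (rpoly (image_mset ((*) c) A)) i = c ^ (size A - i) * coeff (rpoly A) i"
  using assms
proof (induction A arbitrary: i)
  case (add x A)
  show ?case
  proof (cases "i = Suc (size A)")
    case True
    then show ?thesis using coeff_rpoly_size[of "image_mset ((*) c) (add_mset x A)"]
        coeff_rpoly_size[of "add_mset x A"] by simp
  next
    case False
    then have i: "i \<le> size A" using add.prems by simp
    show ?thesis
    proof (cases i)
      case 0
      then show ?thesis using add.IH[of 0] by simp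
    next
      case (Suc j)
      then have "Suc (size A) - i = Suc (size A - i)" "size A - j = Suc (size A - i)" using i by auto
      then show ?thesis using add.IH[of i] add.IH[of j] i Suc
        by (simp add: coeff_rpoly_add_mset algebra_simps del: rpoly_add_mset)
    qed
  qed
qed simp

lemma rpoly_shift: "rpoly (image_mset (\<lambda>x. x - s) A) = pcompose (rpoly A) [:s, 1:]"
  by (induction A) (simp_all add: pcompose_mult pcompose_pCons pcompose_1 del: mult_pCons_left)

lemma coeff_rpoly_sum: "A \<noteq> {#} \<Longrightarrow> coeff (rpoly A) (size A - 1) = - sum_mset A"
proof (induction A)
  case (add x A)
  show ?case
  proof (cases "A = {#}")
    case False
    then obtain k where k: "size A = Suc k" by (cases A) auto
    then have "coeff (rpoly A) (Suc k) = 1" using coeff_rpoly_size[of A] by simp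
    with add.IH[OF False] k show ?thesis
      by (simp add: coeff_rpoly_add_mset del: rpoly_add_mset)
  qed simp
qed simp

text \<open>Cauchy's bound: at a root of modulus above 1 and above the coefficient norm, the leading
  term would outweigh all others together.\<close>

lemma root_bound_pnorm:
  assumes "x \<in># A"
  shows "norm x \<le> max 1 (pnorm (rpoly A))"
proof (rule ccontr)
  assume "\<not> ?thesis"
  then have x: "1 < norm x" "pnorm (rpoly A) < norm x" by auto
  define m where "m = size A - 1"
  have m: "size A = Suc m" using assms unfolding m_def by (cases A) auto
  have "poly (rpoly A) x = 0" using assms by simp
  then have "x ^ Suc m = - (\<Sum>i\<le>m. coeff (rpoly A) i * x ^ i)"
    using coeff_rpoly_size[of A] by (simp add: poly_altdef m eq_neg_iff_add_eq_0 add.commute)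
  then have "norm x ^ Suc m = norm (\<Sum>i\<le>m. coeff (rpoly A) i * x ^ i)"
    by (metis norm_minus_cancel norm_power)
  also have "\<dots> \<le> (\<Sum>i\<le>m. norm (coeff (rpoly A) i) * norm x ^ m)"
    using x by (intro order_trans[OF norm_sum sum_mono])
      (auto simp: norm_mult norm_power intro!: mult_left_mono power_increasing)
  also have "\<dots> \<le> pnorm (rpoly A) * norm x ^ m"
    using x unfolding pnorm_def by (simp add: m distrib_right flip: sum_distrib_right)
  also have "\<dots> < norm x ^ Suc m" using mult_strict_right_mono[OF x(2), of "norm x ^ m"] x(1)
    by (simp add: zero_less_power[OF less_trans[OF zero_less_one x(1)]] less_trans[OF zero_less_one x(1)] del: zero_less_norm_iff)
  finally show False by simp
qed

text \<open>A Fujiwara-type bound, adapted to the weights of the coefficients. If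
  \<open>norm x > 2 * r\<close>, the lower terms are dominated by a geometric series of ratio
  \<open>r / norm x < 1/2\<close>, which sums to less than the leading term.\<close>

lemma root_bound_2:
  assumes "x \<in># A" "0 \<le> r" "\<And>j. 1 \<le> j \<Longrightarrow> j \<le> size A \<Longrightarrow> norm (coeff (rpoly A) (size A - j)) \<le> r ^ j"
  shows "norm x \<le> 2 * r"
proof (rule ccontr)
  assume neg: "\<not> ?thesis"
  then have x: "2 * r < norm x" "0 < norm x" using assms(2) by auto
  define m where "m = size A"
  define t where "t = r / norm x"
  have t: "0 \<le> t" "t < 1/2" using x assms(2) by (auto simp: t_def field_simps)
  have r: "r = t * norm x" using x by (simp add: t_def)
  have "poly (rpoly A) x = 0" using assms by simp
  then have "x ^ m = - (\<Sum>i<m. coeff (rpoly A) i * x ^ i)"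
    using coeff_rpoly_size[of A] by (simp add: poly_altdef m_def eq_neg_iff_add_eq_0 add.commute
        lessThan_Suc_atMost[symmetric])
  then have "norm x ^ m = norm (\<Sum>i<m. coeff (rpoly A) i * x ^ i)"
    by (metis norm_minus_cancel norm_power)
  also have "\<dots> \<le> (\<Sum>i<m. t ^ (m - i) * norm x ^ m)"
  proof (intro order_trans[OF norm_sum sum_mono])
    fix i assume i: "i \<in> {..<m}"
    have "norm (coeff (rpoly A) i) \<le> r ^ (m - i)"
      using assms(3)[of "m - i"] i by (simp add: m_def)
    then have "norm (coeff (rpoly A) i * x ^ i) \<le> r ^ (m - i) * norm x ^ i"
      by (simp add: norm_mult norm_power mult_right_mono)
    also have "\<dots> = t ^ (m - i) * norm x ^ (m - i + i)"
      unfolding r power_mult_distrib power_add by simp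
    finally show "norm (coeff (rpoly A) i * x ^ i) \<le> t ^ (m - i) * norm x ^ m" using i by simp
  qed
  also have "\<dots> = (\<Sum>i<m. t ^ Suc i) * norm x ^ m"
    by (subst sum.nat_diff_reindex[symmetric]) (simp add: sum_distrib_right Suc_diff_Suc)
  also have "\<dots> < norm x ^ m"
  proof -
    have "(\<Sum>i<m. t ^ Suc i) = t * (1 - t ^ m) / (1 - t)"
      using t sum_gp_strict[of t m] by (simp flip: sum_distrib_left)
    also have "\<dots> \<le> t / (1 - t)" using t by (intro divide_right_mono) (auto simp: algebra_simps)
    also have "\<dots> < 1" using t by simp
    finally have "(\<Sum>i<m. t ^ Suc i) < 1" .
    from mult_strict_right_mono[OF this, of "norm x ^ m"] show ?thesis using x by simp
  qed
  finally show False by simp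
qed

text \<open>Dividing the roots by \<open>r\<close> moves them into the unit disc, where the
  coefficient norm is at most \<open>2 ^ size A\<close>; homogeneity of the coefficients gives back
  \<open>r ^ j\<close>.\<close>

lemma coeff_rpoly_small:
  assumes "\<And>x. x \<in># A \<Longrightarrow> norm x \<le> r" "0 < r" "j \<le> size A"
  shows "norm (coeff (rpoly A) (size A - j)) \<le> 2 ^ size A * r ^ j"
proof -
  let ?A = "image_mset ((*) (of_real (inverse r))) A"
  have "norm (coeff (rpoly ?A) (size A - j)) \<le> (1 + 1) ^ size A"
    using assms(1,2) by (intro order_trans[OF coeff_le_pnorm order_trans[OF pnorm_rpoly[of _ 1]]])
      (auto simp: norm_mult norm_inverse norm_divide field_simps)
  moreover have "coeff (rpoly ?A) (size A - j) = of_real (inverse r) ^ j * coeff (rpoly A) (size A - j)"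
    using assms(3) by (subst coeff_rpoly_scale) auto
  ultimately have "norm (of_real (inverse r) ^ j * coeff (rpoly A) (size A - j)) \<le> 2 ^ size A" by simp
  then show ?thesis using assms(2)
    by (simp add: norm_mult norm_power norm_inverse norm_divide field_simps)
qed

text \<open>The Sylvester map of two separated factors is invertible, with a bound on the inverse
  that depends only on the root bound, the separation and the degrees. The induction removes one
  root \<open>b\<close> of \<open>H\<close> at a time: evaluation at \<open>b\<close> fixes the
  value of \<open>v\<close>, and what remains is divisible by \<open>X - b\<close> and is a Bezout
  equation for \<open>G\<close> and the smaller \<open>H'\<close>.\<close>

lemma bezout_rpoly:
  assumes "0 \<le> B" "0 < d"
  shows "\<exists>C\<ge>0. \<forall>G H. size G = m \<longrightarrow> size H = n \<longrightarrow> (\<forall>x. x \<in># G + H \<longrightarrow> norm x \<le> B) \<longrightarrow>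
    (\<forall>x y. x \<in># G \<longrightarrow> y \<in># H \<longrightarrow> d \<le> dist x y) \<longrightarrow>
    (\<forall>u v. (\<forall>i\<ge>m. coeff u i = 0) \<longrightarrow> (\<forall>i\<ge>n. coeff v i = 0) \<longrightarrow>
       pnorm u \<le> C * pnorm (u * rpoly H + rpoly G * v) \<and> pnorm v \<le> C * pnorm (u * rpoly H + rpoly G * v)) \<and>
    (\<forall>e. (\<forall>i\<ge>m+n. coeff e i = 0) \<longrightarrow>
       (\<exists>u v. (\<forall>i\<ge>m. coeff u i = 0) \<and> (\<forall>i\<ge>n. coeff v i = 0) \<and> u * rpoly H + rpoly G * v = e))"
proof (induction n)
  case 0
  show ?case
  proof (intro exI[of _ "1::real"] conjI allI impI)
    fix G H :: "complex multiset" and u v :: "complex poly"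
    assume "size H = 0" "\<forall>i\<ge>0. coeff v i = 0"
    then have "H = {#}" "v = 0" by (auto simp: poly_eq_iff)
    then show "pnorm u \<le> 1 * pnorm (u * rpoly H + rpoly G * v)"
      "pnorm v \<le> 1 * pnorm (u * rpoly H + rpoly G * v)" by auto
  next
    fix G H :: "complex multiset" and e :: "complex poly"
    assume "size H = 0" "\<forall>i\<ge>m + 0. coeff e i = 0"
    then show "\<exists>u v. (\<forall>i\<ge>m. coeff u i = 0) \<and> (\<forall>i\<ge>0. coeff v i = 0) \<and> u * rpoly H + rpoly G * v = e"
      by (intro exI[of _ e] exI[of _ 0]) auto
  qed simp
next
  case (Suc n)
  from Suc.IH obtain C where C0: "0 \<le> C" and C: "\<forall>G H. size G = m \<longrightarrow> size H = n \<longrightarrow>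
    (\<forall>x. x \<in># G + H \<longrightarrow> norm x \<le> B) \<longrightarrow> (\<forall>x y. x \<in># G \<longrightarrow> y \<in># H \<longrightarrow> d \<le> dist x y) \<longrightarrow>
    (\<forall>u v. (\<forall>i\<ge>m. coeff u i = 0) \<longrightarrow> (\<forall>i\<ge>n. coeff v i = 0) \<longrightarrow>
       pnorm u \<le> C * pnorm (u * rpoly H + rpoly G * v) \<and> pnorm v \<le> C * pnorm (u * rpoly H + rpoly G * v)) \<and>
    (\<forall>e. (\<forall>i\<ge>m+n. coeff e i = 0) \<longrightarrow>
       (\<exists>u v. (\<forall>i\<ge>m. coeff u i = 0) \<and> (\<forall>i\<ge>n. coeff v i = 0) \<and> u * rpoly H + rpoly G * v = e))"
    by (elim exE conjE)
  \<comment> \<open>\<open>W\<close> bounds a value at a root \<open>b\<close> of \<open>H\<close>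
    divided by that of \<open>rpoly G\<close>, which is at least \<open>d ^ m\<close> by separation;
    \<open>L\<close> is the cost of dividing by \<open>X - b\<close>, and \<open>K\<close> combines
    the two.\<close>
  define W where "W = (1 + B) ^ (m + n + 1) / d ^ m"
  define L where "L = (m + n + 1 + 1) * (1 + B) ^ (m + n + 1)"
  have L0: "0 \<le> L" unfolding L_def using assms by simp
  define K where "K = L * (1 + W * (1 + B) ^ m)"
  have W0: "0 \<le> W" unfolding W_def using assms by simp
  have K0: "0 \<le> K" unfolding K_def using assms W0 L0 by simp
  have root_step: "norm (poly e b / poly (rpoly G) b) \<le> W * pnorm e \<and> poly (rpoly G) b \<noteq> 0"
    if G: "size G = m" and sep: "\<And>x. x \<in># G \<Longrightarrow> d \<le> dist x b" and b: "norm b \<le> B"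
      and e: "\<forall>i\<ge>m + Suc n. coeff e i = 0" for e G b
  proof -
    have "degree e \<le> m + n + 1" using e by (intro degree_le) auto
    then have 1: "norm (poly e b) \<le> pnorm e * (1 + B) ^ (m + n + 1)"
      using b assms by (intro norm_poly_le) auto
    have 2: "d ^ m \<le> norm (poly (rpoly G) b)"
      using norm_poly_rpoly_ge[of G d b] sep G assms by (simp add: dist_commute)
    have "0 < d ^ m" using assms by simp
    with 2 have "poly (rpoly G) b \<noteq> 0" by (metis norm_zero not_le)
    moreover have "norm (poly e b / poly (rpoly G) b) \<le> pnorm e * (1 + B) ^ (m + n + 1) / d ^ m"
      unfolding norm_divide using 1 2 \<open>0 < d ^ m\<close> order_trans[OF norm_ge_zero 1] by (intro frac_le) auto
    ultimately show ?thesis by (simp add: W_def mult.commute)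
  qed
  define C1 where "C1 = C * K + W + (2 + B) * C * K"
  have "0 \<le> C1" using C0 K0 W0 assms by (simp add: C1_def)
  moreover have "(\<forall>u v. (\<forall>i\<ge>m. coeff u i = 0) \<longrightarrow> (\<forall>i\<ge>Suc n. coeff v i = 0) \<longrightarrow>
       pnorm u \<le> C1 * pnorm (u * rpoly H + rpoly G * v) \<and> pnorm v \<le> C1 * pnorm (u * rpoly H + rpoly G * v)) \<and>
    (\<forall>e. (\<forall>i\<ge>m+Suc n. coeff e i = 0) \<longrightarrow>
       (\<exists>u v. (\<forall>i\<ge>m. coeff u i = 0) \<and> (\<forall>i\<ge>Suc n. coeff v i = 0) \<and> u * rpoly H + rpoly G * v = e))"
    if G: "size G = m" and H: "size H = Suc n" and B: "\<forall>x. x \<in># G + H \<longrightarrow> norm x \<le> B"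
      and sep: "\<forall>x y. x \<in># G \<longrightarrow> y \<in># H \<longrightarrow> d \<le> dist x y" for G H
  proof (rule conjI)
    from H obtain b H' where H': "H = add_mset b H'" "size H' = n"
      by (metis size_eq_Suc_imp_eq_union size_add_mset nat.inject)
    have GB: "pnorm (rpoly G) \<le> (1 + B) ^ m" using pnorm_rpoly[of G B] B G by auto
    have b: "norm b \<le> B" using B H' by auto
    have IHc: "\<forall>x. x \<in># G + H' \<longrightarrow> norm x \<le> B" "\<forall>x y. x \<in># G \<longrightarrow> y \<in># H' \<longrightarrow> d \<le> dist x y"
      using B sep H' by auto
    note IH = C[THEN spec, THEN spec, THEN mp, OF G, THEN mp, OF H'(2), THEN mp, OF IHc(1), THEN mp, OF IHc(2)]
    have sb: "\<And>x. x \<in># G \<Longrightarrow> d \<le> dist x b" using sep H' by auto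
    have e'_bound: "pnorm e' \<le> K * pnorm e"
      if "e - smult (poly e b / poly (rpoly G) b) (rpoly G) = [:- b, 1:] * e'"
        "\<forall>i\<ge>m + Suc n. coeff e i = 0" for e e'
    proof -
      let ?w = "poly e b / poly (rpoly G) b"
      note w = root_step[OF G sb b that(2)]
      have "degree (e - smult ?w (rpoly G)) \<le> m + n + 1"
        using that(2) G by (intro degree_le) (auto simp: coeff_eq_0)
      from pnorm_div_root[OF that(1) b this]
      have 1: "pnorm e' \<le> L * pnorm (e - smult ?w (rpoly G))" by (simp add: L_def)
      have "pnorm (e - smult ?w (rpoly G)) \<le> pnorm e + norm ?w * pnorm (rpoly G)"
        by (metis pnorm_diff pnorm_smult)
      also have "norm ?w * pnorm (rpoly G) \<le> W * pnorm e * (1 + B) ^ m"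
        using w GB W0 by (intro mult_mono) auto
      finally have "L * pnorm (e - smult ?w (rpoly G)) \<le> L * (pnorm e + W * pnorm e * (1 + B) ^ m)"
        using L0 by (intro mult_left_mono) auto
      with 1 show ?thesis by (simp add: K_def algebra_simps)
    qed
    show "\<forall>u v. (\<forall>i\<ge>m. coeff u i = 0) \<longrightarrow> (\<forall>i\<ge>Suc n. coeff v i = 0) \<longrightarrow>
       pnorm u \<le> C1 * pnorm (u * rpoly H + rpoly G * v) \<and> pnorm v \<le> C1 * pnorm (u * rpoly H + rpoly G * v)"
    proof (intro allI impI conjI)
      fix u v :: "complex poly"
      assume u: "\<forall>i\<ge>m. coeff u i = 0" and v: "\<forall>i\<ge>Suc n. coeff v i = 0"
      define e where "e = u * rpoly H + rpoly G * v"
      define v' where "v' = synthetic_div v b"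
      have vv: "v = [:poly v b:] + [:- b, 1:] * v'"
        using synthetic_div_correct'[of b v] by (simp add: v'_def algebra_simps)
      have v'z: "\<forall>i\<ge>n. coeff v' i = 0"
      proof (cases "v' = 0")
        case False
        have "degree v \<le> n" using v by (intro degree_le) auto
        moreover have "degree v' = degree v - 1" by (simp add: v'_def degree_synthetic_div)
        moreover have "degree v \<noteq> 0" using False by (auto simp: v'_def synthetic_div_eq_0_iff)
        ultimately show ?thesis by (auto intro!: coeff_eq_0)
      qed simp
      have ez: "\<forall>i\<ge>m + Suc n. coeff e i = 0"
      proof (cases "m = 0")
        case True
        then have "u = 0" "G = {#}" using u G by (auto simp: poly_eq_iff)
        then show ?thesis using v True by (simp add: e_def)
      next
        case False
        have "degree u \<le> m - 1" using u by (intro degree_le) (use False in auto)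
        moreover have "degree v \<le> n" using v by (intro degree_le) auto
        ultimately have "degree e \<le> m + n" unfolding e_def
          using False G H by (intro degree_add_le order_trans[OF degree_mult_le]) auto
        then show ?thesis by (auto intro!: coeff_eq_0)
      qed
      note w = root_step[OF G sb b ez]
      \<comment> \<open>At the root \<open>b\<close> of \<open>H\<close> the term containing
        \<open>u\<close> vanishes, so the value of \<open>v\<close> there is forced.\<close>
      have ew: "poly e b / poly (rpoly G) b = poly v b"
        using w by (simp add: e_def H'(1))
      have eq: "e - smult (poly v b) (rpoly G) = [:- b, 1:] * (u * rpoly H' + rpoly G * v')"
        unfolding e_def H'(1) rpoly_add_mset by (subst vv) (simp add: algebra_simps smult_add_right)
      have bd: "pnorm (u * rpoly H' + rpoly G * v') \<le> K * pnorm e"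
        by (rule e'_bound[OF _ ez]) (simp only: ew eq)
      have IHu: "pnorm u \<le> C * pnorm (u * rpoly H' + rpoly G * v')"
        and IHv: "pnorm v' \<le> C * pnorm (u * rpoly H' + rpoly G * v')"
        using IH u v'z by blast+
      have u1: "pnorm u \<le> C * (K * pnorm e)" and v1: "pnorm v' \<le> C * (K * pnorm e)"
        using order_trans[OF IHu mult_left_mono[OF bd C0]] order_trans[OF IHv mult_left_mono[OF bd C0]] by auto
      have "pnorm v \<le> pnorm [:poly v b:] + pnorm [:- b, 1:] * pnorm v'"
        by (subst vv) (rule order_trans[OF pnorm_add add_left_mono[OF pnorm_mult]])
      also have "\<dots> \<le> W * pnorm e + (2 + B) * (C * (K * pnorm e))"
        using w b v1 assms unfolding ew by (intro add_mono mult_mono) (auto simp: pnorm_pCons)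
      finally have "pnorm v \<le> (W + (2 + B) * C * K) * pnorm e" by (simp add: algebra_simps)
      also have "\<dots> \<le> (C * K + W + (2 + B) * C * K) * pnorm e"
        using C0 K0 by (intro mult_right_mono) auto
      finally show "pnorm v \<le> C1 * pnorm (u * rpoly H + rpoly G * v)"
        by (simp add: e_def C1_def)
      have "C * K * pnorm e \<le> (C * K + W + (2 + B) * C * K) * pnorm e"
        using C0 K0 W0 assms by (intro mult_right_mono) auto
      with u1 show "pnorm u \<le> C1 * pnorm (u * rpoly H + rpoly G * v)"
        by (simp add: e_def C1_def algebra_simps)
    qed
    show "\<forall>e. (\<forall>i\<ge>m+Suc n. coeff e i = 0) \<longrightarrow>
       (\<exists>u v. (\<forall>i\<ge>m. coeff u i = 0) \<and> (\<forall>i\<ge>Suc n. coeff v i = 0) \<and> u * rpoly H + rpoly G * v = e)"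
    proof (intro allI impI)
      fix e :: "complex poly" assume ez: "\<forall>i\<ge>m + Suc n. coeff e i = 0"
      let ?w = "poly e b / poly (rpoly G) b"
      note w = root_step[OF G sb b ez]
      have "poly (e - smult ?w (rpoly G)) b = 0" using w by simp
      then obtain e' where e': "e - smult ?w (rpoly G) = [:- b, 1:] * e'"
        unfolding poly_eq_0_iff_dvd dvd_def by blast
      have "\<forall>i\<ge>m + n. coeff e' i = 0"
      proof (cases "e' = 0")
        case False
        have "degree (e - smult ?w (rpoly G)) \<le> m + n"
          using ez G by (intro degree_le) (auto simp: coeff_eq_0)
        moreover have "degree (e - smult ?w (rpoly G)) = Suc (degree e')"
          unfolding e' using False by (subst degree_mult_eq) auto
        ultimately show ?thesis by (auto intro!: coeff_eq_0)
      qed simp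
      with IH obtain u v where uv: "\<forall>i\<ge>m. coeff u i = 0" "\<forall>i\<ge>n. coeff v i = 0"
        "u * rpoly H' + rpoly G * v = e'" by blast
      have "u * rpoly H + rpoly G * ([:?w:] + [:- b, 1:] * v) = smult ?w (rpoly G) + [:- b, 1:] * e'"
        unfolding uv(3)[symmetric] H'(1) rpoly_add_mset by (simp add: algebra_simps smult_add_right)
      also have "\<dots> = e" unfolding e'[symmetric] by simp
      finally have eq: "u * rpoly H + rpoly G * ([:?w:] + [:- b, 1:] * v) = e" .
      show "\<exists>u v. (\<forall>i\<ge>m. coeff u i = 0) \<and> (\<forall>i\<ge>Suc n. coeff v i = 0) \<and> u * rpoly H + rpoly G * v = e"
        by (rule exI[of _ u], rule exI[of _ "[:?w:] + [:- b, 1:] * v"], intro conjI uv(1) eq)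
          (use uv(2) in \<open>auto simp: coeff_pCons split: nat.splits\<close>)
    qed
  qed
  ultimately show ?case by blast
qed

text \<open>The modulus of a monic polynomial at \<open>x\<close> is the product of the distances
  from \<open>x\<close> to the roots.\<close>

lemma exists_near_root:
  assumes "0 < r" "norm (poly (rpoly A) x) \<le> r ^ size A" "A \<noteq> {#}"
  shows "\<exists>y. y \<in># A \<and> dist x y \<le> r"
proof (rule ccontr)
  assume "\<not> ?thesis"
  then have far: "r < dist x y" if "y \<in># A" for y using that by force
  have "r ^ size A < norm (poly (rpoly A) x)"
    using assms(3) far
  proof (induction A)
    case (add y A)
    have y: "r < dist x y" using add.prems by simp
    have "r ^ size A \<le> norm (poly (rpoly A) x)"
      using add by (cases "A = {#}") auto
    then have "r * r ^ size A < dist x y * norm (poly (rpoly A) x)"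
      using y assms(1) by (intro mult_less_le_imp_less) auto
    then show ?case by (simp add: norm_mult dist_norm flip: left_diff_distrib)
  qed simp
  with assms(2) show False by simp
qed

text \<open>A root \<open>a\<close> of the first polynomial makes the second one small at
  \<open>a\<close>, so the second one has a root \<open>b\<close> nearby. The pair is matched and
  split off, and induction treats the cofactors. The modulus of continuity is uniform over all root
  multisets in a fixed disc.\<close>

lemma roots_continuous:
  assumes "0 \<le> B"
  shows "0 < \<epsilon> \<Longrightarrow> \<exists>\<delta>>0. \<forall>A A'. size A = m \<longrightarrow> size A' = m \<longrightarrow> (\<forall>x. x \<in># A + A' \<longrightarrow> norm x \<le> B) \<longrightarrow>
    pnorm (rpoly A - rpoly A') \<le> \<delta> \<longrightarrow> matched \<epsilon> A A'"
proof (induction m)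
  case 0
  show ?case by (intro exI[of _ 1]) (auto simp: rel_mset_Zero)
next
  case (Suc m)
  then obtain \<delta>1 where \<delta>1: "0 < \<delta>1" and IH: "\<And>A A'. size A = m \<Longrightarrow> size A' = m \<Longrightarrow>
    (\<And>x. x \<in># A + A' \<Longrightarrow> norm x \<le> B) \<Longrightarrow> pnorm (rpoly A - rpoly A') \<le> \<delta>1 \<Longrightarrow> matched \<epsilon> A A'"
    by blast
  define K where "K = (Suc m + 1) * (1 + B) ^ Suc m"
  have K: "0 < K" using assms by (simp add: K_def)
  \<comment> \<open>The first entry keeps the pair \<open>a\<close>, \<open>b\<close> within
    \<open>\<epsilon>\<close>; the second one makes the exchange of \<open>b\<close> for
    \<open>a\<close> cost at most half of \<open>\<delta>1\<close> after the division.\<close>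
  define \<eta> where "\<eta> = min \<epsilon> (\<delta>1 / (2 * K * (1 + B) ^ m))"
  have \<eta>: "0 < \<eta>" using K \<delta>1 Suc.prems assms by (simp add: \<eta>_def)
  define \<delta> where "\<delta> = min (\<delta>1 / (2 * K)) (\<eta> ^ Suc m / (1 + B) ^ Suc m)"
  have "0 < \<delta>" using K \<delta>1 \<eta> assms by (simp add: \<delta>_def)
  moreover have "matched \<epsilon> A A'"
    if sA: "size A = Suc m" and sA': "size A' = Suc m" and AB: "\<forall>x. x \<in># A + A' \<longrightarrow> norm x \<le> B"
      and d: "pnorm (rpoly A - rpoly A') \<le> \<delta>" for A A'
  proof -
    from sA obtain a A1 where A1: "A = add_mset a A1" "size A1 = m"
      by (metis size_eq_Suc_imp_eq_union size_add_mset nat.inject)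
    have aB: "norm a \<le> B" using AB A1 by auto
    have "poly (rpoly A') a = - poly (rpoly A - rpoly A') a" using A1 by simp
    then have "norm (poly (rpoly A') a) = norm (poly (rpoly A - rpoly A') a)"
      by (metis norm_minus_cancel)
    also have "\<dots> \<le> pnorm (rpoly A - rpoly A') * (1 + B) ^ Suc m"
      using aB assms sA sA' by (intro norm_poly_le degree_diff_le) auto
    also have "\<dots> \<le> \<delta> * (1 + B) ^ Suc m" using d assms by (intro mult_right_mono) auto
    also have "\<dots> \<le> \<eta> ^ Suc m"
    proof -
      have "\<delta> \<le> \<eta> ^ Suc m / (1 + B) ^ Suc m" by (simp add: \<delta>_def)
      then show ?thesis using assms by (simp add: pos_le_divide_eq del: power_Suc)
    qed
    finally have "\<exists>y. y \<in># A' \<and> dist a y \<le> \<eta>"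
      using \<eta> sA' by (intro exists_near_root) auto
    then obtain b where b: "b \<in># A'" "dist a b \<le> \<eta>" by blast
    then obtain A1' where A1': "A' = add_mset b A1'" "size A1' = m"
      using sA' by (metis insert_DiffM nat.inject size_add_mset)
    \<comment> \<open>Both polynomials must be divided by the same factor \<open>X - a\<close>;
      putting it in place of \<open>X - b\<close> in the second one produces the correction
      \<open>(b - a)\<close> times the cofactor.\<close>
    have eq: "(rpoly A - rpoly A') - smult (b - a) (rpoly A1') = [:- a, 1:] * (rpoly A1 - rpoly A1')"
      unfolding A1 A1' rpoly_add_mset by (simp add: poly_eq_poly_eq_iff[symmetric] fun_eq_iff algebra_simps)
    have "degree ((rpoly A - rpoly A') - smult (b - a) (rpoly A1')) \<le> Suc m"
      by (intro degree_diff_le order_trans[OF degree_smult_le]) (simp_all add: sA sA' A1'(2) del: rpoly_add_mset)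
    from pnorm_div_root[OF eq aB this]
    have "pnorm (rpoly A1 - rpoly A1') \<le> K * pnorm ((rpoly A - rpoly A') - smult (b - a) (rpoly A1'))"
      by (simp add: K_def)
    also have "pnorm ((rpoly A - rpoly A') - smult (b - a) (rpoly A1')) \<le>
        pnorm (rpoly A - rpoly A') + norm (b - a) * pnorm (rpoly A1')"
      by (metis pnorm_diff pnorm_smult)
    also have "\<dots> \<le> \<delta>1 / (2 * K) + \<delta>1 / (2 * K * (1 + B) ^ m) * (1 + B) ^ m"
    proof (intro add_mono mult_mono)
      show "pnorm (rpoly A - rpoly A') \<le> \<delta>1 / (2 * K)" using d by (simp add: \<delta>_def)
      show "norm (b - a) \<le> \<delta>1 / (2 * K * (1 + B) ^ m)"
        using b(2) by (simp add: \<eta>_def dist_norm norm_minus_commute)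
      show "pnorm (rpoly A1') \<le> (1 + B) ^ m"
        using pnorm_rpoly[of A1' B] AB A1' by auto
    qed (use K \<delta>1 assms in auto)
    also have "\<dots> = \<delta>1 / K" using assms by simp
    finally have "pnorm (rpoly A1 - rpoly A1') \<le> \<delta>1" using K by simp
    then have "matched \<epsilon> A1 A1'" using AB A1 A1' by (intro IH) auto
    moreover have "dist a b \<le> \<epsilon>" using b(2) by (simp add: \<eta>_def)
    ultimately show ?thesis unfolding A1 A1' by (intro rel_mset_Plus)
  qed
  ultimately show ?case by blast
qed

section \<open>Sequences that are approximable by polynomials in time\<close>

text \<open>A curve on an interval is replaced by its samples at the times i/k, i \<le> k.
  Being of class C^(m-1,1) becomes: around each i0 there is a polynomial of degree less than m
  with error O(|t|^m), where t = (i - i0)/k. In this form the class is visibly stable under the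
  algebraic operations and under restriction to (rescaled) subwindows.\<close>

definition tm :: "nat \<Rightarrow> nat \<Rightarrow> nat \<Rightarrow> complex" where
  "tm k i0 i = of_real ((real i - real i0) / real k)"

text \<open>Only the error is bounded, not \<open>Q\<close>. This is what rescales well: after a
  zoom the size of \<open>Q\<close> is not controlled directly, and \<open>lerr_apx\<close> recovers
  it from a bound on the values.\<close>

definition lerr :: "nat \<Rightarrow> nat \<Rightarrow> nat \<Rightarrow> real \<Rightarrow> (nat \<Rightarrow> complex) \<Rightarrow> complex poly \<Rightarrow> bool" where
  "lerr m k i0 M c Q \<longleftrightarrow> (\<forall>l\<ge>m. coeff Q l = 0) \<and>
     (\<forall>i\<le>k. norm (c i - poly Q (tm k i0 i)) \<le> M * norm (tm k i0 i) ^ m)"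

definition apx :: "nat \<Rightarrow> nat \<Rightarrow> nat \<Rightarrow> real \<Rightarrow> (nat \<Rightarrow> complex) \<Rightarrow> bool" where
  "apx m k i0 M c \<longleftrightarrow> (\<exists>Q. pnorm Q \<le> M \<and> lerr m k i0 M c Q)"

lemma norm_tm: "norm (tm k i0 i) = \<bar>real i - real i0\<bar> / real k"
  by (simp add: tm_def abs_divide del: of_real_divide of_real_diff)

lemma norm_tm_le_1: "i \<le> k \<Longrightarrow> i0 \<le> k \<Longrightarrow> norm (tm k i0 i) \<le> 1"
  unfolding norm_tm by (cases "k = 0") (auto simp: field_simps)

lemma tm_self [simp]: "tm k i i = 0"
  by (simp add: tm_def)

lemma tm_subwindow: "k' > 0 \<Longrightarrow> tm k (w + i0) (w + i) = of_real (real k' / real k) * tm k' i0 i"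
  by (simp add: tm_def)

lemma lerr_self: "lerr m k i0 M c Q \<Longrightarrow> 1 \<le> m \<Longrightarrow> i0 \<le> k \<Longrightarrow> poly Q 0 = c i0"
  unfolding lerr_def by (elim conjE allE[of _ i0]) (auto simp: power_0_left)

lemma lerr_mono: "lerr m k i0 M c Q \<Longrightarrow> M \<le> N \<Longrightarrow> lerr m k i0 N c Q"
  unfolding lerr_def by (meson mult_right_mono norm_ge_zero order_trans zero_le_power)

lemma lerr_cmult: "lerr m k i0 M c Q \<Longrightarrow> lerr m k i0 (norm a * M) (\<lambda>i. a * c i) (smult a Q)"
  unfolding lerr_def by (auto simp: norm_mult mult.assoc mult_left_mono simp flip: right_diff_distrib)

lemma lerr_subwindow:
  assumes "lerr m k (w + i0) M c Q" "w + k' \<le> k" "0 < k'"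
  shows "lerr m k' i0 (M * (real k' / real k) ^ m) (\<lambda>i. c (w + i)) (pcompose Q [:0, of_real (real k' / real k):])"
  unfolding lerr_def
proof (intro conjI allI impI)
  fix l assume "m \<le> l"
  then show "coeff (pcompose Q [:0, of_real (real k' / real k):]) l = 0"
    using assms(1) unfolding lerr_def by (simp add: coeff_pcompose_linear)
next
  fix i assume i: "i \<le> k'"
  have "norm (c (w + i) - poly Q (tm k (w + i0) (w + i))) \<le> M * norm (tm k (w + i0) (w + i)) ^ m"
    using assms i unfolding lerr_def by auto
  then show "norm (c (w + i) - poly (pcompose Q [:0, of_real (real k' / real k):]) (tm k' i0 i))
      \<le> M * (real k' / real k) ^ m * norm (tm k' i0 i) ^ m"
    unfolding tm_subwindow[OF assms(3)]
    by (simp add: poly_pcompose norm_mult norm_divide power_mult_distrib power_divide mult_ac)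
qed

lemma pnorm_pcompose_contract:
  assumes "norm r \<le> 1"
  shows "pnorm (pcompose Q [:0, r:]) \<le> pnorm Q"
proof -
  have "degree (pcompose Q [:0, r:]) \<le> degree Q"
    by (intro degree_le) (auto simp: coeff_pcompose_linear coeff_eq_0)
  then have "pnorm (pcompose Q [:0, r:]) = (\<Sum>i\<le>degree Q. norm r ^ i * norm (coeff Q i))"
    by (subst pnorm_eq) (auto simp: coeff_pcompose_linear norm_mult norm_power)
  also have "\<dots> \<le> (\<Sum>i\<le>degree Q. 1 * norm (coeff Q i))"
    using assms by (intro sum_mono mult_right_mono power_le_one) auto
  finally show ?thesis by (simp add: pnorm_def)
qed

lemma apx_subwindow:
  assumes "apx m k (w + i0) M c" "w + k' \<le> k" "0 < k'"
  shows "apx m k' i0 M (\<lambda>i. c (w + i))"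
proof -
  from assms(1) obtain Q where Q: "pnorm Q \<le> M" "lerr m k (w + i0) M c Q" unfolding apx_def by blast
  have "real k' / real k \<le> 1" using assms by (auto simp: field_simps)
  then have "M * (real k' / real k) ^ m \<le> M * 1"
    using order_trans[OF pnorm_nonneg Q(1)] by (intro mult_left_mono power_le_one) auto
  then have "lerr m k' i0 M (\<lambda>i. c (w + i)) (pcompose Q [:0, of_real (real k' / real k):])"
    using lerr_subwindow[OF Q(2) assms(2,3)] lerr_mono by simp
  moreover have "pnorm (pcompose Q [:0, of_real (real k' / real k):]) \<le> M"
    using \<open>real k' / real k \<le> 1\<close> by (intro order_trans[OF pnorm_pcompose_contract Q(1)]) (simp add: norm_divide)
  ultimately show ?thesis unfolding apx_def by blast
qed

lemma apx_nonneg: "apx m k i0 M c \<Longrightarrow> 0 \<le> M"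
  unfolding apx_def using pnorm_nonneg order_trans by blast

lemma apx_mono: "apx m k i0 M c \<Longrightarrow> M \<le> N \<Longrightarrow> apx m k i0 N c"
  unfolding apx_def using lerr_mono order_trans by blast

lemma apx_const: "1 \<le> m \<Longrightarrow> norm a \<le> M \<Longrightarrow> apx m k i0 M (\<lambda>_. a)"
  unfolding apx_def lerr_def
  using order_trans[OF norm_ge_zero, of a M]
  by (intro exI[of _ "[:a:]"]) (auto simp: pnorm_pCons coeff_pCons split: nat.splits)

lemma apx_add:
  assumes "apx m k i0 M c" "apx m k i0 N c'"
  shows "apx m k i0 (M + N) (\<lambda>i. c i + c' i)"
proof -
  obtain Q Q' where Q: "pnorm Q \<le> M" "lerr m k i0 M c Q" "pnorm Q' \<le> N" "lerr m k i0 N c' Q'"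
    using assms unfolding apx_def by blast
  have "lerr m k i0 (M + N) (\<lambda>i. c i + c' i) (Q + Q')"
    unfolding lerr_def
  proof (intro conjI allI impI)
    fix i assume "i \<le> k"
    then have "norm (c i - poly Q (tm k i0 i)) + norm (c' i - poly Q' (tm k i0 i)) \<le>
        M * norm (tm k i0 i) ^ m + N * norm (tm k i0 i) ^ m"
      using Q unfolding lerr_def by (intro add_mono) auto
    then show "norm (c i + c' i - poly (Q + Q') (tm k i0 i)) \<le> (M + N) * norm (tm k i0 i) ^ m"
      using norm_triangle_ineq[of "c i - poly Q (tm k i0 i)" "c' i - poly Q' (tm k i0 i)"]
      by (simp add: algebra_simps)
  qed (use Q in \<open>auto simp: lerr_def\<close>)
  then show ?thesis unfolding apx_def using order_trans[OF pnorm_add add_mono[OF Q(1,3)]] by blast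
qed

lemma apx_sum:
  assumes "1 \<le> m" "\<And>j. j \<in> S \<Longrightarrow> apx m k i0 (M j) (c j)"
  shows "apx m k i0 (\<Sum>j\<in>S. M j) (\<lambda>i. \<Sum>j\<in>S. c j i)"
  using assms(2)
  by (induction S rule: infinite_finite_induct) (auto intro!: apx_add apx_const assms(1))

lemma apx_value:
  assumes "apx m k i0 M c" "i \<le> k" "i0 \<le> k"
  shows "norm (c i) \<le> 2 * M"
proof -
  obtain Q where Q: "pnorm Q \<le> M" "lerr m k i0 M c Q" using assms unfolding apx_def by blast
  have t: "norm (tm k i0 i) \<le> 1" using norm_tm_le_1 assms by blast
  have "norm (c i - poly Q (tm k i0 i)) \<le> M * norm (tm k i0 i) ^ m" using Q assms unfolding lerr_def by blast
  also have "\<dots> \<le> M * 1" using t apx_nonneg[OF assms(1)] by (intro mult_left_mono power_le_one) auto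
  finally show ?thesis
    using norm_poly_le_pnorm[OF t, of Q] Q(1) norm_triangle_sub[of "c i" "poly Q (tm k i0 i)"] by simp
qed

lemma poly_diff_0_le:
  assumes "norm x \<le> 1"
  shows "norm (poly Q x - poly Q 0) \<le> pnorm Q * norm x"
proof (cases Q)
  case (pCons a p)
  have "norm x * norm (poly p x) \<le> norm x * pnorm p"
    using assms by (intro mult_left_mono norm_poly_le_pnorm) auto
  also have "\<dots> \<le> norm x * pnorm Q" by (intro mult_left_mono) (auto simp: pCons(1) pnorm_pCons)
  finally show ?thesis by (simp add: pCons norm_mult mult.commute)
qed

lemma apx_lip:
  assumes "apx m k i0 M c" "i \<le> k" "i0 \<le> k" "1 \<le> m"
  shows "norm (c i - c i0) \<le> 2 * M * norm (tm k i0 i)"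
proof -
  obtain Q where Q: "pnorm Q \<le> M" "lerr m k i0 M c Q" using assms unfolding apx_def by blast
  have t: "norm (tm k i0 i) \<le> 1" using norm_tm_le_1 assms by blast
  have M: "0 \<le> M" using apx_nonneg[OF assms(1)] .
  have "norm (c i - poly Q (tm k i0 i)) \<le> M * norm (tm k i0 i) ^ m" using Q assms unfolding lerr_def by blast
  also have "\<dots> \<le> M * norm (tm k i0 i)" using t M power_decreasing[of 1 m "norm (tm k i0 i)"] assms
    by (intro mult_left_mono) auto
  finally have 1: "norm (c i - poly Q (tm k i0 i)) \<le> M * norm (tm k i0 i)" .
  have "norm (poly Q (tm k i0 i) - c i0) \<le> pnorm Q * norm (tm k i0 i)"
    using poly_diff_0_le[OF t, of Q] lerr_self[OF Q(2) assms(4,3)] by simp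
  also have "\<dots> \<le> M * norm (tm k i0 i)" using Q by (intro mult_right_mono) auto
  finally show ?thesis using 1 norm_triangle_ineq[of "c i - poly Q (tm k i0 i)" "poly Q (tm k i0 i) - c i0"]
    by simp
qed

lemma poly_cutoff_shift: "(p::complex poly) = poly_cutoff m p + monom 1 m * poly_shift m p"
  by (rule poly_eqI) (simp add: coeff_poly_cutoff coeff_monom_mult coeff_poly_shift)

lemma pnorm_poly_cutoff: "pnorm (poly_cutoff m p) \<le> pnorm p"
proof -
  have "degree (poly_cutoff m p) \<le> degree p"
    by (intro degree_le) (auto simp: coeff_poly_cutoff coeff_eq_0)
  from pnorm_eq[OF this] show ?thesis
    by (simp add: pnorm_def[of p]) (intro sum_mono, auto simp: coeff_poly_cutoff)
qed

lemma pnorm_poly_shift: "pnorm (poly_shift m p) \<le> pnorm p"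
proof -
  have d: "degree (poly_shift m p) \<le> degree p"
    by (intro degree_le) (auto simp: coeff_poly_shift coeff_eq_0)
  have "pnorm (poly_shift m p) = (\<Sum>i\<le>degree p. norm (coeff p (i + m)))"
    by (simp add: pnorm_eq[OF d] coeff_poly_shift)
  also have "\<dots> = (\<Sum>i\<in>(\<lambda>i. i + m) ` {..degree p}. norm (coeff p i))"
    by (subst sum.reindex) auto
  also have "\<dots> \<le> (\<Sum>i\<le>degree p + m. norm (coeff p i))"
    by (intro sum_mono2) auto
  also have "\<dots> = pnorm p" by (subst pnorm_eq[of p "degree p + m"]) auto
  finally show ?thesis .
qed

text \<open>Frees the constructions below from the degree condition: terms of order at least
  \<open>m\<close> go into the error, since all times have modulus at most 1.\<close>

lemma apx_cutoff:
  assumes Q: "pnorm Q \<le> M" and "i0 \<le> k"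
    and e: "\<And>i. i \<le> k \<Longrightarrow> norm (c i - poly Q (tm k i0 i)) \<le> N * norm (tm k i0 i) ^ m"
    and N: "0 \<le> N"
  shows "apx m k i0 (M + N) c"
  unfolding apx_def
proof (intro exI[of _ "poly_cutoff m Q"] conjI)
  show "pnorm (poly_cutoff m Q) \<le> M + N" using pnorm_poly_cutoff[of m Q] Q N by simp
  show "lerr m k i0 (M + N) c (poly_cutoff m Q)"
    unfolding lerr_def
  proof (intro conjI allI impI)
    fix i assume i: "i \<le> k"
    let ?x = "tm k i0 i"
    have "poly Q ?x = poly (poly_cutoff m Q) ?x + ?x ^ m * poly (poly_shift m Q) ?x"
      by (subst poly_cutoff_shift[of Q m]) (simp add: poly_monom)
    then have "norm (c i - poly (poly_cutoff m Q) ?x) \<le> norm (c i - poly Q ?x) + norm (?x ^ m * poly (poly_shift m Q) ?x)"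
      using norm_triangle_ineq[of "c i - poly Q ?x" "?x ^ m * poly (poly_shift m Q) ?x"] by simp
    also have "\<dots> \<le> N * norm ?x ^ m + norm ?x ^ m * M"
      unfolding norm_mult norm_power
      by (intro add_mono e i mult_left_mono order_trans[OF norm_poly_le_pnorm] norm_tm_le_1 assms
          order_trans[OF pnorm_poly_shift]) auto
    finally show "norm (c i - poly (poly_cutoff m Q) ?x) \<le> (M + N) * norm ?x ^ m"
      by (simp add: algebra_simps)
  qed (simp add: coeff_poly_cutoff)
qed

lemma apx_perturb:
  assumes "apx m k i0 M c" "i0 \<le> k" "0 \<le> N"
    and e: "\<And>i. i \<le> k \<Longrightarrow> norm (c' i - c i) \<le> N * norm (tm k i0 i) ^ m"
  shows "apx m k i0 (2 * M + N) c'"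
proof -
  obtain Q where Q: "pnorm Q \<le> M" "lerr m k i0 M c Q" using assms unfolding apx_def by blast
  have "apx m k i0 (M + (M + N)) c'"
  proof (rule apx_cutoff[OF Q(1) assms(2)])
    fix i assume i: "i \<le> k"
    have "norm (c i - poly Q (tm k i0 i)) \<le> M * norm (tm k i0 i) ^ m" using Q i unfolding lerr_def by blast
    then show "norm (c' i - poly Q (tm k i0 i)) \<le> (M + N) * norm (tm k i0 i) ^ m"
      using e[OF i] norm_triangle_ineq[of "c' i - c i" "c i - poly Q (tm k i0 i)"] by (simp add: algebra_simps)
  qed (use apx_nonneg[OF assms(1)] assms in auto)
  then show ?thesis by (simp add: algebra_simps)
qed

lemma apx_trunc:
  assumes "apx m k i0 M c" "i0 \<le> k" "m' \<le> m"
  shows "apx m' k i0 (2 * M) c"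
proof -
  obtain Q where Q: "pnorm Q \<le> M" "lerr m k i0 M c Q" using assms unfolding apx_def by blast
  have "apx m' k i0 (M + M) c"
  proof (rule apx_cutoff[OF Q(1) assms(2)])
    fix i assume i: "i \<le> k"
    have "norm (c i - poly Q (tm k i0 i)) \<le> M * norm (tm k i0 i) ^ m" using Q i unfolding lerr_def by blast
    also have "\<dots> \<le> M * norm (tm k i0 i) ^ m'"
      using norm_tm_le_1[OF i assms(2)] apx_nonneg[OF assms(1)] assms(3)
      by (intro mult_left_mono power_decreasing) auto
    finally show "norm (c i - poly Q (tm k i0 i)) \<le> M * norm (tm k i0 i) ^ m'" .
  qed (use apx_nonneg[OF assms(1)] in auto)
  then show ?thesis by simp
qed

lemma apx_mult:
  assumes "apx m k i0 M c" "apx m k i0 N c'" "i0 \<le> k"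
  shows "apx m k i0 (4 * M * N) (\<lambda>i. c i * c' i)"
proof -
  obtain Q Q' where Q: "pnorm Q \<le> M" "lerr m k i0 M c Q" "pnorm Q' \<le> N" "lerr m k i0 N c' Q'"
    using assms unfolding apx_def by blast
  have MN: "0 \<le> M" "0 \<le> N" using assms apx_nonneg by auto
  have "apx m k i0 (M * N + 3 * M * N) (\<lambda>i. c i * c' i)"
  proof (rule apx_cutoff)
    show "pnorm (Q * Q') \<le> M * N"
      using order_trans[OF pnorm_mult mult_mono[OF Q(1,3)]] MN by simp
    fix i assume i: "i \<le> k"
    let ?x = "tm k i0 i"
    have t: "norm ?x \<le> 1" using norm_tm_le_1 assms i by blast
    have e: "norm (c i - poly Q ?x) \<le> M * norm ?x ^ m" "norm (c' i - poly Q' ?x) \<le> N * norm ?x ^ m"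
      using Q i unfolding lerr_def by blast+
    have "c i * c' i - poly (Q * Q') ?x = (c i - poly Q ?x) * c' i + poly Q ?x * (c' i - poly Q' ?x)"
      by (simp add: algebra_simps)
    also have "norm \<dots> \<le> norm (c i - poly Q ?x) * norm (c' i) + norm (poly Q ?x) * norm (c' i - poly Q' ?x)"
      by (metis norm_mult norm_triangle_ineq)
    also have "\<dots> \<le> M * norm ?x ^ m * (2 * N) + M * (N * norm ?x ^ m)"
      using apx_value[OF assms(2) i assms(3)] MN e order_trans[OF norm_poly_le_pnorm[OF t] Q(1)]
      by (intro add_mono mult_mono) auto
    finally show "norm (c i * c' i - poly (Q * Q') ?x) \<le> 3 * M * N * norm ?x ^ m"
      by (simp add: algebra_simps)
  qed (use MN assms in auto)
  then show ?thesis by (simp add: mult.assoc)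
qed

lemma apx_power:
  assumes "apx m k i0 M c" "i0 \<le> k" "1 \<le> m"
  shows "apx m k i0 ((4 * M) ^ n) (\<lambda>i. c i ^ n)"
proof (induction n)
  case (Suc n)
  show ?case using apx_mult[OF assms(1) Suc assms(2)] by simp
next
  case 0
  show ?case using apx_const[OF assms(3), of 1 1] by simp
qed

lemma apx_cmult:
  assumes "apx m k i0 M c"
  shows "apx m k i0 (norm a * M) (\<lambda>i. a * c i)"
proof -
  obtain Q where Q: "pnorm Q \<le> M" "lerr m k i0 M c Q" using assms unfolding apx_def by blast
  then show ?thesis unfolding apx_def
    by (intro exI[of _ "smult a Q"]) (auto simp: pnorm_smult lerr_cmult mult_left_mono)
qed

text \<open>Truncated geometric series around the base point: \<open>u = 1 - c / c i0\<close>
  vanishes at \<open>i0\<close> and is Lipschitz, so the remainder, a multiple of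
  \<open>u ^ m\<close>, is of order m in time.\<close>

lemma apx_inverse:
  assumes "0 < c0" "1 \<le> m"
  shows "\<exists>K. \<forall>k i0 c. i0 \<le> k \<longrightarrow> apx m k i0 M c \<longrightarrow> (\<forall>i\<le>k. c0 \<le> norm (c i)) \<longrightarrow> apx m k i0 K (\<lambda>i. inverse (c i))"
proof -
  define U where "U = 1 + inverse c0 * M"
  define K where "K = 2 * (inverse c0 * (\<Sum>l<m. (4 * U) ^ l)) + (inverse c0 * (2 * M)) ^ m * inverse c0"
  have "apx m k i0 K (\<lambda>i. inverse (c i))"
    if i0: "i0 \<le> k" and c: "apx m k i0 M c" and lb: "\<forall>i\<le>k. c0 \<le> norm (c i)" for k i0 c
  proof -
    have M: "0 \<le> M" using apx_nonneg[OF c] .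
    have nz: "c i \<noteq> 0" if "i \<le> k" for i using lb that assms(1) by fastforce
    have inv: "norm (inverse (c i)) \<le> inverse c0" if "i \<le> k" for i
      using lb that assms(1) by (simp add: norm_inverse le_imp_inverse_le)
    define u where "u i = 1 + (- inverse (c i0)) * c i" for i
    have "apx m k i0 (1 + norm (- inverse (c i0)) * M) u"
      unfolding u_def by (intro apx_add apx_const apx_cmult c assms) auto
    then have u: "apx m k i0 U u"
      by (rule apx_mono) (use inv[OF i0] M in \<open>simp add: U_def mult_right_mono\<close>)
    have "apx m k i0 (norm (inverse (c i0)) * (\<Sum>l<m. (4 * U) ^ l)) (\<lambda>i. inverse (c i0) * (\<Sum>l<m. u i ^ l))"
      by (intro apx_cmult apx_sum apx_power u i0 assms)
    then have A: "apx m k i0 (inverse c0 * (\<Sum>l<m. (4 * U) ^ l)) (\<lambda>i. inverse (c i0) * (\<Sum>l<m. u i ^ l))"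
      by (rule apx_mono) (use inv[OF i0] apx_nonneg[OF u] in \<open>auto intro!: mult_right_mono sum_nonneg\<close>)
    show ?thesis unfolding K_def
    proof (rule apx_perturb[OF A i0])
      fix i assume i: "i \<le> k"
      let ?x = "tm k i0 i"
      have 1: "1 - u i = inverse (c i0) * c i" by (simp add: u_def)
      have "(1 - u i) * (\<Sum>l<m. u i ^ l) = 1 - u i ^ m"
        by (simp add: one_diff_power_eq lessThan_atLeast0)
      then have "inverse (c i0) * c i * (\<Sum>l<m. u i ^ l) = 1 - u i ^ m" unfolding 1 .
      moreover have "inverse (c i) - inverse (c i0) * (\<Sum>l<m. u i ^ l) =
          inverse (c i) * (1 - inverse (c i0) * c i * (\<Sum>l<m. u i ^ l))"
        using nz[OF i] by (simp add: right_diff_distrib)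
      ultimately have "inverse (c i) - inverse (c i0) * (\<Sum>l<m. u i ^ l) = u i ^ m * inverse (c i)"
        by simp
      moreover have "norm (u i) \<le> inverse c0 * (2 * M) * norm ?x"
      proof -
        have "u i = inverse (c i0) * (c i0 - c i)" using nz[OF i0] by (simp add: u_def algebra_simps)
        then have "norm (u i) = norm (inverse (c i0)) * norm (c i - c i0)"
          by (simp add: norm_mult norm_minus_commute)
        also have "\<dots> \<le> inverse c0 * (2 * M * norm ?x)"
          using apx_lip[OF c i i0 assms(2)] inv[OF i0] assms M by (intro mult_mono) auto
        finally show ?thesis by (simp add: mult_ac)
      qed
      ultimately have "norm (inverse (c i) - inverse (c i0) * (\<Sum>l<m. u i ^ l)) \<le>
          (inverse c0 * (2 * M) * norm ?x) ^ m * inverse c0"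
        unfolding norm_mult norm_power using inv[OF i] assms M
        by (simp only: norm_mult norm_power) (intro mult_mono power_mono, auto)
      then show "norm (inverse (c i) - inverse (c i0) * (\<Sum>l<m. u i ^ l)) \<le>
          (inverse c0 * (2 * M)) ^ m * inverse c0 * norm ?x ^ m"
        by (simp add: power_mult_distrib mult_ac)
    qed (use assms M in auto)
  qed
  then show ?thesis by blast
qed

text \<open>Newton interpolation: one node is divided off at a time, and the quotient takes values
  at most \<open>2 * A / d\<close> at the remaining nodes.\<close>

lemma interpolation_bound:
  assumes "0 < d"
  shows "\<exists>C\<ge>1. \<forall>(Q::complex poly) (S::complex set) A. finite S \<longrightarrow> card S = m \<longrightarrow> (\<forall>x\<in>S. norm x \<le> 1) \<longrightarrow> (\<forall>x\<in>S. \<forall>y\<in>S. x \<noteq> y \<longrightarrow> d \<le> dist x y) \<longrightarrow>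
     (\<forall>l\<ge>m. coeff Q l = 0) \<longrightarrow> 0 \<le> A \<longrightarrow> (\<forall>x\<in>S. norm (poly Q x) \<le> A) \<longrightarrow> pnorm Q \<le> C * A"
proof (induction m)
  case 0
  have "pnorm Q = 0" if "\<forall>l\<ge>0. coeff Q l = 0" for Q
    using that by (simp add: pnorm_def)
  then show ?case by (intro exI[of _ "1::real"]) auto
next
  case (Suc m)
  then obtain C where C1: "1 \<le> C" and C: "\<And>(Q::complex poly) (S::complex set) A. finite S \<Longrightarrow> card S = m \<Longrightarrow> (\<forall>x\<in>S. norm x \<le> 1) \<Longrightarrow>
     (\<forall>x\<in>S. \<forall>y\<in>S. x \<noteq> y \<longrightarrow> d \<le> dist x y) \<Longrightarrow>
     (\<forall>l\<ge>m. coeff Q l = 0) \<Longrightarrow> 0 \<le> A \<Longrightarrow> (\<forall>x\<in>S. norm (poly Q x) \<le> A) \<Longrightarrow> pnorm Q \<le> C * A"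
    by blast
  show ?case
  proof (intro exI[of _ "1 + 4 * C / d"] conjI allI impI)
    show "1 \<le> 1 + 4 * C / d" using C1 assms by simp
    fix Q :: "complex poly" and S :: "complex set" and A :: real
    assume S: "finite S" "card S = Suc m" "\<forall>x\<in>S. norm x \<le> 1" "\<forall>x\<in>S. \<forall>y\<in>S. x \<noteq> y \<longrightarrow> d \<le> dist x y"
      and Q: "\<forall>l\<ge>Suc m. coeff Q l = 0" and A: "0 \<le> A" "\<forall>x\<in>S. norm (poly Q x) \<le> A"
    from S(2) obtain x S' where S': "S = insert x S'" "x \<notin> S'" "card S' = m" by (metis card_Suc_eq)
    define Q' where "Q' = synthetic_div Q x"
    have QQ: "Q = [:poly Q x:] + [:- x, 1:] * Q'"
      using synthetic_div_correct'[of x Q] by (simp add: Q'_def algebra_simps)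
    have deg: "\<forall>l\<ge>m. coeff Q' l = 0"
    proof (cases "Q' = 0")
      case False
      have "degree Q \<le> m" using Q by (intro degree_le) auto
      moreover have "degree Q' = degree Q - 1" by (simp add: Q'_def degree_synthetic_div)
      moreover have "degree Q \<noteq> 0" using False by (auto simp: Q'_def synthetic_div_eq_0_iff)
      ultimately show ?thesis by (auto intro!: coeff_eq_0)
    qed simp
    have "norm (poly Q' y) \<le> 2 * A / d" if y: "y \<in> S'" for y
    proof -
      have d: "d \<le> norm (y - x)" using S S' y by (auto simp: dist_norm)
      have "poly Q y - poly Q x = (y - x) * poly Q' y"
        by (subst QQ) (simp add: algebra_simps)
      then have "norm (y - x) * norm (poly Q' y) = norm (poly Q y - poly Q x)"
        by (simp add: norm_mult)
      also have "\<dots> \<le> 2 * A" using norm_triangle_ineq4[of "poly Q y" "poly Q x"] A(2) y S' by fastforce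
      finally have "d * norm (poly Q' y) \<le> 2 * A" using d mult_right_mono[OF d, of "norm (poly Q' y)"] by simp
      then show ?thesis using assms by (simp add: field_simps)
    qed
    then have "pnorm Q' \<le> C * (2 * A / d)"
      using S S' deg A assms by (intro C[of S']) auto
    moreover have "pnorm Q \<le> norm (poly Q x) + (norm x + 1) * pnorm Q'"
    proof -
      have "pnorm Q \<le> pnorm [:poly Q x:] + pnorm ([:- x, 1:] * Q')" by (subst QQ) (rule pnorm_add)
      also have "pnorm ([:- x, 1:] * Q') \<le> pnorm [:- x, 1:] * pnorm Q'" by (rule pnorm_mult)
      finally show ?thesis by (simp add: pnorm_pCons del: mult_pCons_left)
    qed
    moreover have "(norm x + 1) * pnorm Q' \<le> 2 * pnorm Q'" using S S' by (intro mult_right_mono) auto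
    moreover have "norm (poly Q x) \<le> A" using A(2) S' by blast
    moreover have "(1 + 4 * C / d) * A = A + 2 * (C * (2 * A / d))" by (simp add: field_simps)
    ultimately show "pnorm Q \<le> (1 + 4 * C / d) * A" by linarith
  qed
qed

text \<open>A polynomial of degree below \<open>m\<close> is controlled by its values at
  \<open>m\<close> well separated nodes, and there it is close to the bounded samples. The
  hypothesis \<open>m \<le> k\<close> provides enough samples.\<close>

lemma lerr_apx:
  assumes "1 \<le> m"
  shows "\<exists>C\<ge>1. \<forall>k i0 A M c Q. m \<le> k \<longrightarrow> i0 \<le> k \<longrightarrow> 0 \<le> M \<longrightarrow> (\<forall>i\<le>k. norm (c i) \<le> A) \<longrightarrow> lerr m k i0 M c Q \<longrightarrow>
     apx m k i0 (C * (A + M)) c"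
proof -
  obtain C where C1: "1 \<le> C" and C: "\<And>(Q::complex poly) (S::complex set) A. finite S \<Longrightarrow> card S = m \<Longrightarrow> (\<forall>x\<in>S. norm x \<le> 1) \<Longrightarrow>
     (\<forall>x\<in>S. \<forall>y\<in>S. x \<noteq> y \<longrightarrow> 1 / (2 * real m) \<le> dist x y) \<Longrightarrow>
     (\<forall>l\<ge>m. coeff Q l = 0) \<Longrightarrow> 0 \<le> A \<Longrightarrow> (\<forall>x\<in>S. norm (poly Q x) \<le> A) \<Longrightarrow> pnorm Q \<le> C * A"
    using interpolation_bound[of "1 / (2 * real m)" m] assms by auto
  have "apx m k i0 (C * (A + M)) c"
    if k: "m \<le> k" and i0: "i0 \<le> k" and M: "0 \<le> M" and A: "\<forall>i\<le>k. norm (c i) \<le> A" and Q: "lerr m k i0 M c Q"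
    for k i0 A M c Q
  proof -
    have A0: "0 \<le> A" using A norm_ge_zero order_trans by blast
    \<comment> \<open>The nodes are the samples \<open>0, s, ..., (m - 1) * s\<close>. As
      \<open>k < m * s + m \<le> 2 * m * s\<close>, neighbours are at least
      \<open>1 / (2 * m)\<close> apart in time.\<close>
    define s where "s = k div m"
    have s1: "1 \<le> s" unfolding s_def using k assms by (simp add: div_greater_zero_iff Suc_le_eq)
    have "k < m * s + m" unfolding s_def using assms
      by (metis add.commute div_mult_mod_eq dual_order.strict_trans2 mod_less_divisor mult.commute nat_add_left_cancel_less not_less zero_less_one)
    also have "\<dots> \<le> 2 * m * s" using s1 by simp
    finally have s2: "real k \<le> 2 * real m * real s" by (metis less_imp_le of_nat_le_iff of_nat_mult of_nat_numeral)
    have inj: "dist (tm k i0 (l * s)) (tm k i0 (l' * s)) \<ge> 1 / (2 * real m)" if "l \<noteq> l'" for l l'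
    proof -
      have "tm k i0 (l * s) - tm k i0 (l' * s) = of_real ((real l - real l') * (real s / real k))"
        by (simp add: tm_def diff_divide_distrib left_diff_distrib)
      then have "dist (tm k i0 (l * s)) (tm k i0 (l' * s)) = \<bar>real l - real l'\<bar> * (real s / real k)"
        by (simp add: dist_norm norm_mult norm_divide del: of_real_mult of_real_divide)
          (simp add: abs_mult)
      moreover have "1 \<le> \<bar>real l - real l'\<bar>" using that by linarith
      moreover have "1 / (2 * real m) \<le> real s / real k"
        using s2 k assms by (simp add: field_simps)
      ultimately show ?thesis using mult_mono[of 1 "\<bar>real l - real l'\<bar>" "1 / (2 * real m)" "real s / real k"] by simp
    qed
    define S where "S = (\<lambda>l. tm k i0 (l * s)) ` {..<m}"
    have ls: "l * s \<le> k" if "l < m" for l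
      using that mult_le_mono1[of l m s] by (simp add: s_def) (metis div_times_less_eq_dividend less_imp_le_nat mult.commute order_trans mult_le_mono1)
    have "inj_on (\<lambda>l. tm k i0 (l * s)) {..<m}"
    proof (rule inj_onI)
      fix l l' assume "tm k i0 (l * s) = tm k i0 (l' * s)"
      then show "l = l'" using inj[of l l'] assms by (cases "l = l'") auto
    qed
    then have cS: "card S = m" unfolding S_def by (simp add: card_image)
    have t: "norm (tm k i0 i) \<le> 1" if "i \<le> k" for i using norm_tm_le_1 that i0 by blast
    have "pnorm Q \<le> C * (A + M)"
    proof (rule C[OF _ cS])
      show "\<forall>x\<in>S. norm (poly Q x) \<le> A + M"
      proof
        fix x assume "x \<in> S"
        then obtain l where l: "l < m" "x = tm k i0 (l * s)" by (auto simp: S_def)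
        have "norm (c (l * s) - poly Q x) \<le> M * norm x ^ m" using Q ls[OF l(1)] l unfolding lerr_def by blast
        also have "\<dots> \<le> M * 1" using t[OF ls[OF l(1)]] M l by (intro mult_left_mono power_le_one) auto
        finally show "norm (poly Q x) \<le> A + M"
          using A ls[OF l(1)] norm_triangle_sub[of "poly Q x" "c (l * s)"] by (force simp: norm_minus_commute)
      qed
      show "\<forall>x\<in>S. \<forall>y\<in>S. x \<noteq> y \<longrightarrow> 1 / (2 * real m) \<le> dist x y"
      proof (intro ballI impI)
        fix x y assume "x \<in> S" "y \<in> S" "x \<noteq> y"
        then obtain l l' where "x = tm k i0 (l * s)" "y = tm k i0 (l' * s)" "l \<noteq> l'" by (auto simp: S_def)
        with inj[of l l'] show "1 / (2 * real m) \<le> dist x y" by simp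
      qed
    qed (use Q A0 M t ls in \<open>auto simp: lerr_def S_def\<close>)
    moreover have "lerr m k i0 (C * (A + M)) c Q"
      by (rule lerr_mono[OF Q]) (use C1 A0 M mult_mono[of 1 C M "A + M"] in auto)
    ultimately show ?thesis unfolding apx_def by blast
  qed
  with C1 show ?thesis by blast
qed

lemma apx_coeff_linear_power:
  assumes "1 \<le> m"
  shows "\<exists>K. \<forall>k i0 s. i0 \<le> k \<longrightarrow> apx m k i0 M s \<longrightarrow> (\<forall>j. apx m k i0 K (\<lambda>i. coeff ([:s i, 1:] ^ l) j))"
proof (induction l)
  case 0
  show ?case by (intro exI[of _ 1]) (auto intro!: apx_const assms)
next
  case (Suc l)
  then obtain K where K: "\<And>k i0 s j. i0 \<le> k \<Longrightarrow> apx m k i0 M s \<Longrightarrow> apx m k i0 K (\<lambda>i. coeff ([:s i, 1:] ^ l) j)"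
    by blast
  have "apx m k i0 (4 * M * K + K) (\<lambda>i. coeff ([:s i, 1:] ^ Suc l) j)" if "i0 \<le> k" "apx m k i0 M s" for k i0 s j
  proof (cases j)
    case 0
    have "apx m k i0 (4 * M * K) (\<lambda>i. s i * coeff ([:s i, 1:] ^ l) 0)"
      by (intro apx_mult K that)
    then show ?thesis using 0 apx_nonneg[OF K[OF that]] by (auto intro: apx_mono)
  next
    case (Suc j')
    have "apx m k i0 (4 * M * K + K) (\<lambda>i. s i * coeff ([:s i, 1:] ^ l) j + coeff ([:s i, 1:] ^ l) j')"
      by (intro apx_add apx_mult K that)
    then show ?thesis using Suc by simp
  qed
  then show ?case by blast
qed

text \<open>The new coefficients are polynomial expressions in \<open>s\<close> and the old ones.
  This is what allows the roots to be centred.\<close>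

lemma apx_coeff_shift:
  assumes "1 \<le> m"
  shows "\<exists>K. \<forall>k i0 s p. i0 \<le> k \<longrightarrow> apx m k i0 M s \<longrightarrow> (\<forall>i. degree (p i) \<le> n) \<longrightarrow> (\<forall>j\<le>n. apx m k i0 M (\<lambda>i. coeff (p i) j)) \<longrightarrow>
     (\<forall>j. apx m k i0 K (\<lambda>i. coeff (pcompose (p i) [:s i, 1:]) j))"
proof -
  have "\<exists>K. \<forall>l. \<forall>k i0 s. i0 \<le> k \<longrightarrow> apx m k i0 M s \<longrightarrow> (\<forall>j. apx m k i0 (K l) (\<lambda>i. coeff ([:s i, 1:] ^ l) j))"
    by (rule choice) (use apx_coeff_linear_power[OF assms] in blast)
  then obtain K where K: "\<And>l k i0 s j. i0 \<le> k \<Longrightarrow> apx m k i0 M s \<Longrightarrow> apx m k i0 (K l) (\<lambda>i. coeff ([:s i, 1:] ^ l) j)"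
    by blast
  have main: "apx m k i0 (\<Sum>l\<le>n. 4 * M * K l) (\<lambda>i. coeff (pcompose (p i) [:s i, 1:]) j)"
    if "i0 \<le> k" "apx m k i0 M s" "\<forall>i. degree (p i) \<le> n" "\<forall>j\<le>n. apx m k i0 M (\<lambda>i. coeff (p i) j)" for k i0 s p j
  proof -
    have "coeff (pcompose (p i) [:s i, 1:]) j = (\<Sum>l\<le>n. coeff (p i) l * coeff ([:s i, 1:] ^ l) j)" for i
    proof -
      have "pcompose (p i) [:s i, 1:] = (\<Sum>l\<le>degree (p i). smult (coeff (p i) l) ([:s i, 1:] ^ l))"
        unfolding poly_eq_poly_eq_iff[symmetric]
        by (rule ext) (simp only: poly_pcompose poly_sum poly_smult poly_power poly_altdef[of "p i"])
      also have "\<dots> = (\<Sum>l\<le>n. smult (coeff (p i) l) ([:s i, 1:] ^ l))"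
        using that(3) by (intro sum.mono_neutral_left) (auto simp: coeff_eq_0)
      finally show ?thesis by (simp add: coeff_sum)
    qed
    then have "(\<lambda>i. coeff (pcompose (p i) [:s i, 1:]) j) = (\<lambda>i. \<Sum>l\<le>n. coeff (p i) l * coeff ([:s i, 1:] ^ l) j)"
      by (rule ext)
    moreover have "apx m k i0 (\<Sum>l\<le>n. 4 * M * K l) (\<lambda>i. \<Sum>l\<le>n. coeff (p i) l * coeff ([:s i, 1:] ^ l) j)"
      by (rule apx_sum[OF assms], rule apx_mult[OF that(4)[rule_format] K[OF that(1,2)] that(1)]) simp
    ultimately show ?thesis by (simp only:)
  qed
  show ?thesis by (intro exI allI impI) (rule main)
qed

section \<open>Hensel lifting: regularity of coprime factors\<close>

lemma coeff_mult_0: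
  assumes "\<forall>i\<ge>a. coeff p i = 0" "\<forall>i\<ge>b. coeff q i = 0" "a + b \<le> i"
  shows "coeff (p * q :: complex poly) i = 0"
  unfolding coeff_mult
proof (rule sum.neutral, rule ballI)
  fix j assume "j \<in> {..i}"
  then have "a \<le> j \<or> b \<le> i - j" using assms(3) by auto
  then show "coeff p j * coeff q (i - j) = 0" using assms(1,2) by auto
qed

text \<open>\<^term>\<open>F l\<close> is the coefficient of order l in time of a polynomial whose value at time 0 has the
  roots G + H; the factors are found order by order, each order being a Bezout equation for the two
  coprime factors at time 0.\<close>
lemma hensel_lift:
  fixes n :: nat
  assumes "0 \<le> B" "0 < d" "0 \<le> M"
  shows "\<exists>K\<ge>0. \<forall>G H F. size G = m1 \<longrightarrow> size H = m2 \<longrightarrow> (\<forall>x. x \<in># G + H \<longrightarrow> norm x \<le> B) \<longrightarrow>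
    (\<forall>x y. x \<in># G \<longrightarrow> y \<in># H \<longrightarrow> d \<le> dist x y) \<longrightarrow>
    (\<forall>l. (\<forall>i\<ge>m1 + m2. coeff (F l) i = 0) \<and> pnorm (F l) \<le> M) \<longrightarrow>
    (\<exists>g h. g 0 = rpoly G \<and> h 0 = rpoly H \<and>
      (\<forall>l. 1 \<le> l \<longrightarrow> l \<le> n \<longrightarrow> (\<forall>i\<ge>m1. coeff (g l) i = 0) \<and> (\<forall>i\<ge>m2. coeff (h l) i = 0) \<and>
        pnorm (g l) \<le> K \<and> pnorm (h l) \<le> K \<and> (\<Sum>p\<le>l. g p * h (l - p)) = F l))"
proof (induction n)
  case 0
  have "\<exists>g h. g 0 = rpoly G \<and> h 0 = rpoly H" for G H
    by (intro exI[of _ "\<lambda>_. rpoly G"] exI[of _ "\<lambda>_. rpoly H"]) simp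
  then show ?case by (intro exI[of _ "0::real"]) auto
next
  case (Suc n)
  then obtain K where K0: "0 \<le> K" and K: "\<forall>G H F. size G = m1 \<longrightarrow> size H = m2 \<longrightarrow> (\<forall>x. x \<in># G + H \<longrightarrow> norm x \<le> B) \<longrightarrow>
    (\<forall>x y. x \<in># G \<longrightarrow> y \<in># H \<longrightarrow> d \<le> dist x y) \<longrightarrow>
    (\<forall>l. (\<forall>i\<ge>m1 + m2. coeff (F l) i = 0) \<and> pnorm (F l) \<le> M) \<longrightarrow>
    (\<exists>g h. g 0 = rpoly G \<and> h 0 = rpoly H \<and>
      (\<forall>l. 1 \<le> l \<longrightarrow> l \<le> n \<longrightarrow> (\<forall>i\<ge>m1. coeff (g l) i = 0) \<and> (\<forall>i\<ge>m2. coeff (h l) i = 0) \<and>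
        pnorm (g l) \<le> K \<and> pnorm (h l) \<le> K \<and> (\<Sum>p\<le>l. g p * h (l - p)) = F l))"
    by (elim exE conjE)
  from bezout_rpoly[OF assms(1,2), of m1 m2] obtain C where C0: "0 \<le> C" and C:
    "\<forall>G H. size G = m1 \<longrightarrow> size H = m2 \<longrightarrow> (\<forall>x. x \<in># G + H \<longrightarrow> norm x \<le> B) \<longrightarrow>
    (\<forall>x y. x \<in># G \<longrightarrow> y \<in># H \<longrightarrow> d \<le> dist x y) \<longrightarrow>
    (\<forall>u v. (\<forall>i\<ge>m1. coeff u i = 0) \<longrightarrow> (\<forall>i\<ge>m2. coeff v i = 0) \<longrightarrow>
       pnorm u \<le> C * pnorm (u * rpoly H + rpoly G * v) \<and> pnorm v \<le> C * pnorm (u * rpoly H + rpoly G * v)) \<and>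
    (\<forall>e. (\<forall>i\<ge>m1+m2. coeff e i = 0) \<longrightarrow>
       (\<exists>u v. (\<forall>i\<ge>m1. coeff u i = 0) \<and> (\<forall>i\<ge>m2. coeff v i = 0) \<and> u * rpoly H + rpoly G * v = e))"
    by (elim exE conjE)
  define E where "E = M + n * (K * K)"
  have E0: "0 \<le> E" using assms by (simp add: E_def)
  have main: "\<exists>g h. g 0 = rpoly G \<and> h 0 = rpoly H \<and>
      (\<forall>l. 1 \<le> l \<longrightarrow> l \<le> Suc n \<longrightarrow> (\<forall>i\<ge>m1. coeff (g l) i = 0) \<and> (\<forall>i\<ge>m2. coeff (h l) i = 0) \<and>
        pnorm (g l) \<le> K + C * E \<and> pnorm (h l) \<le> K + C * E \<and> (\<Sum>p\<le>l. g p * h (l - p)) = F l)"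
    if A: "size G = m1" "size H = m2" "\<forall>x. x \<in># G + H \<longrightarrow> norm x \<le> B" "\<forall>x y. x \<in># G \<longrightarrow> y \<in># H \<longrightarrow> d \<le> dist x y"
      and F: "\<forall>l. (\<forall>i\<ge>m1 + m2. coeff (F l) i = 0) \<and> pnorm (F l) \<le> M" for G H F
  proof -
    from K[THEN spec, THEN spec, THEN spec, THEN mp, OF A(1), THEN mp, OF A(2), THEN mp, OF A(3), THEN mp, OF A(4), THEN mp, OF F]
    obtain g h where g0: "g 0 = rpoly G" "h 0 = rpoly H" and gh: "\<And>l. 1 \<le> l \<Longrightarrow> l \<le> n \<Longrightarrow>
      (\<forall>i\<ge>m1. coeff (g l) i = 0) \<and> (\<forall>i\<ge>m2. coeff (h l) i = 0) \<and>
        pnorm (g l) \<le> K \<and> pnorm (h l) \<le> K \<and> (\<Sum>p\<le>l. g p * h (l - p)) = F l"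
      by blast
    \<comment> \<open>The terms of order \<open>Suc n\<close> in the product that contain neither
      \<open>g 0\<close> nor \<open>h 0\<close> are already determined; the two new coefficients
      must account for the rest.\<close>
    define S where "S = (\<Sum>p\<in>{1..n}. g p * h (Suc n - p))"
    define e where "e = F (Suc n) - S"
    have Sz: "coeff S i = 0" if "i \<ge> m1 + m2" for i
      unfolding S_def coeff_sum
      by (rule sum.neutral) (use gh that in \<open>auto intro!: coeff_mult_0\<close>)
    have ez: "\<forall>i\<ge>m1+m2. coeff e i = 0" using F Sz by (simp add: e_def)
    have "pnorm S \<le> (\<Sum>p\<in>{1..n}. K * K)" unfolding S_def
      by (intro order_trans[OF pnorm_sum sum_mono] order_trans[OF pnorm_mult mult_mono])
        (use gh K0 in auto)
    then have eE: "pnorm e \<le> E"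
    proof -
      have "pnorm (F (Suc n)) \<le> M" using F by blast
      then show ?thesis
        using \<open>pnorm S \<le> (\<Sum>p\<in>{1..n}. K * K)\<close> pnorm_diff[of "F (Suc n)" S] by (simp add: e_def E_def)
    qed
    note CC = C[THEN spec, THEN spec, THEN mp, OF A(1), THEN mp, OF A(2), THEN mp, OF A(3), THEN mp, OF A(4)]
    from CC ez obtain u v where uv: "\<forall>i\<ge>m1. coeff u i = 0" "\<forall>i\<ge>m2. coeff v i = 0" "u * rpoly H + rpoly G * v = e"
      by blast
    have "pnorm u \<le> C * pnorm e" "pnorm v \<le> C * pnorm e" using CC uv by auto
    then have bd: "pnorm u \<le> C * E" "pnorm v \<le> C * E"
      using mult_left_mono[OF eE C0] by auto
    define g' where "g' = g(Suc n := u)"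
    define h' where "h' = h(Suc n := v)"
    have old: "g' l = g l" "h' l = h l" if "l \<le> n" for l using that by (auto simp: g'_def h'_def)
    show ?thesis
    proof (rule exI[of _ g'], rule exI[of _ h'], intro conjI)
      show "g' 0 = rpoly G" "h' 0 = rpoly H" using g0 by (auto simp: g'_def h'_def)
      show "\<forall>l. 1 \<le> l \<longrightarrow> l \<le> Suc n \<longrightarrow> (\<forall>i\<ge>m1. coeff (g' l) i = 0) \<and> (\<forall>i\<ge>m2. coeff (h' l) i = 0) \<and>
        pnorm (g' l) \<le> K + C * E \<and> pnorm (h' l) \<le> K + C * E \<and> (\<Sum>p\<le>l. g' p * h' (l - p)) = F l"
      proof (intro allI impI)
        fix l assume l: "1 \<le> l" "l \<le> Suc n"
        have CE: "0 \<le> C * E" using C0 E0 by simp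
        show "(\<forall>i\<ge>m1. coeff (g' l) i = 0) \<and> (\<forall>i\<ge>m2. coeff (h' l) i = 0) \<and>
          pnorm (g' l) \<le> K + C * E \<and> pnorm (h' l) \<le> K + C * E \<and> (\<Sum>p\<le>l. g' p * h' (l - p)) = F l"
        proof (cases "l = Suc n")
          case False
          then have ln: "l \<le> n" using l by simp
          have "(\<Sum>p\<le>l. g' p * h' (l - p)) = (\<Sum>p\<le>l. g p * h (l - p))"
            using ln by (intro sum.cong) (auto simp: old)
          with gh[OF l(1) ln] ln CE show ?thesis by (auto simp: old)
        next
          case True
          have "{..Suc n} = insert 0 (insert (Suc n) {1..n})" by auto
          then have "(\<Sum>p\<le>Suc n. g' p * h' (Suc n - p)) = g' 0 * h' (Suc n) + (g' (Suc n) * h' 0 + (\<Sum>p\<in>{1..n}. g' p * h' (Suc n - p)))"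
            by simp
          also have "(\<Sum>p\<in>{1..n}. g' p * h' (Suc n - p)) = S"
            unfolding S_def by (intro sum.cong) (auto simp: old)
          also have "g' 0 * h' (Suc n) + (g' (Suc n) * h' 0 + S) = F (Suc n)"
            using uv(3) g0 by (simp add: g'_def h'_def e_def algebra_simps)
          finally show ?thesis using True bd uv K0 by (simp add: g'_def h'_def)
        qed
      qed
    qed
  qed
  show ?case
    by (rule exI[of _ "K + C * E"]) (use main K0 C0 E0 in auto)
qed

lemma pnorm_diff_coeffs:
  fixes n :: nat and c :: real
  assumes "\<forall>j\<ge>n. coeff p j = 0" "\<And>j. j < n \<Longrightarrow> norm (coeff p j) \<le> c" "0 \<le> c"
  shows "pnorm p \<le> n * c"
proof -
  have "degree p \<le> n" using assms(1) by (intro degree_le) auto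
  then have "pnorm p = (\<Sum>i\<le>n. norm (coeff p i))" by (rule pnorm_eq)
  also have "\<dots> = (\<Sum>i<n. norm (coeff p i))" using assms(1) by (simp add: lessThan_Suc_atMost[symmetric])
  also have "\<dots> \<le> n * c" using sum_bounded_above[of "{..<n}" "\<lambda>i. norm (coeff p i)" c] assms(2) by simp
  finally show ?thesis .
qed

lemma coeff_rpoly_diff_0: "size A = m \<Longrightarrow> size A' = m \<Longrightarrow> m \<le> i \<Longrightarrow> coeff (rpoly A - rpoly A') i = 0"
  by (cases "i = m") (use coeff_rpoly_size[of A] coeff_rpoly_size[of A'] in \<open>auto simp: coeff_eq_0\<close>)

lemma smult_sum_right: "smult a (sum f S) = (\<Sum>i\<in>S. smult a (f i))"
  by (induction S rule: infinite_finite_induct) (auto simp: smult_add_right)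

text \<open>What the truncated Cauchy product omits consists of at most m^2 terms, all of order at
  least \<open>m\<close> in \<open>x\<close>.\<close>

lemma truncated_product:
  fixes g h :: "nat \<Rightarrow> complex poly" and K :: real
  assumes x: "norm x \<le> 1" and g: "\<And>l. l < m \<Longrightarrow> pnorm (g l) \<le> K" and h: "\<And>l. l < m \<Longrightarrow> pnorm (h l) \<le> K"
    and K: "0 \<le> K"
  shows "pnorm ((\<Sum>l<m. smult (x ^ l) (g l)) * (\<Sum>l<m. smult (x ^ l) (h l))
      - (\<Sum>l<m. smult (x ^ l) (\<Sum>p\<le>l. g p * h (l - p)))) \<le> real m * real m * (K * K) * norm x ^ m"
proof -
  define T where "T = (\<lambda>(l, p). smult (x ^ (l + p)) (g l * h p))"
  have "(\<Sum>l<m. smult (x ^ l) (g l)) * (\<Sum>l<m. smult (x ^ l) (h l)) = sum T ({..<m} \<times> {..<m})"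
    unfolding T_def by (simp add: sum_product sum.cartesian_product power_add mult.commute)
  also have "{..<m} \<times> {..<m} = {(l,p). l + p < m} \<union> {(l,p). l < m \<and> p < m \<and> m \<le> l + p}" by auto
  also have "sum T \<dots> = sum T {(l,p). l + p < m} + sum T {(l,p). l < m \<and> p < m \<and> m \<le> l + p}"
    by (rule sum.union_disjoint)
      (auto intro: finite_subset[of _ "{..<m} \<times> {..<m}"])
  also have "sum T {(l,p). l + p < m} = (\<Sum>l<m. \<Sum>p\<le>l. smult (x ^ l) (g p * h (l - p)))"
    unfolding T_def by (subst sum.triangle_reindex) (auto intro!: sum.cong)
  also have "\<dots> = (\<Sum>l<m. smult (x ^ l) (\<Sum>p\<le>l. g p * h (l - p)))" by (simp add: smult_sum_right)
  finally have "(\<Sum>l<m. smult (x ^ l) (g l)) * (\<Sum>l<m. smult (x ^ l) (h l))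
      - (\<Sum>l<m. smult (x ^ l) (\<Sum>p\<le>l. g p * h (l - p))) = sum T {(l,p). l < m \<and> p < m \<and> m \<le> l + p}" by simp
  moreover have "pnorm (sum T {(l,p). l < m \<and> p < m \<and> m \<le> l + p}) \<le> (\<Sum>lp\<in>{(l,p). l < m \<and> p < m \<and> m \<le> l + p}. K * K * norm x ^ m)"
  proof (rule order_trans[OF pnorm_sum sum_mono])
    fix lp assume "lp \<in> {(l,p). l < m \<and> p < m \<and> m \<le> l + p}"
    then obtain l p where lp: "lp = (l, p)" "l < m" "p < m" "m \<le> l + p" by auto
    have "pnorm (g l * h p) \<le> K * K"
      using g[OF lp(2)] h[OF lp(3)] K by (intro order_trans[OF pnorm_mult mult_mono]) auto
    moreover have "norm x ^ (l + p) \<le> norm x ^ m" using x lp(4) by (intro power_decreasing) auto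
    ultimately have "norm x ^ (l + p) * pnorm (g l * h p) \<le> norm x ^ m * (K * K)"
      using K by (intro mult_mono) auto
    then show "pnorm (T lp) \<le> K * K * norm x ^ m" by (simp add: T_def lp(1) pnorm_smult norm_power mult.commute)
  qed
  moreover have "\<dots> \<le> real m * real m * (K * K) * norm x ^ m"
  proof -
    have "card {(l,p). l < m \<and> p < m \<and> m \<le> l + p} \<le> card ({..<m} \<times> {..<m})"
      by (intro card_mono) auto
    then have "real (card {(l,p). l < m \<and> p < m \<and> m \<le> l + p}) \<le> real m * real m"
      by (simp flip: of_nat_mult)
    then have "real (card {(l,p). l < m \<and> p < m \<and> m \<le> l + p}) * (K * K * norm x ^ m) \<le> real m * real m * (K * K * norm x ^ m)"
      using K by (intro mult_right_mono) auto
    then show ?thesis by (simp add: mult.assoc)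
  qed
  ultimately show ?thesis by simp
qed

lemma poly_sum_lessThan:
  fixes Q :: "complex poly"
  assumes "\<forall>l\<ge>m. coeff Q l = 0"
  shows "poly Q x = (\<Sum>l<m. coeff Q l * x ^ l)"
proof (cases "m = 0")
  case True
  then have "Q = 0" using assms by (auto intro: poly_eqI)
  then show ?thesis using True by simp
next
  case False
  have "degree Q \<le> m - 1" using assms by (intro degree_le) auto
  then show ?thesis using False unfolding poly_altdef
    by (intro sum.mono_neutral_left) (auto simp: coeff_eq_0)
qed

text \<open>The Hensel factors, truncated at order \<open>m\<close> in time, are the candidates for
  the local polynomials. Their product agrees with the given one up to order \<open>m\<close>, and
  the stability of the Bezout identity passes this agreement on to the single factors. Separation
  between roots at different times keeps the true factors close to those at the base point.\<close>

lemma factor_apx: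
  assumes "0 \<le> B" "0 < d" "0 \<le> M" "1 \<le> m"
  shows "\<exists>K. \<forall>k G H. (\<forall>i\<le>k. size (G i) = m1 \<and> size (H i) = m2 \<and> (\<forall>x. x \<in># G i + H i \<longrightarrow> norm x \<le> B)) \<longrightarrow>
    (\<forall>i\<le>k. \<forall>i'\<le>k. \<forall>x y. x \<in># G i \<longrightarrow> y \<in># H i' \<longrightarrow> d \<le> dist x y) \<longrightarrow>
    (\<forall>i0\<le>k. \<forall>j<m1 + m2. apx m k i0 M (\<lambda>i. coeff (rpoly (G i) * rpoly (H i)) j)) \<longrightarrow>
    (\<forall>i0\<le>k. \<forall>j. apx m k i0 K (\<lambda>i. coeff (rpoly (G i)) j))"
proof -
  define M' where "M' = (m1 + m2) * M"
  have M'0: "0 \<le> M'" using assms by (simp add: M'_def)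
  from hensel_lift[OF assms(1,2) M'0, of m1 m2 m] obtain K0 where K00: "0 \<le> K0" and K0:
    "\<forall>G H F. size G = m1 \<longrightarrow> size H = m2 \<longrightarrow> (\<forall>x. x \<in># G + H \<longrightarrow> norm x \<le> B) \<longrightarrow>
    (\<forall>x y. x \<in># G \<longrightarrow> y \<in># H \<longrightarrow> d \<le> dist x y) \<longrightarrow>
    (\<forall>l. (\<forall>i\<ge>m1 + m2. coeff (F l) i = 0) \<and> pnorm (F l) \<le> M') \<longrightarrow>
    (\<exists>g h. g 0 = rpoly G \<and> h 0 = rpoly H \<and>
      (\<forall>l. 1 \<le> l \<longrightarrow> l \<le> m \<longrightarrow> (\<forall>i\<ge>m1. coeff (g l) i = 0) \<and> (\<forall>i\<ge>m2. coeff (h l) i = 0) \<and>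
        pnorm (g l) \<le> K0 \<and> pnorm (h l) \<le> K0 \<and> (\<Sum>p\<le>l. g p * h (l - p)) = F l))"
    by (elim exE conjE)
  from bezout_rpoly[OF assms(1,2), of m1 m2] obtain C where C0: "0 \<le> C" and C:
    "\<forall>G H. size G = m1 \<longrightarrow> size H = m2 \<longrightarrow> (\<forall>x. x \<in># G + H \<longrightarrow> norm x \<le> B) \<longrightarrow>
    (\<forall>x y. x \<in># G \<longrightarrow> y \<in># H \<longrightarrow> d \<le> dist x y) \<longrightarrow>
    (\<forall>u v. (\<forall>i\<ge>m1. coeff u i = 0) \<longrightarrow> (\<forall>i\<ge>m2. coeff v i = 0) \<longrightarrow>
       pnorm u \<le> C * pnorm (u * rpoly H + rpoly G * v) \<and> pnorm v \<le> C * pnorm (u * rpoly H + rpoly G * v)) \<and>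
    (\<forall>e. (\<forall>i\<ge>m1+m2. coeff e i = 0) \<longrightarrow>
       (\<exists>u v. (\<forall>i\<ge>m1. coeff u i = 0) \<and> (\<forall>i\<ge>m2. coeff v i = 0) \<and> u * rpoly H + rpoly G * v = e))"
    by (elim exE conjE)
  define K where "K = K0 + (1 + B) ^ m1 + (1 + B) ^ m2"
  have K: "0 \<le> K" "K0 \<le> K" "(1 + B) ^ m1 \<le> K" "(1 + B) ^ m2 \<le> K" using K00 assms by (auto simp: K_def)
  define L where "L = C * ((m1 + m2) * (2 * M))"
  have L: "0 \<le> L" using C0 assms by (simp add: L_def)
  define S where "S = L + m * K"
  have S: "0 \<le> S" using L K by (simp add: S_def)
  define E where "E = (m1 + m2) * M + real m * real m * (K * K)"
  have E: "0 \<le> E" using assms K by (simp add: E_def)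
  define N where "N = 2 * (C * E) + S * (2 * C * S) ^ m"
  have N: "0 \<le> N" using C0 E S by (simp add: N_def)
  have main: "apx m k i0 (m * K + N) (\<lambda>i. coeff (rpoly (G i)) j)"
    if A: "\<forall>i\<le>k. size (G i) = m1 \<and> size (H i) = m2 \<and> (\<forall>x. x \<in># G i + H i \<longrightarrow> norm x \<le> B)"
      and sep: "\<forall>i\<le>k. \<forall>i'\<le>k. \<forall>x y. x \<in># G i \<longrightarrow> y \<in># H i' \<longrightarrow> d \<le> dist x y"
      and ap: "\<forall>i0\<le>k. \<forall>j<m1 + m2. apx m k i0 M (\<lambda>i. coeff (rpoly (G i) * rpoly (H i)) j)"
      and i0: "i0 \<le> k" for k G H i0 j
  proof -
    define f where "f i = rpoly (G i) * rpoly (H i)" for i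
    have "\<exists>Q. \<forall>j<m1+m2. pnorm (Q j) \<le> M \<and> lerr m k i0 M (\<lambda>i. coeff (f i) j) (Q j)"
      using ap i0 unfolding apx_def f_def by metis
    then obtain Q where Q: "\<And>j. j < m1 + m2 \<Longrightarrow> pnorm (Q j) \<le> M"
      "\<And>j. j < m1 + m2 \<Longrightarrow> lerr m k i0 M (\<lambda>i. coeff (f i) j) (Q j)" by blast
    define F where "F l = (\<Sum>j<m1+m2. monom (coeff (Q j) l) j)" for l
    have coeffF: "coeff (F l) i = (if i < m1 + m2 then coeff (Q i) l else 0)" for l i
      by (simp add: F_def coeff_sum)
    have F: "\<forall>l. (\<forall>i\<ge>m1 + m2. coeff (F l) i = 0) \<and> pnorm (F l) \<le> M'"
    proof (intro allI conjI)
      fix l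
      have "pnorm (F l) \<le> real (m1 + m2) * M"
        using assms by (intro pnorm_diff_coeffs) (auto simp: coeffF intro: order_trans[OF coeff_le_pnorm Q(1)])
      then show "pnorm (F l) \<le> M'" by (simp add: M'_def)
    qed (simp add: coeffF)
    have A0: "size (G i0) = m1" "size (H i0) = m2" "\<forall>x. x \<in># G i0 + H i0 \<longrightarrow> norm x \<le> B"
      "\<forall>x y. x \<in># G i0 \<longrightarrow> y \<in># H i0 \<longrightarrow> d \<le> dist x y" using A sep i0 by blast+
    from K0[THEN spec, THEN spec, THEN spec, THEN mp, OF A0(1), THEN mp, OF A0(2), THEN mp, OF A0(3), THEN mp, OF A0(4), THEN mp, OF F]
    obtain g h where g0: "g 0 = rpoly (G i0)" "h 0 = rpoly (H i0)" and gh: "\<And>l. 1 \<le> l \<Longrightarrow> l \<le> m \<Longrightarrow>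
      (\<forall>i\<ge>m1. coeff (g l) i = 0) \<and> (\<forall>i\<ge>m2. coeff (h l) i = 0) \<and>
        pnorm (g l) \<le> K0 \<and> pnorm (h l) \<le> K0 \<and> (\<Sum>p\<le>l. g p * h (l - p)) = F l"
      by blast
    have pG: "pnorm (rpoly (G i)) \<le> K" "pnorm (rpoly (H i)) \<le> K" if "i \<le> k" for i
      using pnorm_rpoly[of "G i" B] pnorm_rpoly[of "H i" B] A that K by fastforce+
    have gK: "pnorm (g l) \<le> K" "pnorm (h l) \<le> K" if "l < m" for l
      using gh[of l] g0 pG[OF i0] K that by (cases "l = 0"; force)+
    define GG where "GG x = (\<Sum>l<m. smult (x ^ l) (g l))" for x :: complex
    define HH where "HH x = (\<Sum>l<m. smult (x ^ l) (h l))" for x :: complex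
    have split0: "{..<m} = insert 0 {1..<m}" using assms(4) by auto
    have GG0: "GG x = rpoly (G i0) + (\<Sum>l=1..<m. smult (x ^ l) (g l))"
      "HH x = rpoly (H i0) + (\<Sum>l=1..<m. smult (x ^ l) (h l))" for x
      unfolding GG_def HH_def split0 by (simp_all add: g0)
    have tail: "pnorm (\<Sum>l=1..<m. smult (x ^ l) (q l)) \<le> m * K * norm x"
      if x: "norm x \<le> 1" and q: "\<And>l. l < m \<Longrightarrow> pnorm (q l) \<le> K" for q :: "nat \<Rightarrow> complex poly" and x
    proof -
      have "pnorm (\<Sum>l=1..<m. smult (x ^ l) (q l)) \<le> (\<Sum>l=1..<m. norm x * K)"
      proof (rule order_trans[OF pnorm_sum sum_mono])
        fix l assume "l \<in> {1..<m}"
        then show "pnorm (smult (x ^ l) (q l)) \<le> norm x * K"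
          unfolding pnorm_smult norm_power using q x K power_decreasing[of 1 l "norm x"] by (intro mult_mono) auto
      qed
      also have "\<dots> \<le> m * (norm x * K)" using K by (simp add: mult_right_mono)
      finally show ?thesis by (simp add: mult_ac)
    qed
    have fdiff: "pnorm (f i - f i0) \<le> (m1 + m2) * (2 * M * norm (tm k i0 i))" if i: "i \<le> k" for i
    proof (rule pnorm_diff_coeffs)
      show "\<forall>j\<ge>m1 + m2. coeff (f i - f i0) j = 0"
        using A i i0 coeff_rpoly_diff_0[of "G i + H i" "m1 + m2" "G i0 + H i0"] by (simp add: f_def rpoly_union)
      fix j assume "j < m1 + m2"
      then have "apx m k i0 M (\<lambda>i. coeff (f i) j)" using ap i0 unfolding f_def by blast
      from apx_lip[OF this i i0 assms(4)] show "norm (coeff (f i - f i0) j) \<le> 2 * M * norm (tm k i0 i)" by simp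
    qed (use assms in auto)
    have key: "pnorm (rpoly (G i) - GG (tm k i0 i)) \<le> N * norm (tm k i0 i) ^ m" if i: "i \<le> k" for i
    proof -
      define x where "x = tm k i0 i"
      have x: "norm x \<le> 1" unfolding x_def using norm_tm_le_1 i i0 .
      have Ai: "size (G i) = m1" "size (H i) = m2" "\<forall>x. x \<in># G i + H i \<longrightarrow> norm x \<le> B"
        "\<forall>x y. x \<in># G i \<longrightarrow> y \<in># H i \<longrightarrow> d \<le> dist x y" using A sep i by blast+
      \<comment> \<open>The pair (\<open>G i0\<close>, \<open>H i\<close>) mixes two times. It is
        separated by hypothesis, and it is the pair that occurs when the difference of the two
        products is telescoped; this yields a Lipschitz bound for both factors.\<close>
      have Axi: "\<forall>x. x \<in># G i0 + H i \<longrightarrow> norm x \<le> B" "\<forall>x y. x \<in># G i0 \<longrightarrow> y \<in># H i \<longrightarrow> d \<le> dist x y"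
        using A0 Ai sep i i0 by auto
      note Cxi = C[THEN spec, THEN spec, THEN mp, OF A0(1), THEN mp, OF Ai(2), THEN mp, OF Axi(1), THEN mp, OF Axi(2)]
      note Ci = C[THEN spec, THEN spec, THEN mp, OF Ai(1), THEN mp, OF Ai(2), THEN mp, OF Ai(3), THEN mp, OF Ai(4)]
      have z1: "\<forall>j\<ge>m1. coeff (rpoly (G i) - rpoly (G i0)) j = 0" "\<forall>j\<ge>m2. coeff (rpoly (H i) - rpoly (H i0)) j = 0"
        using coeff_rpoly_diff_0[OF Ai(1) A0(1)] coeff_rpoly_diff_0[OF Ai(2) A0(2)] by blast+
      have "(rpoly (G i) - rpoly (G i0)) * rpoly (H i) + rpoly (G i0) * (rpoly (H i) - rpoly (H i0)) = f i - f i0"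
        by (simp add: f_def algebra_simps)
      then have "pnorm (rpoly (G i) - rpoly (G i0)) \<le> C * pnorm (f i - f i0) \<and> pnorm (rpoly (H i) - rpoly (H i0)) \<le> C * pnorm (f i - f i0)"
        using Cxi z1 by metis
      moreover have "C * pnorm (f i - f i0) \<le> L * norm x"
        using mult_left_mono[OF fdiff[OF i] C0] by (simp add: L_def x_def algebra_simps)
      ultimately have lip: "pnorm (rpoly (G i) - rpoly (G i0)) \<le> L * norm x" "pnorm (rpoly (H i) - rpoly (H i0)) \<le> L * norm x"
        by auto
      define u where "u = GG x - rpoly (G i)"
      define v where "v = HH x - rpoly (H i)"
      have ub: "pnorm u \<le> S * norm x"
      proof -
        have "u = (\<Sum>l=1..<m. smult (x ^ l) (g l)) - (rpoly (G i) - rpoly (G i0))" by (simp add: u_def GG0)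
        then have "pnorm u \<le> pnorm (\<Sum>l=1..<m. smult (x ^ l) (g l)) + pnorm (rpoly (G i) - rpoly (G i0))"
          using pnorm_diff by metis
        also have "\<dots> \<le> m * K * norm x + L * norm x" by (intro add_mono tail[OF x gK(1)] lip)
        finally show ?thesis by (simp add: S_def distrib_right)
      qed
      have vb: "pnorm v \<le> S * norm x"
      proof -
        have "v = (\<Sum>l=1..<m. smult (x ^ l) (h l)) - (rpoly (H i) - rpoly (H i0))" by (simp add: v_def GG0)
        then have "pnorm v \<le> pnorm (\<Sum>l=1..<m. smult (x ^ l) (h l)) + pnorm (rpoly (H i) - rpoly (H i0))"
          using pnorm_diff by metis
        also have "\<dots> \<le> m * K * norm x + L * norm x" by (intro add_mono tail[OF x gK(2)] lip)
        finally show ?thesis by (simp add: S_def distrib_right)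
      qed
      have uz: "\<forall>j\<ge>m1. coeff u j = 0"
        using z1(1) gh by (auto simp: u_def GG0 coeff_sum intro!: sum.neutral)
      have vz: "\<forall>j\<ge>m2. coeff v j = 0"
        using z1(2) gh by (auto simp: v_def GG0 coeff_sum intro!: sum.neutral)
      have prod: "pnorm (GG x * HH x - f i) \<le> E * norm x ^ m"
      proof -
        \<comment> \<open>\<open>F\<close> records only the coefficients below the top; the constant
          leading term of the monic product has to be added in order 0.\<close>
        have lower: "(\<Sum>p\<le>l. g p * h (l - p)) = F l + (if l = 0 then monom 1 (m1 + m2) else 0)" if "l < m" for l
        proof (cases "l = 0")
          case True
          have "f i0 = F 0 + monom 1 (m1 + m2)"
          proof (rule poly_eqI)
            fix j
            have "coeff (f i0) (m1 + m2) = 1" "degree (f i0) = m1 + m2"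
              using coeff_rpoly_size[of "G i0 + H i0"] degree_rpoly[of "G i0 + H i0"] A0(1,2)
              by (simp_all add: f_def rpoly_union del: coeff_rpoly_size degree_rpoly)
            moreover have "coeff (Q j) 0 = coeff (f i0) j" if "j < m1 + m2"
              using lerr_self[OF Q(2)[OF that] assms(4) i0] by (simp add: poly_0_coeff_0)
            ultimately show "coeff (f i0) j = coeff (F 0 + monom 1 (m1 + m2)) j"
              by (cases "j < m1 + m2"; cases "j = m1 + m2") (auto simp: coeffF coeff_eq_0)
          qed
          then show ?thesis using True g0 by (simp add: f_def)
        next
          case False
          then show ?thesis using gh[of l] that by auto
        qed
        have "(\<Sum>l<m. smult (x ^ l) (\<Sum>p\<le>l. g p * h (l - p))) = (\<Sum>l<m. smult (x ^ l) (F l)) + monom 1 (m1 + m2)"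
        proof -
          have "(\<Sum>l<m. smult (x ^ l) (\<Sum>p\<le>l. g p * h (l - p))) = (\<Sum>l<m. smult (x ^ l) (F l) + (if l = 0 then monom 1 (m1 + m2) else 0))"
            by (intro sum.cong refl) (auto simp: lower smult_add_right)
          then show ?thesis using assms(4) by (simp add: sum.distrib)
        qed
        moreover have "pnorm ((\<Sum>l<m. smult (x ^ l) (F l)) + monom 1 (m1 + m2) - f i) \<le> (m1 + m2) * (M * norm x ^ m)"
        proof (rule pnorm_diff_coeffs)
          have fi: "coeff (f i) (m1 + m2) = 1" "degree (f i) = m1 + m2"
            using coeff_rpoly_size[of "G i + H i"] degree_rpoly[of "G i + H i"] Ai(1,2)
            by (simp_all add: f_def rpoly_union del: coeff_rpoly_size degree_rpoly)
          show "\<forall>j\<ge>m1 + m2. coeff ((\<Sum>l<m. smult (x ^ l) (F l)) + monom 1 (m1 + m2) - f i) j = 0"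
          proof (intro allI impI)
            fix j assume "m1 + m2 \<le> j"
            then show "coeff ((\<Sum>l<m. smult (x ^ l) (F l)) + monom 1 (m1 + m2) - f i) j = 0"
              using fi by (cases "j = m1 + m2") (auto simp: coeff_sum coeffF coeff_eq_0)
          qed
          fix j assume j: "j < m1 + m2"
          have "coeff ((\<Sum>l<m. smult (x ^ l) (F l)) + monom 1 (m1 + m2) - f i) j = poly (Q j) x - coeff (f i) j"
            using j Q(2)[OF j] by (subst poly_sum_lessThan[of m]) (auto simp: coeff_sum coeffF lerr_def mult.commute)
          then show "norm (coeff ((\<Sum>l<m. smult (x ^ l) (F l)) + monom 1 (m1 + m2) - f i) j) \<le> M * norm x ^ m"
            using Q(2)[OF j] i unfolding lerr_def x_def by (simp add: norm_minus_commute)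
        qed (use assms in auto)
        moreover have "pnorm (GG x * HH x - (\<Sum>l<m. smult (x ^ l) (\<Sum>p\<le>l. g p * h (l - p)))) \<le> real m * real m * (K * K) * norm x ^ m"
          unfolding GG_def HH_def by (rule truncated_product[OF x]) (use gK K in auto)
        ultimately show ?thesis
          using pnorm_add[of "GG x * HH x - (\<Sum>l<m. smult (x ^ l) (\<Sum>p\<le>l. g p * h (l - p)))" "(\<Sum>l<m. smult (x ^ l) (F l)) + monom 1 (m1 + m2) - f i"]
          by (simp add: E_def algebra_simps)
      qed
      \<comment> \<open>Expanded around the true factors, the defect of the candidate product is a
        Bezout expression in the errors \<open>u\<close>, \<open>v\<close> plus the quadratic term
        \<open>u * v\<close>.\<close>
      have "u * rpoly (H i) + rpoly (G i) * v = (GG x * HH x - f i) - u * v"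
        by (simp add: u_def v_def f_def algebra_simps)
      then have "pnorm u \<le> C * pnorm ((GG x * HH x - f i) - u * v)"
        using Ci uz vz by metis
      also have "\<dots> \<le> C * (E * norm x ^ m + pnorm u * pnorm v)"
        using C0 prod by (intro mult_left_mono order_trans[OF pnorm_diff[of "GG x * HH x - f i" "u * v"]] add_mono pnorm_mult) auto
      finally have quad: "pnorm u \<le> C * (E * norm x ^ m + pnorm u * pnorm v)" .
      have "pnorm u \<le> N * norm x ^ m"
      \<comment> \<open>Near \<open>i0\<close> the quadratic term is at most half of
        \<open>pnorm u\<close> and is absorbed. Farther away \<open>norm x\<close> is bounded below,
        so the crude bound \<open>S\<close> is already of order \<open>m\<close>. The two summands
        of \<open>N\<close> belong to these cases.\<close>
      proof (cases "2 * C * S * norm x \<le> 1")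
        case True
        have "C * (pnorm u * pnorm v) \<le> C * (pnorm u * (S * norm x))"
          using C0 vb by (intro mult_left_mono) auto
        also have "\<dots> = pnorm u * (2 * C * S * norm x) / 2" by simp
        also have "\<dots> \<le> pnorm u * 1 / 2" using True by (intro divide_right_mono mult_left_mono) auto
        finally have "pnorm u \<le> 2 * (C * (E * norm x ^ m))" using quad by (simp add: distrib_left)
        also have "\<dots> \<le> N * norm x ^ m" using S C0 by (simp add: N_def distrib_right mult.assoc)
        finally show ?thesis .
      next
        case False
        then have "1 \<le> (2 * C * S * norm x) ^ m" by (intro one_le_power) auto
        then have "S * 1 \<le> S * (2 * C * S * norm x) ^ m" using S by (intro mult_left_mono)
        moreover have "pnorm u \<le> S" using ub mult_left_mono[OF x S] by simp
        moreover have "N * norm x ^ m = 2 * (C * E) * norm x ^ m + S * (2 * C * S * norm x) ^ m"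
          by (simp add: N_def power_mult_distrib algebra_simps)
        moreover have "0 \<le> 2 * (C * E) * norm x ^ m" using C0 E by simp
        ultimately show ?thesis by linarith
      qed
      then show ?thesis unfolding u_def x_def by (subst pnorm_diff_commute)
    qed
    define Qg where "Qg = (\<Sum>l<m. monom (coeff (g l) j) l)"
    have Qg: "poly Qg x = coeff (GG x) j" for x
      by (simp add: Qg_def GG_def poly_sum poly_monom coeff_sum mult.commute)
    show ?thesis
    proof (rule apx_cutoff[OF _ i0 _ N])
      show "pnorm Qg \<le> m * K"
        using K gK by (intro pnorm_diff_coeffs) (auto simp: Qg_def coeff_sum intro: order_trans[OF coeff_le_pnorm])
      fix i assume i: "i \<le> k"
      show "norm (coeff (rpoly (G i)) j - poly Qg (tm k i0 i)) \<le> N * norm (tm k i0 i) ^ m"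
        unfolding Qg using key[OF i] coeff_le_pnorm[of "rpoly (G i) - GG (tm k i0 i)" j] by simp
    qed
  qed
  show ?thesis by (intro exI allI impI) (rule main)
qed

section \<open>Splitting off a cluster of roots\<close>

lemma norm_sum_mset_le:
  fixes c :: real
  assumes "\<And>x. x \<in># M \<Longrightarrow> norm (f x :: complex) \<le> c"
  shows "norm (\<Sum>x\<in>#M. f x) \<le> size M * c"
  using assms
proof (induction M)
  case (add x M)
  have "norm (f x + (\<Sum>x\<in>#M. f x)) \<le> c + size M * c"
    using add by (intro order_trans[OF norm_triangle_ineq add_mono]) auto
  then show ?case by (simp add: algebra_simps)
qed simp

text \<open>Pigeonhole on \<open>m\<close> annuli of width \<open>D / m\<close> around
  \<open>x1\<close>: if each contained a root, the distances to \<open>x1\<close> would take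
  \<open>m\<close> positive values besides 0, too many for \<open>m\<close> roots. The empty annulus
  separates \<open>G\<close> from \<open>H\<close>.\<close>

lemma exists_gap:
  fixes A :: "complex multiset"
  assumes "x1 \<in># A" "x2 \<in># A" "0 < D" "D \<le> dist x1 x2"
  shows "\<exists>G H. A = G + H \<and> G \<noteq> {#} \<and> H \<noteq> {#} \<and> (\<forall>x y. x \<in># G \<longrightarrow> y \<in># H \<longrightarrow> D / size A \<le> dist x y)"
proof -
  define m where "m = size A"
  have m: "0 < m" unfolding m_def using assms(1) by (cases A) auto
  define T where "T = dist x1 ` set_mset A"
  have cT: "card T \<le> m"
  proof -
    have "card (set_mset A) \<le> size A" by (induction A) (auto simp: card_insert_if)
    then show ?thesis
      unfolding T_def m_def using card_image_le[OF finite_set_mset, of "dist x1" A] by simp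
  qed
  have "\<exists>t<m. \<forall>s\<in>T. \<not> (t * D / m < s \<and> s \<le> (t + 1) * D / m)"
  proof (rule ccontr)
    assume "\<not> ?thesis"
    then obtain f where f: "\<And>t. t < m \<Longrightarrow> f t \<in> T \<and> t * D / m < f t \<and> f t \<le> (t + 1) * D / m"
      by (metis (no_types, lifting))
    have less: "f t < f t'" if "t < t'" "t' < m" for t t'
    proof -
      have "f t \<le> (real t + 1) * D / m" using f[of t] that by simp
      also have "\<dots> \<le> real t' * D / m" using that assms(3) by (intro divide_right_mono mult_right_mono) auto
      also have "\<dots> < f t'" using f[of t'] that by simp
      finally show ?thesis .
    qed
    have "inj_on f {..<m}"
      by (rule linorder_inj_onI) (use less in force)+
    then have "card (f ` {..<m}) = m" by (simp add: card_image)
    moreover have "0 \<notin> f ` {..<m}"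
    proof
      assume "0 \<in> f ` {..<m}"
      then obtain t where "t < m" "f t = 0" by auto
      moreover have "0 \<le> real t * D / real m" using assms(3) by simp
      ultimately show False using f[of t] by linarith
    qed
    ultimately have "card (insert 0 (f ` {..<m})) = Suc m" by simp
    moreover have "insert 0 (f ` {..<m}) \<subseteq> T"
      using f assms(1) by (auto simp: T_def intro: image_eqI[of _ _ x1])
    moreover have "finite T" by (simp add: T_def)
    ultimately show False using cT card_mono by (metis not_less_eq_eq)
  qed
  then obtain t where t: "t < m" "\<And>y. y \<in># A \<Longrightarrow> t * D / m < dist x1 y \<Longrightarrow> (t + 1) * D / m < dist x1 y"
    unfolding T_def by force
  define G where "G = filter_mset (\<lambda>y. dist x1 y \<le> t * D / m) A"
  define H where "H = filter_mset (\<lambda>y. \<not> dist x1 y \<le> t * D / m) A"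
  have "A = G + H" unfolding G_def H_def by (rule multiset_partition)
  moreover have "x1 \<in># G" using assms by (auto simp: G_def)
  moreover have "x2 \<in># H"
  proof -
    have "t * D / m < D" using t(1) assms(3) m by (simp add: field_simps)
    then show ?thesis using assms by (auto simp: H_def)
  qed
  moreover have "D / m \<le> dist x y" if "x \<in># G" "y \<in># H" for x y
  proof -
    have "dist x1 x \<le> t * D / m" "(t + 1) * D / m < dist x1 y" using that t(2)[of y] by (auto simp: G_def H_def add.commute)
    moreover have "(t + 1) * D / m = t * D / m + D / m" by (simp add: add_divide_distrib distrib_right)
    moreover have "dist x1 y \<le> dist x1 x + dist x y" by (rule dist_triangle)
    ultimately show ?thesis by linarith
  qed
  ultimately show ?thesis unfolding m_def by (metis empty_not_add_mset multi_member_split)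
qed

text \<open>If all roots were within \<open>r / 2\<close> of one of them, the vanishing sum would
  place them all in the disc of radius \<open>r\<close>, where every lower coefficient is at most
  \<open>2 ^ m * r < \<eta>\<close>. Hence two roots are far apart and \<open>exists_gap\<close>
  applies.\<close>

lemma roots_split:
  assumes "0 < \<eta>" "1 \<le> m"
  shows "\<exists>\<delta>>0. \<forall>A. size A = m \<longrightarrow> sum_mset A = 0 \<longrightarrow>
     (\<exists>j. 1 \<le> j \<and> j \<le> m \<and> \<eta> \<le> norm (coeff (rpoly A) (m - j))) \<longrightarrow>
     (\<exists>G H. A = G + H \<and> G \<noteq> {#} \<and> H \<noteq> {#} \<and> (\<forall>x y. x \<in># G \<longrightarrow> y \<in># H \<longrightarrow> \<delta> \<le> dist x y))"
proof -
  define r where "r = min (1/2) (\<eta> / 2 ^ Suc m)"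
  have r: "0 < r" "r \<le> 1" "2 ^ m * r < \<eta>" using assms(1) by (auto simp: r_def min_def field_simps)
  have "\<exists>G H. A = G + H \<and> G \<noteq> {#} \<and> H \<noteq> {#} \<and> (\<forall>x y. x \<in># G \<longrightarrow> y \<in># H \<longrightarrow> r / 2 / m \<le> dist x y)"
    if A: "size A = m" "sum_mset A = 0" and j: "1 \<le> j" "j \<le> m" "\<eta> \<le> norm (coeff (rpoly A) (m - j))" for A j
  proof -
    have "A \<noteq> {#}" using A assms by auto
    then obtain x1 where x1: "x1 \<in># A" by blast
    have "\<exists>x2. x2 \<in># A \<and> r / 2 \<le> dist x1 x2"
    proof (rule ccontr)
      assume "\<not> ?thesis"
      then have close: "dist x1 x \<le> r / 2" if "x \<in># A" for x using that by force
      have "norm (\<Sum>x\<in>#A. x1 - x) \<le> m * (r / 2)"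
        using norm_sum_mset_le[of A "\<lambda>x. x1 - x" "r/2"] close A by (simp add: dist_norm)
      moreover have "(\<Sum>x\<in>#A. x1 - x) = of_nat m * x1"
      proof -
        have "(\<Sum>x\<in>#A. x1 - x) = of_nat (size A) * x1 - sum_mset A"
          by (induction A) (auto simp: algebra_simps)
        then show ?thesis using A by simp
      qed
      ultimately have "norm x1 \<le> r / 2" using assms by (simp add: norm_mult)
      then have "norm x \<le> r" if "x \<in># A" for x
        using close[OF that] norm_triangle_ineq4[of x1 "x1 - x"] by (simp add: dist_norm)
      then have "norm (coeff (rpoly A) (m - j)) \<le> 2 ^ m * r ^ j"
        using coeff_rpoly_small[of A r j] r A j by simp
      also have "r ^ j \<le> r" using r j power_decreasing[of 1 j r] by simp
      finally show False using r(3) j(3) by simp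
    qed
    then show ?thesis using exists_gap[OF x1, of _ "r / 2"] r A by auto
  qed
  moreover have "0 < r / 2 / m" using r assms by simp
  ultimately show ?thesis by blast
qed

section \<open>The discrete energy\<close>

text \<open>A discrete version of the integral of the q-th power of the speed: steps of size about
  \<open>1 / k\<close> give \<open>k powr (1 - q)\<close>, the factor in all bounds below.\<close>

definition RE :: "real \<Rightarrow> nat \<Rightarrow> (nat \<Rightarrow> 'a::metric_space multiset) \<Rightarrow> real" where
  "RE q k A = (\<Sum>i<k. matchd (A i) (A (Suc i)) powr q)"

lemma RE_0 [simp]: "RE q 0 A = 0"
  by (simp add: RE_def)

lemma RE_mono:
  assumes "\<And>i. i < k \<Longrightarrow> 0 \<le> matchd (A i) (A (Suc i))" "0 \<le> q" "0 \<le> c"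
    and "\<And>i. i < k \<Longrightarrow> matchd (A i) (A (Suc i)) \<le> c * matchd (B i) (B (Suc i))"
    and "\<And>i. i < k \<Longrightarrow> 0 \<le> matchd (B i) (B (Suc i))"
  shows "RE q k A \<le> c powr q * RE q k B"
  unfolding RE_def sum_distrib_left
  using assms by (intro sum_mono) (auto simp flip: powr_mult intro!: powr_mono2)

lemma RE_scale:
  fixes A :: "nat \<Rightarrow> complex multiset"
  assumes "\<And>i. i \<le> k \<Longrightarrow> size (A i) = m" "0 \<le> q"
  shows "RE q k (\<lambda>i. image_mset ((*) c) (A i)) \<le> norm c powr q * RE q k A"
  by (rule RE_mono) (use assms in \<open>auto intro!: matchd_nonneg matchd_scale\<close>)

lemma RE_add: "RE q (k1 + k2) A = RE q k1 A + RE q k2 (\<lambda>i. A (k1 + i))"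
  unfolding RE_def by (induction k2) (simp_all add: add.assoc)

lemma RE_windows:
  assumes "w 0 = 0" "\<And>l. w l \<le> w (Suc l)"
  shows "RE q (w n) A = (\<Sum>l<n. RE q (w (Suc l) - w l) (\<lambda>i. A (w l + i)))"
proof (induction n)
  case (Suc n)
  have "RE q (w (Suc n)) A = RE q (w n + (w (Suc n) - w n)) A" using assms(2)[of n] by simp
  then show ?case by (simp only: RE_add Suc.IH sum.lessThan_Suc)
qed (simp add: assms)

section \<open>Windows in time, normalised families, rescaling\<close>

definition win :: "nat \<Rightarrow> nat \<Rightarrow> nat \<Rightarrow> nat" where
  "win n k l = (l * k) div n"

lemma win_simps [simp]: "win n k 0 = 0" "0 < n \<Longrightarrow> win n k n = k"
  by (auto simp: win_def)

lemma win_mono: "l \<le> l' \<Longrightarrow> win n k l \<le> win n k l'"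
  by (simp add: win_def div_le_mono)

lemma win_le: "0 < n \<Longrightarrow> l \<le> n \<Longrightarrow> win n k l \<le> k"
  using win_mono[of l n n k] by simp

lemma win_bounds:
  fixes n k l :: nat
  assumes "0 < n"
  shows "real l * real k / real n - 1 < real (win n k l)"
    and "real (win n k l) \<le> real l * real k / real n"
proof -
  have "real l * real k = real ((l * k) div n * n + (l * k) mod n)"
    by (simp only: div_mult_mod_eq of_nat_mult)
  then have eq: "real l * real k = real (win n k l) * real n + real ((l * k) mod n)"
    by (simp only: win_def of_nat_add of_nat_mult)
  have "real ((l * k) mod n) < real n" using assms by simp
  then show "real l * real k / real n - 1 < real (win n k l)"
    using assms unfolding eq by (simp add: add_divide_distrib)
  show "real (win n k l) \<le> real l * real k / real n"
    using assms unfolding eq by (simp add: add_divide_distrib)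
qed

text \<open>Rounding changes a window by less than one sample, which for
  \<open>2 * n \<le> k\<close> is at most half of the ideal length \<open>k / n\<close>.\<close>

lemma win_len:
  assumes "0 < n" "2 * n \<le> k"
  shows "real k / (2 * real n) \<le> real (win n k (Suc l) - win n k l)"
    and "real (win n k (Suc l) - win n k l) \<le> 2 * real k / real n"
    and "0 < win n k (Suc l) - win n k l"
proof -
  have eq: "real (win n k (Suc l) - win n k l) = real (win n k (Suc l)) - real (win n k l)"
    using win_mono[of l "Suc l" n k] by (simp add: of_nat_diff)
  have k: "1 \<le> real k / (2 * real n)" using assms
    by (metis div_by_1 divide_le_eq_1_pos le_divide_eq_1_pos mult_2 of_nat_0_less_iff of_nat_add of_nat_le_iff zero_less_mult_iff zero_less_numeral)
  have 1: "real (Suc l) * real k / real n = real l * real k / real n + real k / real n"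
    by (simp add: add_divide_distrib algebra_simps)
  have 2: "real k / real n = real k / (2 * real n) + real k / (2 * real n)" by simp
  have 3: "2 * real k / real n = real k / real n + real k / real n" by simp
  show A: "real k / (2 * real n) \<le> real (win n k (Suc l) - win n k l)"
    using win_bounds[OF assms(1), where k = k and l = "Suc l"] win_bounds[OF assms(1), where k = k and l = l] 1 2 k unfolding eq by linarith
  show "real (win n k (Suc l) - win n k l) \<le> 2 * real k / real n"
    using win_bounds[OF assms(1), where k = k and l = "Suc l"] win_bounds[OF assms(1), where k = k and l = l] 1 2 3 k unfolding eq by linarith
  have "0 < real (win n k (Suc l) - win n k l)" using A k by linarith
  then show "0 < win n k (Suc l) - win n k l" by (simp only: of_nat_0_less_iff)
qed

definition regular :: "nat \<Rightarrow> nat \<Rightarrow> real \<Rightarrow> (nat \<Rightarrow> complex multiset) \<Rightarrow> bool" where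
  "regular m k M A \<longleftrightarrow> (\<forall>i\<le>k. size (A i) = m) \<and>
     (\<forall>i0\<le>k. \<forall>j<m. apx m k i0 M (\<lambda>i. coeff (rpoly (A i)) j))"

text \<open>The weight \<^term>\<open>L ^ j\<close> is that of the j-th elementary symmetric function under dilation of the
  roots, so dividing the roots by L normalises the bound to 1.\<close>
definition cent :: "nat \<Rightarrow> nat \<Rightarrow> real \<Rightarrow> real \<Rightarrow> (nat \<Rightarrow> complex multiset) \<Rightarrow> bool" where
  "cent m k L N A \<longleftrightarrow> (\<forall>i\<le>k. size (A i) = m \<and> sum_mset (A i) = 0 \<and>
       (\<forall>j. 1 \<le> j \<longrightarrow> j \<le> m \<longrightarrow> norm (coeff (rpoly (A i)) (m - j)) \<le> L ^ j)) \<and>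
     (\<forall>i0\<le>k. \<forall>j. 1 \<le> j \<longrightarrow> j \<le> m \<longrightarrow> (\<exists>Q. lerr m k i0 N (\<lambda>i. coeff (rpoly (A i)) (m - j)) Q))"

definition energy_bounded :: "real \<Rightarrow> nat \<Rightarrow> bool" where
  "energy_bounded q m \<longleftrightarrow> (\<forall>M. \<exists>C. \<forall>k A. regular m k M A \<longrightarrow> RE q k A \<le> C * real k powr (1 - q))"

lemma cent_root_bound:
  assumes "cent m k L N A" "0 \<le> L" "i \<le> k" "x \<in># A i"
  shows "norm x \<le> 2 * L"
  using assms root_bound_2[of x "A i" L] unfolding cent_def by auto

lemma cent_trivial_bound:
  assumes "cent m k L N A" "0 \<le> L" "0 \<le> q"
  shows "RE q k A \<le> real k * (4 * L) powr q"
proof -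
  have "RE q k A \<le> (\<Sum>i<k. (4 * L) powr q)"
    unfolding RE_def
  proof (intro sum_mono powr_mono2 assms)
    fix i assume i: "i \<in> {..<k}"
    have s: "size (A i) = size (A (Suc i))" using assms(1) i unfolding cent_def by auto
    then show "0 \<le> matchd (A i) (A (Suc i))" by (rule matchd_nonneg)
    show "matchd (A i) (A (Suc i)) \<le> 4 * L"
    proof (rule matchd_le_all[OF s])
      fix x y assume "x \<in># A i" "y \<in># A (Suc i)"
      then have "norm x \<le> 2 * L" "norm y \<le> 2 * L" using cent_root_bound[OF assms(1,2), of i] cent_root_bound[OF assms(1,2), of "Suc i"] i by auto
      then show "dist x y \<le> 4 * L" using norm_triangle_ineq4[of x y] by (simp add: dist_norm)
    qed (use assms in auto)
  qed
  then show ?thesis by simp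
qed

text \<open>The zoom. Restriction to the window multiplies the Taylor error by the m-th power of its
  relative length, division of the roots by \<open>\<zeta>\<close> multiplies that of the
  coefficient of weight \<open>j\<close> by \<open>\<zeta>\<close> to the power \<open>-j\<close>;
  the last hypothesis balances the two.\<close>

lemma cent_rescale:
  assumes "cent m k L N A" "w + k' \<le> k" "0 < k'" "0 < \<zeta>"
    and "\<And>i j. i \<le> k' \<Longrightarrow> 1 \<le> j \<Longrightarrow> j \<le> m \<Longrightarrow> norm (coeff (rpoly (A (w + i))) (m - j)) \<le> (L' * \<zeta>) ^ j"
    and "\<And>j. 1 \<le> j \<Longrightarrow> j \<le> m \<Longrightarrow> N * (real k' / real k) ^ m \<le> N' * \<zeta> ^ j"
  shows "cent m k' L' N' (\<lambda>i. image_mset ((*) (of_real (inverse \<zeta>))) (A (w + i)))"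
proof -
  let ?c = "complex_of_real (inverse \<zeta>)"
  have sz: "size (A (w + i)) = m" "sum_mset (A (w + i)) = 0" if "i \<le> k'" for i
    using assms(1,2) that unfolding cent_def by auto
  have co: "coeff (rpoly (image_mset ((*) ?c) (A (w + i)))) (m - j) = ?c ^ j * coeff (rpoly (A (w + i))) (m - j)"
    if "i \<le> k'" "j \<le> m" for i j
    using coeff_rpoly_scale[of "m - j" "A (w + i)" ?c] sz[OF that(1)] that(2) by simp
  have cn: "norm (?c ^ j) = inverse (\<zeta> ^ j)" for j using assms(4) by (simp add: norm_power norm_inverse power_inverse)
  show ?thesis unfolding cent_def
  proof (intro conjI allI impI)
    fix i assume i: "i \<le> k'"
    show "size (image_mset ((*) ?c) (A (w + i))) = m" using sz[OF i] by simp
    show "sum_mset (image_mset ((*) ?c) (A (w + i))) = 0"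
      using sum_mset_distrib_left[of ?c "\<lambda>x. x" "A (w + i)"] sz[OF i] by simp
    fix j assume j: "1 \<le> j" "j \<le> m"
    show "norm (coeff (rpoly (image_mset ((*) ?c) (A (w + i)))) (m - j)) \<le> L' ^ j"
      unfolding co[OF i j(2)] norm_mult cn using assms(5)[OF i j] assms(4)
      by (simp add: power_mult_distrib field_simps)
  next
    fix i0 j assume i0: "i0 \<le> k'" and j: "1 \<le> j" "j \<le> m"
    have "w + i0 \<le> k" using i0 assms(2) by simp
    then obtain Q where "lerr m k (w + i0) N (\<lambda>i. coeff (rpoly (A i)) (m - j)) Q"
      using assms(1) j unfolding cent_def by blast
    from lerr_cmult[OF lerr_subwindow[OF this assms(2,3)], of "?c ^ j"]
    have "lerr m k' i0 (inverse (\<zeta> ^ j) * (N * (real k' / real k) ^ m))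
      (\<lambda>i. ?c ^ j * coeff (rpoly (A (w + i))) (m - j)) (smult (?c ^ j) (pcompose Q [:0, of_real (real k' / real k):]))"
      unfolding cn .
    moreover have "inverse (\<zeta> ^ j) * (N * (real k' / real k) ^ m) \<le> N'"
    proof -
      have "inverse (\<zeta> ^ j) * (N * (real k' / real k) ^ m) \<le> inverse (\<zeta> ^ j) * (N' * \<zeta> ^ j)"
        by (rule mult_left_mono[OF assms(6)[OF j]]) (use assms(4) in simp)
      also have "\<dots> = N'" using assms(4) by simp
      finally show ?thesis .
    qed
    ultimately have "lerr m k' i0 N' (\<lambda>i. ?c ^ j * coeff (rpoly (A (w + i))) (m - j)) (smult (?c ^ j) (pcompose Q [:0, of_real (real k' / real k):]))"
      by (rule lerr_mono)
    then have "lerr m k' i0 N' (\<lambda>i. coeff (rpoly (image_mset ((*) ?c) (A (w + i)))) (m - j)) (smult (?c ^ j) (pcompose Q [:0, of_real (real k' / real k):]))"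
      unfolding lerr_def using co j by auto
    then show "\<exists>Q. lerr m k' i0 N' (\<lambda>i. coeff (rpoly (image_mset ((*) ?c) (A (w + i)))) (m - j)) Q" by blast
  qed
qed

lemma RE_unscale:
  fixes A :: "nat \<Rightarrow> complex multiset"
  assumes "\<And>i. i \<le> k \<Longrightarrow> size (A i) = m" "0 \<le> q" "0 < \<zeta>"
  shows "RE q k A \<le> \<zeta> powr q * RE q k (\<lambda>i. image_mset ((*) (of_real (inverse \<zeta>))) (A i))"
proof -
  have "RE q k (\<lambda>i. image_mset ((*) (of_real \<zeta>)) (image_mset ((*) (of_real (inverse \<zeta>))) (A i)))
     \<le> norm (of_real \<zeta> :: complex) powr q * RE q k (\<lambda>i. image_mset ((*) (of_real (inverse \<zeta>))) (A i))"
    by (rule RE_scale) (use assms in auto)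
  moreover have "image_mset ((*) (of_real \<zeta>)) (image_mset ((*) (of_real (inverse \<zeta>))) B) = B" for B :: "complex multiset"
    using assms(3) by (simp add: multiset.map_comp o_def flip: mult.assoc)
  ultimately show ?thesis using assms(3) by simp
qed

section \<open>Energy when at every time some coefficient is large\<close>

lemma rel_mset_partnerR:
  assumes "rel_mset R A B" "y \<in># B"
  shows "\<exists>x. x \<in># A \<and> R x y"
proof -
  obtain B' where "B = add_mset y B'" using multi_member_split[OF assms(2)] by blast
  with assms(1) msed_rel_invR[of R A y B'] show ?thesis by auto
qed

lemma powr_decreasing_neg:
  fixes a b q :: real
  assumes "0 < a" "a \<le> b" "1 \<le> q"
  shows "b powr (1 - q) \<le> a powr (1 - q)"
  using assms powr_mono2'[of "1 - q" a b] by simp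

lemma window_powr:
  fixes k n k' :: nat and q :: real
  assumes "real k / (2 * real n) \<le> real k'" "0 < n" "0 < k" "1 \<le> q"
  shows "real k' powr (1 - q) \<le> (2 * real n) powr (q - 1) * real k powr (1 - q)"
proof -
  have "real k' powr (1 - q) \<le> (real k / (2 * real n)) powr (1 - q)"
    using assms by (intro powr_decreasing_neg) auto
  also have "\<dots> = (2 * real n) powr (q - 1) * real k powr (1 - q)"
    using assms powr_minus_divide[of "2 * real n" "1 - q"] by (simp add: powr_divide)
  finally show ?thesis .
qed

text \<open>On windows so short that the roots move by at most \<open>\<delta> / 4\<close>, the two
  clusters found at the left end persist and stay \<open>\<delta> / 2\<close> apart.
  \<open>factor_apx\<close> makes each cluster regular, and the induction hypothesis bounds its
  energy. The number \<open>n\<close> of windows depends on the constants only, not on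
  \<open>k\<close> or \<open>A\<close>.\<close>

lemma good_energy:
  assumes q: "1 \<le> q" and m: "1 \<le> m" and \<eta>: "0 < \<eta>"
    and IH: "\<And>m'. 1 \<le> m' \<Longrightarrow> m' < m \<Longrightarrow> energy_bounded q m'"
  shows "\<exists>C\<ge>0. \<forall>k A. 1 \<le> k \<longrightarrow> cent m k 1 1 A \<longrightarrow>
    (\<forall>i\<le>k. \<exists>j. 1 \<le> j \<and> j \<le> m \<and> \<eta> \<le> norm (coeff (rpoly (A i)) (m - j))) \<longrightarrow>
    RE q k A \<le> C * real k powr (1 - q)"
proof -
  obtain C1 where C1: "1 \<le> C1" and ap: "\<And>k i0 A M c Q. m \<le> k \<Longrightarrow> i0 \<le> k \<Longrightarrow> 0 \<le> M \<Longrightarrow>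
     (\<forall>i\<le>k. norm (c i) \<le> A) \<Longrightarrow> lerr m k i0 M c Q \<Longrightarrow> apx m k i0 (C1 * (A + M)) c"
    using lerr_apx[OF m] by metis
  obtain \<delta> where \<delta>: "0 < \<delta>" and split: "\<And>A. size A = m \<Longrightarrow> sum_mset A = 0 \<Longrightarrow>
     (\<exists>j. 1 \<le> j \<and> j \<le> m \<and> \<eta> \<le> norm (coeff (rpoly A) (m - j))) \<Longrightarrow>
     (\<exists>G H. A = G + H \<and> G \<noteq> {#} \<and> H \<noteq> {#} \<and> (\<forall>x y. x \<in># G \<longrightarrow> y \<in># H \<longrightarrow> \<delta> \<le> dist x y))"
    using roots_split[OF \<eta> m] by metis
  obtain \<delta>1 where \<delta>1: "0 < \<delta>1" and cont: "\<And>A A'. size A = m \<Longrightarrow> size A' = m \<Longrightarrow> (\<forall>x. x \<in># A + A' \<longrightarrow> norm x \<le> 2) \<Longrightarrow>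
    pnorm (rpoly A - rpoly A') \<le> \<delta>1 \<Longrightarrow> matched (\<delta> / 4) A A'"
    using roots_continuous[of 2 "\<delta>/4" m] \<delta> by (metis divide_pos_pos zero_le_numeral zero_less_numeral)
  \<comment> \<open>Each coefficient is Lipschitz in time with constant \<open>4 * C1\<close>, so
    within time \<open>\<kappa>\<close> the polynomial changes by at most \<open>\<delta>1\<close>
    in norm.\<close>
  define \<kappa> where "\<kappa> = \<delta>1 / (real m * 4 * C1)"
  have \<kappa>: "0 < \<kappa>" using \<delta>1 C1 m by (simp add: \<kappa>_def)
  obtain n :: nat where n: "2 / \<kappa> < real n" using reals_Archimedean2 by blast
  have n0: "0 < n" using n \<kappa> by (metis divide_pos_pos less_trans of_nat_0_less_iff zero_less_numeral)
  have n\<kappa>: "2 / real n \<le> \<kappa>" using n n0 \<kappa> by (simp add: field_simps)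
  have "\<exists>K. \<forall>k G H. (\<forall>i\<le>k. size (G i) = m1 \<and> size (H i) = m - m1 \<and> (\<forall>x. x \<in># G i + H i \<longrightarrow> norm x \<le> 2)) \<longrightarrow>
    (\<forall>i\<le>k. \<forall>i'\<le>k. \<forall>x y. x \<in># G i \<longrightarrow> y \<in># H i' \<longrightarrow> \<delta> / 2 \<le> dist x y) \<longrightarrow>
    (\<forall>i0\<le>k. \<forall>j<m1 + (m - m1). apx m k i0 (2 * C1) (\<lambda>i. coeff (rpoly (G i) * rpoly (H i)) j)) \<longrightarrow>
    (\<forall>i0\<le>k. \<forall>j. apx m k i0 K (\<lambda>i. coeff (rpoly (G i)) j))" for m1
    using factor_apx[of 2 "\<delta>/2" "2 * C1" m m1 "m - m1"] \<delta> C1 m by simp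
  then have "\<exists>K. \<forall>m1. \<forall>k G H. (\<forall>i\<le>k. size (G i) = m1 \<and> size (H i) = m - m1 \<and> (\<forall>x. x \<in># G i + H i \<longrightarrow> norm x \<le> 2)) \<longrightarrow>
    (\<forall>i\<le>k. \<forall>i'\<le>k. \<forall>x y. x \<in># G i \<longrightarrow> y \<in># H i' \<longrightarrow> \<delta> / 2 \<le> dist x y) \<longrightarrow>
    (\<forall>i0\<le>k. \<forall>j<m1 + (m - m1). apx m k i0 (2 * C1) (\<lambda>i. coeff (rpoly (G i) * rpoly (H i)) j)) \<longrightarrow>
    (\<forall>i0\<le>k. \<forall>j. apx m k i0 (K m1) (\<lambda>i. coeff (rpoly (G i)) j))"
    by (intro choice allI)
  then obtain K where K': "\<forall>m1. \<forall>k G H. (\<forall>i\<le>k. size (G i) = m1 \<and> size (H i) = m - m1 \<and> (\<forall>x. x \<in># G i + H i \<longrightarrow> norm x \<le> 2)) \<longrightarrow>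
    (\<forall>i\<le>k. \<forall>i'\<le>k. \<forall>x y. x \<in># G i \<longrightarrow> y \<in># H i' \<longrightarrow> \<delta> / 2 \<le> dist x y) \<longrightarrow>
    (\<forall>i0\<le>k. \<forall>j<m1 + (m - m1). apx m k i0 (2 * C1) (\<lambda>i. coeff (rpoly (G i) * rpoly (H i)) j)) \<longrightarrow>
    (\<forall>i0\<le>k. \<forall>j. apx m k i0 (K m1) (\<lambda>i. coeff (rpoly (G i)) j))" ..
  note K = K'[THEN spec, THEN spec, THEN spec, THEN spec, THEN mp, THEN mp, THEN mp]
  have "\<exists>C. \<forall>k A. 1 \<le> m1 \<longrightarrow> m1 < m \<longrightarrow> regular m1 k (2 * K m1) A \<longrightarrow> RE q k A \<le> C * real k powr (1 - q)" for m1
    using IH[of m1] unfolding energy_bounded_def by metis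
  then obtain Ce where Ce: "\<And>m1 k A. 1 \<le> m1 \<Longrightarrow> m1 < m \<Longrightarrow> regular m1 k (2 * K m1) A \<Longrightarrow> RE q k A \<le> Ce m1 * real k powr (1 - q)"
    by metis
  define CT where "CT = (\<Sum>m1<m. \<bar>Ce m1\<bar>)"
  have CT0: "0 \<le> CT" by (simp add: CT_def sum_nonneg)
  have CeT: "Ce m1 \<le> CT" if "m1 < m" for m1
    using member_le_sum[of m1 "{..<m}" "\<lambda>m1. \<bar>Ce m1\<bar>"] that unfolding CT_def by auto
  \<comment> \<open>Below \<open>k0\<close> there are too few samples for interpolation or for the
    windows; the trivial bound then enters \<open>C\<close> as its second summand.\<close>
  define k0 where "k0 = max m (2 * n)"
  define C where "C = 2 * CT * real n * (2 * real n) powr (q - 1) + real k0 * 4 powr q * real k0 powr (q - 1)"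
  have C0: "0 \<le> C" using CT0 by (simp add: C_def)
  have main: "RE q k A \<le> C * real k powr (1 - q)"
    if k: "1 \<le> k" and A: "cent m k 1 1 A"
      and big: "\<forall>i\<le>k. \<exists>j. 1 \<le> j \<and> j \<le> m \<and> \<eta> \<le> norm (coeff (rpoly (A i)) (m - j))" for k A
  proof (cases "k < k0")
    case True
    have "RE q k A \<le> real k * (4 * 1) powr q" using cent_trivial_bound[OF A] q by simp
    also have "\<dots> \<le> real k0 * 4 powr q" using True by (simp add: mult_right_mono)
    also have "\<dots> = real k0 * 4 powr q * real k0 powr (q - 1) * real k0 powr (1 - q)"
      using True by (simp flip: powr_add)
    also have "\<dots> \<le> real k0 * 4 powr q * real k0 powr (q - 1) * real k powr (1 - q)"
      using True k q by (intro mult_left_mono powr_decreasing_neg) auto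
    also have "\<dots> \<le> C * real k powr (1 - q)"
      using CT0 by (intro mult_right_mono) (auto simp: C_def)
    finally show ?thesis .
  next
    case False
    then have kk: "m \<le> k" "2 * n \<le> k" by (auto simp: k0_def)
    have szA: "size (A i) = m" "sum_mset (A i) = 0" if "i \<le> k" for i using A that unfolding cent_def by auto
    have apA: "apx m k i0 (2 * C1) (\<lambda>i. coeff (rpoly (A i)) j)" if i0: "i0 \<le> k" and j: "j < m" for i0 j
    proof -
      have j': "1 \<le> m - j" "m - j \<le> m" "m - (m - j) = j" using j by auto
      obtain Q where "lerr m k i0 1 (\<lambda>i. coeff (rpoly (A i)) j) Q"
        using A i0 j' unfolding cent_def by metis
      moreover have "\<forall>i\<le>k. norm (coeff (rpoly (A i)) j) \<le> 1"
        using A j' unfolding cent_def by (metis power_one)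
      ultimately have "apx m k i0 (C1 * (1 + 1)) (\<lambda>i. coeff (rpoly (A i)) j)"
        using ap[OF kk(1) i0] by (metis zero_le_one)
      then show ?thesis by (simp add: mult.commute)
    qed
    have window: "RE q k' (\<lambda>i. A (w + i)) \<le> 2 * CT * real k' powr (1 - q)"
      if k': "0 < k'" "w + k' \<le> k" "real k' \<le> 2 * real k / real n" for w k'
    proof -
      have wk: "w \<le> k" using k' by simp
      have "\<exists>j. 1 \<le> j \<and> j \<le> m \<and> \<eta> \<le> norm (coeff (rpoly (A w)) (m - j))" using big wk by blast
      from split[OF szA(1)[OF wk] szA(2)[OF wk] this] obtain G0 H0 where GH0: "A w = G0 + H0" "G0 \<noteq> {#}" "H0 \<noteq> {#}"
        "\<And>x y. x \<in># G0 \<Longrightarrow> y \<in># H0 \<Longrightarrow> \<delta> \<le> dist x y" by blast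
      have AB: "norm x \<le> 2" if "x \<in># A i" "i \<le> k" for x i using cent_root_bound[OF A _ that(2,1)] by simp
      have mt: "matched (\<delta> / 4) (A w) (A (w + i))" if i: "i \<le> k'" for i
      proof (rule cont)
        have wi: "w + i \<le> k" using i k' by simp
        show "size (A w) = m" "size (A (w + i)) = m" using szA wk wi by auto
        show "\<forall>x. x \<in># A w + A (w + i) \<longrightarrow> norm x \<le> 2" using AB wk wi by auto
        have "pnorm (rpoly (A w) - rpoly (A (w + i))) \<le> real m * (2 * (2 * C1) * (real i / real k))"
        proof (rule pnorm_diff_coeffs)
          show "\<forall>j\<ge>m. coeff (rpoly (A w) - rpoly (A (w + i))) j = 0"
            using coeff_rpoly_diff_0[OF szA(1)[OF wk] szA(1)[OF wi]] by blast
          fix j assume "j < m"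
          from apx_lip[OF apA[OF wk this] wi wk m]
          show "norm (coeff (rpoly (A w) - rpoly (A (w + i))) j) \<le> 2 * (2 * C1) * (real i / real k)"
            by (simp add: norm_tm norm_minus_commute)
        qed (use C1 in auto)
        also have "\<dots> \<le> real m * (2 * (2 * C1) * \<kappa>)"
        proof -
          have "real i / real k \<le> real k' / real k" using i by (simp add: divide_right_mono)
          also have "\<dots> \<le> 2 / real n" using k'(3) k n0 by (simp add: field_simps)
          finally show ?thesis using n\<kappa> C1 by (intro mult_left_mono) auto
        qed
        also have "\<dots> = \<delta>1" using C1 m by (simp add: \<kappa>_def)
        finally show "pnorm (rpoly (A w) - rpoly (A (w + i))) \<le> \<delta>1" .
      qed
      \<comment> \<open>The matching carries both clusters to every time of the window. Each end of
        a pair has moved by at most \<open>\<delta> / 4\<close>, so \<open>\<delta> / 2\<close>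
        remains even between different times.\<close>
      have "\<exists>G H. A (w + i) = G + H \<and> matched (\<delta> / 4) G0 G \<and> matched (\<delta> / 4) H0 H" if "i \<le> k'" for i
        using mt[OF that] unfolding GH0(1) by (rule rel_mset_splitL)
      then obtain G H where GH: "\<And>i. i \<le> k' \<Longrightarrow> A (w + i) = G i + H i"
        "\<And>i. i \<le> k' \<Longrightarrow> matched (\<delta> / 4) G0 (G i)" "\<And>i. i \<le> k' \<Longrightarrow> matched (\<delta> / 4) H0 (H i)"
        by metis
      define m1 where "m1 = size G0"
      define m2 where "m2 = size H0"
      have mm: "m1 + m2 = m" "1 \<le> m1" "1 \<le> m2" "m1 < m" "m2 < m" "m2 = m - m1" "m1 = m - m2"
        using szA(1)[OF wk] GH0(1-3) by (auto simp: m1_def m2_def Suc_le_eq nonempty_has_size)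
      have sz: "size (G i) = m1" "size (H i) = m2" if "i \<le> k'" for i
        using rel_mset_size[OF GH(2)[OF that]] rel_mset_size[OF GH(3)[OF that]] by (simp_all add: m1_def m2_def)
      have sep: "\<delta> / 2 \<le> dist x y" if c: "i \<le> k'" "i' \<le> k'" "x \<in># G i" "y \<in># H i'" for i i' x y
      proof -
        obtain x0 y0 where "x0 \<in># G0" "dist x0 x \<le> \<delta> / 4" "y0 \<in># H0" "dist y0 y \<le> \<delta> / 4"
          using rel_mset_partnerR[OF GH(2)[OF c(1)] c(3)] rel_mset_partnerR[OF GH(3)[OF c(2)] c(4)] by blast
        with GH0(4)[of x0 y0] show ?thesis
          using dist_triangle[of x0 y0 x] dist_triangle[of x y0 y] by (simp add: dist_commute)
      qed
      have bd: "norm x \<le> 2" if "i \<le> k'" "x \<in># G i + H i" for i x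
        using AB[of x "w + i"] GH(1)[OF that(1)] that k'(2) by auto
      have apP: "apx m k' i0 (2 * C1) (\<lambda>i. coeff (rpoly (G i) * rpoly (H i)) j)" if i0: "i0 \<le> k'" and j: "j < m" for i0 j
      proof -
        have "apx m k' i0 (2 * C1) (\<lambda>i. coeff (rpoly (A (w + i))) j)"
          by (rule apx_subwindow[OF apA[OF _ j]]) (use i0 k' in auto)
        then show ?thesis unfolding apx_def lerr_def using GH(1) by (simp add: rpoly_union)
      qed
      have regG: "regular m1 k' (2 * K m1) G"
      proof -
        have "\<forall>i\<le>k'. size (G i) = m1 \<and> size (H i) = m - m1 \<and> (\<forall>x. x \<in># G i + H i \<longrightarrow> norm x \<le> 2)"
          using sz mm(6) bd by auto
        moreover have "\<forall>i\<le>k'. \<forall>i'\<le>k'. \<forall>x y. x \<in># G i \<longrightarrow> y \<in># H i' \<longrightarrow> \<delta> / 2 \<le> dist x y"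
          using sep by (metis dist_commute)
        moreover have "\<forall>i0\<le>k'. \<forall>j<m1 + (m - m1). apx m k' i0 (2 * C1) (\<lambda>i. coeff (rpoly (G i) * rpoly (H i)) j)"
          using apP mm(4) by (simp add: mult.commute)
        ultimately have *: "\<forall>i0\<le>k'. \<forall>j. apx m k' i0 (K m1) (\<lambda>i. coeff (rpoly (G i)) j)"
          by (rule K)
        \<comment> \<open>A cluster of \<open>m1\<close> roots is to be regular of order
          \<open>m1\<close> only; the surplus order is truncated at the price of a factor 2.\<close>
        show ?thesis unfolding regular_def
        proof (intro conjI allI impI)
          fix i0 j assume "i0 \<le> k'"
          then show "apx m1 k' i0 (2 * K m1) (\<lambda>i. coeff (rpoly (G i)) j)"
            using * mm(4) by (intro apx_trunc[of m]) auto
        qed (rule sz(1))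
      qed
      have regH: "regular m2 k' (2 * K m2) H"
      proof -
        have "\<forall>i\<le>k'. size (H i) = m2 \<and> size (G i) = m - m2 \<and> (\<forall>x. x \<in># H i + G i \<longrightarrow> norm x \<le> 2)"
          using sz mm(7) bd by auto
        moreover have "\<forall>i\<le>k'. \<forall>i'\<le>k'. \<forall>x y. x \<in># H i \<longrightarrow> y \<in># G i' \<longrightarrow> \<delta> / 2 \<le> dist x y"
          using sep by (metis dist_commute)
        moreover have "\<forall>i0\<le>k'. \<forall>j<m2 + (m - m2). apx m k' i0 (2 * C1) (\<lambda>i. coeff (rpoly (H i) * rpoly (G i)) j)"
          using apP mm(5) by (simp add: mult.commute)
        ultimately have *: "\<forall>i0\<le>k'. \<forall>j. apx m k' i0 (K m2) (\<lambda>i. coeff (rpoly (H i)) j)"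
          by (rule K)
        show ?thesis unfolding regular_def
        proof (intro conjI allI impI)
          fix i0 j assume "i0 \<le> k'"
          then show "apx m2 k' i0 (2 * K m2) (\<lambda>i. coeff (rpoly (H i)) j)"
            using * mm(5) by (intro apx_trunc[of m]) auto
        qed (rule sz(2))
      qed
      have "RE q k' (\<lambda>i. A (w + i)) \<le> RE q k' G + RE q k' H"
        unfolding RE_def sum.distrib[symmetric]
      proof (rule sum_mono)
        fix i assume i: "i \<in> {..<k'}"
        have s: "size (G i) = size (G (Suc i))" "size (H i) = size (H (Suc i))" using sz i by auto
        note nn = matchd_nonneg[OF s(1)] matchd_nonneg[OF s(2)]
        have "matchd (A (w + i)) (A (w + Suc i)) \<le> max (matchd (G i) (G (Suc i))) (matchd (H i) (H (Suc i)))"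
          using matchd_union[OF s] GH(1)[of i] GH(1)[of "Suc i"] i by auto
        moreover have "0 \<le> matchd (A (w + i)) (A (w + Suc i))"
          using szA i k'(2) by (intro matchd_nonneg) auto
        ultimately have "matchd (A (w + i)) (A (w + Suc i)) powr q \<le> max (matchd (G i) (G (Suc i))) (matchd (H i) (H (Suc i))) powr q"
          using q by (intro powr_mono2) auto
        also have "\<dots> \<le> matchd (G i) (G (Suc i)) powr q + matchd (H i) (H (Suc i)) powr q"
          by (auto simp: max_def)
        finally show "matchd (A (w + i)) (A (w + Suc i)) powr q \<le> \<dots>" .
      qed
      also have "\<dots> \<le> CT * real k' powr (1 - q) + CT * real k' powr (1 - q)"
        by (intro add_mono order_trans[OF Ce[OF mm(2,4) regG] mult_right_mono[OF CeT[OF mm(4)]]]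
            order_trans[OF Ce[OF mm(3,5) regH] mult_right_mono[OF CeT[OF mm(5)]]]) auto
      finally show ?thesis by simp
    qed
    have "RE q k A = RE q (win n k n) A" using n0 by simp
    also have "\<dots> = (\<Sum>l<n. RE q (win n k (Suc l) - win n k l) (\<lambda>i. A (win n k l + i)))"
      by (rule RE_windows) (auto intro: win_mono)
    also have "\<dots> \<le> (\<Sum>l<n. 2 * CT * ((2 * real n) powr (q - 1) * real k powr (1 - q)))"
    proof (rule sum_mono)
      fix l assume l: "l \<in> {..<n}"
      let ?k' = "win n k (Suc l) - win n k l"
      have "win n k l + ?k' = win n k (Suc l)" using win_mono[of l "Suc l" n k] by simp
      then have "win n k l + ?k' \<le> k" using win_le[OF n0, of "Suc l" k] l by simp
      then have "RE q ?k' (\<lambda>i. A (win n k l + i)) \<le> 2 * CT * real ?k' powr (1 - q)"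
        using win_len[OF n0 kk(2), of l] by (intro window) auto
      also have "\<dots> \<le> 2 * CT * ((2 * real n) powr (q - 1) * real k powr (1 - q))"
        using CT0 win_len[OF n0 kk(2), of l] n0 k q by (intro mult_left_mono window_powr) auto
      finally show "RE q ?k' (\<lambda>i. A (win n k l + i)) \<le> \<dots>" .
    qed
    also have "\<dots> = 2 * CT * real n * (2 * real n) powr (q - 1) * real k powr (1 - q)" by simp
    also have "\<dots> \<le> C * real k powr (1 - q)"
      by (intro mult_right_mono) (auto simp: C_def)
    finally show ?thesis .
  qed
  show ?thesis by (rule exI[of _ C], rule conjI[OF C0], intro allI impI, rule main)
qed

section \<open>The centred case: bad windows and the induction on the number of samples\<close>

lemma rpoly_compare:
  fixes c :: real
  assumes "\<And>r. r \<in># R \<Longrightarrow> norm (y - r) \<le> c * norm (x - r)" "0 \<le> c"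
  shows "norm (poly (rpoly R) y) \<le> c ^ size R * norm (poly (rpoly R) x)"
  using assms
proof (induction R)
  case (add r R)
  have "norm (y - r) * norm (poly (rpoly R) y) \<le> (c * norm (x - r)) * (c ^ size R * norm (poly (rpoly R) x))"
    using add by (intro mult_mono) auto
  then show ?case by (simp add: norm_mult mult_ac flip: left_diff_distrib)
qed simp

text \<open>If every root of \<open>Q\<close> had distance at least \<open>1 / n\<close> from
  \<open>x\<close>, each linear factor at \<open>y\<close> would be at most \<open>n + 1\<close>
  times its value at \<open>x\<close>, and \<open>Q\<close> could not drop from \<open>b\<close> at
  \<open>y\<close> to so small a value at \<open>x\<close>.\<close>

lemma poly_small_near_root:
  fixes Q :: "complex poly"
  assumes "\<forall>l\<ge>m. coeff Q l = 0" "0 < n" "dist x y \<le> 1" "b \<le> norm (poly Q y)" "norm (poly Q x) < b / (real n + 1) ^ m"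
  shows "\<exists>r. r \<in># proots Q \<and> dist x r < 1 / real n"
proof (rule ccontr)
  assume "\<not> ?thesis"
  then have far: "1 / real n \<le> dist x r" if "r \<in># proots Q" for r using that by force
  have "norm (y - r) \<le> (real n + 1) * norm (x - r)" if "r \<in># proots Q" for r
  proof -
    have "1 \<le> real n * norm (x - r)" using far[OF that] assms(2) by (simp add: dist_norm field_simps)
    moreover have "norm (y - r) \<le> norm (x - r) + 1"
      using assms(3) norm_triangle_ineq[of "x - r" "y - x"] by (simp add: dist_norm norm_minus_commute)
    ultimately show ?thesis by (simp add: algebra_simps)
  qed
  from rpoly_compare[of "proots Q", OF this]
  have 1: "norm (poly (rpoly (proots Q)) y) \<le> (real n + 1) ^ size (proots Q) * norm (poly (rpoly (proots Q)) x)" by simp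
  have Q: "norm (poly Q z) = norm (lead_coeff Q) * norm (poly (rpoly (proots Q)) z)" for z
    by (subst smult_rpoly_proots) (simp add: norm_mult)
  have "degree Q \<le> m" using assms(1) by (intro degree_le) auto
  then have "size (proots Q) \<le> m" using size_proots_le[of Q] by simp
  then have "(real n + 1) ^ size (proots Q) \<le> (real n + 1) ^ m" by (intro power_increasing) auto
  then have 2: "norm (poly (rpoly (proots Q)) y) \<le> (real n + 1) ^ m * norm (poly (rpoly (proots Q)) x)"
    using 1 by (meson mult_right_mono norm_ge_zero order_trans)
  have "norm (poly Q y) \<le> (real n + 1) ^ m * norm (poly Q x)"
    unfolding Q using mult_left_mono[OF 2, of "norm (lead_coeff Q)"] by (simp add: mult_ac)
  then have "b \<le> (real n + 1) ^ m * norm (poly Q x)" using assms(4) by simp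
  moreover have "(real n + 1) ^ m * norm (poly Q x) < b"
    using assms(5) by (simp add: pos_less_divide_eq mult.commute)
  ultimately show False by simp
qed

lemma card_nat_near:
  fixes y :: real
  shows "finite {l::nat. \<bar>real l - y\<bar> < 2} \<and> card {l::nat. \<bar>real l - y\<bar> < 2} \<le> 4"
proof (cases "{l::nat. \<bar>real l - y\<bar> < 2} = {}")
  case False
  define l0 where "l0 = (LEAST l::nat. \<bar>real l - y\<bar> < 2)"
  from False obtain l1 :: nat where "\<bar>real l1 - y\<bar> < 2" by blast
  then have l0: "\<bar>real l0 - y\<bar> < 2" unfolding l0_def by (rule LeastI)
  have sub: "{l::nat. \<bar>real l - y\<bar> < 2} \<subseteq> {l0..<l0+4}"
  proof
    fix l assume "l \<in> {l::nat. \<bar>real l - y\<bar> < 2}"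
    then have l: "\<bar>real l - y\<bar> < 2" by simp
    then have "l0 \<le> l" unfolding l0_def by (rule Least_le)
    moreover have "real l < real (l0 + 4)" using l l0 by simp
    ultimately show "l \<in> {l0..<l0+4}" by simp
  qed
  show ?thesis using card_mono[OF _ sub] finite_subset[OF sub] by simp
next
  case True
  then show ?thesis by (simp only: True) simp
qed

text \<open>The product decays like n to the power \<open>-e\<close> with
  \<open>e = q / m - (q - 1)\<close>, and \<open>e\<close> is positive exactly when
  \<open>q * (m - 1) < m\<close>. It is the total weight of the at most \<open>5 * m\<close> bad
  windows in \<open>centred_energy\<close>.\<close>

lemma exists_window_number:
  fixes q c :: real
  assumes "1 \<le> m" "q * (real m - 1) < real m" "0 < c"
  shows "\<exists>n::nat. 1 \<le> n \<and> c \<le> real n \<and> 5 * real m * ((c / n) powr (q / m) * (2 * real n) powr (q - 1)) \<le> 1 / 2"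
proof -
  define e where "e = q / m - (q - 1)"
  have "e = (real m - q * (real m - 1)) / real m" using assms(1) by (simp add: e_def field_simps)
  then have e: "0 < e" using assms by simp
  define K where "K = 5 * real m * (c powr (q / m) * 2 powr (q - 1))"
  have K: "0 < K" using assms by (simp add: K_def)
  have "((\<lambda>n. real n powr (- e)) \<longlongrightarrow> 0) sequentially"
    by (rule tendsto_neg_powr) (use e filterlim_real_sequentially in auto)
  then have "\<forall>\<^sub>F n in sequentially. real n powr (- e) < 1 / (2 * K)"
    by (rule order_tendstoD) (use K in auto)
  moreover have "\<forall>\<^sub>F n in sequentially. max 1 (nat \<lceil>c\<rceil>) \<le> n" by (rule eventually_ge_at_top)
  ultimately have "\<forall>\<^sub>F n in sequentially. real n powr (- e) < 1 / (2 * K) \<and> max 1 (nat \<lceil>c\<rceil>) \<le> n"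
    by eventually_elim simp
  then obtain n where n: "real n powr (- e) < 1 / (2 * K)" "max 1 (nat \<lceil>c\<rceil>) \<le> n"
    using eventually_happens[of _ sequentially] by auto
  have n1: "1 \<le> n" "c \<le> real n" using n(2) by (auto simp: nat_le_iff ceiling_le_iff)
  have "5 * real m * ((c / n) powr (q / m) * (2 * real n) powr (q - 1)) = K * (real n powr (q - 1) / real n powr (q / m))"
    using n1 assms by (simp add: K_def powr_divide powr_mult)
  also have "real n powr (q - 1) / real n powr (q / m) = real n powr (- e)"
    by (simp add: e_def flip: powr_diff)
  also have "K * real n powr (- e) \<le> 1 / 2"
    using n(1) K by (simp add: field_simps)
  finally show ?thesis using n1 by blast
qed

text \<open>The induction on \<open>k\<close> is run for coefficients bounded by
  \<open>L ^ j\<close> with Taylor error still 1. The gap between \<open>L\<close> and 1 gives a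
  dichotomy. If all coefficients are below \<open>(L / 3) ^ j\<close>, there is room to halve the
  time interval and rescale without loss. Otherwise, after division by \<open>L\<close>, some
  coefficient is at least \<open>1 / 3 ^ m\<close> at some time while the Taylor error is only
  \<open>1 / L\<close>, so that it really follows a polynomial in time.\<close>

lemma centred_energy:
  assumes q: "1 \<le> q" and m: "1 \<le> m" and qm: "q * (real m - 1) < real m"
    and IH: "\<And>m'. 1 \<le> m' \<Longrightarrow> m' < m \<Longrightarrow> energy_bounded q m'"
  shows "\<exists>C. \<forall>k A. 1 \<le> k \<longrightarrow> cent m k 1 1 A \<longrightarrow> RE q k A \<le> C * real k powr (1 - q)"
proof -
  obtain C1 where C1: "1 \<le> C1" and ap: "\<And>k i0 A M c Q. m \<le> k \<Longrightarrow> i0 \<le> k \<Longrightarrow> 0 \<le> M \<Longrightarrow>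
     (\<forall>i\<le>k. norm (c i) \<le> A) \<Longrightarrow> lerr m k i0 M c Q \<Longrightarrow> apx m k i0 (C1 * (A + M)) c"
    using lerr_apx[OF m] by metis
  \<comment> \<open>A Lipschitz constant in time for the coefficients \<open>b j\<close> below,
    which are at most 1 and have Taylor error \<open>1 / L \<le> 1\<close>.\<close>
  define C2 where "C2 = 4 * C1"
  have C2: "4 \<le> C2" using C1 by (simp add: C2_def)
  obtain n :: nat where n: "1 \<le> n" "3 * C2 \<le> real n"
    "5 * real m * ((3 * C2 / n) powr (q / m) * (2 * real n) powr (q - 1)) \<le> 1 / 2"
    using exists_window_number[OF m qm, of "3 * C2"] C2 by auto
  have n12: "12 \<le> real n" using n C2 by simp
  \<comment> \<open>On a window with a time at which all \<open>b j\<close> are below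
    \<open>1 / n\<close>, Lipschitz continuity over length \<open>2 / n\<close> keeps them below
    \<open>3 * C2 / n\<close>, which is \<open>\<zeta> ^ m\<close> and so at most every
    \<open>\<zeta> ^ j\<close>.\<close>
  define \<zeta> where "\<zeta> = (3 * C2 / n) powr (1 / m)"
  have \<zeta>0: "0 < \<zeta>" using n C2 by (simp add: \<zeta>_def)
  have \<zeta>m: "\<zeta> ^ m = 3 * C2 / n"
    using n C2 m by (simp add: \<zeta>_def powr_powr flip: powr_realpow)
  have \<zeta>1: "\<zeta> \<le> 1" unfolding \<zeta>_def using n C2 m by (intro powr_le1) auto
  have \<zeta>q: "\<zeta> powr q = (3 * C2 / n) powr (q / m)" by (simp add: \<zeta>_def powr_powr)
  have \<zeta>j: "3 * C2 / n \<le> \<zeta> ^ j" if "j \<le> m" for j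
    unfolding \<zeta>m[symmetric] using \<zeta>0 \<zeta>1 that by (intro power_decreasing) auto
  \<comment> \<open>The threshold of \<open>poly_small_near_root\<close> for
    \<open>b = 1 / (2 * 3 ^ m)\<close>: a value of \<open>Q\<close> below it forces a root within
    \<open>1 / n\<close>.\<close>
  define \<theta> where "\<theta> = (1 / (2 * 3 ^ m)) / (real n + 1) ^ m"
  have \<theta>: "0 < \<theta>" by (simp add: \<theta>_def)
  define \<eta> where "\<eta> = min (\<theta> / 4) (1 / n)"
  have \<eta>: "0 < \<eta>" "\<eta> \<le> \<theta> / 4" "\<eta> \<le> 1 / n" using \<theta> n by (auto simp: \<eta>_def)
  \<comment> \<open>The entry \<open>2 * 3 ^ m\<close> keeps \<open>Q\<close> at least
    \<open>1 / (2 * 3 ^ m)\<close> where the coefficient it follows is at least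
    \<open>1 / 3 ^ m\<close>; with \<open>4 / \<theta>\<close> the error \<open>1 / L\<close> is at
    most \<open>\<theta> / 4\<close>, and with \<open>\<eta> \<le> \<theta> / 4\<close> small
    coefficients give values of \<open>Q\<close> below \<open>\<theta>\<close>.\<close>
  define L where "L = max (max 3 (2 * 3 ^ m)) (4 / \<theta>)"
  have L: "3 \<le> L" "2 * 3 ^ m \<le> L" "4 / \<theta> \<le> L" by (auto simp: L_def)
  have L\<theta>: "1 / L \<le> \<theta> / 4" using L \<theta> by (simp add: field_simps)
  have L3: "1 / L \<le> 1 / (2 * 3 ^ m)" using L(1,2) by (intro divide_left_mono) auto
  obtain CG where CG: "0 \<le> CG" and good: "\<And>k A. 1 \<le> k \<Longrightarrow> cent m k 1 1 A \<Longrightarrow>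
    (\<forall>i\<le>k. \<exists>j. 1 \<le> j \<and> j \<le> m \<and> \<eta> \<le> norm (coeff (rpoly (A i)) (m - j))) \<Longrightarrow>
    RE q k A \<le> CG * real k powr (1 - q)"
    using good_energy[OF q m \<eta>(1) IH] by metis
  define k0 where "k0 = max (2 * n) m"
  define Y where "Y = L powr q * CG * (2 * real n) powr (q - 1)"
  \<comment> \<open>The first summand is twice the share of the good windows, which leaves one half
    of \<open>B\<close> for the bad ones; the second summand settles
    \<open>k \<le> k0\<close>.\<close>
  define B where "B = 2 * (real n * Y) + real k0 * (4 * L) powr q * real k0 powr (q - 1)"
  have Y0: "0 \<le> Y" using CG by (simp add: Y_def)
  have B0: "0 \<le> B" using Y0 by (simp add: B_def)
  have main: "1 \<le> k \<longrightarrow> cent m k L 1 A \<longrightarrow> RE q k A \<le> B * real k powr (1 - q)" for k A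
  proof (induction k arbitrary: A rule: less_induct)
    case (less k)
    show ?case
    proof (intro impI)
      assume k: "1 \<le> k" and A: "cent m k L 1 A"
      have szA: "size (A i) = m" "sum_mset (A i) = 0" if "i \<le> k" for i using A that unfolding cent_def by auto
      have rescaled: "RE q k' (\<lambda>i. A (w + i)) \<le> z powr q * B * real k' powr (1 - q)"
        if w: "0 < k'" "k' < k" "w + k' \<le> k" "0 < z"
          and c1: "\<And>i j. i \<le> k' \<Longrightarrow> 1 \<le> j \<Longrightarrow> j \<le> m \<Longrightarrow> norm (coeff (rpoly (A (w + i))) (m - j)) \<le> (L * z) ^ j"
          and c2: "\<And>j. 1 \<le> j \<Longrightarrow> j \<le> m \<Longrightarrow> (real k' / real k) ^ m \<le> z ^ j" for w k' z
      proof -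
        let ?A' = "\<lambda>i. image_mset ((*) (of_real (inverse z))) (A (w + i))"
        have "cent m k' L 1 ?A'" using cent_rescale[OF A w(3,1,4), of L 1] c1 c2 by simp
        then have "RE q k' ?A' \<le> B * real k' powr (1 - q)" using less[OF w(2), of ?A'] w(1) by simp
        moreover have "RE q k' (\<lambda>i. A (w + i)) \<le> z powr q * RE q k' ?A'"
          by (rule RE_unscale[of _ _ m]) (use szA w q in auto)
        ultimately show ?thesis
          using mult_left_mono[of "RE q k' ?A'" "B * real k' powr (1 - q)" "z powr q"] by (simp add: mult.assoc)
      qed
      show "RE q k A \<le> B * real k powr (1 - q)"
      proof (cases "k \<le> k0")
        case True
        have "RE q k A \<le> real k * (4 * L) powr q" using cent_trivial_bound[OF A] q L by simp
        also have "\<dots> \<le> real k0 * (4 * L) powr q" using True by (simp add: mult_right_mono)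
        also have "\<dots> = real k0 * (4 * L) powr q * real k0 powr (q - 1) * real k0 powr (1 - q)"
          using True k by (simp flip: powr_add)
        also have "\<dots> \<le> real k0 * (4 * L) powr q * real k0 powr (q - 1) * real k powr (1 - q)"
          using True k q by (intro mult_left_mono powr_decreasing_neg) auto
        also have "\<dots> \<le> B * real k powr (1 - q)"
          using Y0 by (intro mult_right_mono) (auto simp: B_def)
        finally show ?thesis .
      next
        case False
        then have kk: "m \<le> k" "2 * n \<le> k" by (auto simp: k0_def)
        show ?thesis
        proof (cases "\<forall>i\<le>k. \<forall>j. 1 \<le> j \<longrightarrow> j \<le> m \<longrightarrow> norm (coeff (rpoly (A i)) (m - j)) \<le> (L / 3) ^ j")
          case True
          \<comment> \<open>With \<open>z = k' / k\<close> the factors combine exactly,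
            \<open>z powr q * k' powr (1 - q) = z * k powr (1 - q)\<close>, so the two halves add up
            to the bound with the same \<open>B\<close>. The room from \<open>L / 3\<close> to
            \<open>L\<close> is spent on \<open>z \<ge> 1/3\<close>.\<close>
          have half: "RE q k' (\<lambda>i. A (w + i)) \<le> (real k' / real k) * (B * real k powr (1 - q))"
            if w: "0 < k'" "k' < k" "w + k' \<le> k" "k \<le> 3 * k'" for w k'
          proof -
            let ?z = "real k' / real k"
            have z: "0 < ?z" "?z \<le> 1" "1 / 3 \<le> ?z" using w by (auto simp: field_simps)
            have "RE q k' (\<lambda>i. A (w + i)) \<le> ?z powr q * B * real k' powr (1 - q)"
            proof (rule rescaled[OF w(1-3) z(1)])
              fix i j assume i: "i \<le> k'" and j: "1 \<le> j" "j \<le> m"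
              have "norm (coeff (rpoly (A (w + i))) (m - j)) \<le> (L / 3) ^ j" using True i j w by auto
              also have "\<dots> \<le> (L * ?z) ^ j" using mult_left_mono[OF z(3), of L] L by (intro power_mono) auto
              finally show "norm (coeff (rpoly (A (w + i))) (m - j)) \<le> (L * ?z) ^ j" .
            qed (use z in \<open>auto intro!: power_decreasing\<close>)
            also have "?z powr q * B * real k' powr (1 - q) = ?z * (B * real k powr (1 - q))"
            proof -
              have "?z powr q = ?z * ?z powr (q - 1)" using z by (simp add: powr_diff)
              moreover have "?z powr (q - 1) * real k' powr (1 - q) = real k powr (1 - q)"
                using w by (simp add: powr_divide powr_minus_divide[of "real k" "q - 1", simplified] flip: powr_add)
              ultimately show ?thesis by (simp add: mult_ac)
            qed
            finally show ?thesis .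
          qed
          define k1 where "k1 = k div 2"
          define k2 where "k2 = k - k1"
          have "2 \<le> k" using kk n by simp
          then have k12: "k1 + k2 = k" "0 < k1" "0 < k2" "k1 < k" "k2 < k" "k \<le> 3 * k1" "k \<le> 3 * k2"
            unfolding k1_def k2_def by auto
          have "RE q k A = RE q k1 (\<lambda>i. A (0 + i)) + RE q k2 (\<lambda>i. A (k1 + i))"
            using RE_add[of q k1 k2 A] k12 by simp
          also have "\<dots> \<le> (real k1 / real k) * (B * real k powr (1 - q)) + (real k2 / real k) * (B * real k powr (1 - q))"
            using k12 by (intro add_mono half) auto
          also have "\<dots> = (real k1 / real k + real k2 / real k) * (B * real k powr (1 - q))" by (simp add: distrib_right)
          also have "real k1 / real k + real k2 / real k = 1"
            using k12 k by (simp flip: add_divide_distrib of_nat_add)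
          finally show ?thesis by simp
        next
          case False
          then obtain i1 j1 where i1: "i1 \<le> k" and j1: "1 \<le> j1" "j1 \<le> m"
            and large: "(L / 3) ^ j1 < norm (coeff (rpoly (A i1)) (m - j1))"
            unfolding not_all not_imp not_le by blast
          \<comment> \<open>Division by \<open>L\<close> leaves all coefficients at most 1 and
            lowers the Taylor error to \<open>1 / L\<close>, because every weight \<open>j\<close>
            is at least 1.\<close>
          define bA where "bA i = image_mset ((*) (complex_of_real (inverse L))) (A i)" for i
          have bA: "cent m k 1 (1 / L) bA"
          proof -
            have "cent m k 1 (1 / L) (\<lambda>i. image_mset ((*) (of_real (inverse L))) (A (0 + i)))"
            proof (rule cent_rescale[OF A])
              show "0 < k" "0 < L" "0 + k \<le> k" using L k by auto
              fix i j assume "i \<le> k" "1 \<le> j" "j \<le> m"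
              then show "norm (coeff (rpoly (A (0 + i))) (m - j)) \<le> (1 * L) ^ j" using A unfolding cent_def by simp
            next
              fix j assume j: "1 \<le> j" "j \<le> m"
              have "L ^ 1 \<le> L ^ j" using j L by (intro power_increasing) auto
              then show "1 * (real k / real k) ^ m \<le> 1 / L * L ^ j" using k L by (simp add: field_simps)
            qed
            then show ?thesis by (simp add: bA_def[abs_def])
          qed
          define b where "b j i = coeff (rpoly (bA i)) (m - j)" for j i
          have b_abs: "b j = (\<lambda>i. coeff (rpoly (bA i)) (m - j))" for j by (rule ext) (simp add: b_def)
          have b_le: "norm (b j i) \<le> 1" if "i \<le> k" "1 \<le> j" "j \<le> m" for i j
            using bA that unfolding cent_def b_def by simp
          have b_lerr: "\<exists>Q. lerr m k i0 (1 / L) (b j) Q" if "i0 \<le> k" "1 \<le> j" "j \<le> m" for i0 j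
            using bA that unfolding cent_def b_abs by simp
          have b_eq: "norm (coeff (rpoly (A i)) (m - j)) = L ^ j * norm (b j i)" if "i \<le> k" "j \<le> m" for i j
          proof -
            have "b j i = complex_of_real (inverse L) ^ j * coeff (rpoly (A i)) (m - j)"
              using coeff_rpoly_scale[of "m - j" "A i" "complex_of_real (inverse L)"] szA[OF that(1)] that(2)
              by (simp add: b_def bA_def)
            then show ?thesis using L by (simp add: norm_mult norm_power norm_inverse power_inverse)
          qed
          have lipb: "norm (b j i - b j i') \<le> C2 * (\<bar>real i - real i'\<bar> / real k)"
            if c: "i \<le> k" "i' \<le> k" "1 \<le> j" "j \<le> m" for i i' j
          proof -
            obtain Q where "lerr m k i' (1 / L) (b j) Q" using b_lerr[OF c(2-4)] by blast
            moreover have "\<forall>i\<le>k. norm (b j i) \<le> 1" using b_le c by simp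
            ultimately have "apx m k i' (C1 * (1 + 1 / L)) (b j)" using ap[OF kk(1) c(2)] L by simp
            then have "apx m k i' (2 * C1) (b j)"
              by (rule apx_mono) (use C1 L in \<open>simp add: field_simps\<close>)
            from apx_lip[OF this c(1,2) m] show ?thesis by (simp add: norm_tm C2_def)
          qed
          \<comment> \<open>A single polynomial based at time 0 follows \<open>b j1\<close> on the
            whole interval up to \<open>1 / L\<close>, since times are at most 1.\<close>
          obtain Q where Q: "lerr m k 0 (1 / L) (b j1) Q" using b_lerr[OF _ j1, of 0] by blast
          have Qb: "norm (b j1 i - poly Q (tm k 0 i)) \<le> 1 / L" if "i \<le> k" for i
          proof -
            have "norm (b j1 i - poly Q (tm k 0 i)) \<le> 1 / L * norm (tm k 0 i) ^ m" using Q that unfolding lerr_def by blast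
            also have "\<dots> \<le> 1 / L * 1" using L norm_tm_le_1[OF that, of 0] by (intro mult_left_mono power_le_one) auto
            finally show ?thesis by simp
          qed
          have bi1: "1 / 3 ^ m \<le> norm (b j1 i1)"
          proof -
            have "L ^ j1 * (1 / 3 ^ j1) < L ^ j1 * norm (b j1 i1)"
              using large b_eq[OF i1 j1(2)] by (simp add: power_divide)
            moreover have "0 < L ^ j1" using L by simp
            ultimately have "1 / 3 ^ j1 < norm (b j1 i1)" using mult_less_cancel_left_pos by blast
            moreover have "(1::real) / 3 ^ m \<le> 1 / 3 ^ j1" using j1 by (intro divide_left_mono power_increasing) auto
            ultimately show ?thesis by simp
          qed
          have Qi1: "1 / (2 * 3 ^ m) \<le> norm (poly Q (tm k 0 i1))"
            using bi1 Qb[OF i1] L3 norm_triangle_sub[of "b j1 i1" "poly Q (tm k 0 i1)"] by simp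
          define bad where "bad = {l. l < n \<and> (\<exists>i. win n k l \<le> i \<and> i \<le> win n k (Suc l) \<and> (\<forall>j. 1 \<le> j \<longrightarrow> j \<le> m \<longrightarrow> norm (b j i) < \<eta>))}"
          \<comment> \<open>In a bad window \<open>Q\<close> falls below \<open>\<theta>\<close> at
            some time, which is then within \<open>1 / n\<close> of the real part of a root of
            \<open>Q\<close>. Measured in windows, and with one more unit for the position inside
            the window, this confines \<open>l\<close> to an interval of radius 2, which contains at
            most 4 integers.\<close>
          have bad_sub: "bad \<subseteq> (\<Union>r\<in>set_mset (proots Q). {l. \<bar>real l - real n * Re r\<bar> < 2})"
          proof
            fix l assume "l \<in> bad"
            then obtain i where l: "l < n" and i: "win n k l \<le> i" "i \<le> win n k (Suc l)"
              and small: "norm (b j1 i) < \<eta>" using j1 unfolding bad_def by blast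
            have ik: "i \<le> k" using i(2) win_le[of n "Suc l" k] l by simp
            have sm: "norm (poly Q (tm k 0 i)) < (1 / (2 * 3 ^ m)) / (real n + 1) ^ m"
              using small Qb[OF ik] \<eta> L\<theta> \<theta> norm_triangle_sub[of "poly Q (tm k 0 i)" "b j1 i"]
              unfolding \<theta>_def[symmetric] by (simp add: norm_minus_commute)
            have dd: "dist (tm k 0 i) (tm k 0 i1) \<le> 1"
            proof -
              have "tm k 0 i - tm k 0 i1 = tm k i1 i" by (simp add: tm_def diff_divide_distrib)
              then show ?thesis using norm_tm_le_1[OF ik i1] by (simp add: dist_norm)
            qed
            have "\<forall>l\<ge>m. coeff Q l = 0" "0 < n" using Q n unfolding lerr_def by auto
            from poly_small_near_root[OF this dd Qi1 sm]
            obtain r where r: "r \<in># proots Q" "dist (tm k 0 i) r < 1 / real n" by blast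
            have "\<bar>Re (tm k 0 i - r)\<bar> < 1 / real n" using r(2) abs_Re_le_cmod[of "tm k 0 i - r"] by (simp add: dist_norm)
            then have "\<bar>real i / real k - Re r\<bar> < 1 / real n" by (simp add: tm_def)
            then have "real n * \<bar>real i / real k - Re r\<bar> < 1" using n by (simp add: field_simps)
            moreover have "real n * \<bar>real i / real k - Re r\<bar> = \<bar>real n * (real i / real k) - real n * Re r\<bar>"
              by (subst right_diff_distrib[symmetric]) (simp only: abs_mult abs_of_nat)
            ultimately have 1: "\<bar>real n * (real i / real k) - real n * Re r\<bar> < 1" by simp
            have "real l * real k / real n - 1 < real i" "real i \<le> real (Suc l) * real k / real n"
              using win_bounds(1)[where k = k and l = l and n = n] win_bounds(2)[where k = k and l = "Suc l" and n = n] i n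
              by linarith+
            then have "real l * real k - real n < real n * real i" "real n * real i \<le> real (Suc l) * real k"
              using n by (simp_all add: field_simps)
            then have "(real l * real k - real n) / real k < real n * real i / real k" "real n * real i / real k \<le> real (Suc l) * real k / real k"
              using k by (simp_all only: divide_strict_right_mono divide_right_mono of_nat_0_less_iff of_nat_0_le_iff Suc_le_eq One_nat_def)
            moreover have "real n / real k \<le> 1" using kk k by simp
            moreover have "(real l * real k - real n) / real k = real l - real n / real k"
              "real (Suc l) * real k / real k = real l + 1" "real n * (real i / real k) = real n * real i / real k"
              using k by (simp_all add: diff_divide_distrib)
            ultimately have "\<bar>real n * (real i / real k) - real l\<bar> \<le> 1" by linarith
            with 1 have "\<bar>real l - real n * Re r\<bar> < 2" by linarith
            then show "l \<in> (\<Union>r\<in>set_mset (proots Q). {l. \<bar>real l - real n * Re r\<bar> < 2})" using r(1) by blast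
          qed
          have card_bad: "real (card bad) \<le> 5 * real m"
          proof -
            have "card bad \<le> card (\<Union>r\<in>set_mset (proots Q). {l. \<bar>real l - real n * Re r\<bar> < 2})"
              by (rule card_mono[OF _ bad_sub]) (use card_nat_near in auto)
            also have "\<dots> \<le> (\<Sum>r\<in>set_mset (proots Q). card {l. \<bar>real l - real n * Re r\<bar> < 2})"
              by (rule card_UN_le) simp
            also have "\<dots> \<le> (\<Sum>r\<in>set_mset (proots Q). 4)" by (intro sum_mono) (use card_nat_near in auto)
            also have "\<dots> = 4 * card (set_mset (proots Q))" by simp
            also have "card (set_mset (proots Q)) \<le> m"
            proof -
              have "0 < norm (poly Q (tm k 0 i1))" by (rule less_le_trans[OF _ Qi1]) simp
              then have "Q \<noteq> 0" by auto
              then have "card (set_mset (proots Q)) \<le> degree Q" by (simp add: card_poly_roots_bound)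
              also have "degree Q \<le> m" using Q unfolding lerr_def by (intro degree_le) auto
              finally show ?thesis .
            qed
            finally show ?thesis by simp
          qed
          define X where "X = \<zeta> powr q * B * (2 * real n) powr (q - 1)"
          have X0: "0 \<le> X" using B0 by (simp add: X_def)
          have n0: "0 < n" using n by simp
          have win_k: "win n k l + (win n k (Suc l) - win n k l) \<le> k" if "l < n" for l
            using that win_mono[of l "Suc l" n k] win_le[OF n0, of "Suc l" k] by simp
          have wpow: "real (win n k (Suc l) - win n k l) powr (1 - q) \<le> (2 * real n) powr (q - 1) * real k powr (1 - q)" for l
            using win_len(1)[OF n0 kk(2), of l] n0 k q by (intro window_powr) auto
          have each: "RE q (win n k (Suc l) - win n k l) (\<lambda>i. A (win n k l + i)) \<le>
              ((if l \<in> bad then X else 0) + Y) * real k powr (1 - q)" if l: "l < n" for l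
          proof -
            let ?w = "win n k l" and ?k' = "win n k (Suc l) - win n k l"
            have len: "0 < ?k'" "real ?k' \<le> 2 * real k / real n" using win_len[OF n0 kk(2), of l] by auto
            show ?thesis
            proof (cases "l \<in> bad")
              case True
              then obtain i2 where i2: "?w \<le> i2" "i2 \<le> win n k (Suc l)"
                and small: "\<And>j. 1 \<le> j \<Longrightarrow> j \<le> m \<Longrightarrow> norm (b j i2) < \<eta>" unfolding bad_def by blast
              have i2k: "i2 \<le> k" using i2(2) win_le[OF n0, of "Suc l" k] l by simp
              have lk: "real ?k' / real k \<le> 2 / real n" using len(2) k n0 by (simp add: field_simps)
              have "real ?k' < real k"
              proof -
                have "real ?k' / real k < 1" using lk n12 by (smt (verit) divide_less_eq_1_pos)
                then show ?thesis using k by simp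
              qed
              then have lt: "?k' < k" by (simp only: of_nat_less_iff)
              \<comment> \<open>A bad window leads back to the same problem with fewer samples,
                after division of the roots by \<open>\<zeta>\<close>.\<close>
              have "RE q ?k' (\<lambda>i. A (?w + i)) \<le> \<zeta> powr q * B * real ?k' powr (1 - q)"
              proof (rule rescaled[OF len(1) lt win_k[OF l] \<zeta>0])
                fix i j assume i: "i \<le> ?k'" and j: "1 \<le> j" "j \<le> m"
                have wi: "?w + i \<le> k" using i win_k[OF l] by simp
                have "\<bar>real (?w + i) - real i2\<bar> \<le> real ?k'" using i i2 by linarith
                then have "\<bar>real (?w + i) - real i2\<bar> / real k \<le> 2 / real n"
                  using lk by (meson divide_right_mono of_nat_0_le_iff order_trans)
                then have "C2 * (\<bar>real (?w + i) - real i2\<bar> / real k) \<le> C2 * (2 / real n)"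
                  using C2 by (intro mult_left_mono) auto
                then have "norm (b j (?w + i)) \<le> \<eta> + C2 * (2 / real n)"
                  using lipb[OF wi i2k j] small[OF j] norm_triangle_sub[of "b j (?w + i)" "b j i2"] by linarith
                also have "\<dots> \<le> C2 / n + C2 * (2 / real n)"
                  using \<eta>(3) C2 n0 by (intro add_right_mono order_trans[OF \<eta>(3)] divide_right_mono) auto
                also have "\<dots> = 3 * C2 / n" by (simp add: field_simps)
                also have "\<dots> \<le> \<zeta> ^ j" using \<zeta>j j by simp
                finally have "norm (b j (?w + i)) \<le> \<zeta> ^ j" .
                then show "norm (coeff (rpoly (A (?w + i))) (m - j)) \<le> (L * \<zeta>) ^ j"
                  unfolding b_eq[OF wi j(2)] power_mult_distrib using L by (intro mult_left_mono) auto
              next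
                fix j assume j: "1 \<le> j" "j \<le> m"
                have "real ?k' / real k \<le> 1" using lt by simp
                then have "(real ?k' / real k) ^ m \<le> real ?k' / real k"
                  using m power_decreasing[of 1 m "real ?k' / real k"] by simp
                also have "\<dots> \<le> 3 * C2 / n" using lk C2 n0 by (intro order_trans[OF lk] divide_right_mono) auto
                also have "\<dots> \<le> \<zeta> ^ j" using \<zeta>j j by simp
                finally show "(real ?k' / real k) ^ m \<le> \<zeta> ^ j" .
              qed
              also have "\<dots> \<le> \<zeta> powr q * B * ((2 * real n) powr (q - 1) * real k powr (1 - q))"
                using B0 wpow by (intro mult_left_mono) auto
              also have "\<dots> = X * real k powr (1 - q)" by (simp add: X_def)
              also have "\<dots> \<le> (X + Y) * real k powr (1 - q)" using Y0 by (intro mult_right_mono) auto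
              finally show ?thesis using True by simp
            next
              \<comment> \<open>In a good window the roots divided by \<open>L\<close> have some
                coefficient at least \<open>\<eta>\<close> at every time, so the cluster bound
                \<open>good\<close> applies; undoing the division costs
                \<open>L powr q\<close>.\<close>
              case False
              let ?A' = "\<lambda>i. image_mset ((*) (of_real (inverse L))) (A (?w + i))"
              have rk: "real ?k' / real k \<le> 1" using win_k[OF l] k by simp
              have "cent m ?k' 1 1 ?A'"
              proof (rule cent_rescale[OF A win_k[OF l] len(1)])
                show "0 < L" using L by simp
                fix i j assume i: "i \<le> ?k'" and j: "1 \<le> j" "j \<le> m"
                have "?w + i \<le> k" using i win_k[OF l] by simp
                then show "norm (coeff (rpoly (A (?w + i))) (m - j)) \<le> (1 * L) ^ j"
                  using A j unfolding cent_def by simp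
              next
                fix j assume j: "1 \<le> j" "j \<le> m"
                have "(real ?k' / real k) ^ m \<le> 1" using rk by (intro power_le_one) auto
                also have "\<dots> \<le> L ^ j" using L by (intro one_le_power) auto
                finally show "1 * (real ?k' / real k) ^ m \<le> 1 * L ^ j" by simp
              qed
              moreover have "\<forall>i\<le>?k'. \<exists>j. 1 \<le> j \<and> j \<le> m \<and> \<eta> \<le> norm (coeff (rpoly (?A' i)) (m - j))"
              proof (intro allI impI)
                fix i assume i: "i \<le> ?k'"
                have "win n k l \<le> ?w + i" "?w + i \<le> win n k (Suc l)" using i win_mono[of l "Suc l" n k] by auto
                then have "\<not> (\<forall>j. 1 \<le> j \<longrightarrow> j \<le> m \<longrightarrow> norm (b j (?w + i)) < \<eta>)" using False l unfolding bad_def by blast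
                then show "\<exists>j. 1 \<le> j \<and> j \<le> m \<and> \<eta> \<le> norm (coeff (rpoly (?A' i)) (m - j))"
                  unfolding b_def bA_def by (simp add: not_less)
              qed
              ultimately have "RE q ?k' ?A' \<le> CG * real ?k' powr (1 - q)" using len(1) by (intro good) auto
              then have "L powr q * RE q ?k' ?A' \<le> L powr q * (CG * real ?k' powr (1 - q))"
                by (intro mult_left_mono) auto
              moreover have "RE q ?k' (\<lambda>i. A (?w + i)) \<le> L powr q * RE q ?k' ?A'"
                by (rule RE_unscale[of _ _ m]) (use szA win_k[OF l] q L in auto)
              moreover have "L powr q * (CG * real ?k' powr (1 - q)) \<le> L powr q * (CG * ((2 * real n) powr (q - 1) * real k powr (1 - q)))"
                using CG wpow by (intro mult_left_mono) auto
              ultimately show ?thesis using False by (simp add: Y_def mult.assoc)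
            qed
          qed
          have "RE q k A = RE q (win n k n) A" using n0 by simp
          also have "\<dots> = (\<Sum>l<n. RE q (win n k (Suc l) - win n k l) (\<lambda>i. A (win n k l + i)))"
            by (rule RE_windows) (auto intro: win_mono)
          also have "\<dots> \<le> (\<Sum>l<n. ((if l \<in> bad then X else 0) + Y) * real k powr (1 - q))"
            by (intro sum_mono each) auto
          also have "\<dots> = ((\<Sum>l<n. if l \<in> bad then X else 0) + real n * Y) * real k powr (1 - q)"
            by (simp add: sum.distrib flip: sum_distrib_right)
          also have "(\<Sum>l<n. if l \<in> bad then X else 0) = real (card bad) * X"
          proof -
            have "{..<n} \<inter> {l. l \<in> bad} = bad" unfolding bad_def by auto
            then show ?thesis by (simp add: sum.If_cases)
          qed
          also have "real (card bad) * X \<le> B / 2"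
          proof -
            have "real (card bad) * X \<le> 5 * real m * X" using card_bad X0 by (intro mult_right_mono)
            also have "\<dots> = B * (5 * real m * ((3 * C2 / n) powr (q / m) * (2 * real n) powr (q - 1)))"
              by (simp add: X_def \<zeta>q)
            also have "\<dots> \<le> B * (1 / 2)" using n(3) B0 by (intro mult_left_mono)
            finally show ?thesis by simp
          qed
          also have "(B / 2 + real n * Y) * real k powr (1 - q) \<le> B * real k powr (1 - q)"
            by (intro mult_right_mono) (auto simp: B_def)
          finally show ?thesis by (simp add: mult_right_mono)
        qed
      qed
    qed
  qed
  have "RE q k A \<le> B * real k powr (1 - q)" if "1 \<le> k" "cent m k 1 1 A" for k A
  proof -
    have "1 \<le> L ^ j" for j using L(1) by (intro one_le_power) simp
    then have "cent m k L 1 A" using that(2) unfolding cent_def by (auto intro: order_trans)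
    then show ?thesis using main that(1) by blast
  qed
  then show ?thesis by blast
qed

section \<open>Removal of the centring hypothesis, induction on the number of roots\<close>

lemma powr_add_le:
  fixes a b q :: real
  assumes "0 \<le> a" "0 \<le> b" "0 \<le> q"
  shows "(a + b) powr q \<le> 2 powr q * (a powr q + b powr q)"
proof -
  have "(a + b) powr q \<le> (2 * max a b) powr q" using assms by (intro powr_mono2) auto
  also have "\<dots> = 2 powr q * max a b powr q" using assms by (simp add: powr_mult)
  also have "\<dots> \<le> 2 powr q * (a powr q + b powr q)" by (intro mult_left_mono) (auto simp: max_def)
  finally show ?thesis .
qed

lemma apx_cong: "(\<And>i. i \<le> k \<Longrightarrow> c i = c' i) \<Longrightarrow> apx m k i0 M c \<longleftrightarrow> apx m k i0 M c'"
  unfolding apx_def lerr_def by auto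

text \<open>Tschirnhaus shift by the mean \<open>s\<close> of the roots. The mean is itself a
  coefficient up to a factor, hence Lipschitz; its motion adds at most \<open>2 * M / k\<close> per
  step and \<open>(2 * M) powr q * k powr (1 - q)\<close> in total. Division by
  \<open>\<sigma>\<close> then normalises the constants to 1.\<close>

lemma energy_bounded_centre:
  assumes q: "1 \<le> q" and m: "1 \<le> m"
    and cb: "\<exists>C. \<forall>k A. 1 \<le> k \<longrightarrow> cent m k 1 1 A \<longrightarrow> RE q k A \<le> C * real k powr (1 - q)"
  shows "energy_bounded q m"
  unfolding energy_bounded_def
proof
  fix M0 :: real
  from cb obtain C where C: "\<And>k A. 1 \<le> k \<Longrightarrow> cent m k 1 1 A \<Longrightarrow> RE q k A \<le> C * real k powr (1 - q)" by blast
  define M where "M = max 1 M0"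
  have M: "1 \<le> M" by (simp add: M_def)
  from apx_coeff_shift[OF m, of M m] obtain K where K: "\<And>k i0 s p j. i0 \<le> k \<Longrightarrow> apx m k i0 M s \<Longrightarrow>
     (\<forall>i. degree (p i) \<le> m) \<Longrightarrow> (\<forall>j\<le>m. apx m k i0 M (\<lambda>i. coeff (p i) j)) \<Longrightarrow>
     apx m k i0 K (\<lambda>i. coeff (pcompose (p i) [:s i, 1:]) j)" by blast
  define \<sigma> where "\<sigma> = 2 * max 1 K"
  have \<sigma>: "1 \<le> \<sigma>" "2 * K \<le> \<sigma>" "max 1 K \<le> \<sigma>" by (auto simp: \<sigma>_def)
  have \<sigma>j: "\<sigma> \<le> \<sigma> ^ j" if "1 \<le> j" for j using \<sigma>(1) that power_increasing[of 1 j \<sigma>] by simp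
  define D where "D = 2 powr q * (\<sigma> powr q * C + (2 * M) powr q)"
  have main: "RE q k A \<le> D * real k powr (1 - q)" if A: "regular m k M0 A" and k: "1 \<le> k" for k A
  proof -
    have sz: "size (A i) = m" if "i \<le> k" for i using A that unfolding regular_def by blast
    have ap: "apx m k i0 M (\<lambda>i. coeff (rpoly (A i)) j)" if "i0 \<le> k" "j < m" for i0 j
    proof -
      have "apx m k i0 M0 (\<lambda>i. coeff (rpoly (A i)) j)" using A that unfolding regular_def by blast
      then show ?thesis by (rule apx_mono) (simp add: M_def)
    qed
    define s where "s i = - (1 / of_nat m) * coeff (rpoly (A i)) (m - 1)" for i
    have s: "apx m k i0 M s" if "i0 \<le> k" for i0
    proof -
      have "apx m k i0 (norm (- (1 / of_nat m) :: complex) * M) s"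
        unfolding s_def by (rule apx_cmult, rule ap) (use that m in auto)
      then show ?thesis
        by (rule apx_mono) (use m M in \<open>simp add: norm_divide divide_le_eq\<close>)
    qed
    \<comment> \<open>Set to 0 beyond \<open>k\<close>, because \<open>apx_coeff_shift\<close> asks
      for the degree bound at every index while sizes are known only up to \<open>k\<close>.\<close>
    define p where "p i = (if i \<le> k then rpoly (A i) else 0)" for i
    define A' where "A' i = image_mset (\<lambda>x. x - s i) (A i)" for i
    have pA': "pcompose (p i) [:s i, 1:] = rpoly (A' i)" if "i \<le> k" for i
      using that by (simp add: p_def A'_def rpoly_shift)
    have A'ap: "apx m k i0 K (\<lambda>i. coeff (rpoly (A' i)) j)" if i0: "i0 \<le> k" for i0 j
    proof -
      have "apx m k i0 K (\<lambda>i. coeff (pcompose (p i) [:s i, 1:]) j)"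
      proof (rule K[OF i0 s[OF i0]])
        show "\<forall>i. degree (p i) \<le> m" using sz by (simp add: p_def)
        show "\<forall>j\<le>m. apx m k i0 M (\<lambda>i. coeff (p i) j)"
        proof (intro allI impI)
          fix j assume j: "j \<le> m"
          show "apx m k i0 M (\<lambda>i. coeff (p i) j)"
          proof (cases "j = m")
            case True
            have "apx m k i0 M (\<lambda>_. 1)" using M m by (intro apx_const) auto
            moreover have "coeff (p i) m = 1" if "i \<le> k" for i
              using coeff_rpoly_size[of "A i"] sz[OF that] that by (simp add: p_def)
            ultimately show ?thesis
              unfolding True by (subst apx_cong[of k _ "\<lambda>_. 1"])
          next
            case False
            with j have "apx m k i0 M (\<lambda>i. coeff (rpoly (A i)) j)" using ap i0 by simp
            then show ?thesis
              by (subst apx_cong[of k _ "\<lambda>i. coeff (rpoly (A i)) j"]) (auto simp: p_def)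
          qed
        qed
      qed
      then show ?thesis
        by (subst apx_cong[of k _ "\<lambda>i. coeff (pcompose (p i) [:s i, 1:]) j"]) (auto simp: pA')
    qed
    have "cent m k \<sigma> (max 1 K) A'"
      unfolding cent_def
    proof (intro conjI allI impI)
      fix i assume i: "i \<le> k"
      show szA': "size (A' i) = m" using sz[OF i] by (simp add: A'_def)
      have ne: "A i \<noteq> {#}" using sz[OF i] m by auto
      have "sum_mset (A i) = of_nat m * s i"
        using coeff_rpoly_sum[OF ne] sz[OF i] m by (simp add: s_def)
      moreover have "sum_mset (image_mset (\<lambda>x. x - c) B) = sum_mset B - of_nat (size B) * c" for c :: complex and B
        by (induction B) (auto simp: algebra_simps)
      ultimately show "sum_mset (A' i) = 0" using sz[OF i] by (simp add: A'_def)
      fix j assume j: "1 \<le> j" "j \<le> m"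
      have "norm (coeff (rpoly (A' i)) (m - j)) \<le> 2 * K" by (rule apx_value[OF A'ap[OF i] i i])
      also have "\<dots> \<le> \<sigma> ^ j" using \<sigma> \<sigma>j[OF j(1)] by linarith
      finally show "norm (coeff (rpoly (A' i)) (m - j)) \<le> \<sigma> ^ j" .
    next
      fix i0 j assume "i0 \<le> k"
      from A'ap[OF this, of "m - j"] show "\<exists>Q. lerr m k i0 (max 1 K) (\<lambda>i. coeff (rpoly (A' i)) (m - j)) Q"
        unfolding apx_def by (meson lerr_mono max.cobounded2)
    qed
    then have "cent m k 1 1 (\<lambda>i. image_mset ((*) (of_real (inverse \<sigma>))) (A' (0 + i)))"
    proof (rule cent_rescale)
      show "0 + k \<le> k" "0 < k" "0 < \<sigma>" using k \<sigma> by auto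
      fix i j assume "i \<le> k" "1 \<le> j" "j \<le> m"
      then show "norm (coeff (rpoly (A' (0 + i))) (m - j)) \<le> (1 * \<sigma>) ^ j"
        using \<open>cent m k \<sigma> (max 1 K) A'\<close> unfolding cent_def by simp
    next
      fix j assume "1 \<le> j" "j \<le> m"
      then show "max 1 K * (real k / real k) ^ m \<le> 1 * \<sigma> ^ j" using \<sigma>(3) \<sigma>j[of j] k by simp
    qed
    then have "RE q k (\<lambda>i. image_mset ((*) (of_real (inverse \<sigma>))) (A' i)) \<le> C * real k powr (1 - q)"
      using C[OF k] by simp
    then have "\<sigma> powr q * RE q k (\<lambda>i. image_mset ((*) (of_real (inverse \<sigma>))) (A' i)) \<le> \<sigma> powr q * (C * real k powr (1 - q))"
      by (intro mult_left_mono) auto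
    moreover have "RE q k A' \<le> \<sigma> powr q * RE q k (\<lambda>i. image_mset ((*) (of_real (inverse \<sigma>))) (A' i))"
      by (rule RE_unscale[of _ _ m]) (use sz q \<sigma> in \<open>auto simp: A'_def\<close>)
    ultimately have RA': "RE q k A' \<le> \<sigma> powr q * C * real k powr (1 - q)" by (simp add: mult.assoc)
    have "RE q k A \<le> (\<Sum>i<k. 2 powr q * (matchd (A' i) (A' (Suc i)) powr q + (2 * M / real k) powr q))"
      unfolding RE_def
    proof (rule sum_mono)
      fix i assume "i \<in> {..<k}"
      then have i: "i \<le> k" "Suc i \<le> k" by auto
      have s': "size (A' i) = size (A' (Suc i))" "size (A i) = size (A (Suc i))" using sz i by (auto simp: A'_def)
      have uncentre: "image_mset (\<lambda>x. x + s i) (A' i) = A i" for i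
        by (simp add: A'_def multiset.map_comp o_def)
      have "matchd (image_mset (\<lambda>x. x + s i) (A' i)) (image_mset (\<lambda>x. x + s (Suc i)) (A' (Suc i))) \<le>
          1 * matchd (A' i) (A' (Suc i)) + 2 * M / real k"
      proof (rule matchd_image[OF s'(1)])
        fix x y
        have "norm (s (Suc i) - s i) \<le> 2 * M * norm (tm k i (Suc i))" by (rule apx_lip[OF s i(2,1) m]) (rule i(1))
        also have "norm (tm k i (Suc i)) = 1 / real k" by (simp add: norm_tm)
        finally have "norm (s i - s (Suc i)) \<le> 2 * M / real k" by (simp add: norm_minus_commute)
        then show "dist (x + s i) (y + s (Suc i)) \<le> 1 * dist x y + 2 * M / real k"
          using norm_triangle_ineq[of "x - y" "s i - s (Suc i)"] by (simp add: dist_norm algebra_simps)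
      qed (use M in auto)
      then have "matchd (A i) (A (Suc i)) \<le> matchd (A' i) (A' (Suc i)) + 2 * M / real k" unfolding uncentre by simp
      then have "matchd (A i) (A (Suc i)) powr q \<le> (matchd (A' i) (A' (Suc i)) + 2 * M / real k) powr q"
        using q matchd_nonneg[OF s'(2)] by (intro powr_mono2) auto
      also have "\<dots> \<le> 2 powr q * (matchd (A' i) (A' (Suc i)) powr q + (2 * M / real k) powr q)"
        using q M matchd_nonneg[OF s'(1)] by (intro powr_add_le) auto
      finally show "matchd (A i) (A (Suc i)) powr q \<le> \<dots>" .
    qed
    also have "\<dots> = 2 powr q * (RE q k A' + real k * (2 * M / real k) powr q)"
      by (simp add: RE_def sum.distrib flip: sum_distrib_left)
    also have "real k * (2 * M / real k) powr q = (2 * M) powr q * real k powr (1 - q)"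
      using k M by (simp add: powr_divide powr_diff)
    also have "2 powr q * (RE q k A' + (2 * M) powr q * real k powr (1 - q)) \<le>
       2 powr q * (\<sigma> powr q * C * real k powr (1 - q) + (2 * M) powr q * real k powr (1 - q))"
      using RA' by (intro mult_left_mono add_right_mono) auto
    also have "\<dots> = D * real k powr (1 - q)" by (simp add: D_def algebra_simps)
    finally show ?thesis .
  qed
  show "\<exists>C. \<forall>k A. regular m k M0 A \<longrightarrow> RE q k A \<le> C * real k powr (1 - q)"
  proof (intro exI[of _ D] allI impI)
    fix k A assume "regular m k M0 A"
    then show "RE q k A \<le> D * real k powr (1 - q)" using main[of k A] by (cases "k = 0") auto
  qed
qed

text \<open>The condition on the exponent passes to every smaller number of roots because
  \<open>q \<ge> 1\<close>.\<close>

lemma energy_bounded_roots: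
  "1 \<le> q \<Longrightarrow> 1 \<le> m \<Longrightarrow> q * (real m - 1) < real m \<Longrightarrow> energy_bounded q m"
proof (induction m rule: less_induct)
  case (less m)
  show ?case
  proof (rule energy_bounded_centre[OF less.prems(1,2)], rule centred_energy[OF less.prems])
    fix m' assume m': "1 \<le> m'" "m' < m"
    have "1 * (real m - real m') \<le> q * (real m - real m')"
      using less.prems(1) m' by (intro mult_right_mono) auto
    then have "q * (real m' - 1) < real m'" using less.prems(3) by (simp add: algebra_simps)
    with m' less.prems(1) show "energy_bounded q m'" by (intro less.IH) auto
  qed
qed

section \<open>A dyadic criterion for absolute continuity\<close>

text \<open>The sharp constant is essential: it cancels the factor by which \<open>en\<close> is
  renormalised from one dyadic level to the next, so that energies do not decrease under
  refinement.\<close>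

lemma powr_sum2_le:
  fixes a b q :: real
  assumes "0 \<le> a" "0 \<le> b" "1 \<le> q"
  shows "(a + b) powr q \<le> 2 powr (q - 1) * (a powr q + b powr q)"
proof (cases "a = 0 \<or> b = 0")
  case True
  have "1 \<le> (2::real) powr (q - 1)" using assms by (intro ge_one_powr_ge_zero) auto
  then have "1 * (a powr q + b powr q) \<le> 2 powr (q - 1) * (a powr q + b powr q)" by (intro mult_right_mono) auto
  with True show ?thesis by auto
next
  case False
  then have ab: "0 < a" "0 < b" using assms by auto
  have "((1 - 1/2) *\<^sub>R a + (1/2) *\<^sub>R b) powr q \<le> (1 - 1/2) * a powr q + (1/2) * b powr q"
    using powr_convex[OF assms(3)] ab by (intro convex_onD) auto
  then have "((a + b) / 2) powr q \<le> (a powr q + b powr q) / 2" by (simp add: field_simps)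
  then have "(a + b) powr q / 2 powr q \<le> (a powr q + b powr q) / 2" using ab by (simp add: powr_divide)
  then show ?thesis by (simp add: powr_diff field_simps)
qed

definition dcell :: "nat \<Rightarrow> nat \<Rightarrow> real set" where
  "dcell n i = {real i / 2 ^ n ..< real (Suc i) / 2 ^ n}"

lemma dcell_split: "dcell n i = dcell (Suc n) (2 * i) \<union> dcell (Suc n) (2 * i + 1)"
proof -
  have "real i / 2 ^ n = real (2 * i) / 2 ^ Suc n" "real (Suc i) / 2 ^ n = real (Suc (2 * i + 1)) / 2 ^ Suc n"
    by (simp_all add: field_simps)
  moreover have "real (2 * i) / 2 ^ Suc n \<le> real (Suc (2 * i)) / 2 ^ Suc n"
    "real (Suc (2 * i)) / 2 ^ Suc n \<le> real (Suc (2 * i + 1)) / 2 ^ Suc n"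
    by (intro divide_right_mono; simp)+
  ultimately show ?thesis unfolding dcell_def by (simp add: ivl_disj_un del: of_nat_Suc power_Suc)
qed

lemma emeasure_dcell: "emeasure lborel (dcell n i) = ennreal (1 / 2 ^ n)"
proof -
  have "real i / 2 ^ n \<le> real (Suc i) / 2 ^ n" by (intro divide_right_mono) auto
  then show ?thesis unfolding dcell_def by (simp add: diff_divide_distrib[symmetric] del: of_nat_Suc)
qed

lemma dcell_floor: "\<tau> \<in> dcell n i \<Longrightarrow> nat \<lfloor>\<tau> * 2 ^ n\<rfloor> = i"
proof -
  assume "\<tau> \<in> dcell n i"
  then have "real i \<le> \<tau> * 2 ^ n" "\<tau> * 2 ^ n < real i + 1" by (auto simp: dcell_def field_simps)
  then have "\<lfloor>\<tau> * 2 ^ n\<rfloor> = int i" by (intro floor_unique) auto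
  then show ?thesis by simp
qed

text \<open>\<open>D\<close> is only an upper bound for a distance on ordered pairs of times.
  \<open>D_cont\<close> serves twice: it yields \<open>D t t = 0\<close>, and it extends the
  estimate from dyadic to arbitrary times.\<close>

locale dyadic_energy =
  fixes D :: "real \<Rightarrow> real \<Rightarrow> real" and q1 C :: real
  assumes q1: "1 \<le> q1"
    and D_nonneg: "\<And>s t. 0 \<le> s \<Longrightarrow> s \<le> t \<Longrightarrow> t \<le> 1 \<Longrightarrow> 0 \<le> D s t"
    and D_tri: "\<And>s t u. 0 \<le> s \<Longrightarrow> s \<le> t \<Longrightarrow> t \<le> u \<Longrightarrow> u \<le> 1 \<Longrightarrow> D s u \<le> D s t + D t u"
    and D_cont: "\<And>e. 0 < e \<Longrightarrow> \<exists>d>0. \<forall>s t. 0 \<le> s \<longrightarrow> s \<le> t \<longrightarrow> t \<le> 1 \<longrightarrow> t - s < d \<longrightarrow> D s t \<le> e"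
    and energy: "\<And>n. (\<Sum>i<2^n. D (real i / 2 ^ n) (real (Suc i) / 2 ^ n) powr q1) \<le> C * (2 ^ n) powr (1 - q1)"
begin

definition dn :: "nat \<Rightarrow> nat \<Rightarrow> real" where
  "dn n i = D (real i / 2 ^ n) (real (Suc i) / 2 ^ n)"

definition speed :: "nat \<Rightarrow> real \<Rightarrow> real" where
  "speed n \<tau> = 2 ^ n * dn n (nat \<lfloor>\<tau> * 2 ^ n\<rfloor>)"

text \<open>The integral of \<open>speed n powr q1\<close> over the cell: length
  \<open>1 / 2 ^ n\<close> times \<open>(2 ^ n * dn n i) powr q1\<close>.\<close>

definition en :: "nat \<Rightarrow> nat \<Rightarrow> real" where
  "en n i = dn n i powr q1 * (2 ^ n) powr (q1 - 1)"

text \<open>The energy inside the cell \<open>(n, i)\<close> seen at level \<open>n + k\<close>; the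
  binary recursion matches the bisection in \<open>weak_type\<close>.\<close>

fun En :: "nat \<Rightarrow> nat \<Rightarrow> nat \<Rightarrow> real" where
  "En 0 n i = en n i"
| "En (Suc k) n i = En k (Suc n) (2 * i) + En k (Suc n) (2 * i + 1)"

lemma cell_le: "i < 2 ^ n \<Longrightarrow> real (Suc i) / 2 ^ n \<le> 1"
proof -
  assume "i < 2 ^ n"
  then have "Suc i \<le> 2 ^ n" by simp
  then have "real (Suc i) \<le> real (2 ^ n)" by (simp only: of_nat_le_iff)
  then show ?thesis by simp
qed

lemma dn_nonneg: "i < 2 ^ n \<Longrightarrow> 0 \<le> dn n i"
  unfolding dn_def by (intro D_nonneg cell_le divide_right_mono) auto

lemma dn_split:
  assumes "i < 2 ^ n"
  shows "dn n i \<le> dn (Suc n) (2 * i) + dn (Suc n) (2 * i + 1)"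
proof -
  have eq: "real i / 2 ^ n = real (2 * i) / 2 ^ Suc n" "real (Suc i) / 2 ^ n = real (Suc (2 * i + 1)) / 2 ^ Suc n"
    "real (Suc (2 * i)) / 2 ^ Suc n = real (2 * i + 1) / 2 ^ Suc n"
    by (simp_all add: field_simps)
  show ?thesis unfolding dn_def eq
    by (rule D_tri) (use assms cell_le[OF assms] in \<open>auto simp: eq(2) simp del: of_nat_Suc power_Suc intro!: divide_right_mono\<close>)
qed

lemma en_split:
  assumes "i < 2 ^ n"
  shows "en n i \<le> en (Suc n) (2 * i) + en (Suc n) (2 * i + 1)"
proof -
  have i2: "2 * i < 2 ^ Suc n" "2 * i + 1 < 2 ^ Suc n" using assms by auto
  have "dn n i powr q1 \<le> (dn (Suc n) (2 * i) + dn (Suc n) (2 * i + 1)) powr q1"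
    using dn_split[OF assms] dn_nonneg[OF assms] q1 by (intro powr_mono2) auto
  also have "\<dots> \<le> 2 powr (q1 - 1) * (dn (Suc n) (2 * i) powr q1 + dn (Suc n) (2 * i + 1) powr q1)"
    by (intro powr_sum2_le dn_nonneg i2 q1)
  finally have "en n i \<le> 2 powr (q1 - 1) * (dn (Suc n) (2 * i) powr q1 + dn (Suc n) (2 * i + 1) powr q1) * (2 ^ n) powr (q1 - 1)"
    unfolding en_def by (rule mult_right_mono) simp
  also have "\<dots> = en (Suc n) (2 * i) + en (Suc n) (2 * i + 1)"
    by (simp add: en_def powr_mult algebra_simps)
  finally show ?thesis .
qed

lemma En_ge: "i < 2 ^ n \<Longrightarrow> en n i \<le> En k n i"
proof (induction k arbitrary: n i)
  case (Suc k)
  then have i2: "2 * i < 2 ^ Suc n" "2 * i + 1 < 2 ^ Suc n" by auto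
  show ?case using en_split[OF Suc.prems] Suc.IH[OF i2(1)] Suc.IH[OF i2(2)] by simp
qed simp

lemma En_sum: "En k n i = (\<Sum>j<2^k. en (n + k) (i * 2 ^ k + j))"
proof (induction k arbitrary: n i)
  case (Suc k)
  have "(\<Sum>j<2^Suc k. en (n + Suc k) (i * 2 ^ Suc k + j)) =
      (\<Sum>j<2^k. en (n + Suc k) (i * 2 ^ Suc k + j)) + (\<Sum>j=2^k..<2^k+2^k. en (n + Suc k) (i * 2 ^ Suc k + j))"
    by (simp add: lessThan_atLeast0 sum.atLeastLessThan_concat mult_2)
  also have "(\<Sum>j=2^k..<2^k+2^k. en (n + Suc k) (i * 2 ^ Suc k + j)) = (\<Sum>j<2^k. en (n + Suc k) (i * 2 ^ Suc k + (j + 2 ^ k)))"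
    using sum.shift_bounds_nat_ivl[of "\<lambda>j. en (n + Suc k) (i * 2 ^ Suc k + j)" 0 "2 ^ k" "2 ^ k"]
    by (simp add: lessThan_atLeast0)
  finally show ?case by (simp add: Suc.IH algebra_simps)
qed simp

lemma En_total: "En k 0 0 \<le> C"
proof -
  have "En k 0 0 = (\<Sum>j<2^k. dn k j powr q1) * (2 ^ k) powr (q1 - 1)"
    by (simp add: En_sum en_def sum_distrib_right)
  also have "\<dots> \<le> (C * (2 ^ k) powr (1 - q1)) * (2 ^ k) powr (q1 - 1)"
    using energy[of k] by (intro mult_right_mono) (auto simp: dn_def)
  also have "\<dots> = C" by (simp add: mult.assoc flip: powr_add)
  finally show ?thesis .
qed

section \<open>The dyadic maximal function\<close>

lemma speed_measurable [measurable]: "speed n \<in> borel_measurable borel"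
  unfolding speed_def by measurable

lemma speed_dcell: "\<tau> \<in> dcell n i \<Longrightarrow> speed n \<tau> = 2 ^ n * dn n i"
  by (simp add: speed_def dcell_floor)

text \<open>Stopping at the first level where the speed exceeds \<open>lam\<close>: a cell that is
  selected there has length at most its energy divided by \<open>lam powr q1\<close>, and this
  energy only grows under refinement; a cell that is not selected is bisected.\<close>

lemma weak_type:
  assumes "0 < lam"
  shows "i < 2 ^ n \<Longrightarrow> emeasure lborel {\<tau> \<in> dcell n i. \<exists>j. n \<le> j \<and> j \<le> n + k \<and> lam < speed j \<tau>} \<le> ennreal (En k n i / lam powr q1)"
proof (induction k arbitrary: n i)
  case (0 n i)
  show ?case
  proof (cases "lam < 2 ^ n * dn n i")
    case True
    have "{\<tau> \<in> dcell n i. \<exists>j. n \<le> j \<and> j \<le> n + 0 \<and> lam < speed j \<tau>} \<subseteq> dcell n i" by auto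
    then have "emeasure lborel {\<tau> \<in> dcell n i. \<exists>j. n \<le> j \<and> j \<le> n + 0 \<and> lam < speed j \<tau>} \<le> emeasure lborel (dcell n i)"
      by (rule emeasure_mono) (simp add: dcell_def)
    also have "\<dots> \<le> ennreal (en n i / lam powr q1)"
      unfolding emeasure_dcell
    proof (rule ennreal_leI)
      have "lam powr q1 \<le> (2 ^ n * dn n i) powr q1" using True assms q1 by (intro powr_mono2) auto
      then have "lam powr q1 / 2 ^ n \<le> (2 ^ n * dn n i) powr q1 / 2 ^ n" by (intro divide_right_mono) auto
      also have "\<dots> = en n i" using dn_nonneg[OF 0] by (simp add: en_def powr_mult powr_diff)
      finally show "1 / 2 ^ n \<le> en n i / lam powr q1" using assms by (simp add: field_simps)
    qed
    finally show ?thesis by simp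
  next
    case False
    then have "{\<tau> \<in> dcell n i. \<exists>j. n \<le> j \<and> j \<le> n + 0 \<and> lam < speed j \<tau>} = {}"
      using speed_dcell by force
    then show ?thesis by (simp only: emeasure_empty) simp
  qed
next
  case (Suc k n i)
  have i2: "2 * i < 2 ^ Suc n" "2 * i + 1 < 2 ^ Suc n" using Suc.prems by auto
  let ?S = "\<lambda>n i k. {\<tau> \<in> dcell n i. \<exists>j. n \<le> j \<and> j \<le> n + k \<and> lam < speed j \<tau>}"
  have meas: "?S n i k \<in> sets lborel" for n i k by (simp add: dcell_def)
  show ?case
  proof (cases "lam < 2 ^ n * dn n i")
    case True
    have "emeasure lborel (?S n i (Suc k)) \<le> emeasure lborel (dcell n i)"
      by (rule emeasure_mono) (auto simp: dcell_def)
    also have "\<dots> \<le> ennreal (en n i / lam powr q1)"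
      unfolding emeasure_dcell
    proof (rule ennreal_leI)
      have "lam powr q1 \<le> (2 ^ n * dn n i) powr q1" using True assms q1 by (intro powr_mono2) auto
      then have "lam powr q1 / 2 ^ n \<le> (2 ^ n * dn n i) powr q1 / 2 ^ n" by (intro divide_right_mono) auto
      also have "\<dots> = en n i" using dn_nonneg[OF Suc.prems] by (simp add: en_def powr_mult powr_diff)
      finally show "1 / 2 ^ n \<le> en n i / lam powr q1" using assms by (simp add: field_simps)
    qed
    also have "\<dots> \<le> ennreal (En (Suc k) n i / lam powr q1)"
      using En_ge[OF Suc.prems, of "Suc k"] by (intro ennreal_leI divide_right_mono) auto
    finally show ?thesis .
  next
    case False
    have "?S n i (Suc k) \<subseteq> ?S (Suc n) (2 * i) k \<union> ?S (Suc n) (2 * i + 1) k"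
    proof
      fix \<tau> assume "\<tau> \<in> ?S n i (Suc k)"
      then obtain j where \<tau>: "\<tau> \<in> dcell n i" and j: "n \<le> j" "j \<le> n + Suc k" "lam < speed j \<tau>" by auto
      have "j \<noteq> n" using speed_dcell[OF \<tau>] j(3) False by auto
      then have "Suc n \<le> j" "j \<le> Suc n + k" using j by auto
      then show "\<tau> \<in> ?S (Suc n) (2 * i) k \<union> ?S (Suc n) (2 * i + 1) k"
        using \<tau> j(3) unfolding dcell_split[of n i] by blast
    qed
    then have "emeasure lborel (?S n i (Suc k)) \<le> emeasure lborel (?S (Suc n) (2 * i) k \<union> ?S (Suc n) (2 * i + 1) k)"
      by (rule emeasure_mono) (intro sets.Un meas)
    also have "\<dots> \<le> emeasure lborel (?S (Suc n) (2 * i) k) + emeasure lborel (?S (Suc n) (2 * i + 1) k)"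
      by (rule emeasure_subadditive[OF meas meas])
    also have "\<dots> \<le> ennreal (En k (Suc n) (2 * i) / lam powr q1) + ennreal (En k (Suc n) (2 * i + 1) / lam powr q1)"
      by (intro add_mono Suc.IH i2)
    also have "\<dots> = ennreal (En (Suc k) n i / lam powr q1)"
    proof -
      have "0 \<le> En k n i" if "i < 2 ^ n" for n i
        by (rule order_trans[OF _ En_ge[OF that]]) (simp add: en_def)
      then show ?thesis using i2 by (subst ennreal_plus[symmetric]) (auto simp: add_divide_distrib simp del: ennreal_plus)
    qed
    finally show ?thesis .
  qed
qed

text \<open>Cut down to \<open>{0..<1}\<close>, where the cell index stays below
  \<open>2 ^ n\<close>. The values are extended reals because finiteness is obtained only almost
  everywhere.\<close>

definition maxi :: "real \<Rightarrow> ennreal" where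
  "maxi \<tau> = (SUP n. ennreal (speed n \<tau>) * indicator {0..<1} \<tau>)"

lemma maxi_measurable [measurable]: "maxi \<in> borel_measurable borel"
  unfolding maxi_def by measurable

lemma C_nonneg: "0 \<le> C"
  using En_total[of 0] by (simp add: en_def) (meson mult_nonneg_nonneg order_trans powr_ge_zero)

lemma maxi_weak:
  assumes "0 < lam"
  shows "emeasure lborel {\<tau>. ennreal lam < maxi \<tau>} \<le> ennreal (C / lam powr q1)"
proof -
  let ?S = "\<lambda>k. {\<tau> \<in> dcell 0 0. \<exists>j. 0 \<le> j \<and> j \<le> 0 + k \<and> lam < speed j \<tau>}"
  have sub: "{\<tau>. ennreal lam < maxi \<tau>} \<subseteq> (\<Union>k. ?S k)"
  proof
    fix \<tau> assume "\<tau> \<in> {\<tau>. ennreal lam < maxi \<tau>}"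
    then obtain n where n: "ennreal lam < ennreal (speed n \<tau>) * indicator {0..<1} \<tau>"
      unfolding maxi_def by (auto simp: less_SUP_iff)
    then have "\<tau> \<in> {0..<1}" by (cases "\<tau> \<in> {0..<1}") (auto simp del: atLeastLessThan_iff)
    moreover from this n have "lam < speed n \<tau>" using assms by (simp add: ennreal_less_iff)
    ultimately show "\<tau> \<in> (\<Union>k. ?S k)" by (auto simp: dcell_def)
  qed
  have meas: "?S k \<in> sets lborel" for k by (simp add: dcell_def)
  have "emeasure lborel {\<tau>. ennreal lam < maxi \<tau>} \<le> emeasure lborel (\<Union>k. ?S k)"
    by (rule emeasure_mono[OF sub]) (intro sets.countable_UN'' countableI_type meas)
  also have "\<dots> = (SUP k. emeasure lborel (?S k))"
  proof (rule SUP_emeasure_incseq[symmetric])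
    show "range ?S \<subseteq> sets lborel" using meas by blast
    show "incseq ?S" by (rule incseq_SucI) (auto intro: le_SucI)
  qed
  also have "\<dots> \<le> ennreal (C / lam powr q1)"
  proof (rule SUP_least)
    fix k
    have "emeasure lborel (?S k) \<le> ennreal (En k 0 0 / lam powr q1)" by (rule weak_type[OF assms]) simp
    also have "\<dots> \<le> ennreal (C / lam powr q1)" by (intro ennreal_leI divide_right_mono En_total) auto
    finally show "emeasure lborel (?S k) \<le> ennreal (C / lam powr q1)" .
  qed
  finally show ?thesis .
qed

text \<open>The weak-type bound tends to 0 as \<open>lam\<close> grows. It follows that passing to
  the real function \<open>mm\<close> alters \<open>maxi\<close> on a null set only.\<close>

lemma maxi_finite: "AE \<tau> in lborel. maxi \<tau> < \<infinity>"
proof -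
  have "emeasure lborel {\<tau>. maxi \<tau> = \<infinity>} \<le> ennreal e" if e: "0 < e" for e
  proof -
    define lam where "lam = max 1 (C / e)"
    have lam: "1 \<le> lam" "C / e \<le> lam" by (auto simp: lam_def)
    have "emeasure lborel {\<tau>. maxi \<tau> = \<infinity>} \<le> emeasure lborel {\<tau>. ennreal lam < maxi \<tau>}"
      by (rule emeasure_mono) (auto simp: less_top)
    also have "\<dots> \<le> ennreal (C / lam powr q1)" using lam by (intro maxi_weak) auto
    also have "\<dots> \<le> ennreal e"
    proof (rule ennreal_leI)
      have "lam powr 1 \<le> lam powr q1" using lam q1 by (intro powr_mono) auto
      then have "C / lam powr q1 \<le> C / lam" using lam C_nonneg by (intro divide_left_mono) auto
      also have "\<dots> \<le> e" using lam e by (simp add: field_simps)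
      finally show "C / lam powr q1 \<le> e" .
    qed
    finally show ?thesis .
  qed
  then have "emeasure lborel {\<tau>. maxi \<tau> = \<infinity>} \<le> 0"
    by (intro ennreal_le_epsilon[where y = 0]) (simp only: add_0)
  then have "emeasure lborel {\<tau> \<in> space lborel. \<not> maxi \<tau> < \<infinity>} = 0" by (simp add: less_top[symmetric])
  then show ?thesis by (subst AE_iff_measurable[OF _ refl]) auto
qed

definition mm :: "real \<Rightarrow> real" where "mm \<tau> = enn2real (maxi \<tau>)"

lemma mm_measurable [measurable]: "mm \<in> borel_measurable borel"
  unfolding mm_def by measurable

lemma mm_nonneg: "0 \<le> mm \<tau>" by (simp add: mm_def)

text \<open>Layer-cake sum over the levels \<open>2 ^ k\<close>: by the weak-type bound the level
  \<open>k\<close> contributes a constant times \<open>(2 powr (q - q1)) ^ k\<close>, a convergent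
  geometric series because \<open>q < q1\<close>.\<close>

lemma mm_powr_finite:
  assumes q: "1 \<le> q" "q < q1"
  shows "(\<integral>\<^sup>+\<tau>. ennreal (mm \<tau> powr q) * indicator {0..1} \<tau> \<partial>lborel) < \<infinity>"
proof -
  let ?g = "\<lambda>k \<tau>. ennreal (2 powr (real (Suc k) * q)) * indicator {\<tau>. ennreal (2 ^ k) < maxi \<tau>} \<tau>"
  have pt: "ennreal (mm \<tau> powr q) * indicator {0..1} \<tau> \<le> indicator {0..1} \<tau> + (\<Sum>k. ?g k \<tau>)" for \<tau>
  proof (cases "mm \<tau> \<le> 1")
    case True
    then have "ennreal (mm \<tau> powr q) \<le> ennreal 1" using q mm_nonneg by (intro ennreal_leI powr_le1) auto
    then show ?thesis by (auto simp: indicator_def intro: add_increasing2)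
  next
    case False
    obtain K0 where "mm \<tau> \<le> 2 ^ K0" using real_arch_pow[of 2 "mm \<tau>"] by (auto intro: less_imp_le)
    define K where "K = (LEAST K. mm \<tau> \<le> 2 ^ K)"
    have K: "mm \<tau> \<le> 2 ^ K" unfolding K_def by (rule LeastI[of _ K0]) fact
    have "K \<noteq> 0" using K False by (cases K) auto
    then obtain k where k: "K = Suc k" by (cases K) auto
    have "\<not> mm \<tau> \<le> 2 ^ k" using not_less_Least[of k "\<lambda>K. mm \<tau> \<le> 2 ^ K"] k unfolding K_def[symmetric] by simp
    then have lt: "2 ^ k < mm \<tau>" by simp
    have "ennreal (2 ^ k) < maxi \<tau>"
    proof (cases "maxi \<tau>")
      case (real r)
      then show ?thesis using lt by (simp add: mm_def ennreal_less_iff)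
    next
      case top
      then show ?thesis by simp
    qed
    moreover have "mm \<tau> powr q \<le> 2 powr (real (Suc k) * q)"
    proof -
      have "mm \<tau> powr q \<le> (2 ^ Suc k) powr q" using K k mm_nonneg q by (intro powr_mono2) auto
      also have "\<dots> = 2 powr (real (Suc k) * q)" by (simp only: powr_realpow[symmetric] powr_powr zero_less_numeral)
      finally show ?thesis .
    qed
    ultimately have "ennreal (mm \<tau> powr q) \<le> ?g k \<tau>" by (simp add: ennreal_leI)
    also have "\<dots> = (\<Sum>k\<in>{k}. ?g k \<tau>)" by (subst sum.insert) auto
    also have "\<dots> \<le> (\<Sum>k. ?g k \<tau>)" by (rule sum_le_suminf) auto
    finally have "ennreal (mm \<tau> powr q) \<le> (\<Sum>k. ?g k \<tau>)" .
    then show ?thesis by (auto simp: indicator_def intro: add_increasing)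
  qed
  define r where "r = 2 powr (q - q1)"
  have r: "0 \<le> r" "r < 1" using q by (auto simp: r_def powr_less_one)
  have "(\<integral>\<^sup>+\<tau>. ennreal (mm \<tau> powr q) * indicator {0..1} \<tau> \<partial>lborel) \<le>
      (\<integral>\<^sup>+\<tau>. indicator {0..1} \<tau> + (\<Sum>k. ?g k \<tau>) \<partial>lborel)" by (intro nn_integral_mono pt)
  also have "\<dots> = (\<integral>\<^sup>+\<tau>. indicator {0..1::real} \<tau> \<partial>lborel) + (\<Sum>k. (\<integral>\<^sup>+\<tau>. ?g k \<tau> \<partial>lborel))"
  proof -
    have "{\<tau>. ennreal (2 ^ k) < maxi \<tau>} \<in> sets borel" for k by measurable
    then have g: "?g k \<in> borel_measurable lborel" for k
      by (intro borel_measurable_times_ennreal borel_measurable_const borel_measurable_indicator) auto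
    have "(\<integral>\<^sup>+\<tau>. indicator {0..1} \<tau> + (\<Sum>k. ?g k \<tau>) \<partial>lborel) =
        (\<integral>\<^sup>+\<tau>. indicator {0..1::real} \<tau> \<partial>lborel) + (\<integral>\<^sup>+\<tau>. (\<Sum>k. ?g k \<tau>) \<partial>lborel)"
    proof (rule nn_integral_add[of "indicator {0..1}" lborel "\<lambda>\<tau>. \<Sum>k. ?g k \<tau>"])
      show "(\<lambda>\<tau>. \<Sum>k. ?g k \<tau>) \<in> borel_measurable lborel" by (rule borel_measurable_suminf_order[OF g])
    qed simp
    also have "(\<integral>\<^sup>+\<tau>. (\<Sum>k. ?g k \<tau>) \<partial>lborel) = (\<Sum>k. (\<integral>\<^sup>+\<tau>. ?g k \<tau> \<partial>lborel))"
      by (rule nn_integral_suminf[OF g])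
    finally show ?thesis .
  qed
  also have "\<dots> = 1 + (\<Sum>k. ennreal (2 powr (real (Suc k) * q)) * emeasure lborel {\<tau>. ennreal (2 ^ k) < maxi \<tau>})"
  proof -
    have "(\<integral>\<^sup>+\<tau>. indicator {0..1::real} \<tau> \<partial>lborel) = (1::ennreal)"
      by (subst nn_integral_indicator) auto
    moreover have "(\<integral>\<^sup>+\<tau>. ?g k \<tau> \<partial>lborel) =
        ennreal (2 powr (real (Suc k) * q)) * emeasure lborel {\<tau>. ennreal (2 ^ k) < maxi \<tau>}" for k
      by (rule nn_integral_cmult_indicator) simp
    ultimately show ?thesis by (simp only:)
  qed
  also have "\<dots> \<le> 1 + (\<Sum>k. ennreal (2 powr q * C * r ^ k))"
  proof (intro add_left_mono suminf_le allI)
    fix k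
    have "ennreal (2 powr (real (Suc k) * q)) * emeasure lborel {\<tau>. ennreal (2 ^ k) < maxi \<tau>} \<le>
       ennreal (2 powr (real (Suc k) * q)) * ennreal (C / (2 ^ k) powr q1)"
      by (intro mult_left_mono maxi_weak) auto
    also have "\<dots> = ennreal (2 powr (real (Suc k) * q) * (C / (2 ^ k) powr q1))"
      by (subst ennreal_mult'[symmetric]) auto
    also have "2 powr (real (Suc k) * q) * (C / (2 ^ k) powr q1) = 2 powr q * C * r ^ k"
    proof -
      have "2 powr (real (Suc k) * q) = 2 powr q * 2 powr (real k * q)" by (simp add: distrib_right powr_add)
      moreover have "(2 ^ k) powr q1 = 2 powr (real k * q1)" by (simp only: powr_realpow[symmetric] powr_powr zero_less_numeral)
      moreover have "r ^ k = 2 powr (real k * q) / 2 powr (real k * q1)"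
        by (simp add: r_def powr_realpow[symmetric] powr_powr powr_diff[symmetric] algebra_simps)
      ultimately show ?thesis by simp
    qed
    finally show "ennreal (2 powr (real (Suc k) * q)) * emeasure lborel {\<tau>. ennreal (2 ^ k) < maxi \<tau>} \<le> ennreal (2 powr q * C * r ^ k)" .
  qed auto
  also have "(\<Sum>k. ennreal (2 powr q * C * r ^ k)) = ennreal (\<Sum>k. 2 powr q * C * r ^ k)"
    using r C_nonneg by (intro suminf_ennreal2 summable_mult summable_geometric) auto
  also have "1 + \<dots> < \<infinity>" by simp
  finally show ?thesis .
qed

lemma mm_integrable:
  assumes q: "1 \<le> q" "q < q1"
  shows "set_integrable lborel {0..1} (\<lambda>t. \<bar>mm t\<bar> powr q)" "set_integrable lborel {0..1} mm"
proof -
  show A: "set_integrable lborel {0..1} (\<lambda>t. \<bar>mm t\<bar> powr q)"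
    unfolding set_integrable_def
  proof (rule integrableI_bounded)
    have "(\<integral>\<^sup>+ x. ennreal (norm (indicat_real {0..1} x *\<^sub>R \<bar>mm x\<bar> powr q)) \<partial>lborel) =
       (\<integral>\<^sup>+\<tau>. ennreal (mm \<tau> powr q) * indicator {0..1} \<tau> \<partial>lborel)"
      by (intro nn_integral_cong) (auto simp: indicator_def mm_nonneg)
    then show "(\<integral>\<^sup>+ x. ennreal (norm (indicat_real {0..1} x *\<^sub>R \<bar>mm x\<bar> powr q)) \<partial>lborel) < \<infinity>"
      using mm_powr_finite[OF q] by simp
  qed simp
  have "set_integrable lborel {0..1} (\<lambda>t. 1 + \<bar>mm t\<bar> powr q)"
    by (intro set_integral_add A) (simp add: set_integrable_def)
  then show "set_integrable lborel {0..1} mm"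
    unfolding set_integrable_def
  proof (rule Bochner_Integration.integrable_bound)
    show "AE x in lborel. norm (indicat_real {0..1} x *\<^sub>R mm x) \<le> norm (indicat_real {0..1} x *\<^sub>R (1 + \<bar>mm x\<bar> powr q))"
    proof (rule AE_I2)
      fix x
      have "mm x \<le> 1 + mm x powr q"
      proof (cases "mm x \<le> 1")
        case False
        then have "mm x powr 1 \<le> mm x powr q" using q by (intro powr_mono) auto
        then show ?thesis using False by simp
      qed (use powr_ge_zero[of "mm x" q] in linarith)
      then show "norm (indicat_real {0..1} x *\<^sub>R mm x) \<le> norm (indicat_real {0..1} x *\<^sub>R (1 + \<bar>mm x\<bar> powr q))"
        using mm_nonneg[of x] by (auto simp: indicator_def)
    qed
  qed simp
qed

section \<open>Integration of the maximal function\<close>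

lemma speed_le_mm: "AE \<tau> in lborel. \<tau> \<in> {0..<1} \<longrightarrow> speed n \<tau> \<le> mm \<tau>"
  using maxi_finite
proof eventually_elim
  case (elim \<tau>)
  show ?case
  proof
    assume "\<tau> \<in> {0..<1}"
    then have "ennreal (speed n \<tau>) \<le> maxi \<tau>"
      unfolding maxi_def by (intro SUP_upper2[of n]) auto
    also have "maxi \<tau> = ennreal (mm \<tau>)" using elim by (simp add: mm_def)
    finally show "speed n \<tau> \<le> mm \<tau>" using mm_nonneg by (simp add: ennreal_le_iff)
  qed
qed

text \<open>On its cell the speed of level \<open>n\<close> is the constant
  \<open>2 ^ n * dn n i\<close>, whose integral is \<open>dn n i\<close>, and \<open>mm\<close>
  dominates it almost everywhere.\<close>

lemma dn_le_integral:
  assumes q: "1 \<le> q" "q < q1" and i: "i < 2 ^ n"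
  shows "dn n i \<le> (LBINT \<tau>=real i / 2 ^ n..real (Suc i) / 2 ^ n. mm \<tau>)"
proof -
  let ?a = "real i / 2 ^ n" and ?b = "real (Suc i) / 2 ^ n"
  have ab: "?a \<le> ?b" "0 \<le> ?a" "?b \<le> 1" using cell_le[OF i] by (auto intro: divide_right_mono)
  have int: "set_integrable lborel {?a..?b} mm"
    by (rule set_integrable_subset[OF mm_integrable(2)[OF q]]) (use ab in auto)
  have "dn n i = (LBINT \<tau>:{?a..?b}. 2 ^ n * dn n i)"
  proof -
    have "measure lborel {?a..?b} = 1 / 2 ^ n"
      using ab(1) by (simp add: diff_divide_distrib[symmetric] del: of_nat_Suc)
    then show ?thesis using ab(1) by (simp add: set_integral_const del: of_nat_Suc)
  qed
  also have "\<dots> \<le> (LBINT \<tau>:{?a..?b}. mm \<tau>)"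
  proof (rule set_integral_mono_AE)
    show "set_integrable lborel {?a..?b} (\<lambda>\<tau>. 2 ^ n * dn n i)"
      by (rule borel_integrable_atLeastAtMost') (rule continuous_on_const)
    have "AE \<tau> in lborel. \<tau> \<noteq> ?b" by (rule AE_lborel_singleton)
    with speed_le_mm[of n] show "AE \<tau>\<in>{?a..?b} in lborel. 2 ^ n * dn n i \<le> mm \<tau>"
    proof eventually_elim
      case (elim \<tau>)
      show ?case
      proof
        assume "\<tau> \<in> {?a..?b}"
        then have t: "?a \<le> \<tau>" "\<tau> < ?b" using elim(2) by (auto simp del: of_nat_Suc)
        then have "0 \<le> \<tau>" "\<tau> < 1" using ab by linarith+
        with t have "\<tau> \<in> dcell n i" "\<tau> \<in> {0..<1}" by (auto simp: dcell_def simp del: of_nat_Suc)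
        then show "2 ^ n * dn n i \<le> mm \<tau>" using elim(1) speed_dcell by metis
      qed
    qed
  qed (rule int)
  finally show ?thesis using ab(1) by (simp add: interval_integral_Icc del: of_nat_Suc)
qed

lemma mm_interval_integrable:
  fixes a b :: real
  assumes q: "1 \<le> q" "q < q1" and "0 \<le> a" "a \<le> b" "b \<le> 1"
  shows "interval_lebesgue_integrable lborel (ereal a) (ereal b) mm"
  unfolding interval_integrable_to_infinity_eq interval_lebesgue_integrable_def
  using assms by (auto intro!: set_integrable_subset[OF mm_integrable(2)[OF q]] simp: einterval_def)

lemma interval_add:
  fixes a b c :: real
  assumes q: "1 \<le> q" "q < q1" and "0 \<le> a" "a \<le> b" "b \<le> c" "c \<le> 1"
  shows "(LBINT \<tau>=a..b. mm \<tau>) + (LBINT \<tau>=b..c. mm \<tau>) = (LBINT \<tau>=a..c. mm \<tau>)"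
proof (rule interval_integral_sum)
  have "min (ereal a) (min (ereal b) (ereal c)) = ereal a" "max (ereal a) (max (ereal b) (ereal c)) = ereal c"
    using assms by (auto simp: min_def max_def)
  then show "interval_lebesgue_integrable lborel (min (ereal a) (min (ereal b) (ereal c))) (max (ereal a) (max (ereal b) (ereal c))) mm"
    using mm_interval_integrable[OF q] assms by simp
qed

lemma interval_nonneg:
  fixes a b :: real
  assumes "a \<le> b"
  shows "0 \<le> (LBINT \<tau>=a..b. mm \<tau>)"
  using assms mm_nonneg by (simp add: interval_integral_Icc set_lebesgue_integral_def integral_nonneg_AE)

lemma dyadic_bound:
  assumes q: "1 \<le> q" "q < q1"
  shows "i + l \<le> 2 ^ n \<Longrightarrow> D (real i / 2 ^ n) (real (i + l) / 2 ^ n) \<le> (LBINT \<tau>=real i / 2 ^ n..real (i + l) / 2 ^ n. mm \<tau>)"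
proof (induction l)
  case 0
  have ii: "0 \<le> real i / 2 ^ n" "real i / 2 ^ n \<le> 1" using 0
    by (auto simp: divide_le_eq)
  have "D (real i / 2 ^ n) (real i / 2 ^ n) \<le> e" if "0 < e" for e
    using D_cont[OF that] ii by force
  then have "D (real i / 2 ^ n) (real i / 2 ^ n) \<le> 0" by (rule field_le_epsilon) simp
  then show ?case by simp
next
  case (Suc l)
  have il: "i + l < 2 ^ n" "i + l \<le> 2 ^ n" using Suc.prems by auto
  have a: "0 \<le> real i / 2 ^ n" "real i / 2 ^ n \<le> real (i + l) / 2 ^ n" "real (i + l) / 2 ^ n \<le> real (Suc (i + l)) / 2 ^ n"
    "real (Suc (i + l)) / 2 ^ n \<le> 1"
    using cell_le[OF il(1)] by (auto intro: divide_right_mono)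
  have "D (real i / 2 ^ n) (real (Suc (i + l)) / 2 ^ n) \<le> D (real i / 2 ^ n) (real (i + l) / 2 ^ n) + dn n (i + l)"
    unfolding dn_def by (rule D_tri) (use a in auto)
  also have "\<dots> \<le> (LBINT \<tau>=real i / 2 ^ n..real (i + l) / 2 ^ n. mm \<tau>) + (LBINT \<tau>=real (i + l) / 2 ^ n..real (Suc (i + l)) / 2 ^ n. mm \<tau>)"
    by (intro add_mono Suc.IH il dn_le_integral[OF q])
  also have "\<dots> = (LBINT \<tau>=real i / 2 ^ n..real (Suc (i + l)) / 2 ^ n. mm \<tau>)"
    by (rule interval_add[OF q]) (use a in auto)
  finally show ?case by simp
qed

text \<open>Both end points are moved inwards to dyadic times of a fine level, at a cost
  \<open>e / 2\<close> each by continuity. If \<open>t - s < d\<close> there may be no dyadic points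
  in between, but then continuity alone suffices.\<close>

lemma D_le_integral:
  assumes q: "1 \<le> q" "q < q1" and st: "0 \<le> s" "s \<le> t" "t \<le> 1"
  shows "D s t \<le> (LBINT \<tau>=s..t. mm \<tau>)"
proof (rule field_le_epsilon)
  fix e :: real assume e: "0 < e"
  obtain d where d: "0 < d" "\<And>s t. 0 \<le> s \<Longrightarrow> s \<le> t \<Longrightarrow> t \<le> 1 \<Longrightarrow> t - s < d \<Longrightarrow> D s t \<le> e / 2"
    using D_cont[of "e/2"] e by auto
  show "D s t \<le> (LBINT \<tau>=s..t. mm \<tau>) + e"
  proof (cases "t - s < d")
    case True
    then have "D s t \<le> e / 2" using d st by blast
    then show ?thesis using interval_nonneg[OF st(2)] e by linarith
  next
    case False
    obtain n where n: "2 / d < 2 ^ n" using real_arch_pow[of 2 "2/d"] by auto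
    then have n': "2 / 2 ^ n < d" using d by (simp add: field_simps)
    define i where "i = nat \<lceil>s * 2 ^ n\<rceil>"
    define j where "j = nat \<lfloor>t * 2 ^ n\<rfloor>"
    have i: "s * 2 ^ n \<le> real i" "real i < s * 2 ^ n + 1" unfolding i_def using st by (simp_all add: of_nat_nat) linarith+
    have j: "real j \<le> t * 2 ^ n" "t * 2 ^ n < real j + 1" unfolding j_def using st by (simp_all add: of_nat_nat)
    have "2 \<le> d * 2 ^ n" using n' by (simp add: field_simps)
    also have "\<dots> \<le> (t - s) * 2 ^ n" using False by (intro mult_right_mono) auto
    finally have "2 \<le> (t - s) * 2 ^ n" .
    then have "real i \<le> real j" using i j by (simp add: left_diff_distrib)
    then have ij: "i \<le> j" by simp
    have "t * 2 ^ n \<le> 2 ^ n" using st by simp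
    then have "real j \<le> 2 ^ n" using j(1) by linarith
    then have "real j \<le> real (2 ^ n)" by simp
    then have j2: "j \<le> 2 ^ n" by (simp only: of_nat_le_iff)
    let ?s = "real i / 2 ^ n" and ?t = "real j / 2 ^ n"
    have ord: "s \<le> ?s" "?s \<le> ?t" "?t \<le> t" using i(1) j(1) ij by (auto simp: field_simps divide_right_mono)
    have close: "?s - s < d" "t - ?t < d" using i(2) j(2) n' d by (auto simp: field_simps)
    have "D s t \<le> D s ?s + D ?s t" by (rule D_tri) (use st ord in linarith)+
    also have "D ?s t \<le> D ?s ?t + D ?t t" by (rule D_tri) (use st ord in linarith)+
    also have "D s ?s \<le> e / 2" by (rule d(2)) (use st ord close in linarith)+
    also have "D ?t t \<le> e / 2" by (rule d(2)) (use st ord close in linarith)+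
    also have "D ?s ?t \<le> (LBINT \<tau>=?s..?t. mm \<tau>)" using dyadic_bound[OF q, of i "j - i" n] ij j2 by simp
    also have "(LBINT \<tau>=?s..?t. mm \<tau>) \<le> (LBINT \<tau>=s..t. mm \<tau>)"
    proof -
      have le: "?s \<le> 1" "?t \<le> 1" "0 \<le> ?s" "0 \<le> ?t" "s \<le> ?t" using st ord by linarith+
      note interval_add[OF q st(1) ord(1,2) le(2)] interval_add[OF q st(1) le(5) ord(3) st(3)]
      then show ?thesis using interval_nonneg[OF ord(1)] interval_nonneg[OF ord(3)] by linarith
    qed
    finally show ?thesis by simp
  qed
qed

end

section \<open>The Fubini--Study distance\<close>

text \<open>The right-hand root is the sine of \<open>arccos x\<close>. For
  \<open>x \<ge> 1/2\<close> the mean value theorem for the sine applies with slope at least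
  \<open>1/2\<close>; otherwise the right-hand side is at least 2, which exceeds
  \<open>pi / 2\<close>.\<close>

lemma arccos_le_sqrt:
  assumes "0 \<le> x" "x \<le> 1"
  shows "arccos x \<le> 4 * sqrt (1 - x\<^sup>2)"
proof -
  have s: "sin (arccos x) = sqrt (1 - x\<^sup>2)" using assms by (intro sin_arccos) auto
  have b: "0 \<le> arccos x" "arccos x \<le> pi / 2"
    using assms by (intro arccos_lbound arccos_le_pi2; simp)+
  show ?thesis
  proof (cases "1 / 2 \<le> x")
    case True
    show ?thesis
    proof (cases "arccos x = 0")
      case False
      then have pos: "0 < arccos x" using b by simp
      then obtain z where z: "0 < z" "z < arccos x" "sin (arccos x) - sin 0 = (arccos x - 0) * cos z"
        using MVT2[of 0 "arccos x" sin cos] by (auto intro: DERIV_sin)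
      have "cos (arccos x) \<le> cos z" using z b pi_gt_zero by (intro cos_monotone_0_pi_le) auto
      then have "1 / 2 \<le> cos z" using True assms by simp
      then have "arccos x * (1 / 2) \<le> arccos x * cos z" using b by (intro mult_left_mono)
      then have "arccos x * (1 / 2) \<le> sqrt (1 - x\<^sup>2)" using z(3) s by simp
      then show ?thesis using b by linarith
    qed (use assms in \<open>simp add: power_le_one\<close>)
  next
    case False
    have "x\<^sup>2 \<le> (1/2)\<^sup>2" using False assms by (intro power_mono) auto
    then have "(1/2)\<^sup>2 \<le> 1 - x\<^sup>2" by (simp add: power2_eq_square)
    then have "1 / 2 \<le> sqrt (1 - x\<^sup>2)" by (rule real_le_rsqrt)
    then show ?thesis using b(2) pi_half_less_two by linarith
  qed
qed

lemma mult_cnj_norm: "z * cnj z = of_real ((norm z)\<^sup>2)"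
  by (rule complex_norm_square[symmetric])

definition cip :: "complex^'n::finite \<Rightarrow> complex^'n \<Rightarrow> complex" where
  "cip u v = (\<Sum>i\<in>UNIV. u$i * cnj (v$i))"

lemma Re_cip: "Re (cip u v) = u \<bullet> v"
  by (simp add: cip_def inner_vec_def inner_complex_def)

lemma cip_self: "cip u u = of_real ((norm u)\<^sup>2)"
proof -
  have "cip u u = of_real (\<Sum>i\<in>UNIV. (norm (u$i))\<^sup>2)"
    unfolding cip_def mult_cnj_norm of_real_sum ..
  then show ?thesis by (simp add: norm_vec_def L2_set_def sum_nonneg del: of_real_power of_real_sum)
qed

lemma norm_cip_self: "norm (cip u u) = (norm u)\<^sup>2"
  unfolding cip_self norm_of_real by simp

lemma proj_trace:
  "(\<Sum>i\<in>UNIV. \<Sum>j\<in>UNIV. proj u $ i $ j * proj v $ j $ i) =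
     of_real ((norm (cip u v))\<^sup>2 / ((norm u)\<^sup>2 * (norm v)\<^sup>2))"
proof -
  have "(\<Sum>i\<in>UNIV. \<Sum>j\<in>UNIV. proj u $ i $ j * proj v $ j $ i) =
     (\<Sum>i\<in>UNIV. \<Sum>j\<in>UNIV. (u$i * cnj (v$i)) * cnj (u$j * cnj (v$j))) / of_real ((norm u)\<^sup>2 * (norm v)\<^sup>2)"
    by (simp add: proj_def sum_divide_distrib mult_ac)
  also have "(\<Sum>i\<in>UNIV. \<Sum>j\<in>UNIV. (u$i * cnj (v$i)) * cnj (u$j * cnj (v$j))) = cip u v * cnj (cip u v)"
    by (simp add: cip_def sum_product)
  also have "\<dots> = of_real ((norm (cip u v))\<^sup>2)" by (rule mult_cnj_norm)
  finally show ?thesis by simp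
qed

lemma proj_inner: "proj u \<bullet> proj v = (norm (cip u v))\<^sup>2 / ((norm u)\<^sup>2 * (norm v)\<^sup>2)"
proof -
  have "proj u \<bullet> proj v = Re (\<Sum>i\<in>UNIV. \<Sum>j\<in>UNIV. proj u $ i $ j * cnj (proj v $ i $ j))"
    by (simp add: inner_vec_def inner_complex_def)
  also have "(\<Sum>i\<in>UNIV. \<Sum>j\<in>UNIV. proj u $ i $ j * cnj (proj v $ i $ j)) =
      (\<Sum>i\<in>UNIV. \<Sum>j\<in>UNIV. proj u $ i $ j * proj v $ j $ i)"
    by (simp add: proj_def mult.commute)
  finally show ?thesis unfolding proj_trace by simp
qed

lemma dist_proj:
  assumes "u \<noteq> 0" "v \<noteq> 0"
  shows "(dist (proj u) (proj v))\<^sup>2 = 2 - 2 * ((norm (cip u v))\<^sup>2 / ((norm u)\<^sup>2 * (norm v)\<^sup>2))"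
proof -
  have self: "proj w \<bullet> proj w = 1" if "w \<noteq> 0" for w :: "complex^'n"
    using that by (simp add: proj_inner norm_cip_self power2_eq_square)
  show ?thesis
    using self[OF assms(1)] self[OF assms(2)]
    unfolding proj_inner[of u v, symmetric] dist_norm power2_norm_eq_inner[of "proj u - proj v"]
      inner_diff_left inner_diff_right inner_commute[of "proj v" "proj u"] by simp
qed

text \<open>Obtained by expanding the square of \<open>norm (cip u v - (norm v)^2) \<ge> 0\<close>.
  The left-hand side is the Gram determinant of \<open>u\<close> and \<open>v\<close>.\<close>

lemma cip_defect: "(norm u)\<^sup>2 * (norm v)\<^sup>2 - (norm (cip u v))\<^sup>2 \<le> (norm v)\<^sup>2 * (norm (u - v))\<^sup>2"
proof -
  have "0 \<le> (norm (cip u v - of_real ((norm v)\<^sup>2)))\<^sup>2" by simp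
  also have "(norm (cip u v - of_real ((norm v)\<^sup>2)))\<^sup>2 =
      (norm (cip u v))\<^sup>2 - 2 * (norm v)\<^sup>2 * (u \<bullet> v) + ((norm v)\<^sup>2)\<^sup>2"
    unfolding cmod_power2 Re_cip[symmetric] by (simp add: power2_eq_square algebra_simps)
  finally have "0 \<le> \<dots>" .
  moreover have eq: "(norm (u - v))\<^sup>2 = (norm u)\<^sup>2 - 2 * (u \<bullet> v) + (norm v)\<^sup>2"
    unfolding power2_norm_eq_inner inner_diff_left inner_diff_right inner_commute[of v u] by simp
  then have "(norm v)\<^sup>2 * (norm (u - v))\<^sup>2 = (norm u)\<^sup>2 * (norm v)\<^sup>2 - 2 * (norm v)\<^sup>2 * (u \<bullet> v) + ((norm v)\<^sup>2)\<^sup>2"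
    unfolding eq by (simp add: power2_eq_square algebra_simps)
  ultimately show ?thesis by linarith
qed

lemma dist_proj_le:
  assumes "u \<noteq> 0" "v \<noteq> 0" "0 < c" "c \<le> norm u"
  shows "dist (proj u) (proj v) \<le> 2 * norm (u - v) / c"
proof -
  define N where "N = (norm u)\<^sup>2 * (norm v)\<^sup>2"
  have N: "0 < N" using assms by (simp add: N_def)
  have "(dist (proj u) (proj v))\<^sup>2 = 2 * ((N - (norm (cip u v))\<^sup>2) / N)"
    using N unfolding dist_proj[OF assms(1,2)] N_def[symmetric] by (simp add: diff_divide_distrib)
  also have "\<dots> \<le> 2 * (((norm v)\<^sup>2 * (norm (u - v))\<^sup>2) / N)"
    using N cip_defect[of u v] unfolding N_def by (intro mult_left_mono divide_right_mono) auto
  also have "\<dots> = 2 * ((norm (u - v))\<^sup>2 / (norm u)\<^sup>2)" using assms by (simp add: N_def)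
  also have "\<dots> \<le> 4 * ((norm (u - v))\<^sup>2 / c\<^sup>2)"
  proof -
    have "c\<^sup>2 \<le> (norm u)\<^sup>2" using assms by (intro power_mono) auto
    then have "(norm (u - v))\<^sup>2 / (norm u)\<^sup>2 \<le> (norm (u - v))\<^sup>2 / c\<^sup>2"
      by (rule divide_left_mono) (use assms in \<open>simp_all add: zero_less_mult_iff\<close>)
    moreover have "0 \<le> (norm (u - v))\<^sup>2 / c\<^sup>2" by simp
    ultimately show ?thesis by linarith
  qed
  also have "\<dots> = (2 * norm (u - v) / c)\<^sup>2" unfolding power_divide power_mult_distrib by simp
  finally show ?thesis by (rule power2_le_imp_le) (use assms in simp)
qed

text \<open>With \<open>x\<close> the cosine of the angle between the lines, the squared distance of
  the projectors is \<open>2 - 2 * x^2\<close>, so the chordal distance controls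
  \<open>arccos x\<close> by the preceding inequality. Matchings can thus be measured in the
  Euclidean norm of matrices.\<close>

lemma fs_dist_le:
  assumes "u \<noteq> 0" "v \<noteq> 0"
  shows "0 \<le> fs_dist (proj u) (proj v)" "fs_dist (proj u) (proj v) \<le> 4 * dist (proj u) (proj v)"
proof -
  define x where "x = norm (cip u v) / (norm u * norm v)"
  have x2: "x\<^sup>2 = (norm (cip u v))\<^sup>2 / ((norm u)\<^sup>2 * (norm v)\<^sup>2)"
    by (simp add: x_def power_divide power_mult_distrib)
  have x0: "0 \<le> x" by (simp add: x_def)
  have d: "(dist (proj u) (proj v))\<^sup>2 = 2 - 2 * x\<^sup>2" using dist_proj[OF assms] x2 by simp
  have "x\<^sup>2 \<le> 1" using d zero_le_power2[of "dist (proj u) (proj v)"] by linarith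
  then have x1: "x \<le> 1" using x0 power2_le_imp_le[of x 1] by simp
  have fs: "fs_dist (proj u) (proj v) = arccos x"
    unfolding fs_dist_def proj_trace using x0 by (simp add: x2[symmetric])
  show "0 \<le> fs_dist (proj u) (proj v)" unfolding fs using x0 x1 by (intro arccos_lbound) auto
  have "sqrt (1 - x\<^sup>2) \<le> dist (proj u) (proj v)"
    using d \<open>x\<^sup>2 \<le> 1\<close> by (intro real_le_lsqrt) auto
  then show "fs_dist (proj u) (proj v) \<le> 4 * dist (proj u) (proj v)"
    unfolding fs using arccos_le_sqrt[OF x0 x1] by linarith
qed

lemma proj_scale: "c \<noteq> 0 \<Longrightarrow> proj (c *s u) = proj u"
proof -
  assume c: "c \<noteq> 0"
  have "norm (c *s u) = norm c * norm u"
  proof -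
    have "(norm (c *s u))\<^sup>2 = (norm c * norm u)\<^sup>2"
      unfolding norm_vec_def L2_set_def power_mult_distrib
      by (simp add: sum_nonneg norm_mult power_mult_distrib sum_distrib_left)
    then show ?thesis by (metis norm_ge_zero mult_nonneg_nonneg power2_eq_iff_nonneg)
  qed
  then have "(c *s u)$i * cnj ((c *s u)$j) / of_real ((norm (c *s u))\<^sup>2) =
      (c * cnj c) * (u$i * cnj (u$j)) / (of_real ((norm c)\<^sup>2) * of_real ((norm u)\<^sup>2))" for i j
    by (simp add: power_mult_distrib mult_ac)
  then show ?thesis using c unfolding mult_cnj_norm by (simp add: proj_def vec_eq_iff)
qed

lemma norm_proj_le: "norm (proj u) \<le> 1"
proof (cases "u = 0")
  case True
  then show ?thesis by (simp add: proj_def norm_vec_def L2_set_def)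
next
  case False
  have "(norm (proj u))\<^sup>2 = 1"
    using False by (simp only: power2_norm_eq_inner[of "proj u"] proj_inner norm_cip_self) (simp add: power2_eq_square)
  then show ?thesis unfolding power2_eq_1_iff by auto
qed

section \<open>Restriction of a form to a line\<close>

lemma finite_monoms: "finite (monoms d :: ('n::finite \<Rightarrow> nat) set)"
proof -
  have "monoms d \<subseteq> PiE UNIV (\<lambda>_::'n. {..d})"
    unfolding monoms_def by (auto intro!: member_le_sum)
  then show ?thesis by (rule finite_subset) (auto intro: finite_PiE)
qed

definition lpoly :: "nat \<Rightarrow> (('n::finite \<Rightarrow> nat) \<Rightarrow> complex) \<Rightarrow> complex^'n \<Rightarrow> complex^'n \<Rightarrow> complex poly" where
  "lpoly d c a b = (\<Sum>\<alpha>\<in>monoms d. smult (c \<alpha>) (\<Prod>i\<in>UNIV. [:b$i, a$i:] ^ \<alpha> i))"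

lemma poly_lpoly: "poly (lpoly d c a b) s = hpoly d c (s *s a + b)"
  by (simp add: lpoly_def hpoly_def poly_sum poly_prod add.commute)

lemma line_poly_eq: "line_poly d c a b = lpoly d c a b"
  unfolding line_poly_def
proof (rule the_equality)
  fix h assume "\<forall>s. poly h s = hpoly d c (s *s a + b)"
  then have "poly h = poly (lpoly d c a b)" by (auto simp: poly_lpoly)
  then show "h = lpoly d c a b" by (simp add: poly_eq_poly_eq_iff)
qed (simp add: poly_lpoly)

lemma hpoly_scale: "hpoly d c (k *s z) = k ^ d * hpoly d c z"
  unfolding hpoly_def sum_distrib_left
proof (rule sum.cong[OF refl])
  fix \<alpha> :: "'a \<Rightarrow> nat" assume "\<alpha> \<in> monoms d"
  then have d: "(\<Sum>i\<in>UNIV. \<alpha> i) = d" by (simp add: monoms_def)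
  have "(\<Prod>i\<in>UNIV. ((k *s z) $ i) ^ \<alpha> i) = (\<Prod>i\<in>UNIV. k ^ \<alpha> i) * (\<Prod>i\<in>UNIV. (z $ i) ^ \<alpha> i)"
    by (simp add: power_mult_distrib prod.distrib)
  also have "(\<Prod>i\<in>UNIV. k ^ \<alpha> i) = k ^ d" by (simp add: d flip: power_sum)
  finally show "c \<alpha> * (\<Prod>i\<in>UNIV. ((k *s z) $ i) ^ \<alpha> i) = k ^ d * (c \<alpha> * (\<Prod>i\<in>UNIV. (z $ i) ^ \<alpha> i))" by simp
qed

lemma degree_lpoly: "degree (lpoly d c a b) \<le> d"
  unfolding lpoly_def
proof (rule degree_sum_le[OF finite_monoms])
  fix \<alpha> :: "'a \<Rightarrow> nat" assume "\<alpha> \<in> monoms d"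
  then have d: "(\<Sum>i\<in>UNIV. \<alpha> i) = d" by (simp add: monoms_def)
  have "degree (\<Prod>i\<in>UNIV. [:b$i, a$i:] ^ \<alpha> i) \<le> (\<Sum>i\<in>UNIV. degree ([:b$i, a$i:] ^ \<alpha> i))"
    using degree_prod_sum_le[of UNIV "\<lambda>i. [:b$i, a$i:] ^ \<alpha> i"] by (simp add: o_def)
  also have "\<dots> \<le> (\<Sum>i\<in>UNIV. \<alpha> i)"
  proof (rule sum_mono)
    fix i
    have "degree ([:b$i, a$i:] ^ \<alpha> i) \<le> degree [:b$i, a$i:] * \<alpha> i" by (rule degree_power_le)
    also have "\<dots> \<le> 1 * \<alpha> i" by (intro mult_right_mono) auto
    finally show "degree ([:b$i, a$i:] ^ \<alpha> i) \<le> \<alpha> i" by simp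
  qed
  finally show "degree (smult (c \<alpha>) (\<Prod>i\<in>UNIV. [:b$i, a$i:] ^ \<alpha> i)) \<le> d"
    using d by (intro order_trans[OF degree_smult_le]) simp
qed

lemma hpoly_line:
  assumes "y \<noteq> 0"
  shows "hpoly d c (x *s a + y *s b) = y ^ d * poly (lpoly d c a b) (x / y)"
proof -
  have "x *s a + y *s b = y *s ((x / y) *s a + b)" using assms by (simp add: vec_eq_iff field_simps)
  then show ?thesis by (simp only: hpoly_scale poly_lpoly)
qed

text \<open>Exchanging \<open>a\<close> and \<open>b\<close> reverses the coefficients at level
  \<open>d\<close>, so the top coefficient is the constant one of the reversed polynomial, that is,
  the value of the form at the point at infinity \<open>a\<close>.\<close>

lemma coeff_lpoly_top: "coeff (lpoly d c a b) d = hpoly d c a"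
proof -
  let ?h = "lpoly d c a b" and ?r = "lpoly d c b a"
  define r' where "r' = (\<Sum>k\<le>d. monom (coeff ?h k) (d - k))"
  have "poly ([:0, 1:] * (?r - r')) y = 0" for y
  proof (cases "y = 0")
    case False
    have "poly ?r y = hpoly d c (1 *s a + y *s b)" by (simp add: poly_lpoly add.commute)
    also have "\<dots> = y ^ d * poly ?h (1 / y)" by (rule hpoly_line[OF False])
    also have "poly ?h (1 / y) = (\<Sum>k\<le>d. coeff ?h k * (1 / y) ^ k)"
      unfolding poly_altdef using degree_lpoly[of d c a b]
      by (intro sum.mono_neutral_left) (auto simp: coeff_eq_0)
    also have "y ^ d * \<dots> = (\<Sum>k\<le>d. coeff ?h k * y ^ (d - k))"
      using False by (simp add: sum_distrib_left power_diff power_divide mult_ac)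
    also have "\<dots> = poly r' y" by (simp add: r'_def poly_sum poly_monom)
    finally show ?thesis by simp
  qed simp
  then have "[:0, 1:] * (?r - r') = 0" using poly_all_0_iff_0 by blast
  then have "?r = r'" by (simp del: mult_pCons_left)
  then have "poly ?r 0 = poly r' 0" by simp
  moreover have "poly ?r 0 = hpoly d c a" by (simp add: poly_lpoly)
  moreover have "poly r' 0 = coeff ?h d"
  proof -
    have "poly r' 0 = (\<Sum>k\<le>d. if k = d then coeff ?h k else 0)"
      unfolding r'_def poly_sum poly_monom by (intro sum.cong) (auto simp: power_0_left)
    then show ?thesis by simp
  qed
  ultimately show ?thesis by simp
qed

lemma lpoly_roots:
  assumes "hpoly d c a \<noteq> 0"
  shows "lpoly d c a b = smult (hpoly d c a) (rpoly (proots (lpoly d c a b)))"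
    and "size (proots (lpoly d c a b)) = d" and "lpoly d c a b \<noteq> 0" and "degree (lpoly d c a b) = d"
proof -
  have deg: "degree (lpoly d c a b) = d"
    using degree_lpoly[of d c a b] coeff_lpoly_top[of d c a b] assms
    by (metis coeff_eq_0 le_neq_implies_less)
  then show "degree (lpoly d c a b) = d" .
  have "lead_coeff (lpoly d c a b) = hpoly d c a" using deg coeff_lpoly_top[of d c a b] by simp
  then show "lpoly d c a b = smult (hpoly d c a) (rpoly (proots (lpoly d c a b)))"
    using smult_rpoly_proots[of "lpoly d c a b"] by simp
  show "size (proots (lpoly d c a b)) = d" using deg by (simp add: size_proots_complex)
  show "lpoly d c a b \<noteq> 0" using coeff_lpoly_top[of d c a b] assms by auto
qed

lemma prod_mset_smult_linear:
  "(\<Prod>r\<in>#R. [:- (p r), q r:]) = smult (\<Prod>r\<in>#R. q r) (rpoly (image_mset (\<lambda>r. p r / q r) R))"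
  if "\<And>r. r \<in># R \<Longrightarrow> q r \<noteq> (0::complex)"
  using that
proof (induction R)
  case (add r R)
  have "[:- (p r), q r:] = smult (q r) [:- (p r / q r), 1:]" using add.prems by simp
  then show ?case using add
    by (simp only: image_mset_add_mset prod_mset.add_mset rpoly_add_mset mult_smult_left mult_smult_right smult_smult)
      (simp add: mult.commute)
qed simp

lemma hpoly_factored:
  assumes "hpoly d c a \<noteq> 0"
  shows "hpoly d c (x *s a + y *s b) = hpoly d c a * (\<Prod>r\<in>#proots (lpoly d c a b). x - r * y)"
proof (cases "y = 0")
  case True
  then show ?thesis using lpoly_roots(2)[OF assms, of b] by (simp add: hpoly_scale)
next
  case False
  let ?R = "proots (lpoly d c a b)"
  have pr: "poly (rpoly R) z = (\<Prod>r\<in>#R. z - r)" for R z by (induction R) (auto simp: algebra_simps)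
  have "hpoly d c (x *s a + y *s b) = y ^ d * (hpoly d c a * (\<Prod>r\<in>#?R. x / y - r))"
    unfolding hpoly_line[OF False] by (subst lpoly_roots(1)[OF assms]) (simp add: pr)
  also have "y ^ d = (\<Prod>r\<in>#?R. y)" using lpoly_roots(2)[OF assms, of b] by simp
  also have "(\<Prod>r\<in>#?R. y) * (hpoly d c a * (\<Prod>r\<in>#?R. x / y - r)) = hpoly d c a * (\<Prod>r\<in>#?R. y * (x / y - r))"
    by (simp add: prod_mset.distrib)
  also have "(\<lambda>r. y * (x / y - r)) = (\<lambda>r. x - r * y)" using False by (auto simp: right_diff_distrib)
  finally show ?thesis .
qed

text \<open>The roots in two affine charts of one line correspond under a Moebius map, and
  corresponding parameters give proportional vectors. No root reaches infinity because neither
  \<open>a\<close> nor \<open>a'\<close> is a zero.\<close>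

lemma chart_change:
  assumes pa: "hpoly d c a \<noteq> 0" and pa': "hpoly d c a' \<noteq> 0"
    and a': "a' = \<alpha> *s a + \<beta> *s b" and b': "b' = \<gamma> *s a + \<delta> *s b" and ind: "lin_indep2 a' b'"
  shows "image_mset (\<lambda>r. proj (r *s a + b)) (proots (lpoly d c a b)) =
    image_mset (\<lambda>s. proj (s *s a' + b')) (proots (lpoly d c a' b'))"
proof -
  let ?R = "proots (lpoly d c a b)"
  have "hpoly d c a' = hpoly d c a * (\<Prod>r\<in>#?R. \<alpha> - r * \<beta>)"
    unfolding a' by (rule hpoly_factored[OF pa])
  then have nz: "\<alpha> - r * \<beta> \<noteq> 0" if "r \<in># ?R" for r
    using pa' that by (auto simp: prod_mset_zero_iff)
  \<comment> \<open>The solution \<open>s\<close> of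
    \<open>s * \<alpha> + \<gamma> = r * (s * \<beta> + \<delta>)\<close>, the condition that the
    new parameter \<open>s\<close> names the old point \<open>r\<close>.\<close>
  define \<phi> where "\<phi> r = (r * \<delta> - \<gamma>) / (\<alpha> - r * \<beta>)" for r
  have "lpoly d c a' b' = smult (hpoly d c a) (\<Prod>r\<in>#?R. [:- (r * \<delta> - \<gamma>), \<alpha> - r * \<beta>:])"
  proof -
    have "poly (lpoly d c a' b') s = poly (smult (hpoly d c a) (\<Prod>r\<in>#?R. [:- (r * \<delta> - \<gamma>), \<alpha> - r * \<beta>:])) s" for s
    proof -
      have "s *s a' + b' = (s * \<alpha> + \<gamma>) *s a + (s * \<beta> + \<delta>) *s b"
        unfolding a' b' by (simp add: vec_eq_iff algebra_simps)
      then have "poly (lpoly d c a' b') s = hpoly d c a * (\<Prod>r\<in>#?R. (s * \<alpha> + \<gamma>) - r * (s * \<beta> + \<delta>))"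
        by (simp only: poly_lpoly hpoly_factored[OF pa])
      moreover have "poly (\<Prod>r\<in>#R. [:- (r * \<delta> - \<gamma>), \<alpha> - r * \<beta>:]) s = (\<Prod>r\<in>#R. (s * \<alpha> + \<gamma>) - r * (s * \<beta> + \<delta>))" for R
        by (induction R) (auto simp: algebra_simps)
      ultimately show ?thesis by simp
    qed
    then show ?thesis by (simp add: poly_eq_poly_eq_iff[symmetric] fun_eq_iff)
  qed
  also have "\<dots> = smult (hpoly d c a * (\<Prod>r\<in>#?R. \<alpha> - r * \<beta>)) (rpoly (image_mset \<phi> ?R))"
    by (subst prod_mset_smult_linear[OF nz]) (auto simp: \<phi>_def[abs_def])
  finally have fac: "lpoly d c a' b' = smult (hpoly d c a * (\<Prod>r\<in>#?R. \<alpha> - r * \<beta>)) (rpoly (image_mset \<phi> ?R))" .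
  have "proots (lpoly d c a' b') = image_mset \<phi> ?R"
  proof -
    have "(\<Prod>r\<in>#?R. \<alpha> - r * \<beta>) \<noteq> 0" using nz by (auto simp: prod_mset_zero_iff)
    then have "hpoly d c a * (\<Prod>r\<in>#?R. \<alpha> - r * \<beta>) \<noteq> 0" using pa by (rule no_zero_divisors[rotated])
    from proots_smult[OF this, of "rpoly (image_mset \<phi> ?R)"] show ?thesis
      unfolding fac proots_rpoly .
  qed
  moreover have "proj (\<phi> r *s a' + b') = proj (r *s a + b)" if r: "r \<in># ?R" for r
  proof -
    define k where "k = \<phi> r * \<beta> + \<delta>"
    have "\<phi> r * (\<alpha> - r * \<beta>) = r * \<delta> - \<gamma>" using nz[OF r] by (simp add: \<phi>_def)
    then have "\<phi> r * \<alpha> + \<gamma> = r * k" by (simp add: k_def algebra_simps)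
    moreover have "\<phi> r *s a' + b' = (\<phi> r * \<alpha> + \<gamma>) *s a + k *s b"
      unfolding a' b' k_def by (simp add: vec_eq_iff algebra_simps)
    ultimately have eq: "\<phi> r *s a' + b' = k *s (r *s a + b)" by (simp add: vec_eq_iff algebra_simps)
    have "k \<noteq> 0"
    proof
      assume "k = 0"
      then have "\<phi> r *s a' + 1 *s b' = 0" using eq by simp
      then show False using ind unfolding lin_indep2_def by (metis zero_neq_one)
    qed
    then show ?thesis unfolding eq by (rule proj_scale)
  qed
  ultimately show ?thesis by (auto simp: multiset.map_comp o_def intro!: image_mset_cong)
qed

section \<open>Outside the Fano discriminant no line lies on the hypersurface\<close>

definition gradh :: "nat \<Rightarrow> (('n::finite \<Rightarrow> nat) \<Rightarrow> complex) \<Rightarrow> complex^'n \<Rightarrow> 'n \<Rightarrow> complex" where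
  "gradh d c x i = (\<Sum>\<alpha>\<in>monoms d. c \<alpha> * (of_nat (\<alpha> i) * (x$i) ^ (\<alpha> i - 1) * (\<Prod>j\<in>UNIV - {i}. (x$j) ^ \<alpha> j)))"

lemma dir_deriv_eq: "dir_deriv d c x w = (\<Sum>i\<in>UNIV. w$i * gradh d c x i)"
proof -
  have lin: "((\<lambda>e. (x$i + e * w$i) ^ k) has_field_derivative (of_nat k * (x$i) ^ (k - 1) * w$i)) (at 0)" for i k
    by (rule derivative_eq_intros refl | simp)+
  have "((\<lambda>e. \<Prod>i\<in>UNIV. (x$i + e * w$i) ^ \<alpha> i) has_field_derivative
      (\<Sum>i\<in>UNIV. (of_nat (\<alpha> i) * (x$i) ^ (\<alpha> i - 1) * w$i) * (\<Prod>j\<in>UNIV - {i}. (x$j + 0 * w$j) ^ \<alpha> j))) (at 0)" for \<alpha>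
    by (rule has_field_derivative_prod) (rule lin)
  then have "((\<lambda>e. \<Sum>\<alpha>\<in>monoms d. c \<alpha> * (\<Prod>i\<in>UNIV. (x$i + e * w$i) ^ \<alpha> i)) has_field_derivative
      (\<Sum>\<alpha>\<in>monoms d. c \<alpha> * (\<Sum>i\<in>UNIV. (of_nat (\<alpha> i) * (x$i) ^ (\<alpha> i - 1) * w$i) * (\<Prod>j\<in>UNIV - {i}. (x$j + 0 * w$j) ^ \<alpha> j)))) (at 0)"
    by (intro DERIV_sum DERIV_cmult)
  then have "((\<lambda>e. hpoly d c (x + e *s w)) has_field_derivative
      (\<Sum>\<alpha>\<in>monoms d. c \<alpha> * (\<Sum>i\<in>UNIV. (of_nat (\<alpha> i) * (x$i) ^ (\<alpha> i - 1) * w$i) * (\<Prod>j\<in>UNIV - {i}. (x$j) ^ \<alpha> j)))) (at 0)"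
    by (simp add: hpoly_def)
  then have "dir_deriv d c x w = (\<Sum>\<alpha>\<in>monoms d. c \<alpha> * (\<Sum>i\<in>UNIV. (of_nat (\<alpha> i) * (x$i) ^ (\<alpha> i - 1) * w$i) * (\<Prod>j\<in>UNIV - {i}. (x$j) ^ \<alpha> j)))"
    unfolding dir_deriv_def by (rule DERIV_imp_deriv)
  also have "\<dots> = (\<Sum>i\<in>UNIV. w$i * gradh d c x i)"
    unfolding gradh_def sum_distrib_left by (subst sum.swap) (simp add: mult_ac)
  finally show ?thesis .
qed

lemma dir_deriv_add: "dir_deriv d c x (v + w) = dir_deriv d c x v + dir_deriv d c x w"
  by (simp add: dir_deriv_eq distrib_right sum.distrib)

lemma dir_deriv_scale: "dir_deriv d c x (k *s w) = k * dir_deriv d c x w"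
  by (simp add: dir_deriv_eq sum_distrib_left mult.assoc)

lemma dir_deriv_sum: "dir_deriv d c x (\<Sum>k\<in>S. f k) = (\<Sum>k\<in>S. dir_deriv d c x (f k))"
  by (induction S rule: infinite_finite_induct) (auto simp: dir_deriv_add, auto simp: dir_deriv_eq)

lemma exists_linear_relation:
  fixes f :: "nat \<Rightarrow> complex^'m"
  assumes "CARD('m) < N"
  shows "\<exists>u. (\<exists>k<N. u k \<noteq> 0) \<and> (\<Sum>k<N. u k *s f k) = 0"
proof (cases "inj_on f {..<N}")
  case True
  have "vec.dependent (f ` {..<N})"
  proof (rule ccontr)
    assume "\<not> vec.dependent (f ` {..<N})"
    then have "card (f ` {..<N}) \<le> vec.dim (UNIV :: (complex^'m) set)"
      by (intro vec.independent_card_le_dim) auto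
    then show False using assms True unfolding vec_dim_card by (simp add: card_image)
  qed
  then obtain g where g: "\<exists>v\<in>f ` {..<N}. g v \<noteq> 0" "(\<Sum>v\<in>f ` {..<N}. g v *s v) = 0"
    by (subst (asm) vec.dependent_finite) auto
  show ?thesis
    by (rule exI[of _ "g \<circ> f"]) (use g True in \<open>auto simp: sum.reindex\<close>)
next
  case False
  then obtain i j where ij: "i < N" "j < N" "i \<noteq> j" "f i = f j" by (auto simp: inj_on_def)
  define u where "u k = (if k = i then 1 else if k = j then -1 else (0::complex))" for k
  have "(\<Sum>k<N. u k *s f k) = (\<Sum>k\<in>{i, j}. u k *s f k)"
    by (rule sum.mono_neutral_right) (use ij in \<open>auto simp: u_def\<close>)
  also have "\<dots> = 0" using ij by (simp add: u_def)
  finally show ?thesis using ij(1) by (intro exI[of _ u]) (auto simp: u_def)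
qed

text \<open>Dimension count. Along a contained line, transversality would give \<open>d + 1\<close>
  motions (u, v) realising all monomials, and the four motions of the frame within its own line act
  by 0. These are \<open>d + 5\<close> vectors in dimension \<open>2 * CARD('n) < d + 5\<close>, yet
  they would be linearly independent.\<close>

lemma no_line_if_not_fano:
  fixes c :: "('n::finite \<Rightarrow> nat) \<Rightarrow> complex" and a b :: "complex^'n"
  assumes d: "int d > 2 * (int CARD('n) - 1) - 3" and nf: "\<not> fano_disc d c" and ind: "lin_indep2 a b"
  shows "\<exists>s t. hpoly d c (s *s a + t *s b) \<noteq> 0"
proof (rule ccontr)
  assume "\<not> ?thesis"
  then have zero: "hpoly d c (s *s a + t *s b) = 0" for s t by blast
  have "\<forall>k\<le>d. \<exists>u v. \<forall>s t. dir_deriv d c (s *s a + t *s b) (s *s u + t *s v) = s ^ k * t ^ (d - k)"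
    using nf ind zero unfolding fano_disc_def by blast
  then obtain u v where uv: "\<And>k s t. k \<le> d \<Longrightarrow> dir_deriv d c (s *s a + t *s b) (s *s u k + t *s v k) = s ^ k * t ^ (d - k)"
    by metis
  have tang: "dir_deriv d c (s *s a + t *s b) (p *s a + q *s b) = 0" for s t p q
  proof -
    have "hpoly d c (s *s a + t *s b + e *s (p *s a + q *s b)) = 0" for e
      using zero[of "s + e * p" "t + e * q"] by (simp add: vec_eq_iff algebra_simps hpoly_def)
    then show ?thesis by (simp add: dir_deriv_def)
  qed
  \<comment> \<open>The indices \<open>d + 1\<close> to \<open>d + 4\<close> stand for the motions
    (a, 0), (b, 0), (0, a), (0, b), which leave the line in place.\<close>
  define u' where "u' k = (if k \<le> d then u k else if k = d + 1 then a else if k = d + 2 then b else 0)" for k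
  define v' where "v' k = (if k \<le> d then v k else if k = d + 3 then a else if k = d + 4 then b else 0)" for k
  define f :: "nat \<Rightarrow> complex^('n + 'n)" where "f k = (\<chi> i. case i of Inl i \<Rightarrow> u' k $ i | Inr i \<Rightarrow> v' k $ i)" for k
  have "CARD('n + 'n) < d + 5" using d by simp
  from exists_linear_relation[OF this, of f] obtain l where l: "\<exists>k<d + 5. l k \<noteq> 0" "(\<Sum>k<d+5. l k *s f k) = 0" by blast
  have comp: "(\<Sum>k<d+5. l k * f k $ i) = 0" for i
    using l(2) by (simp add: vec_eq_iff)
  have U: "(\<Sum>k<d+5. l k *s u' k) = 0" unfolding vec_eq_iff using comp[of "Inl _"] by (simp add: f_def)
  have V: "(\<Sum>k<d+5. l k *s v' k) = 0" unfolding vec_eq_iff using comp[of "Inr _"] by (simp add: f_def)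
  have split: "{..<d+5} = {..d} \<union> {d+1, d+2, d+3, d+4}" by auto
  have U': "(\<Sum>k\<le>d. l k *s u k) + (l (d+1) *s a + l (d+2) *s b) = 0"
    using U unfolding split by (subst (asm) sum.union_disjoint) (auto simp: u'_def)
  have V': "(\<Sum>k\<le>d. l k *s v k) + (l (d+3) *s a + l (d+4) *s b) = 0"
    using V unfolding split by (subst (asm) sum.union_disjoint) (auto simp: v'_def)
  have poly0: "(\<Sum>k\<le>d. l k * s ^ k) = 0" for s
  proof -
    \<comment> \<open>The derivative at \<open>s a + b\<close> turns the relation into a polynomial
      in \<open>s\<close>; the four extra motions contribute directions tangent to the line, along
      which the form vanishes.\<close>
    let ?D = "dir_deriv d c (s *s a + 1 *s b)"
    have "(\<Sum>k\<le>d. l k * s ^ k) = (\<Sum>k\<le>d. l k * ?D (s *s u k + 1 *s v k))"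
      using uv[of _ s 1] by (intro sum.cong) auto
    also have "\<dots> = ?D (\<Sum>k\<le>d. l k *s (s *s u k + 1 *s v k))"
      by (simp only: dir_deriv_sum dir_deriv_scale)
    also have "(\<Sum>k\<le>d. l k *s (s *s u k + 1 *s v k)) = s *s (\<Sum>k\<le>d. l k *s u k) + (\<Sum>k\<le>d. l k *s v k)"
      by (simp add: vec_eq_iff sum_distrib_left sum.distrib algebra_simps)
    also have "\<dots> = (- (s * l (d+1) + l (d+3))) *s a + (- (s * l (d+2) + l (d+4))) *s b"
    proof -
      have eqs: "(\<Sum>k\<le>d. l k *s u k) = - (l (d+1) *s a + l (d+2) *s b)" "(\<Sum>k\<le>d. l k *s v k) = - (l (d+3) *s a + l (d+4) *s b)"
        by (rule eq_neg_iff_add_eq_0[THEN iffD2, OF U'], rule eq_neg_iff_add_eq_0[THEN iffD2, OF V'])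
      show ?thesis unfolding eqs by (simp add: vec_eq_iff algebra_simps)
    qed
    also have "?D \<dots> = 0" by (rule tang)
    finally show ?thesis .
  qed
  have lz: "l k = 0" if "k \<le> d" for k
  proof -
    define p where "p = (\<Sum>k\<le>d. monom (l k) k)"
    have "poly p s = 0" for s using poly0[of s] by (simp add: p_def poly_sum poly_monom)
    then have "p = 0" using poly_all_0_iff_0 by blast
    then have "coeff p k = 0" by simp
    then show ?thesis using that by (simp add: p_def coeff_sum)
  qed
  have "l (d+1) = 0 \<and> l (d+2) = 0" using U' lz ind unfolding lin_indep2_def by simp
  moreover have "l (d+3) = 0 \<and> l (d+4) = 0" using V' lz ind unfolding lin_indep2_def by simp
  ultimately have "l k = 0" if "k < d + 5" for k
    using that lz split by (metis Un_iff atMost_iff insert_iff lessThan_iff singletonD)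
  then show False using l(1) by blast
qed

text \<open>A binary form of degree \<open>d\<close> that vanishes at \<open>d + 1\<close> points of
  an affine chart is zero. This provides the finite family of charts
  \<open>k \<le> d\<close>.\<close>

lemma exists_nonzero_point:
  fixes c :: "('n::finite \<Rightarrow> nat) \<Rightarrow> complex" and a b :: "complex^'n"
  assumes "hpoly d c (s *s a + t *s b) \<noteq> 0"
  shows "\<exists>k\<le>d. hpoly d c (a + of_nat k *s b) \<noteq> 0"
proof (rule ccontr)
  assume "\<not> ?thesis"
  then have z: "poly (lpoly d c b a) (of_nat k) = 0" if "k \<le> d" for k
    using that by (auto simp: poly_lpoly add.commute)
  have "lpoly d c b a = 0"
  proof (rule ccontr)
    assume nz: "lpoly d c b a \<noteq> 0"
    have "(of_nat ` {..d} :: complex set) \<subseteq> {x. poly (lpoly d c b a) x = 0}" using z by auto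
    then have "card (of_nat ` {..d} :: complex set) \<le> card {x. poly (lpoly d c b a) x = 0}"
      using poly_roots_finite[OF nz] by (rule card_mono[rotated])
    also have "\<dots> \<le> degree (lpoly d c b a)" by (rule card_poly_roots_bound[OF nz])
    also have "\<dots> \<le> d" by (rule degree_lpoly)
    finally show False by (simp add: card_image inj_on_def)
  qed
  then have z: "hpoly d c (s *s a + t *s b) = 0"
    if "hpoly d c (s *s a + t *s b) = (if s = 0 then t ^ d * coeff (lpoly d c b a) d else s ^ d * poly (lpoly d c b a) (t / s))"
    unfolding that by simp
  have "hpoly d c (s *s a + t *s b) = (if s = 0 then t ^ d * coeff (lpoly d c b a) d else s ^ d * poly (lpoly d c b a) (t / s))"
    using hpoly_line[of s d c t b a] by (simp add: coeff_lpoly_top hpoly_scale add.commute)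
  from z[OF this] show False using assms by simp
qed

section \<open>Orthonormal frames and a lower bound uniform over lines and times\<close>

lemma cip_le: "norm (cip u v) \<le> norm u * norm v"
proof (cases "u = 0 \<or> v = 0")
  case True
  then show ?thesis by (auto simp: cip_def)
next
  case False
  then have uv: "u \<noteq> 0" "v \<noteq> 0" by auto
  have "(norm (cip u v))\<^sup>2 / ((norm u)\<^sup>2 * (norm v)\<^sup>2) \<le> 1"
    using dist_proj[OF uv] zero_le_power2[of "dist (proj u) (proj v)"] by linarith
  then have "(norm (cip u v))\<^sup>2 \<le> (norm u * norm v)\<^sup>2"
    using uv by (simp add: pos_divide_le_eq power_mult_distrib)
  then show ?thesis by (rule power2_le_imp_le) simp
qed

definition orthon :: "complex^'n::finite \<Rightarrow> complex^'n \<Rightarrow> bool" where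
  "orthon a b \<longleftrightarrow> norm a = 1 \<and> norm b = 1 \<and> cip a b = 0"

lemma cip_add_scale: "cip (x *s a + y *s b) e = x * cip a e + y * cip b e"
  by (simp add: cip_def distrib_right sum.distrib sum_distrib_left mult.assoc)

lemma cip_swap: "cip b a = cnj (cip a b)"
  by (simp add: cip_def mult.commute)

lemma orthon_coords:
  assumes "orthon a b"
  shows "norm x \<le> norm (x *s a + y *s b)" "norm y \<le> norm (x *s a + y *s b)"
proof -
  have s: "cip a a = 1" "cip b b = 1" "cip a b = 0" "cip b a = 0"
    using assms by (simp_all add: orthon_def cip_self cip_swap[of b a])
  have "x = cip (x *s a + y *s b) a" "y = cip (x *s a + y *s b) b" by (simp_all add: cip_add_scale s)
  then show "norm x \<le> norm (x *s a + y *s b)" "norm y \<le> norm (x *s a + y *s b)"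
    using cip_le[of "x *s a + y *s b" a] cip_le[of "x *s a + y *s b" b] assms by (simp_all add: orthon_def)
qed

lemma orthon_lin_indep: "orthon a b \<Longrightarrow> lin_indep2 a b"
  unfolding lin_indep2_def using orthon_coords[of a b] by (metis norm_le_zero_iff norm_zero)

lemma norm_smult_vec: "norm (c *s (u :: complex^'n::finite)) = norm c * norm u"
proof -
  have "(norm (c *s u))\<^sup>2 = (norm c * norm u)\<^sup>2"
    unfolding norm_vec_def L2_set_def power_mult_distrib
    by (simp add: sum_nonneg norm_mult power_mult_distrib sum_distrib_left)
  then show ?thesis by (metis norm_ge_zero mult_nonneg_nonneg power2_eq_iff_nonneg)
qed

lemma exists_orthon:
  assumes "lin_indep2 a b"
  shows "\<exists>x y z. orthon (x *s a) (y *s a + z *s b)"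
proof -
  have a: "a \<noteq> 0"
  proof
    assume "a = 0"
    then have "1 *s a + 0 *s b = 0" by simp
    then show False using assms unfolding lin_indep2_def by (metis zero_neq_one)
  qed
  define x where "x = complex_of_real (1 / norm a)"
  define e1 where "e1 = x *s a"
  have e1: "norm e1 = 1" using a by (simp add: e1_def x_def norm_smult_vec norm_divide)
  define w where "w = (- cip b e1 * x) *s a + 1 *s b"
  have w: "w \<noteq> 0" using assms unfolding w_def lin_indep2_def by (metis zero_neq_one)
  define r where "r = complex_of_real (1 / norm w)"
  have "cip w e1 = - cip b e1 * (x * cip a e1) + cip b e1"
    unfolding w_def cip_add_scale by simp
  also have "x * cip a e1 = cip e1 e1" by (simp add: e1_def cip_def sum_distrib_left mult.assoc)
  also have "\<dots> = 1" using e1 by (simp add: cip_self)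
  finally have "cip w e1 = 0" by simp
  then have "cip e1 w = 0" by (simp add: cip_swap[of e1 w])
  then have "cip e1 (r *s w) = 0" by (simp add: cip_def r_def sum_divide_distrib[symmetric])
  moreover have "norm (r *s w) = 1" using w by (simp add: r_def norm_smult_vec norm_divide)
  moreover have "r *s w = (r * (- cip b e1 * x)) *s a + r *s b" by (simp add: w_def vec_eq_iff algebra_simps)
  ultimately show ?thesis using e1 unfolding orthon_def e1_def by metis
qed

text \<open>The sum over \<open>k\<close> of the moduli at the candidate points is continuous and
  positive on the compact set of times and orthonormal frames, hence bounded below there.\<close>

lemma uniform_nonvanishing:
  fixes P :: "real \<Rightarrow> ('n::finite \<Rightarrow> nat) \<Rightarrow> complex"
  assumes cont: "\<And>\<alpha>. \<alpha> \<in> monoms d \<Longrightarrow> continuous_on {0..1} (\<lambda>t. P t \<alpha>)"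
    and nz: "\<And>t a b. t \<in> {0..1} \<Longrightarrow> lin_indep2 a b \<Longrightarrow> \<exists>k\<le>d. hpoly d (P t) (a + of_nat k *s b) \<noteq> 0"
  shows "\<exists>c0>0. \<forall>t\<in>{0..1}. \<forall>a b. orthon a b \<longrightarrow> (\<exists>k\<le>d. c0 \<le> norm (hpoly d (P t) (a + of_nat k *s b)))"
proof -
  define K where "K = {0..1::real} \<times> {ab::(complex^'n) \<times> (complex^'n). orthon (fst ab) (snd ab)}"
  define G where "G = (\<lambda>(t, ab). \<Sum>k\<le>d. norm (hpoly d (P t) (fst ab + of_nat k *s snd ab)))"
  have "compact {ab::(complex^'n) \<times> (complex^'n). orthon (fst ab) (snd ab)}"
    unfolding compact_eq_bounded_closed
  proof
    have "{ab::(complex^'n) \<times> (complex^'n). orthon (fst ab) (snd ab)} \<subseteq> cball 0 1 \<times> cball 0 1"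
      by (auto simp: orthon_def)
    then show "bounded {ab::(complex^'n) \<times> (complex^'n). orthon (fst ab) (snd ab)}"
      by (rule bounded_subset[rotated]) (intro bounded_Times bounded_cball)
    show "closed {ab::(complex^'n) \<times> (complex^'n). orthon (fst ab) (snd ab)}"
      unfolding orthon_def cip_def
      by (intro closed_Collect_conj closed_Collect_eq continuous_intros)
  qed
  then have cK: "compact K" unfolding K_def by (intro compact_Times) auto
  have cG: "continuous_on K G"
    unfolding G_def hpoly_def case_prod_beta vector_add_component vector_smult_component
  proof (intro continuous_intros)
    fix \<alpha> :: "'n \<Rightarrow> nat" assume "\<alpha> \<in> monoms d"
    have "continuous_on K (\<lambda>x. P (fst x) \<alpha>)"
      by (rule continuous_on_compose2[OF cont[OF \<open>\<alpha> \<in> monoms d\<close>] continuous_on_fst[OF continuous_on_id]]) (auto simp: K_def)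
    then show "continuous_on K (\<lambda>x. P (fst x) \<alpha>)" .
  qed
  have pos: "0 < G z" if "z \<in> K" for z
  proof -
    obtain t a b where z: "z = (t, a, b)" by (cases z) auto
    have t: "t \<in> {0..1}" "lin_indep2 a b" using that orthon_lin_indep by (auto simp: z K_def)
    then obtain k where k: "k \<le> d" "hpoly d (P t) (a + of_nat k *s b) \<noteq> 0" using nz by blast
    have "norm (hpoly d (P t) (a + of_nat k *s b)) \<le> G z"
      unfolding G_def z using k(1) by (auto intro!: member_le_sum)
    then show ?thesis using k(2) by (meson less_le_trans zero_less_norm_iff)
  qed
  show ?thesis
  proof (cases "K = {}")
    case True
    then have "\<not> orthon a b" for a b :: "complex^'n" unfolding K_def by force
    then show ?thesis by (intro exI[of _ 1]) auto
  next
    case False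
    then obtain z0 where z0: "z0 \<in> K" "\<And>z. z \<in> K \<Longrightarrow> G z0 \<le> G z"
      using continuous_attains_inf[OF cK False cG] by blast
    \<comment> \<open>Of the \<open>d + 1\<close> summands at least one reaches the average.\<close>
    have "\<exists>k\<le>d. G z0 / (d + 1) \<le> norm (hpoly d (P t) (a + of_nat k *s b))"
      if "t \<in> {0..1}" "orthon a b" for t a b
    proof (rule ccontr)
      assume "\<not> ?thesis"
      then have "norm (hpoly d (P t) (a + of_nat k *s b)) < G z0 / (d + 1)" if "k \<le> d" for k using that by force
      then have "(\<Sum>k\<le>d. norm (hpoly d (P t) (a + of_nat k *s b))) < (\<Sum>k\<le>d. G z0 / (d + 1))"
        by (intro sum_strict_mono) auto
      then have "G (t, a, b) < (\<Sum>k\<le>d. G z0 / (d + 1))" by (simp add: G_def)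
      also have "\<dots> = G z0" by simp
      also have "G z0 \<le> G (t, a, b)" by (rule z0(2)) (use that in \<open>auto simp: K_def\<close>)
      finally show False by simp
    qed
    moreover have "0 < G z0 / (d + 1)" using pos[OF z0(1)] by simp
    ultimately show ?thesis by blast
  qed
qed

section \<open>Taylor approximation of Lipschitz-smooth curves\<close>

text \<open>Induction on the order: the remainder of order \<open>Suc k\<close> has as derivative
  the remainder of order \<open>k\<close> of the shifted family, and the mean value inequality gains
  one power of the time difference.\<close>

lemma taylor_lipschitz:
  fixes D :: "nat \<Rightarrow> real \<Rightarrow> complex"
  assumes "\<And>j t. j < k \<Longrightarrow> t \<in> {0..1} \<Longrightarrow> (D j has_vector_derivative D (Suc j) t) (at t within {0..1})"
    and "\<And>s t. s \<in> {0..1} \<Longrightarrow> t \<in> {0..1} \<Longrightarrow> norm (D k s - D k t) \<le> L * \<bar>s - t\<bar>"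
    and "0 \<le> L" "t \<in> {0..1}" "t0 \<in> {0..1}"
  shows "norm (D 0 t - (\<Sum>l\<le>k. ((t - t0) ^ l / fact l) *\<^sub>R D l t0)) \<le> L * \<bar>t - t0\<bar> ^ Suc k"
  using assms
proof (induction k arbitrary: D t)
  case 0
  then show ?case by simp
next
  case (Suc k)
  define g where "g x = D 0 x - (\<Sum>l\<le>Suc k. ((x - t0) ^ l / fact l) *\<^sub>R D l t0)" for x
  define g' where "g' x = D 1 x - (\<Sum>l\<le>k. ((x - t0) ^ l / fact l) *\<^sub>R D (Suc l) t0)" for x
  have seg: "closed_segment t0 t \<subseteq> {0..1}" using Suc.prems(4,5) by (simp add: closed_segment_subset)
  have der: "(g has_vector_derivative g' x) (at x within closed_segment t0 t)" if x: "x \<in> closed_segment t0 t" for x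
  proof -
    have dterm: "((\<lambda>x. ((x - t0) ^ Suc l / fact (Suc l)) *\<^sub>R c) has_vector_derivative ((x - t0) ^ l / fact l) *\<^sub>R c) (at x within closed_segment t0 t)" for l and c :: complex
    proof -
      have "((\<lambda>x. (x - t0) ^ Suc l / fact (Suc l)) has_field_derivative (x - t0) ^ l / fact l) (at x within closed_segment t0 t)"
      proof -
        have "((\<lambda>x. (x - t0) ^ Suc l) has_field_derivative real (Suc l) * (x - t0) ^ l) (at x within closed_segment t0 t)"
          by (rule derivative_eq_intros refl | simp)+
        from DERIV_cdivide[OF this, of "fact (Suc l)"] show ?thesis
          by (simp only: fact_Suc mult_divide_mult_cancel_left_if) (simp add: fact_Suc)
      qed
      from has_vector_derivative_scaleR[OF this has_vector_derivative_const[of c]] show ?thesis by simp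
    qed
    have "(D 0 has_vector_derivative D 1 x) (at x within closed_segment t0 t)"
      using has_vector_derivative_within_subset[OF Suc.prems(1)[of 0 x] seg] x seg by auto
    moreover have "g = (\<lambda>x. D 0 x - (D 0 t0 + (\<Sum>l\<le>k. ((x - t0) ^ Suc l / fact (Suc l)) *\<^sub>R D (Suc l) t0)))"
      unfolding g_def by (subst sum.atMost_Suc_shift) simp
    moreover have sm: "((\<lambda>x. \<Sum>l\<le>k. ((x - t0) ^ Suc l / fact (Suc l)) *\<^sub>R D (Suc l) t0) has_vector_derivative
        (\<Sum>l\<le>k. ((x - t0) ^ l / fact l) *\<^sub>R D (Suc l) t0)) (at x within closed_segment t0 t)"
      by (rule has_vector_derivative_sum) (rule dterm)
    moreover note has_vector_derivative_diff[OF calculation(1) has_vector_derivative_add[OF has_vector_derivative_const[of "D 0 t0"] sm]]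
    ultimately show ?thesis unfolding g'_def by simp
  qed
  have bound: "norm (g' x) \<le> L * \<bar>t - t0\<bar> ^ Suc k" if x: "x \<in> closed_segment t0 t" for x
  proof -
    have "norm (g' x) \<le> L * \<bar>x - t0\<bar> ^ Suc k"
      unfolding g'_def using Suc.IH[of "\<lambda>j. D (Suc j)" x] Suc.prems x seg by auto
    also have "\<bar>x - t0\<bar> \<le> \<bar>t - t0\<bar>" using x by (auto simp: closed_segment_eq_real_ivl split: if_splits)
    then have "L * \<bar>x - t0\<bar> ^ Suc k \<le> L * \<bar>t - t0\<bar> ^ Suc k"
      using Suc.prems(3) by (intro mult_left_mono power_mono) auto
    finally show ?thesis .
  qed
  have "norm (g t - g t0) \<le> (L * \<bar>t - t0\<bar> ^ Suc k) * norm (t - t0)"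
  proof (rule differentiable_bound[of "closed_segment t0 t" g "\<lambda>x h. h *\<^sub>R g' x"])
    fix x assume x: "x \<in> closed_segment t0 t"
    show "(g has_derivative (\<lambda>h. h *\<^sub>R g' x)) (at x within closed_segment t0 t)"
      using der[OF x] unfolding has_vector_derivative_def .
    show "onorm (\<lambda>h. h *\<^sub>R g' x) \<le> L * \<bar>t - t0\<bar> ^ Suc k"
    proof (rule onorm_le)
      fix h
      show "norm (h *\<^sub>R g' x) \<le> L * \<bar>t - t0\<bar> ^ Suc k * norm h"
        using mult_left_mono[OF bound[OF x], of "norm h"] by (simp only: norm_scaleR real_norm_def mult.commute)
    qed
  qed auto
  moreover have "g t0 = 0" unfolding g_def by (subst sum.atMost_Suc_shift) simp
  ultimately show ?case unfolding g_def[of t, symmetric] by (simp add: mult_ac)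
qed

text \<open>The continuous-time counterpart of \<open>apx\<close>, with one constant for all base
  points, so that it can be sampled on any subinterval at any rate.\<close>

definition locpoly :: "nat \<Rightarrow> real \<Rightarrow> (real \<Rightarrow> complex) \<Rightarrow> bool" where
  "locpoly m M f \<longleftrightarrow> (\<forall>t0\<in>{0..1}. \<exists>Q. (\<forall>l\<ge>m. coeff Q l = 0) \<and> pnorm Q \<le> M \<and>
     (\<forall>t\<in>{0..1}. norm (f t - poly Q (of_real (t - t0))) \<le> M * \<bar>t - t0\<bar> ^ m))"

lemma Ck1_locpoly:
  assumes "Ck1_on k {0..1} f"
  shows "\<exists>M\<ge>0. locpoly (Suc k) M f"
proof -
  obtain D L where D0: "\<forall>t\<in>{0..1}. D 0 t = f t"
    and D: "\<forall>j<k. \<forall>t\<in>{0..1}. (D j has_vector_derivative D (Suc j) t) (at t within {0..1})"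
    and L: "\<forall>s\<in>{0..1}. \<forall>t\<in>{0..1}. norm (D k s - D k t) \<le> L * \<bar>s - t\<bar>"
    using assms unfolding Ck1_on_def by blast
  have "norm (D k 0 - D k 1) \<le> L * \<bar>0 - 1\<bar>" using L[rule_format, of 0 1] by simp
  then have "norm (D k 0 - D k 1) \<le> L" by simp
  then have L0: "0 \<le> L" by (rule order_trans[OF norm_ge_zero])
  have "\<exists>B. \<forall>t\<in>{0..1}. norm (D l t) \<le> B" if "l \<le> k" for l
  proof (cases "l = k")
    case True
    have "norm (D k t) \<le> norm (D k 0) + L" if "t \<in> {0..1}" for t
    proof -
      have "norm (D k t - D k 0) \<le> L * \<bar>t - 0\<bar>" using L[rule_format, of t 0] that by simp
      also have "\<dots> \<le> L * 1" using L0 that by (intro mult_left_mono) auto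
      finally show ?thesis using norm_triangle_sub[of "D k t" "D k 0"] by simp
    qed
    then show ?thesis using True by blast
  next
    case False
    have "continuous_on {0..1} (D l)"
      by (rule continuous_on_vector_derivative[where f' = "D (Suc l)"]) (use D False that in auto)
    then have "bounded (D l ` {0..1})" by (intro compact_imp_bounded compact_continuous_image) auto
    then show ?thesis unfolding bounded_iff by auto
  qed
  then obtain B where B: "\<And>l t. l \<le> k \<Longrightarrow> t \<in> {0..1} \<Longrightarrow> norm (D l t) \<le> B l" by metis
  have B0: "0 \<le> B l" if "l \<le> k" for l using order_trans[OF norm_ge_zero B[OF that, of 0]] by simp
  define M where "M = L + (\<Sum>l\<le>k. B l)"
  have "0 \<le> (\<Sum>l\<le>k. B l)" by (rule sum_nonneg) (use B0 in simp)
  then have M: "L \<le> M" "(\<Sum>l\<le>k. B l) \<le> M" "0 \<le> M" using L0 by (auto simp: M_def)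
  have "locpoly (Suc k) M f"
    unfolding locpoly_def
  proof
    fix t0 :: real assume t0: "t0 \<in> {0..1}"
    define Q where "Q = (\<Sum>l\<le>k. monom (D l t0 / fact l) l)"
    have Q: "poly Q (of_real x) = (\<Sum>l\<le>k. (x ^ l / fact l) *\<^sub>R D l t0)" for x
      by (simp add: Q_def poly_sum poly_monom scaleR_conv_of_real mult_ac)
    have "pnorm Q \<le> (\<Sum>l\<le>k. B l)"
      unfolding Q_def
    proof (rule order_trans[OF pnorm_sum sum_mono])
      fix l assume l: "l \<in> {..k}"
      have "pnorm (monom (D l t0 / fact l) l) = norm (D l t0) / fact l"
      proof -
        have "pnorm (monom (D l t0 / fact l) l) = (\<Sum>i\<le>l. norm (coeff (monom (D l t0 / fact l) l) i))"
          by (rule pnorm_eq) (rule degree_monom_le)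
        also have "\<dots> = (\<Sum>i\<le>l. if i = l then norm (D l t0) / fact l else 0)"
          by (intro sum.cong) (auto simp: norm_divide)
        finally show ?thesis by simp
      qed
      also have "\<dots> \<le> norm (D l t0) / 1" by (intro divide_left_mono fact_ge_1) auto
      also have "\<dots> \<le> B l" using B l t0 by simp
      finally show "pnorm (monom (D l t0 / fact l) l) \<le> B l" .
    qed
    moreover have "norm (f t - poly Q (of_real (t - t0))) \<le> M * \<bar>t - t0\<bar> ^ Suc k" if t: "t \<in> {0..1}" for t
    proof -
      have "norm (D 0 t - (\<Sum>l\<le>k. ((t - t0) ^ l / fact l) *\<^sub>R D l t0)) \<le> L * \<bar>t - t0\<bar> ^ Suc k"
        by (rule taylor_lipschitz) (use D L L0 t t0 in auto)
      also have "\<dots> \<le> M * \<bar>t - t0\<bar> ^ Suc k" using M by (intro mult_right_mono) auto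
      finally show ?thesis unfolding Q using D0 t by simp
    qed
    moreover have "\<forall>l\<ge>Suc k. coeff Q l = 0" by (simp add: Q_def coeff_sum)
    ultimately show "\<exists>Q. (\<forall>l\<ge>Suc k. coeff Q l = 0) \<and> pnorm Q \<le> M \<and>
     (\<forall>t\<in>{0..1}. norm (f t - poly Q (of_real (t - t0))) \<le> M * \<bar>t - t0\<bar> ^ Suc k)"
      using M(2) by (intro exI[of _ Q]) auto
  qed
  with M(3) show ?thesis by blast
qed

lemma locpoly_mono: "locpoly m M f \<Longrightarrow> M \<le> N \<Longrightarrow> locpoly m N f"
  unfolding locpoly_def by (meson abs_ge_zero mult_right_mono order_trans zero_le_power)

lemma locpoly_lip:
  assumes f: "locpoly m M f" and m: "1 \<le> m" and t: "t \<in> {0..1}" "t0 \<in> {0..1}"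
  shows "norm (f t - f t0) \<le> 2 * M * \<bar>t - t0\<bar>"
proof -
  obtain Q where Q: "pnorm Q \<le> M" and e: "\<And>t. t \<in> {0..1} \<Longrightarrow> norm (f t - poly Q (of_real (t - t0))) \<le> M * \<bar>t - t0\<bar> ^ m"
    using f t(2) unfolding locpoly_def by blast
  have M: "0 \<le> M" using Q pnorm_nonneg order_trans by blast
  have Q0: "poly Q 0 = f t0" using e[OF t(2)] m by (simp add: power_0_left)
  have x: "\<bar>t - t0\<bar> \<le> 1" using t by auto
  have "M * \<bar>t - t0\<bar> ^ m \<le> M * \<bar>t - t0\<bar>"
    using M x power_decreasing[of 1 m "\<bar>t - t0\<bar>"] m by (intro mult_left_mono) auto
  then have 1: "norm (f t - poly Q (of_real (t - t0))) \<le> M * \<bar>t - t0\<bar>" using e[OF t(1)] by simp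
  have "norm (poly Q (of_real (t - t0)) - poly Q 0) \<le> pnorm Q * norm (complex_of_real (t - t0))"
    by (rule poly_diff_0_le) (use x in \<open>simp only: norm_of_real\<close>)
  also have "\<dots> \<le> M * \<bar>t - t0\<bar>" using Q unfolding norm_of_real by (intro mult_right_mono) auto
  finally show ?thesis using 1 Q0 norm_triangle_ineq[of "f t - poly Q (of_real (t - t0))" "poly Q (of_real (t - t0)) - f t0"]
    by simp
qed

text \<open>The samples run through the r-th of \<open>N0\<close> equal subintervals. Stretching it
  to unit length contracts the argument of \<open>Q\<close> by \<open>1 / N0\<close>, which
  increases neither bound.\<close>

lemma locpoly_apx:
  assumes f: "locpoly m M f" and N0: "r < N0" and k: "0 < k" and i0: "i0 \<le> k"
  shows "apx m k i0 M (\<lambda>i. f ((real r + real i / real k) / real N0))"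
proof -
  let ?t = "\<lambda>i. (real r + real i / real k) / real N0"
  have t: "?t i \<in> {0..1}" if "i \<le> k" for i
  proof -
    have "real i / real k \<le> 1" using that k by simp
    moreover have "real r + 1 \<le> real N0" using N0 by linarith
    ultimately have "real r + real i / real k \<le> real N0" by linarith
    then have "?t i \<le> 1" using N0 by (subst pos_divide_le_eq) auto
    moreover have "0 \<le> ?t i" by simp
    ultimately show ?thesis by simp
  qed
  obtain Q where Q: "\<forall>l\<ge>m. coeff Q l = 0" "pnorm Q \<le> M"
    and e: "\<And>t. t \<in> {0..1} \<Longrightarrow> norm (f t - poly Q (of_real (t - ?t i0))) \<le> M * \<bar>t - ?t i0\<bar> ^ m"
    using f t[OF i0] unfolding locpoly_def by blast
  have M: "0 \<le> M" using Q pnorm_nonneg order_trans by blast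
  let ?c = "complex_of_real (1 / real N0)"
  have diff: "?t i - ?t i0 = (1 / real N0) * ((real i - real i0) / real k)" for i
    by (simp add: diff_divide_distrib add_divide_distrib)
  have inv: "1 / real N0 \<le> 1" using N0 by simp
  have cn: "norm ?c \<le> 1" unfolding norm_of_real using inv by simp
  show ?thesis unfolding apx_def lerr_def
  proof (intro exI[of _ "pcompose Q [:0, ?c:]"] conjI allI impI)
    show "pnorm (pcompose Q [:0, ?c:]) \<le> M" by (rule order_trans[OF pnorm_pcompose_contract[OF cn] Q(2)])
    fix l assume "m \<le> l"
    then show "coeff (pcompose Q [:0, ?c:]) l = 0" using Q(1) by (simp add: coeff_pcompose_linear)
  next
    fix i assume i: "i \<le> k"
    have arg: "complex_of_real (?t i - ?t i0) = tm k i0 i * ?c"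
      unfolding diff tm_def by (simp add: mult.commute)
    have "norm (f (?t i) - poly Q (of_real (?t i - ?t i0))) \<le> M * \<bar>?t i - ?t i0\<bar> ^ m" by (rule e[OF t[OF i]])
    also have "\<bar>?t i - ?t i0\<bar> \<le> norm (tm k i0 i)"
    proof -
      have "\<bar>?t i - ?t i0\<bar> = norm (tm k i0 i) * norm ?c"
        by (simp only: norm_mult[symmetric] arg[symmetric] norm_of_real[of "?t i - ?t i0"])
      also have "\<dots> \<le> norm (tm k i0 i) * 1" using cn by (intro mult_left_mono) auto
      finally show ?thesis by simp
    qed
    then have "M * \<bar>?t i - ?t i0\<bar> ^ m \<le> M * norm (tm k i0 i) ^ m"
      using M by (intro mult_left_mono power_mono) auto
    finally show "norm (f (?t i) - poly (pcompose Q [:0, ?c:]) (tm k i0 i)) \<le> M * norm (tm k i0 i) ^ m"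
      unfolding arg by (simp add: poly_pcompose)
  qed
qed

section \<open>Zeros on a line along a curve of forms\<close>

lemma pnorm_power: "pnorm (p ^ n) \<le> pnorm p ^ n"
proof (induction n)
  case (Suc n)
  have "pnorm (p ^ Suc n) \<le> pnorm p * pnorm (p ^ n)" by (simp add: pnorm_mult)
  also have "\<dots> \<le> pnorm p * pnorm p ^ n" by (intro mult_left_mono Suc) auto
  finally show ?case by simp
qed simp

lemma pnorm_prod: "pnorm (\<Prod>i\<in>S. f i) \<le> (\<Prod>i\<in>S. pnorm (f i))"
proof (induction S rule: infinite_finite_induct)
  case (insert x S)
  then show ?case by (auto intro!: order_trans[OF pnorm_mult] mult_left_mono)
qed auto

definition wpoly :: "complex^'n::finite \<Rightarrow> complex^'n \<Rightarrow> ('n \<Rightarrow> nat) \<Rightarrow> complex poly" where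
  "wpoly a b \<alpha> = (\<Prod>i\<in>UNIV. [:b$i, a$i:] ^ \<alpha> i)"

lemma pnorm_wpoly:
  assumes "norm a \<le> R" "norm b \<le> R" "\<alpha> \<in> monoms d"
  shows "pnorm (wpoly a b \<alpha>) \<le> (2 * R) ^ d"
proof -
  have "pnorm (wpoly a b \<alpha>) \<le> (\<Prod>i\<in>UNIV. pnorm ([:b$i, a$i:] ^ \<alpha> i))"
    unfolding wpoly_def by (rule pnorm_prod)
  also have "\<dots> \<le> (\<Prod>i\<in>UNIV. (2 * R) ^ \<alpha> i)"
  proof (rule prod_mono, rule conjI)
    fix i
    have "pnorm [:b$i, a$i:] \<le> 2 * R"
      using order_trans[OF Finite_Cartesian_Product.norm_nth_le assms(1), of i] order_trans[OF Finite_Cartesian_Product.norm_nth_le assms(2), of i] by (simp add: pnorm_pCons)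
    then show "pnorm ([:b$i, a$i:] ^ \<alpha> i) \<le> (2 * R) ^ \<alpha> i"
      by (intro order_trans[OF pnorm_power power_mono]) auto
  qed simp
  also have "\<dots> = (2 * R) ^ d" using assms(3) unfolding monoms_def by (simp only: mem_Collect_eq flip: power_sum)
  finally show ?thesis .
qed

lemma coeff_lpoly: "coeff (lpoly d c a b) j = (\<Sum>\<alpha>\<in>monoms d. c \<alpha> * coeff (wpoly a b \<alpha>) j)"
  by (simp add: lpoly_def wpoly_def coeff_sum)

lemma coeff_rpoly_lpoly:
  assumes "hpoly d c a \<noteq> 0"
  shows "coeff (rpoly (proots (lpoly d c a b))) j = coeff (lpoly d c a b) j * inverse (coeff (lpoly d c a b) d)"
proof -
  have "coeff (lpoly d c a b) j = hpoly d c a * coeff (rpoly (proots (lpoly d c a b))) j"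
    by (subst lpoly_roots(1)[OF assms]) simp
  then show ?thesis using assms by (simp add: coeff_lpoly_top)
qed

section \<open>Zeros as points of projective space, independence of the chart\<close>

definition zeroset :: "nat \<Rightarrow> (('n::finite \<Rightarrow> nat) \<Rightarrow> complex) \<Rightarrow> complex^'n \<Rightarrow> complex^'n \<Rightarrow> (complex^'n^'n) multiset" where
  "zeroset d c a b = image_mset (\<lambda>r. proj (r *s a + b)) (proots (lpoly d c a b))"

lemma size_zeroset: "hpoly d c a \<noteq> 0 \<Longrightarrow> size (zeroset d c a b) = d"
  by (simp add: zeroset_def lpoly_roots(2))

lemma matchd_zeroset_le_2:
  assumes "hpoly d c a \<noteq> 0" "hpoly d c' a \<noteq> 0"
  shows "matchd (zeroset d c a b) (zeroset d c' a b) \<le> 2"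
proof (rule matchd_le_all)
  fix x y assume "x \<in># zeroset d c a b" "y \<in># zeroset d c' a b"
  then obtain u v where "x = proj u" "y = proj v" by (auto simp: zeroset_def)
  then show "dist x y \<le> 2" using norm_proj_le[of u] norm_proj_le[of v] norm_triangle_ineq4[of x y] by (simp add: dist_norm)
qed (use assms in \<open>auto simp: size_zeroset\<close>)

lemma orthon_chart_indep:
  assumes "orthon a b"
  shows "lin_indep2 (a + k *s b) b"
  unfolding lin_indep2_def
proof (intro allI impI)
  fix \<alpha> \<beta> assume "\<alpha> *s (a + k *s b) + \<beta> *s b = 0"
  then have "\<alpha> *s a + (\<alpha> * k + \<beta>) *s b = 0" by (simp add: vec_eq_iff algebra_simps)
  then show "\<alpha> = 0 \<and> \<beta> = 0" using orthon_lin_indep[OF assms] unfolding lin_indep2_def by fastforce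
qed

text \<open>Gaussian frames may be arbitrarily skew, while the constants below are uniform only over
  orthonormal ones. The zeros are therefore computed in an orthonormal frame of the same line, which
  depends neither on the form nor on the time.\<close>

lemma chart_exists:
  assumes "lin_indep2 a b"
  shows "\<exists>e1 e2. orthon e1 e2 \<and> (\<forall>d c k. hpoly d c a \<noteq> 0 \<longrightarrow> hpoly d c (e1 + k *s e2) \<noteq> 0 \<longrightarrow>
     zeroset d c a b = zeroset d c (e1 + k *s e2) e2)"
proof -
  obtain x y z where o: "orthon (x *s a) (y *s a + z *s b)" using exists_orthon[OF assms] by blast
  have "zeroset d c a b = zeroset d c (x *s a + k *s (y *s a + z *s b)) (y *s a + z *s b)"
    if "hpoly d c a \<noteq> 0" "hpoly d c (x *s a + k *s (y *s a + z *s b)) \<noteq> 0" for d c k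
    unfolding zeroset_def
  proof (rule chart_change[OF that])
    show "x *s a + k *s (y *s a + z *s b) = (x + k * y) *s a + (k * z) *s b"
      by (simp add: vec_eq_iff algebra_simps)
    show "lin_indep2 (x *s a + k *s (y *s a + z *s b)) (y *s a + z *s b)" by (rule orthon_chart_indep[OF o])
  qed simp
  with o show ?thesis by blast
qed

text \<open>The vector \<open>s (a + k b) + b\<close> has orthonormal coordinates \<open>s\<close>
  and \<open>s * k + 1\<close>, which cannot both be small, so its norm is bounded below for all
  \<open>s\<close> and the passage to projectors is Lipschitz on the whole chart.\<close>

lemma chart_lipschitz:
  assumes o: "orthon a b" and k: "k \<le> d"
  shows "dist (proj (s *s (a + of_nat k *s b) + b)) (proj (s' *s (a + of_nat k *s b) + b)) \<le> 4 * (real d + 1)\<^sup>2 * dist s s'"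
proof -
  let ?a = "a + of_nat k *s b"
  have low: "1 / (2 * (real d + 1)) \<le> norm (s *s ?a + b)" for s
  proof -
    have eq: "s *s ?a + b = s *s a + (s * of_nat k + 1) *s b" by (simp add: vec_eq_iff algebra_simps)
    have "1 \<le> norm (s * of_nat k) + norm (s * of_nat k + 1)"
      using norm_triangle_ineq4[of "s * of_nat k + 1" "s * of_nat k"] by simp
    also have "norm (s * of_nat k) \<le> norm s * real d" using k by (simp add: norm_mult mult_left_mono)
    also have "norm s * real d + norm (s * of_nat k + 1) \<le> norm (s *s ?a + b) * real d + norm (s *s ?a + b)"
      unfolding eq by (intro add_mono mult_right_mono orthon_coords[OF o]) auto
    finally have "1 \<le> norm (s *s ?a + b) * (real d + 1)" by (simp add: algebra_simps)
    then have "1 / (real d + 1) \<le> norm (s *s ?a + b)" by (simp add: field_simps)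
    moreover have "1 / (2 * (real d + 1)) \<le> 1 / (real d + 1)" by (intro divide_left_mono) auto
    ultimately show ?thesis by linarith
  qed
  have pos: "0 < 1 / (2 * (real d + 1))" by simp
  have nz: "s *s ?a + b \<noteq> 0" for s using low[of s] pos by (metis norm_zero not_le)
  have "dist (proj (s *s ?a + b)) (proj (s' *s ?a + b)) \<le> 2 * norm ((s *s ?a + b) - (s' *s ?a + b)) / (1 / (2 * (real d + 1)))"
    by (rule dist_proj_le[OF nz nz pos low])
  also have "(s *s ?a + b) - (s' *s ?a + b) = (s - s') *s ?a" by (simp add: vec_eq_iff algebra_simps)
  also have "norm ((s - s') *s ?a) = dist s s' * norm ?a" by (simp only: norm_smult_vec dist_norm)
  also have "2 * (dist s s' * norm ?a) / (1 / (2 * (real d + 1))) = 4 * (real d + 1) * dist s s' * norm ?a"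
    by (simp add: field_simps)
  also have "\<dots> \<le> 4 * (real d + 1) * dist s s' * (real d + 1)"
  proof (intro mult_left_mono)
    have "norm ?a \<le> norm a + norm (of_nat k *s b)" by (rule norm_triangle_ineq)
    also have "\<dots> \<le> real d + 1" using o k by (simp add: orthon_def norm_smult_vec)
    finally show "norm ?a \<le> real d + 1" .
  qed simp
  finally show ?thesis by (simp add: power2_eq_square mult_ac)
qed

text \<open>What smoothness and compactness leave: \<open>M\<close> serves all coefficients and
  \<open>c0\<close> all lines and times; only the index \<open>k\<close> of the chart may
  vary.\<close>

locale form_curve =
  fixes P :: "real \<Rightarrow> ('n::finite \<Rightarrow> nat) \<Rightarrow> complex" and d :: nat and M c0 :: real
  assumes d: "1 \<le> d" and M: "0 \<le> M" and c0: "0 < c0"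
    and smooth: "\<And>\<alpha>. \<alpha> \<in> monoms d \<Longrightarrow> locpoly d M (\<lambda>t. P t \<alpha>)"
    and nonvanishing: "\<And>t a b. t \<in> {0..1} \<Longrightarrow> orthon a b \<Longrightarrow> \<exists>k\<le>d. c0 \<le> norm (hpoly d (P t) (a + of_nat k *s b))"
begin

definition R :: real where "R = real d + 1"
definition Nm :: real where "Nm = real (card (monoms d :: ('n \<Rightarrow> nat) set))"

lemma chart_norms: "orthon a b \<Longrightarrow> k \<le> d \<Longrightarrow> norm (a + of_nat k *s b) \<le> R" "orthon a b \<Longrightarrow> norm b \<le> R"
proof -
  assume o: "orthon a b"
  then show "norm b \<le> R" by (simp add: orthon_def R_def)
  assume k: "k \<le> d"
  have "norm (a + of_nat k *s b) \<le> norm a + norm (of_nat k *s b)" by (rule norm_triangle_ineq)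
  also have "\<dots> \<le> R" using o k by (simp add: orthon_def norm_smult_vec R_def)
  finally show "norm (a + of_nat k *s b) \<le> R" .
qed

definition Lc :: real where "Lc = Nm * (2 * M * (2 * R) ^ d)"

lemma Lc_nonneg: "0 \<le> Lc" using M by (simp add: Lc_def Nm_def R_def)

lemma coeff_lip:
  assumes o: "orthon a b" and k: "k \<le> d" and t: "t \<in> {0..1}" "t0 \<in> {0..1}"
  shows "norm (coeff (lpoly d (P t) (a + of_nat k *s b) b) j - coeff (lpoly d (P t0) (a + of_nat k *s b) b) j) \<le> Lc * \<bar>t - t0\<bar>"
proof -
  let ?W = "\<lambda>\<alpha>. coeff (wpoly (a + of_nat k *s b) b \<alpha>) j"
  have "coeff (lpoly d (P t) (a + of_nat k *s b) b) j - coeff (lpoly d (P t0) (a + of_nat k *s b) b) j =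
      (\<Sum>\<alpha>\<in>monoms d. (P t \<alpha> - P t0 \<alpha>) * ?W \<alpha>)"
    by (simp add: coeff_lpoly left_diff_distrib sum_subtractf)
  also have "norm \<dots> \<le> (\<Sum>\<alpha>\<in>(monoms d :: ('n \<Rightarrow> nat) set). 2 * M * \<bar>t - t0\<bar> * (2 * R) ^ d)"
    unfolding norm_mult
  proof (rule order_trans[OF norm_sum sum_mono])
    fix \<alpha> :: "'n \<Rightarrow> nat" assume \<alpha>: "\<alpha> \<in> monoms d"
    have "norm (?W \<alpha>) \<le> (2 * R) ^ d"
      by (rule order_trans[OF coeff_le_pnorm pnorm_wpoly[OF chart_norms(1)[OF o k] chart_norms(2)[OF o] \<alpha>]])
    then show "norm ((P t \<alpha> - P t0 \<alpha>) * ?W \<alpha>) \<le> 2 * M * \<bar>t - t0\<bar> * (2 * R) ^ d"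
      unfolding norm_mult using locpoly_lip[OF smooth[OF \<alpha>] d t] M by (intro mult_mono) auto
  qed
  also have "\<dots> = Lc * \<bar>t - t0\<bar>" by (simp add: Lc_def Nm_def mult_ac)
  finally show ?thesis .
qed

lemma hpoly_lip:
  assumes "orthon a b" "k \<le> d" "t \<in> {0..1}" "t0 \<in> {0..1}"
  shows "norm (hpoly d (P t) (a + of_nat k *s b) - hpoly d (P t0) (a + of_nat k *s b)) \<le> Lc * \<bar>t - t0\<bar>"
  using coeff_lip[OF assms, of d] by (simp add: coeff_lpoly_top)

text \<open>The monic coefficients are those of the restricted form times the inverse of the leading
  one, which is at least \<open>c0 / 2\<close> in modulus; \<open>apx\<close> is stable under these
  operations with constants independent of the line.\<close>

lemma chart_regular:
  "\<exists>M2. \<forall>r N0 k a b l. r < N0 \<longrightarrow> 0 < k \<longrightarrow> orthon a b \<longrightarrow> l \<le> d \<longrightarrow>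
     (\<forall>i\<le>k. c0 / 2 \<le> norm (hpoly d (P ((real r + real i / real k) / real N0)) (a + of_nat l *s b))) \<longrightarrow>
     regular d k M2 (\<lambda>i. proots (lpoly d (P ((real r + real i / real k) / real N0)) (a + of_nat l *s b) b))"
proof -
  define M1 where "M1 = Nm * ((2 * R) ^ d * M)"
  have "0 < c0 / 2" using c0 by simp
  from apx_inverse[OF this d, of M1] obtain K where K: "\<And>k i0 c. i0 \<le> k \<Longrightarrow> apx d k i0 M1 c \<Longrightarrow>
    (\<forall>i\<le>k. c0 / 2 \<le> norm (c i)) \<Longrightarrow> apx d k i0 K (\<lambda>i. inverse (c i))" by blast
  have "regular d k (4 * M1 * K) (\<lambda>i. proots (lpoly d (P ((real r + real i / real k) / real N0)) (a + of_nat l *s b) b))"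
    if r: "r < N0" and k: "0 < k" and o: "orthon a b" and l: "l \<le> d"
      and nz: "\<forall>i\<le>k. c0 / 2 \<le> norm (hpoly d (P ((real r + real i / real k) / real N0)) (a + of_nat l *s b))"
    for r N0 k a b l
  proof -
    let ?P = "\<lambda>i. P ((real r + real i / real k) / real N0)"
    let ?a = "a + of_nat l *s b"
    have co: "apx d k i0 M1 (\<lambda>i. coeff (lpoly d (?P i) ?a b) j)" if i0: "i0 \<le> k" for i0 j
    proof -
      have "apx d k i0 (\<Sum>\<alpha>\<in>(monoms d :: ('n \<Rightarrow> nat) set). (2 * R) ^ d * M) (\<lambda>i. \<Sum>\<alpha>\<in>monoms d. coeff (wpoly ?a b \<alpha>) j * ?P i \<alpha>)"
      proof (rule apx_sum[OF d])
        fix \<alpha> :: "'n \<Rightarrow> nat" assume \<alpha>: "\<alpha> \<in> monoms d"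
        have W: "norm (coeff (wpoly ?a b \<alpha>) j) \<le> (2 * R) ^ d"
          by (rule order_trans[OF coeff_le_pnorm pnorm_wpoly[OF chart_norms(1)[OF o l] chart_norms(2)[OF o] \<alpha>]])
        have "apx d k i0 (norm (coeff (wpoly ?a b \<alpha>) j) * M) (\<lambda>i. coeff (wpoly ?a b \<alpha>) j * ?P i \<alpha>)"
          by (rule apx_cmult, rule locpoly_apx[OF smooth[OF \<alpha>] r k i0])
        then show "apx d k i0 ((2 * R) ^ d * M) (\<lambda>i. coeff (wpoly ?a b \<alpha>) j * ?P i \<alpha>)"
          by (rule apx_mono) (use W M in \<open>auto intro: mult_right_mono\<close>)
      qed
      then show ?thesis by (simp add: coeff_lpoly M1_def Nm_def mult.commute)
    qed
    have nz': "hpoly d (?P i) ?a \<noteq> 0" if "i \<le> k" for i using nz that c0 by fastforce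
    show ?thesis unfolding regular_def
    proof (intro conjI allI impI)
      fix i assume "i \<le> k"
      then show "size (proots (lpoly d (?P i) ?a b)) = d" using nz' lpoly_roots(2) by blast
    next
      fix i0 j assume i0: "i0 \<le> k"
      have "apx d k i0 K (\<lambda>i. inverse (coeff (lpoly d (?P i) ?a b) d))"
        by (rule K[OF i0 co[OF i0]]) (use nz in \<open>simp add: coeff_lpoly_top\<close>)
      from apx_mult[OF co[OF i0, of j] this i0]
      show "apx d k i0 (4 * M1 * K) (\<lambda>i. coeff (rpoly (proots (lpoly d (?P i) ?a b))) j)"
        by (subst apx_cong[OF coeff_rpoly_lpoly[OF nz']])
    qed
  qed
  then show ?thesis by blast
qed

text \<open>Time is cut into a fixed number \<open>N0\<close> of pieces on each of which one chart
  remains valid. There the root bound applies and the chart map is Lipschitz. As the energy is that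
  of points of projective space, the pieces can be added although their charts differ.\<close>

lemma line_energy:
  assumes q: "1 \<le> q" "q * (real d - 1) < real d"
  shows "\<exists>C\<ge>0. \<forall>n a b. lin_indep2 a b \<longrightarrow> (\<forall>i\<le>2^n. hpoly d (P (real i / 2 ^ n)) a \<noteq> 0) \<longrightarrow>
     RE q (2 ^ n) (\<lambda>i. zeroset d (P (real i / 2 ^ n)) a b) \<le> C * real (2 ^ n) powr (1 - q)"
proof -
  obtain M2 where M2: "\<And>r N0 k a b l. r < N0 \<Longrightarrow> 0 < k \<Longrightarrow> orthon a b \<Longrightarrow> l \<le> d \<Longrightarrow>
     (\<forall>i\<le>k. c0 / 2 \<le> norm (hpoly d (P ((real r + real i / real k) / real N0)) (a + of_nat l *s b))) \<Longrightarrow>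
     regular d k M2 (\<lambda>i. proots (lpoly d (P ((real r + real i / real k) / real N0)) (a + of_nat l *s b) b))"
    using chart_regular by blast
  obtain Ce where Ce: "\<And>k A. regular d k M2 A \<Longrightarrow> RE q k A \<le> Ce * real k powr (1 - q)"
    using energy_bounded_roots[OF q(1) d q(2)] unfolding energy_bounded_def by blast
  \<comment> \<open>So fine that the leading coefficient changes by at most \<open>c0 / 2\<close> on
    a piece; a power of two, so that the pieces fit the dyadic samples.\<close>
  obtain n0 where n0: "2 * Lc / c0 < 2 ^ n0" using real_arch_pow[of 2 "2 * Lc / c0"] by auto
  define N0 :: nat where "N0 = 2 ^ n0"
  have N0: "0 < N0" "real N0 = 2 ^ n0" by (auto simp: N0_def)
  have LN: "Lc / real N0 \<le> c0 / 2" using n0 c0 unfolding N0(2) by (simp add: field_simps)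
  define Lp where "Lp = 4 * (real d + 1)\<^sup>2"
  have Lp: "0 \<le> Lp" by (simp add: Lp_def)
  define C where "C = real N0 * real N0 powr (q - 1) * Lp powr q * \<bar>Ce\<bar> + 2 powr q * real N0 powr q"
  have C0: "0 \<le> C" by (simp add: C_def)
  have main: "RE q (2 ^ n) (\<lambda>i. zeroset d (P (real i / 2 ^ n)) a b) \<le> C * real (2 ^ n) powr (1 - q)"
    if ind: "lin_indep2 a b" and nz: "\<forall>i\<le>2^n. hpoly d (P (real i / 2 ^ n)) a \<noteq> 0" for n a b
  proof -
    let ?Z = "\<lambda>i. zeroset d (P (real i / 2 ^ n)) a b"
    have sz: "size (?Z i) = d" if "i \<le> 2 ^ n" for i using nz that by (simp add: size_zeroset)
    have mn: "0 \<le> matchd (?Z i) (?Z (Suc i))" if "i < 2 ^ n" for i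
      using sz[of i] sz[of "Suc i"] that by (intro matchd_nonneg) auto
    show ?thesis
    \<comment> \<open>Fewer samples than pieces: each of the boundedly many steps has length at most
      2, as projectors have norm at most 1.\<close>
    proof (cases "n < n0")
      case True
      have "RE q (2 ^ n) ?Z \<le> (\<Sum>i<(2::nat)^n. 2 powr q)"
        unfolding RE_def
      proof (intro sum_mono powr_mono2)
        fix i :: nat assume "i \<in> {..<2 ^ n}"
        then have i: "i < 2 ^ n" "i \<le> 2 ^ n" "Suc i \<le> 2 ^ n" by auto
        show "0 \<le> matchd (?Z i) (?Z (Suc i))" by (rule mn[OF i(1)])
        show "matchd (?Z i) (?Z (Suc i)) \<le> 2" using nz i by (intro matchd_zeroset_le_2) blast+
      qed (use q in simp)
      also have "\<dots> = 2 powr q * (real (2 ^ n) powr q * real (2 ^ n) powr (1 - q))"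
        by (simp add: powr_add[symmetric] mult.commute)
      also have "\<dots> \<le> 2 powr q * (real N0 powr q * real (2 ^ n) powr (1 - q))"
      proof -
        have "(2::real) ^ n \<le> 2 ^ n0" using True by (intro power_increasing) auto
        then show ?thesis using q unfolding N0(2) by (intro mult_left_mono mult_right_mono powr_mono2) auto
      qed
      also have "\<dots> \<le> C * real (2 ^ n) powr (1 - q)"
        by (simp add: C_def distrib_right)
      finally show ?thesis .
    next
      case False
      define k :: nat where "k = 2 ^ (n - n0)"
      have k0: "0 < k" by (simp add: k_def)
      have kN: "N0 * k = 2 ^ n" using False by (simp add: N0_def k_def flip: power_add)
      have kNr: "real N0 * real k = 2 ^ n" using kN by (metis of_nat_mult of_nat_numeral of_nat_power)
      obtain e1 e2 where o: "orthon e1 e2" and ch: "\<And>c l. hpoly d c a \<noteq> 0 \<Longrightarrow> hpoly d c (e1 + l *s e2) \<noteq> 0 \<Longrightarrow>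
         zeroset d c a b = zeroset d c (e1 + l *s e2) e2" using chart_exists[OF ind] by blast
      have piece: "RE q k (\<lambda>i. ?Z (r * k + i)) \<le> Lp powr q * \<bar>Ce\<bar> * real k powr (1 - q)" if r: "r < N0" for r
      proof -
        let ?t = "\<lambda>i. (real r + real i / real k) / real N0"
        have teq: "real (r * k + i) / 2 ^ n = ?t i" for i
          using k0 N0 unfolding kNr[symmetric] by (simp add: field_simps)
        have ile: "r * k + i \<le> 2 ^ n" if "i \<le> k" for i
        proof -
          have "r * k + i \<le> (r + 1) * k" using that by simp
          also have "\<dots> \<le> N0 * k" using r by (intro mult_right_mono) auto
          finally show ?thesis using kN by simp
        qed
        have t: "?t i \<in> {0..1}" if "i \<le> k" for i
        proof -
          have "real (r * k + i) \<le> real (2 ^ n)" using ile[OF that] by (simp only: of_nat_le_iff)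
          then have "real (r * k + i) / 2 ^ n \<le> 1" by simp
          then show ?thesis unfolding teq by simp
        qed
        obtain l where l: "l \<le> d" "c0 \<le> norm (hpoly d (P (?t 0)) (e1 + of_nat l *s e2))"
          using nonvanishing[OF t[of 0] o] by auto
        have big: "c0 / 2 \<le> norm (hpoly d (P (?t i)) (e1 + of_nat l *s e2))" if i: "i \<le> k" for i
        proof -
          have "norm (hpoly d (P (?t i)) (e1 + of_nat l *s e2) - hpoly d (P (?t 0)) (e1 + of_nat l *s e2)) \<le> Lc * \<bar>?t i - ?t 0\<bar>"
            by (rule hpoly_lip[OF o l(1) t[OF i] t]) simp
          also have "\<bar>?t i - ?t 0\<bar> \<le> 1 / real N0"
          proof -
            have "?t i - ?t 0 = (real i / real k) / real N0" by (simp add: add_divide_distrib)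
            moreover have "real i / real k \<le> 1" using i k0 by simp
            then have "(real i / real k) / real N0 \<le> 1 / real N0" by (rule divide_right_mono) simp
            ultimately show ?thesis by (metis abs_of_nonneg divide_nonneg_nonneg of_nat_0_le_iff)
          qed
          then have "Lc * \<bar>?t i - ?t 0\<bar> \<le> Lc * (1 / real N0)" by (intro mult_left_mono Lc_nonneg)
          also have "\<dots> \<le> c0 / 2" using LN by simp
          finally show ?thesis
            using l(2) norm_triangle_sub[of "hpoly d (P (?t 0)) (e1 + of_nat l *s e2)" "hpoly d (P (?t i)) (e1 + of_nat l *s e2)"]
            by (simp add: norm_minus_commute)
        qed
        let ?S = "\<lambda>i. proots (lpoly d (P (?t i)) (e1 + of_nat l *s e2) e2)"
        have reg: "regular d k M2 ?S" by (rule M2[OF r k0 o l(1)]) (use big in blast)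
        have zs: "?Z (r * k + i) = image_mset (\<lambda>s. proj (s *s (e1 + of_nat l *s e2) + e2)) (?S i)" if i: "i \<le> k" for i
        proof -
          have "hpoly d (P (?t i)) a \<noteq> 0" using nz ile[OF i] teq by metis
          moreover have "hpoly d (P (?t i)) (e1 + of_nat l *s e2) \<noteq> 0" using big[OF i] c0 by auto
          ultimately have "zeroset d (P (?t i)) a b = zeroset d (P (?t i)) (e1 + of_nat l *s e2) e2" by (rule ch)
          then show ?thesis unfolding teq by (simp add: zeroset_def)
        qed
        have sS: "size (?S i) = d" if "i \<le> k" for i using reg that unfolding regular_def by blast
        have "RE q k (\<lambda>i. ?Z (r * k + i)) \<le> Lp powr q * RE q k ?S"
        proof (rule RE_mono)
          fix i assume i: "i < k"
          then have i': "i \<le> k" "Suc i \<le> k" by auto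
          have ss: "size (?S i) = size (?S (Suc i))" unfolding sS[OF i'(1)] sS[OF i'(2)] ..
          show "0 \<le> matchd (?S i) (?S (Suc i))" by (rule matchd_nonneg[OF ss])
          show "0 \<le> matchd (?Z (r * k + i)) (?Z (r * k + Suc i))"
            using zs[OF i'(1)] zs[OF i'(2)] ss by (intro matchd_nonneg) simp
          have "matchd (?Z (r * k + i)) (?Z (r * k + Suc i)) \<le> Lp * matchd (?S i) (?S (Suc i)) + 0"
            unfolding zs[OF i'(1)] zs[OF i'(2)]
            by (rule matchd_image[OF ss Lp]) (use chart_lipschitz[OF o l(1)] in \<open>auto simp: Lp_def\<close>)
          then show "matchd (?Z (r * k + i)) (?Z (r * k + Suc i)) \<le> Lp * matchd (?S i) (?S (Suc i))" by simp
        qed (use q Lp in auto)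
        also have "\<dots> \<le> Lp powr q * (\<bar>Ce\<bar> * real k powr (1 - q))"
          by (intro mult_left_mono order_trans[OF Ce[OF reg] mult_right_mono]) auto
        finally show ?thesis by (simp add: mult.assoc)
      qed
      have "RE q (2 ^ n) ?Z = RE q (N0 * k) ?Z" by (simp add: kN)
      also have "\<dots> = (\<Sum>r<N0. RE q (Suc r * k - r * k) (\<lambda>i. ?Z (r * k + i)))"
        by (rule RE_windows[of "\<lambda>r. r * k" q N0 ?Z]) auto
      also have "\<dots> \<le> (\<Sum>r<N0. Lp powr q * \<bar>Ce\<bar> * real k powr (1 - q))"
        by (rule sum_mono) (use piece in simp)
      also have "\<dots> = real N0 * (Lp powr q * \<bar>Ce\<bar> * real k powr (1 - q))" by simp
      also have "real k powr (1 - q) = real N0 powr (q - 1) * real (2 ^ n) powr (1 - q)"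
      proof -
        have "real (2 ^ n) = real N0 * real k" using kNr by simp
        then have "real (2 ^ n) powr (1 - q) = real N0 powr (1 - q) * real k powr (1 - q)" by (simp add: powr_mult)
        then show ?thesis using N0 by (simp add: mult.assoc[symmetric] powr_add[symmetric])
      qed
      also have "real N0 * (Lp powr q * \<bar>Ce\<bar> * (real N0 powr (q - 1) * real (2 ^ n) powr (1 - q))) \<le> C * real (2 ^ n) powr (1 - q)"
        by (simp add: C_def distrib_right mult_ac)
      finally show ?thesis .
    qed
  qed
  show ?thesis by (rule exI[of _ C], rule conjI[OF C0], intro allI impI, rule main) auto
qed

text \<open>A chart good at time \<open>s\<close> remains good at \<open>t\<close>, the monic
  coefficients in it are Lipschitz in time, and \<open>roots_continuous\<close> is uniform over
  bounded roots. The uniformity over lines yields \<open>D_cont\<close> after integration.\<close>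

lemma line_continuous:
  assumes e: "0 < e"
  shows "\<exists>\<delta>>0. \<forall>s t a b. s \<in> {0..1} \<longrightarrow> t \<in> {0..1} \<longrightarrow> \<bar>t - s\<bar> < \<delta> \<longrightarrow> lin_indep2 a b \<longrightarrow>
     hpoly d (P s) a \<noteq> 0 \<longrightarrow> hpoly d (P t) a \<noteq> 0 \<longrightarrow> matchd (zeroset d (P s) a b) (zeroset d (P t) a b) \<le> e"
proof -
  define Lp where "Lp = 4 * (real d + 1)\<^sup>2"
  have Lp: "0 < Lp" by (simp add: Lp_def)
  define Mc where "Mc = Nm * ((2 * R) ^ d * (2 * M))"
  have cb: "norm (coeff (lpoly d (P t) (a + of_nat k *s b) b) j) \<le> Mc"
    if o: "orthon a b" and k: "k \<le> d" and t: "t \<in> {0..1}" for a b k t j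
  proof -
    have "norm (coeff (lpoly d (P t) (a + of_nat k *s b) b) j) \<le> (\<Sum>\<alpha>\<in>(monoms d :: ('n \<Rightarrow> nat) set). 2 * M * (2 * R) ^ d)"
      unfolding coeff_lpoly
    proof (rule order_trans[OF norm_sum sum_mono])
      fix \<alpha> :: "'n \<Rightarrow> nat" assume \<alpha>: "\<alpha> \<in> monoms d"
      have W: "norm (coeff (wpoly (a + of_nat k *s b) b \<alpha>) j) \<le> (2 * R) ^ d"
        by (rule order_trans[OF coeff_le_pnorm pnorm_wpoly[OF chart_norms(1)[OF o k] chart_norms(2)[OF o] \<alpha>]])
      obtain Q where Q: "pnorm Q \<le> M" "norm (P t \<alpha> - poly Q (of_real (t - t))) \<le> M * \<bar>t - t\<bar> ^ d"
        using smooth[OF \<alpha>] t unfolding locpoly_def by blast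
      have "P t \<alpha> = poly Q 0" using Q(2) d by (simp add: power_0_left)
      then have "norm (P t \<alpha>) \<le> 2 * M" using norm_poly_le_pnorm[of 0 Q] Q(1) M by simp
      then show "norm (P t \<alpha> * coeff (wpoly (a + of_nat k *s b) b \<alpha>) j) \<le> 2 * M * (2 * R) ^ d"
        unfolding norm_mult using W M by (intro mult_mono) auto
    qed
    then show ?thesis by (simp add: Mc_def Nm_def mult_ac)
  qed
  have Mc: "0 \<le> Mc" using M by (simp add: Mc_def Nm_def R_def)
  define B where "B = max 1 ((real d + 1) * (Mc * (2 / c0)))"
  have B: "0 \<le> B" by (simp add: B_def)
  have "0 < e / Lp" using e Lp by simp
  from roots_continuous[OF B this, of d] obtain \<delta>1 where \<delta>1: "0 < \<delta>1" and rc: "\<And>A A'. size A = d \<Longrightarrow> size A' = d \<Longrightarrow>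
    (\<forall>x. x \<in># A + A' \<longrightarrow> norm x \<le> B) \<Longrightarrow> pnorm (rpoly A - rpoly A') \<le> \<delta>1 \<Longrightarrow> matched (e / Lp) A A'" by blast
  define Kc where "Kc = (real d + 1) * (Lc * (2 / c0) + Mc * (Lc * ((2 / c0) * (2 / c0)))) + 1"
  have Kc: "1 \<le> Kc" using Lc_nonneg Mc c0 by (simp add: Kc_def)
  define \<delta> where "\<delta> = min (c0 / (2 * (Lc + 1))) (\<delta>1 / Kc)"
  have \<delta>: "0 < \<delta>" using c0 Lc_nonneg \<delta>1 Kc by (simp add: \<delta>_def)
  have main: "matchd (zeroset d (P s) a b) (zeroset d (P t) a b) \<le> e"
    if s: "s \<in> {0..1}" and t: "t \<in> {0..1}" and st: "\<bar>t - s\<bar> < \<delta>" and ind: "lin_indep2 a b"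
      and nz: "hpoly d (P s) a \<noteq> 0" "hpoly d (P t) a \<noteq> 0" for s t a b
  proof -
    obtain e1 e2 where o: "orthon e1 e2" and ch: "\<And>c l. hpoly d c a \<noteq> 0 \<Longrightarrow> hpoly d c (e1 + l *s e2) \<noteq> 0 \<Longrightarrow>
       zeroset d c a b = zeroset d c (e1 + l *s e2) e2" using chart_exists[OF ind] by blast
    obtain l where l: "l \<le> d" "c0 \<le> norm (hpoly d (P s) (e1 + of_nat l *s e2))" using nonvanishing[OF s o] by auto
    let ?a = "e1 + of_nat l *s e2"
    have "Lc * \<bar>t - s\<bar> \<le> c0 / 2"
    proof -
      have "Lc * \<bar>t - s\<bar> \<le> (Lc + 1) * (c0 / (2 * (Lc + 1)))"
        using st Lc_nonneg by (intro mult_mono) (auto simp: \<delta>_def)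
      also have "\<dots> = c0 / 2"
      proof -
        have "x * (c0 / (2 * x)) = c0 / 2" if "x \<noteq> 0" for x :: real using that by simp
        then show ?thesis using Lc_nonneg by (metis add_nonneg_eq_0_iff zero_le_one zero_neq_one)
      qed
      finally show ?thesis .
    qed
    then have bt: "c0 / 2 \<le> norm (hpoly d (P t) ?a)"
      using hpoly_lip[OF o l(1) t s] l(2) norm_triangle_sub[of "hpoly d (P s) ?a" "hpoly d (P t) ?a"] by (simp add: norm_minus_commute)
    have bs: "c0 / 2 \<le> norm (hpoly d (P s) ?a)" using l(2) c0 by simp
    have nza: "hpoly d (P s) ?a \<noteq> 0" "hpoly d (P t) ?a \<noteq> 0" using bt bs c0 by auto
    let ?S = "\<lambda>t. proots (lpoly d (P t) ?a e2)"
    have inv: "norm (inverse (hpoly d (P t) ?a)) \<le> 2 / c0" if "c0 / 2 \<le> norm (hpoly d (P t) ?a)" for t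
      using le_imp_inverse_le[OF that] c0 by (simp add: norm_inverse)
    have co: "coeff (rpoly (?S t)) j = coeff (lpoly d (P t) ?a e2) j * inverse (hpoly d (P t) ?a)"
      if "hpoly d (P t) ?a \<noteq> 0" for t j
      using coeff_rpoly_lpoly[OF that] by (simp add: coeff_lpoly_top)
    have rb: "norm x \<le> B" if u: "u \<in> {0..1}" "c0 / 2 \<le> norm (hpoly d (P u) ?a)" and x: "x \<in># ?S u" for u x
    proof -
      have nzu: "hpoly d (P u) ?a \<noteq> 0" using u(2) c0 by auto
      have "pnorm (rpoly (?S u)) \<le> (real d + 1) * (Mc * (2 / c0))"
      proof (rule pnorm_le)
        show "degree (rpoly (?S u)) \<le> d" using lpoly_roots(2)[OF nzu] by simp
        fix i
        show "norm (coeff (rpoly (?S u)) i) \<le> Mc * (2 / c0)"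
          unfolding co[OF nzu] norm_mult using cb[OF o l(1) u(1)] inv[OF u(2)] Mc c0 by (intro mult_mono) auto
      qed
      then show ?thesis using root_bound_pnorm[OF x] by (simp add: B_def add.commute)
    qed
    have szS: "size (?S s) = d" "size (?S t) = d" by (rule lpoly_roots(2)[OF nza(1)], rule lpoly_roots(2)[OF nza(2)])
    have "pnorm (rpoly (?S s) - rpoly (?S t)) \<le> (real d + 1) * ((Lc * (2 / c0) + Mc * (Lc * ((2 / c0) * (2 / c0)))) * \<bar>t - s\<bar>)"
    proof (rule pnorm_le)
      show "degree (rpoly (?S s) - rpoly (?S t)) \<le> d" using szS by (intro degree_diff_le) auto
      fix i
      let ?cs = "coeff (lpoly d (P s) ?a e2) i" and ?ct = "coeff (lpoly d (P t) ?a e2) i"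
      let ?hs = "hpoly d (P s) ?a" and ?ht = "hpoly d (P t) ?a"
      have eq: "coeff (rpoly (?S s) - rpoly (?S t)) i = (?cs - ?ct) * inverse ?hs + ?ct * ((?ht - ?hs) * (inverse ?hs * inverse ?ht))"
      proof -
        have alg: "x * inverse h - y * inverse g = (x - y) * inverse h + y * ((g - h) * (inverse h * inverse g))"
          if "h \<noteq> 0" "g \<noteq> 0" for x y h g :: complex using that by (simp add: field_simps)
        show ?thesis unfolding coeff_diff co[OF nza(1)] co[OF nza(2)] by (rule alg[OF nza])
      qed
      have "norm (coeff (rpoly (?S s) - rpoly (?S t)) i) \<le> norm (?cs - ?ct) * norm (inverse ?hs) + norm ?ct * (norm (?ht - ?hs) * (norm (inverse ?hs) * norm (inverse ?ht)))"
        unfolding eq by (rule order_trans[OF norm_triangle_ineq]) (simp only: norm_mult order_refl)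
      also have "\<dots> \<le> (Lc * \<bar>t - s\<bar>) * (2 / c0) + Mc * ((Lc * \<bar>t - s\<bar>) * ((2 / c0) * (2 / c0)))"
      proof -
        have c1: "norm (?cs - ?ct) \<le> Lc * \<bar>t - s\<bar>" using coeff_lip[OF o l(1) s t, of i] by (simp only: abs_minus_commute)
        have c2: "norm (?ht - ?hs) \<le> Lc * \<bar>t - s\<bar>" by (rule hpoly_lip[OF o l(1) t s])
        have n1: "0 \<le> Lc * \<bar>t - s\<bar>" "0 \<le> 2 / c0" using Lc_nonneg c0 by auto
        show ?thesis
          by (rule add_mono[OF mult_mono[OF c1 inv[OF bs] n1(1) norm_ge_zero]
              mult_mono[OF cb[OF o l(1) t] mult_mono[OF c2 mult_mono[OF inv[OF bs] inv[OF bt] n1(2) norm_ge_zero] n1(1)] Mc]])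
            (auto intro!: mult_nonneg_nonneg)
      qed
      finally show "norm (coeff (rpoly (?S s) - rpoly (?S t)) i) \<le> (Lc * (2 / c0) + Mc * (Lc * ((2 / c0) * (2 / c0)))) * \<bar>t - s\<bar>"
        by (simp add: algebra_simps)
    qed
    also have "\<dots> \<le> Kc * \<bar>t - s\<bar>" by (simp add: Kc_def algebra_simps)
    also have "\<dots> \<le> Kc * (\<delta>1 / Kc)" using st Kc by (intro mult_left_mono) (auto simp: \<delta>_def)
    also have "\<dots> = \<delta>1" using Kc by simp
    finally have "matched (e / Lp) (?S s) (?S t)"
      by (intro rc szS) (use rb[OF s bs] rb[OF t bt] in auto)
    then have m: "matchd (?S s) (?S t) \<le> e / Lp" using e Lp by (intro matchd_le) auto
    have "matchd (zeroset d (P s) ?a e2) (zeroset d (P t) ?a e2) \<le> Lp * matchd (?S s) (?S t) + 0"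
      unfolding zeroset_def
      by (rule matchd_image) (use szS Lp chart_lipschitz[OF o l(1)] in \<open>auto simp: Lp_def\<close>)
    also have "\<dots> \<le> Lp * (e / Lp) + 0" using m Lp by (intro add_right_mono mult_left_mono) auto
    also have "\<dots> = e" using Lp by simp
    finally show ?thesis using ch[OF nz(1) nza(1)] ch[OF nz(2) nza(2)] by simp
  qed
  show ?thesis by (rule exI[of _ \<delta>], rule conjI[OF \<delta>], intro allI impI, rule main)
qed

end

section \<open>Almost every line is in general position\<close>

text \<open>Fubini for the set of (b, s) with \<open>b + s v\<close> in \<open>S\<close>. For fixed
  \<open>b\<close> the section is finite, so the set is null; for fixed \<open>s\<close> the section
  is a translate of \<open>S\<close>, so its measure is also that of \<open>S\<close> times the
  infinite length of the real line.\<close>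

lemma null_of_finite_fibres:
  fixes S :: "'a::euclidean_space set"
  assumes S: "S \<in> sets borel" and fin: "\<And>b. finite {s::real. b + s *\<^sub>R v \<in> S}"
  shows "S \<in> null_sets lborel"
proof -
  define A where "A = {p \<in> space ((lborel :: 'a measure) \<Otimes>\<^sub>M (lborel :: real measure)). fst p + snd p *\<^sub>R v \<in> S}"
  have A: "A \<in> sets (lborel \<Otimes>\<^sub>M lborel)" unfolding A_def by measurable (use S in measurable)
  have "emeasure (lborel \<Otimes>\<^sub>M lborel) A = (\<integral>\<^sup>+b. emeasure lborel (Pair b -` A) \<partial>lborel)"
    by (rule lborel.emeasure_pair_measure_alt[OF A])
  also have "\<dots> = 0"
  proof -
    have "emeasure lborel (Pair b -` A) = 0" for b
    proof -
      have "Pair b -` A = {s. b + s *\<^sub>R v \<in> S}" by (auto simp: A_def space_pair_measure)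
      then show ?thesis using fin[of b] by (simp add: emeasure_lborel_countable countable_finite)
    qed
    then show ?thesis by simp
  qed
  finally have "0 = emeasure (lborel \<Otimes>\<^sub>M lborel) A" ..
  also have "\<dots> = (\<integral>\<^sup>+s. emeasure lborel ((\<lambda>b. (b, s)) -` A) \<partial>lborel)" by (rule lborel_pair.emeasure_pair_measure_alt2[OF A])
  also have "\<dots> = (\<integral>\<^sup>+s. emeasure lborel S \<partial>(lborel :: real measure))"
  proof (rule nn_integral_cong)
    fix s :: real
    have "(\<lambda>b. (b, s)) -` A = (+) (s *\<^sub>R v) -` S \<inter> space lborel" by (auto simp: A_def space_pair_measure add.commute)
    then have "emeasure lborel ((\<lambda>b. (b, s)) -` A) = emeasure (distr lborel borel ((+) (s *\<^sub>R v))) S"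
      using S by (simp add: emeasure_distr)
    then show "emeasure lborel ((\<lambda>b. (b, s)) -` A) = emeasure lborel S" by (simp add: lborel_distr_plus)
  qed
  also have "\<dots> = emeasure lborel S * \<infinity>" by simp
  finally show ?thesis using S by (auto simp: null_sets_def ennreal_mult_top split: if_splits)
qed

lemma continuous_hpoly: "continuous_on UNIV (hpoly d c)"
  unfolding hpoly_def by (intro continuous_intros)

lemma sets_gauss [measurable_cong]: "sets gauss = sets borel"
  by (simp add: gauss_def)

lemma sigma_finite_gauss: "sigma_finite_measure gauss"
  unfolding gauss_def by (subst sigma_finite_measure.sigma_finite_iff_density_finite[OF lborel.sigma_finite_measure_axioms]) auto

lemma AE_gauss_notin:
  assumes "S \<in> sets borel" "\<And>b. finite {s::real. b + s *\<^sub>R v \<in> S}"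
  shows "AE x in gauss. x \<notin> S"
  unfolding gauss_def using AE_not_in[OF null_of_finite_fibres[OF assms]] by (subst AE_density) auto

lemma AE_hpoly_nonzero:
  assumes "hpoly d c v \<noteq> 0"
  shows "AE a in gauss. hpoly d c a \<noteq> 0"
proof -
  have cl: "closed {a. hpoly d c a = 0}"
    using continuous_closed_vimage[of "{0}" "hpoly d c"] continuous_hpoly[of d c]
    by (simp add: vimage_def continuous_on_eq_continuous_at)
  have "finite {s::real. b + s *\<^sub>R v \<in> {a. hpoly d c a = 0}}" for b
  proof -
    have "lpoly d c v b \<noteq> 0" using assms by (rule lpoly_roots(3))
    then have "finite {s. poly (lpoly d c v b) s = 0}" by (rule poly_roots_finite)
    then have "finite ((of_real :: real \<Rightarrow> complex) -` {s. poly (lpoly d c v b) s = 0})"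
      by (rule finite_vimageI) (simp add: inj_def)
    moreover have "(of_real s :: complex) *s v = s *\<^sub>R v" for s
      by (simp add: vec_eq_iff scaleR_conv_of_real[where 'a=complex])
    ultimately show ?thesis by (simp add: vimage_def poly_lpoly add.commute)
  qed
  from AE_gauss_notin[OF borel_closed[OF cl] this] show ?thesis by simp
qed

lemma lin_indep2_minor:
  fixes a b :: "complex^'n::finite"
  assumes "a $ i * b $ j \<noteq> a $ j * b $ i"
  shows "lin_indep2 a b"
  unfolding lin_indep2_def
proof (intro allI impI)
  fix \<alpha> \<beta> assume "\<alpha> *s a + \<beta> *s b = 0"
  then have e: "\<alpha> * a $ k + \<beta> * b $ k = 0" for k by (simp add: vec_eq_iff)
  have "\<beta> * (a $ i * b $ j - a $ j * b $ i) = 0" using e[of i] e[of j] by algebra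
  moreover have "\<alpha> * (a $ i * b $ j - a $ j * b $ i) = 0" using e[of i] e[of j] by algebra
  ultimately show "\<alpha> = 0 \<and> \<beta> = 0" using assms by simp
qed

text \<open>Take \<open>i\<close> with \<open>a $ i \<noteq> 0\<close> and some
  \<open>j \<noteq> i\<close>: along the j-th axis, equality of the two products pins down
  \<open>b $ j\<close>.\<close>

lemma AE_minor:
  fixes a :: "complex^'n::finite"
  assumes "CARD('n) \<ge> 2" "a \<noteq> 0"
  shows "AE b :: complex^'n in gauss. \<exists>i j. a $ i * b $ j \<noteq> a $ j * b $ i"
proof -
  obtain i where i: "a $ i \<noteq> 0" using assms(2) by (auto simp: vec_eq_iff)
  have "UNIV \<noteq> {i}"
  proof
    assume "UNIV = {i}"
    then have "CARD('n) = card {i}" by simp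
    then show False using assms(1) by simp
  qed
  then obtain j where j: "j \<noteq> i" by auto
  have "closed {b :: complex^'n. a $ i * b $ j = a $ j * b $ i}" by (intro closed_Collect_eq continuous_intros)
  moreover have "finite {s::real. b + s *\<^sub>R axis j 1 \<in> {b :: complex^'n. a $ i * b $ j = a $ j * b $ i}}" for b
  proof (rule finite_subset)
    show "{s::real. b + s *\<^sub>R axis j 1 \<in> {b :: complex^'n. a $ i * b $ j = a $ j * b $ i}} \<subseteq>
       of_real -` {a $ j * b $ i / a $ i - b $ j}"
      using i j by (auto simp: axis_def field_simps scaleR_conv_of_real[where 'a=complex])
  qed (rule finite_vimageI, auto simp: inj_def)
  ultimately have "AE b in gauss. b \<notin> {b :: complex^'n. a $ i * b $ j = a $ j * b $ i}" by (intro AE_gauss_notin borel_closed)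
  then show ?thesis by (rule AE_mp) (auto intro!: AE_I2)
qed

lemma AE_general_position:
  fixes c :: "('n::finite \<Rightarrow> nat) \<Rightarrow> complex"
  assumes card: "CARD('n) \<ge> 2" and d: "1 \<le> d" and v: "hpoly d c v \<noteq> 0"
  shows "AE ab in gauss \<Otimes>\<^sub>M gauss. hpoly d c (fst ab) \<noteq> 0 \<and> lin_indep2 (fst ab) (snd ab)"
proof -
  interpret g: sigma_finite_measure "gauss :: (complex^'n) measure" by (rule sigma_finite_gauss)
  interpret pair_sigma_finite "gauss :: (complex^'n) measure" "gauss :: (complex^'n) measure" ..
  let ?G = "gauss \<Otimes>\<^sub>M gauss :: ((complex^'n) \<times> (complex^'n)) measure"
  have G: "sets ?G = sets borel" by (simp only: sets_pair_measure_cong[OF sets_gauss sets_gauss] borel_prod)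
  have "AE ab in ?G. hpoly d c (fst ab) \<noteq> 0 \<and> (\<exists>i j. (fst ab :: complex^'n) $ i * (snd ab :: complex^'n) $ j \<noteq> (fst ab :: complex^'n) $ j * (snd ab :: complex^'n) $ i)"
  proof (rule AE_pair_measure)
    have "continuous_on UNIV (\<lambda>ab :: ((complex^'n) \<times> (complex^'n)). hpoly d c (fst ab))"
      by (rule continuous_on_compose2[OF continuous_hpoly]) (auto intro!: continuous_intros)
    then have "open {ab :: ((complex^'n) \<times> (complex^'n)). hpoly d c (fst ab) \<noteq> 0}"
      by (rule open_Collect_neq) (intro continuous_intros)
    moreover have "open {ab :: ((complex^'n) \<times> (complex^'n)). \<exists>i j. (fst ab :: complex^'n) $ i * (snd ab :: complex^'n) $ j \<noteq> (fst ab :: complex^'n) $ j * (snd ab :: complex^'n) $ i}"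
      unfolding Collect_ex_eq by (intro open_UN ballI open_Collect_neq continuous_intros)
    ultimately have "open {ab :: ((complex^'n) \<times> (complex^'n)). hpoly d c (fst ab) \<noteq> 0 \<and> (\<exists>i j. (fst ab :: complex^'n) $ i * (snd ab :: complex^'n) $ j \<noteq> (fst ab :: complex^'n) $ j * (snd ab :: complex^'n) $ i)}"
      by (simp only: Collect_conj_eq open_Int)
    then show "{ab \<in> space ?G. hpoly d c (fst ab) \<noteq> 0 \<and> (\<exists>i j. (fst ab :: complex^'n) $ i * (snd ab :: complex^'n) $ j \<noteq> (fst ab :: complex^'n) $ j * (snd ab :: complex^'n) $ i)} \<in> sets ?G"
      using borel_open unfolding G by (simp add: space_pair_measure gauss_def)
    show "AE a in gauss. AE b in gauss. hpoly d c (fst (a, b)) \<noteq> 0 \<and>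
        (\<exists>i j. (fst (a, b) :: complex^'n) $ i * (snd (a, b) :: complex^'n) $ j \<noteq> (fst (a, b) :: complex^'n) $ j * (snd (a, b) :: complex^'n) $ i)"
      using AE_hpoly_nonzero[OF v]
    proof (rule eventually_mono)
      fix a :: "complex^'n" assume a: "hpoly d c a \<noteq> 0"
      have "hpoly d c 0 = 0" using hpoly_scale[of d c 0 0] d by (simp add: power_0_left)
      then have "a \<noteq> 0" using a by auto
      from AE_minor[OF card this] show "AE b in gauss. hpoly d c (fst (a, b)) \<noteq> 0 \<and>
        (\<exists>i j. (fst (a, b) :: complex^'n) $ i * (snd (a, b) :: complex^'n) $ j \<noteq> (fst (a, b) :: complex^'n) $ j * (snd (a, b) :: complex^'n) $ i)"
        using a by simp
    qed
  qed
  then show ?thesis by (rule eventually_mono) (use lin_indep2_minor in blast)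
qed

section \<open>Measurable enumeration of the zeros\<close>

text \<open>By compactness a zero exists exactly when a countable dense subset of \<open>K\<close>
  takes arbitrarily small values; this replaces an uncountable union by countable
  operations.\<close>

lemma sets_zero_in_compact:
  fixes F :: "'x \<Rightarrow> complex \<Rightarrow> real"
  assumes K: "compact K" and cont: "\<And>x. x \<in> space M \<Longrightarrow> continuous_on K (F x)"
    and meas: "\<And>z. (\<lambda>x. F x z) \<in> borel_measurable M" and nonneg: "\<And>x z. 0 \<le> F x z"
  shows "{x \<in> space M. \<exists>z\<in>K. F x z = 0} \<in> sets M"
proof -
  obtain D where D: "countable D" "D \<subseteq> K" "K \<subseteq> closure D" using separable[of K] by blast
  have "(\<exists>z\<in>K. F x z = 0) \<longleftrightarrow> (\<forall>n::nat. \<exists>z\<in>D. F x z < 1 / real (Suc n))" if x: "x \<in> space M" for x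
  proof
    assume "\<exists>z\<in>K. F x z = 0"
    then obtain z where z: "z \<in> K" "F x z = 0" by blast
    show "\<forall>n::nat. \<exists>z\<in>D. F x z < 1 / real (Suc n)"
    proof
      fix n :: nat
      have "0 < 1 / real (Suc n)" by simp
      then obtain \<delta> where \<delta>: "0 < \<delta>" "\<And>w. w \<in> K \<Longrightarrow> dist w z < \<delta> \<Longrightarrow> dist (F x w) (F x z) < 1 / real (Suc n)"
        using cont[OF x] z(1) unfolding continuous_on_iff by blast
      obtain w where "w \<in> D" "dist w z < \<delta>" using D(3) z(1) \<delta>(1) by (metis closure_approachable subset_iff)
      then show "\<exists>z\<in>D. F x z < 1 / real (Suc n)" using \<delta>(2)[of w] D(2) z(2) nonneg[of x w] by (intro bexI[of _ w]) (auto simp: dist_real_def)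
    qed
  next
    assume A: "\<forall>n::nat. \<exists>z\<in>D. F x z < 1 / real (Suc n)"
    then have "K \<noteq> {}" using D(2) by blast
    then obtain z where z: "z \<in> K" "\<And>w. w \<in> K \<Longrightarrow> F x z \<le> F x w"
      using continuous_attains_inf[OF K _ cont[OF x]] by blast
    have "\<not> 0 < F x z"
    proof
      assume "0 < F x z"
      then obtain n where "1 / real (Suc n) < F x z" using nat_approx_posE by blast
      moreover obtain w where "w \<in> D" "F x w < 1 / real (Suc n)" using A by blast
      ultimately show False using z(2)[of w] D(2) by auto
    qed
    then show "\<exists>z\<in>K. F x z = 0" using z(1) nonneg[of x z] by force
  qed
  then have "{x \<in> space M. \<exists>z\<in>K. F x z = 0} = {x \<in> space M. \<forall>n::nat. \<exists>z\<in>D. F x z < 1 / real (Suc n)}" by blast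
  also have "\<dots> \<in> sets M"
    using D(1) meas by measurable
  finally show ?thesis .
qed

text \<open>The minimum is at most \<open>y\<close> exactly when there is a zero in the closed set
  where \<open>g \<le> y\<close>, which is exhausted by compact sets.\<close>

lemma borel_measurable_Min_zeros:
  fixes F :: "'x \<Rightarrow> complex \<Rightarrow> real" and g :: "complex \<Rightarrow> real"
  assumes cont: "\<And>x. x \<in> space M \<Longrightarrow> continuous_on UNIV (F x)"
    and meas: "\<And>z. (\<lambda>x. F x z) \<in> borel_measurable M" and nonneg: "\<And>x z. 0 \<le> F x z"
    and g: "continuous_on UNIV g"
    and zeros: "\<And>x. x \<in> space M \<Longrightarrow> finite {z. F x z = 0}" "\<And>x. x \<in> space M \<Longrightarrow> {z. F x z = 0} \<noteq> {}"
  shows "(\<lambda>x. Min (g ` {z. F x z = 0})) \<in> borel_measurable M"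
proof (rule borel_measurableI_le)
  fix y
  have cl: "closed {z. g z \<le> y}" by (rule closed_Collect_le) (auto intro: g continuous_intros)
  have "{x \<in> space M. Min (g ` {z. F x z = 0}) \<le> y} =
      (\<Union>N::nat. {x \<in> space M. \<exists>z\<in>cball 0 (real N) \<inter> {z. g z \<le> y}. F x z = 0})"
  proof (rule set_eqI)
    fix x
    have "Min (g ` {z. F x z = 0}) \<le> y \<longleftrightarrow> (\<exists>N::nat. \<exists>z\<in>cball 0 (real N) \<inter> {z. g z \<le> y}. F x z = 0)" if x: "x \<in> space M"
    proof -
      have "Min (g ` {z. F x z = 0}) \<le> y \<longleftrightarrow> (\<exists>z. F x z = 0 \<and> g z \<le> y)"
        using zeros[OF x] by (subst Min_le_iff) auto
      also have "\<dots> \<longleftrightarrow> (\<exists>N::nat. \<exists>z\<in>cball 0 (real N) \<inter> {z. g z \<le> y}. F x z = 0)"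
      proof
        assume "\<exists>z. F x z = 0 \<and> g z \<le> y"
        then obtain z where "F x z = 0" "g z \<le> y" by blast
        moreover obtain N :: nat where "norm z \<le> real N" using real_arch_simple by blast
        ultimately show "\<exists>N::nat. \<exists>z\<in>cball 0 (real N) \<inter> {z. g z \<le> y}. F x z = 0"
          by (intro exI[of _ N] bexI[of _ z]) auto
      qed blast
      finally show ?thesis .
    qed
    then show "x \<in> {x \<in> space M. Min (g ` {z. F x z = 0}) \<le> y} \<longleftrightarrow>
        x \<in> (\<Union>N::nat. {x \<in> space M. \<exists>z\<in>cball 0 (real N) \<inter> {z. g z \<le> y}. F x z = 0})" by blast
  qed
  also have "\<dots> \<in> sets M"
    by (intro sets.countable_UN image_subsetI sets_zero_in_compact[OF compact_Int_closed[OF compact_cball cl]]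
        continuous_on_subset[OF cont] meas nonneg) auto
  finally show "{x \<in> space M. Min (g ` {z. F x z = 0}) \<le> y} \<in> sets M" .
qed

text \<open>The lexicographically first root: least real part, then least imaginary part among the
  roots with that real part.\<close>

lemma measurable_root:
  fixes p :: "'x \<Rightarrow> complex poly"
  assumes coeffs: "\<And>j. (\<lambda>x. coeff (p x) j) \<in> borel_measurable M"
    and deg: "\<And>x. x \<in> space M \<Longrightarrow> degree (p x) = Suc m"
  shows "\<exists>z\<in>borel_measurable M. \<forall>x\<in>space M. poly (p x) (z x) = 0"
proof -
  define S where "S x = {z. norm (poly (p x) z) = 0}" for x
  define re where "re x = Min (Re ` S x)" for x
  \<comment> \<open>The zeros of \<open>F x\<close> are the roots of least real part, so the same
    lemma serves for the second minimisation.\<close>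
  define F where "F x z = norm (poly (p x) z) + \<bar>Re z - re x\<bar>" for x z
  define im where "im x = Min (Im ` {z. F x z = 0})" for x
  have S: "finite (S x)" "S x \<noteq> {}" if "x \<in> space M" for x
  proof -
    have "p x \<noteq> 0" using deg[OF that] by auto
    then show "finite (S x)" using poly_roots_finite[of "p x"] by (simp add: S_def)
    have "\<not> constant (poly (p x))" using deg[OF that] by (simp add: constant_degree)
    then show "S x \<noteq> {}" using fundamental_theorem_of_algebra[of "p x"] by (auto simp: S_def)
  qed
  have poly_meas [measurable]: "(\<lambda>x. norm (poly (p x) z)) \<in> borel_measurable M" for z
  proof -
    have "(\<lambda>x. \<Sum>i\<le>Suc m. coeff (p x) i * z ^ i) \<in> borel_measurable M"
      by (intro borel_measurable_sum borel_measurable_times coeffs borel_measurable_const)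
    then have "(\<lambda>x. poly (p x) z) \<in> borel_measurable M"
      by (rule measurable_cong[THEN iffD1, rotated]) (simp add: poly_altdef deg)
    then show ?thesis by measurable
  qed
  have re [measurable]: "re \<in> borel_measurable M"
    unfolding re_def[abs_def] S_def
    by (rule borel_measurable_Min_zeros) (use S in \<open>auto simp: S_def intro!: continuous_intros\<close>)
  have Z: "{z. F x z = 0} = {z \<in> S x. Re z = re x}" for x
    by (auto simp: F_def S_def add_nonneg_eq_0_iff)
  have Z1: "finite {z. F x z = 0}" "{z. F x z = 0} \<noteq> {}" if "x \<in> space M" for x
  proof -
    show "finite {z. F x z = 0}" unfolding Z using S(1)[OF that] by simp
    have "re x \<in> Re ` S x" unfolding re_def using S[OF that] by (intro Min_in) auto
    then show "{z. F x z = 0} \<noteq> {}" unfolding Z by auto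
  qed
  have im [measurable]: "im \<in> borel_measurable M"
    unfolding im_def[abs_def]
    by (rule borel_measurable_Min_zeros) (use Z1 in \<open>auto simp: F_def intro!: continuous_intros\<close>)
  show ?thesis
  proof (intro bexI ballI)
    show "(\<lambda>x. Complex (re x) (im x)) \<in> borel_measurable M"
      unfolding borel_measurable_complex_iff by simp
    fix x assume x: "x \<in> space M"
    have "im x \<in> Im ` {z. F x z = 0}" unfolding im_def using Z1[OF x] by (intro Min_in) auto
    then obtain z where "z \<in> S x" "Re z = re x" "Im z = im x" unfolding Z by auto
    moreover from this have "Complex (re x) (im x) = z" by (simp add: complex_eq_iff)
    ultimately show "poly (p x) (Complex (re x) (im x)) = 0" by (simp add: S_def)
  qed
qed

text \<open>One measurable root is divided off at a time. The quotient has measurable coefficients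
  by the synthetic division recursion, started above the degree, where they vanish.\<close>

lemma measurable_roots:
  fixes p :: "'x \<Rightarrow> complex poly"
  assumes "\<And>j. (\<lambda>x. coeff (p x) j) \<in> borel_measurable M"
    and "\<And>x. x \<in> space M \<Longrightarrow> degree (p x) = m \<and> p x \<noteq> 0"
  shows "\<exists>r. (\<forall>i. r i \<in> borel_measurable M) \<and> (\<forall>x\<in>space M. proots (p x) = mset (map (\<lambda>i. r i x) [0..<m]))"
  using assms
proof (induction m arbitrary: p)
  case 0
  have "proots (p x) = {#}" if "x \<in> space M" for x
  proof -
    have "degree (p x) = 0" using "0.prems"(2)[OF that] by blast
    then show ?thesis by (auto elim!: degree_eq_zeroE)
  qed
  then show ?case by (intro exI[of _ "\<lambda>i x. 0"]) auto
next
  case (Suc m)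
  obtain z where z: "z \<in> borel_measurable M" "\<And>x. x \<in> space M \<Longrightarrow> poly (p x) (z x) = 0"
    using measurable_root[of p M m] Suc.prems by blast
  define s where "s x = synthetic_div (p x) (z x)" for x
  have s: "p x = [:- z x, 1:] * s x" if "x \<in> space M" for x
    using synthetic_div_correct'[of "z x" "p x"] z(2)[OF that] by (simp add: s_def)
  have s0: "degree (s x) = m \<and> s x \<noteq> 0" if "x \<in> space M" for x
  proof -
    have "s x \<noteq> 0" using s[OF that] Suc.prems(2)[OF that] by auto
    moreover have "degree (s x) = m" using Suc.prems(2)[OF that] by (simp add: s_def degree_synthetic_div)
    ultimately show ?thesis by blast
  qed
  have rec: "coeff (s x) j = coeff (p x) (Suc j) + z x * coeff (s x) (Suc j)" if "x \<in> space M" for x j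
    unfolding s[OF that] by simp
  have big: "(\<lambda>x. coeff (s x) j) \<in> borel_measurable M" if "m < j" for j
    by (rule measurable_cong[THEN iffD1, of _ "\<lambda>_. 0"]) (use s0 that in \<open>auto simp: coeff_eq_0\<close>)
  have coeffs: "(\<lambda>x. coeff (s x) j) \<in> borel_measurable M" for j
  proof (cases "j \<le> Suc m")
    case True
    then show ?thesis
    proof (induction rule: inc_induct)
      case base
      show ?case by (rule big) simp
    next
      case (step j)
      have "(\<lambda>x. coeff (p x) (Suc j) + z x * coeff (s x) (Suc j)) \<in> borel_measurable M"
        by (intro borel_measurable_add borel_measurable_times Suc.prems(1) z(1) step.IH)
      then show ?case by (rule measurable_cong[THEN iffD1, rotated]) (simp add: rec[of _ j])
    qed
  qed (use big in simp)
  from Suc.IH[OF coeffs s0] obtain r where r: "\<And>i. r i \<in> borel_measurable M"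
    "\<And>x. x \<in> space M \<Longrightarrow> proots (s x) = mset (map (\<lambda>i. r i x) [0..<m])" by blast
  show ?case
  proof (intro exI[of _ "\<lambda>i. if i < m then r i else z"] conjI allI ballI)
    fix x assume x: "x \<in> space M"
    have "proots (p x) = add_mset (z x) (proots (s x))"
      unfolding s[OF x] using s0[OF x] by (subst proots_mult) auto
    also have "proots (s x) = mset (map (\<lambda>i. r i x) [0..<m])" by (rule r(2)[OF x])
    also have "map (\<lambda>i. r i x) [0..<m] = map (\<lambda>i. (if i < m then r i else z) x) [0..<m]" by simp
    also have "add_mset (z x) (mset \<dots>) = mset (map (\<lambda>i. (if i < m then r i else z) x) [0..<Suc m])" by simp
    finally show "proots (p x) = mset (map (\<lambda>i. (if i < m then r i else z) x) [0..<Suc m])" .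
  qed (use r(1) z(1) in auto)
qed

section \<open>Measurable optimal matchings\<close>

lemma matched_iff_permutes:
  "matched r (mset (map X [0..<m])) (mset (map Y [0..<m])) \<longleftrightarrow>
    (\<exists>\<sigma>. \<sigma> permutes {..<m} \<and> (\<forall>i<m. dist (X i) (Y (\<sigma> i)) \<le> r))"
proof
  assume "matched r (mset (map X [0..<m])) (mset (map Y [0..<m]))"
  then obtain xs ys where xy: "mset xs = mset (map X [0..<m])" "mset ys = mset (map Y [0..<m])"
    "list_all2 (\<lambda>x y. dist x y \<le> r) xs ys" unfolding rel_mset_def by blast
  from list_all2_reorder_left_invariance[OF xy(3) xy(1)[symmetric]] obtain ys' where
    ys': "list_all2 (\<lambda>x y. dist x y \<le> r) (map X [0..<m]) ys'" "mset ys' = mset (map Y [0..<m])" using xy(2) by auto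
  from mset_eq_permutation[OF ys'(2)] obtain \<sigma> where \<sigma>: "\<sigma> permutes {..<length (map Y [0..<m])}"
    "permute_list \<sigma> (map Y [0..<m]) = ys'" by blast
  have "dist (X i) (Y (\<sigma> i)) \<le> r" if "i < m" for i
  proof -
    have "\<sigma> i < m" using permutes_in_image[OF \<sigma>(1), of i] that by simp
    then have "ys' ! i = Y (\<sigma> i)" unfolding \<sigma>(2)[symmetric] using permute_list_nth[OF \<sigma>(1), of i] that by simp
    then show ?thesis using list_all2_nthD[OF ys'(1), of i] that by simp
  qed
  then show "\<exists>\<sigma>. \<sigma> permutes {..<m} \<and> (\<forall>i<m. dist (X i) (Y (\<sigma> i)) \<le> r)" using \<sigma>(1) by auto
next
  assume "\<exists>\<sigma>. \<sigma> permutes {..<m} \<and> (\<forall>i<m. dist (X i) (Y (\<sigma> i)) \<le> r)"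
  then obtain \<sigma> where \<sigma>: "\<sigma> permutes {..<m}" "\<And>i. i < m \<Longrightarrow> dist (X i) (Y (\<sigma> i)) \<le> r" by blast
  have p: "\<sigma> permutes {..<length (map Y [0..<m])}" using \<sigma>(1) by simp
  have "list_all2 (\<lambda>x y. dist x y \<le> r) (map X [0..<m]) (permute_list \<sigma> (map Y [0..<m]))"
  proof (rule list_all2_all_nthI)
    fix i assume i: "i < length (map X [0..<m])"
    then have "\<sigma> i < m" using permutes_in_image[OF \<sigma>(1), of i] by simp
    then show "dist (map X [0..<m] ! i) (permute_list \<sigma> (map Y [0..<m]) ! i) \<le> r"
      using permute_list_nth[OF p, of i] i \<sigma>(2)[of i] by simp
  qed simp
  then show "matched r (mset (map X [0..<m])) (mset (map Y [0..<m]))"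
    unfolding rel_mset_def using mset_permute_list[OF p] by blast
qed

text \<open>There are finitely many permutations, so the infimum is attained: otherwise the best of
  them would exceed it by a positive amount.\<close>

lemma optimal_permutation:
  "\<exists>\<sigma>. \<sigma> permutes {..<m} \<and> (\<forall>i<m. dist (X i) (Y (\<sigma> i)) \<le> matchd (mset (map X [0..<m])) (mset (map Y [0..<m])))"
proof (rule ccontr)
  define r where "r = matchd (mset (map X [0..<m])) (mset (map Y [0..<m]))"
  let ?S = "{\<sigma>. \<sigma> permutes {..<m}}"
  assume "\<not> ?thesis"
  then have "\<forall>\<sigma>\<in>?S. \<exists>i. i < m \<and> r < dist (X i) (Y (\<sigma> i))" unfolding r_def by (auto simp: not_le)
  then obtain g where g: "\<And>\<sigma>. \<sigma> \<in> ?S \<Longrightarrow> g \<sigma> < m \<and> r < dist (X (g \<sigma>)) (Y (\<sigma> (g \<sigma>)))" by metis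
  define s where "s = Min ((\<lambda>\<sigma>. dist (X (g \<sigma>)) (Y (\<sigma> (g \<sigma>)))) ` ?S)"
  have fin: "finite ?S" by (rule finite_permutations) simp
  have ne: "?S \<noteq> {}" using permutes_id[of "{..<m}"] by blast
  have rs: "r < s" unfolding s_def using fin ne g by (subst Min_gr_iff) auto
  then have "matched ((r + s) / 2) (mset (map X [0..<m])) (mset (map Y [0..<m]))"
    by (intro matchd_matched) (auto simp: r_def)
  then obtain \<sigma> where \<sigma>: "\<sigma> \<in> ?S" "\<And>i. i < m \<Longrightarrow> dist (X i) (Y (\<sigma> i)) \<le> (r + s) / 2"
    unfolding matched_iff_permutes by blast
  have "s \<le> dist (X (g \<sigma>)) (Y (\<sigma> (g \<sigma>)))" unfolding s_def using fin \<sigma>(1) by (intro Min_le) auto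
  then show False using \<sigma>(2)[of "g \<sigma>"] g[OF \<sigma>(1)] rs by auto
qed

lemma matchd_le_iff_permutes:
  assumes "0 \<le> r"
  shows "matchd (mset (map X [0..<m])) (mset (map Y [0..<m])) \<le> r \<longleftrightarrow>
    (\<exists>\<sigma>\<in>{\<sigma>. \<sigma> permutes {..<m}}. \<forall>i\<in>{..<m}. dist (X i) (Y (\<sigma> i)) \<le> r)"
proof
  assume le: "matchd (mset (map X [0..<m])) (mset (map Y [0..<m])) \<le> r"
  obtain \<sigma> where "\<sigma> permutes {..<m}" "\<forall>i<m. dist (X i) (Y (\<sigma> i)) \<le> matchd (mset (map X [0..<m])) (mset (map Y [0..<m]))"
    using optimal_permutation[of m X Y] by blast
  then show "\<exists>\<sigma>\<in>{\<sigma>. \<sigma> permutes {..<m}}. \<forall>i\<in>{..<m}. dist (X i) (Y (\<sigma> i)) \<le> r" using le by force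
next
  assume "\<exists>\<sigma>\<in>{\<sigma>. \<sigma> permutes {..<m}}. \<forall>i\<in>{..<m}. dist (X i) (Y (\<sigma> i)) \<le> r"
  then have "matched r (mset (map X [0..<m])) (mset (map Y [0..<m]))" unfolding matched_iff_permutes by blast
  then show "matchd (mset (map X [0..<m])) (mset (map Y [0..<m])) \<le> r" by (rule matchd_le[OF assms])
qed

lemma borel_measurable_matchd:
  fixes X Y :: "nat \<Rightarrow> 'x \<Rightarrow> 'a :: {metric_space, second_countable_topology}"
  assumes X: "\<And>i. X i \<in> borel_measurable M" and Y: "\<And>i. Y i \<in> borel_measurable M"
  shows "(\<lambda>x. matchd (mset (map (\<lambda>i. X i x) [0..<m])) (mset (map (\<lambda>i. Y i x) [0..<m]))) \<in> borel_measurable M"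
proof (rule borel_measurableI_le)
  fix r
  let ?f = "\<lambda>x. matchd (mset (map (\<lambda>i. X i x) [0..<m])) (mset (map (\<lambda>i. Y i x) [0..<m]))"
  show "{x \<in> space M. ?f x \<le> r} \<in> sets M"
  proof (cases "0 \<le> r")
    case True
    have "{x \<in> space M. \<exists>\<sigma>\<in>{\<sigma>. \<sigma> permutes {..<m}}. \<forall>i\<in>{..<m}. dist (X i x) (Y (\<sigma> i) x) \<le> r} \<in> sets M"
    proof (intro sets.sets_Collect_finite_Ex sets.sets_Collect_finite_All)
      fix \<sigma> i
      show "{x \<in> space M. dist (X i x) (Y (\<sigma> i) x) \<le> r} \<in> sets M"
        using borel_measurable_dist[OF X[of i] Y[of "\<sigma> i"]] by measurable
    qed (auto intro: finite_permutations)
    then show ?thesis by (simp only: matchd_le_iff_permutes[OF True])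
  next
    case False
    have f0: "0 \<le> ?f x" for x by (intro matchd_nonneg) simp
    have "\<not> ?f x \<le> r" for x using f0[of x] False by linarith
    then show ?thesis by simp
  qed
qed

text \<open>The permutations are enumerated and the first optimal one is taken; the least such index
  is a measurable function with countably many values.\<close>

lemma measurable_optimal_permutation:
  fixes X Y :: "nat \<Rightarrow> 'x \<Rightarrow> 'a :: {metric_space, second_countable_topology}"
  assumes X: "\<And>i. X i \<in> borel_measurable M" and Y: "\<And>i. Y i \<in> borel_measurable M"
  shows "\<exists>\<tau>. (\<forall>i. (\<lambda>x. Y (\<tau> x i) x) \<in> borel_measurable M) \<and> (\<forall>x. \<tau> x permutes {..<m} \<and>
     (\<forall>i<m. dist (X i x) (Y (\<tau> x i) x) \<le> matchd (mset (map (\<lambda>i. X i x) [0..<m])) (mset (map (\<lambda>i. Y i x) [0..<m]))))"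
proof -
  let ?S = "{\<sigma>. \<sigma> permutes {..<m}}"
  let ?f = "\<lambda>x. matchd (mset (map (\<lambda>i. X i x) [0..<m])) (mset (map (\<lambda>i. Y i x) [0..<m]))"
  have cS: "countable ?S" by (intro countable_finite finite_permutations) simp
  have ne: "?S \<noteq> {}" using permutes_id[of "{..<m}"] by blast
  define s where "s = from_nat_into ?S"
  define good where "good k x \<longleftrightarrow> (\<forall>i\<in>{..<m}. dist (X i x) (Y (s k i) x) \<le> ?f x)" for k x
  define \<kappa> where "\<kappa> x = (LEAST k. good k x)" for x
  have s: "s k permutes {..<m}" for k using from_nat_into[OF ne, of k] by (simp add: s_def)
  have "\<exists>k. good k x" for x
  proof -
    obtain \<sigma> where \<sigma>: "\<sigma> permutes {..<m}" "\<forall>i<m. dist (X i x) (Y (\<sigma> i) x) \<le> ?f x"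
      using optimal_permutation[of m "\<lambda>i. X i x" "\<lambda>i. Y i x"] by blast
    obtain k where "s k = \<sigma>" using from_nat_into_surj[OF cS, of \<sigma>] \<sigma>(1) unfolding s_def by auto
    then show ?thesis using \<sigma>(2) unfolding good_def by blast
  qed
  then have good: "good (\<kappa> x) x" for x unfolding \<kappa>_def by (rule LeastI_ex)
  have good_meas: "(\<lambda>x. good k x) \<in> measurable M (count_space UNIV)" for k
  proof -
    have "{x \<in> space M. \<forall>i\<in>{..<m}. dist (X i x) (Y (s k i) x) \<le> ?f x} \<in> sets M"
    proof (intro sets.sets_Collect_finite_All)
      fix i
      show "{x \<in> space M. dist (X i x) (Y (s k i) x) \<le> ?f x} \<in> sets M"
        using borel_measurable_dist[OF X[of i] Y[of "s k i"]] borel_measurable_matchd[OF X Y] by measurable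
    qed simp
    then show ?thesis unfolding good_def pred_def .
  qed
  have \<kappa>: "\<kappa> \<in> measurable M (count_space UNIV)"
    unfolding \<kappa>_def[abs_def] by (rule measurable_Least[OF good_meas])
  show ?thesis
  proof (intro exI[of _ "\<lambda>x. s (\<kappa> x)"] conjI allI s)
    fix i
    show "(\<lambda>x. Y (s (\<kappa> x) i) x) \<in> borel_measurable M"
      by (rule measurable_compose_countable[where f = "\<lambda>k. Y (s k i)", OF Y \<kappa>])
  qed (use good in \<open>auto simp: good_def\<close>)
qed

section \<open>The zero measure as a push-forward\<close>

abbreviation frames :: "((complex^'n::finite) \<times> (complex^'n)) measure" where
  "frames \<equiv> gauss \<Otimes>\<^sub>M gauss"

lemma sets_frames: "sets frames = sets borel"
  by (simp only: sets_pair_measure_cong[OF sets_gauss sets_gauss] borel_prod)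

lemma space_frames: "space frames = UNIV"
  using sets_eq_imp_space_eq[OF sets_frames] by simp

lemma continuous_imp_measurable_frames: "continuous_on UNIV f \<Longrightarrow> f \<in> borel_measurable frames"
  using measurable_cong_sets[OF sets_frames refl] borel_measurable_continuous_onI by blast

lemma sum_mset_count:
  fixes g :: "'a \<Rightarrow> 'b::comm_semiring_1"
  shows "(\<Sum>x\<in>#M. g x) = (\<Sum>x\<in>set_mset M. of_nat (count M x) * g x)"
proof (induction M)
  case (add x M)
  have "(\<Sum>y\<in>set_mset (add_mset x M). of_nat (count (add_mset x M) y) * g y)
      = (\<Sum>y\<in>insert x (set_mset M). of_nat (count M y) * g y + (if y = x then g y else 0))"
    by (intro sum.cong) (auto simp: algebra_simps)
  also have "\<dots> = (\<Sum>y\<in>insert x (set_mset M). of_nat (count M y) * g y) + g x"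
    by (simp add: sum.distrib sum.delta)
  also have "(\<Sum>y\<in>insert x (set_mset M). of_nat (count M y) * g y) = (\<Sum>y\<in>set_mset M. of_nat (count M y) * g y)"
    by (intro sum.mono_neutral_right) (auto simp: not_in_iff)
  finally show ?case using add.IH by (simp add: add.commute)
qed simp

lemma measurable_proj: "proj \<in> borel_measurable borel"
proof -
  have "(\<lambda>v :: complex^'a. inverse ((norm v)\<^sup>2) *\<^sub>R (\<chi> i j. v $ i * cnj (v $ j))) \<in> borel_measurable borel"
  proof (intro borel_measurable_scaleR)
    show "(\<lambda>v :: complex^'a. \<chi> i j. v $ i * cnj (v $ j)) \<in> borel_measurable borel"
      by (intro borel_measurable_continuous_onI continuous_intros)
  qed measurable
  also have "(\<lambda>v :: complex^'a. inverse ((norm v)\<^sup>2) *\<^sub>R (\<chi> i j. v $ i * cnj (v $ j))) = proj"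
    by (intro ext) (simp add: proj_def vec_eq_iff scaleR_conv_of_real[where 'a=complex] divide_inverse mult.commute)
  finally show ?thesis .
qed

text \<open>The fallback value on the null set where the point at infinity is a zero keeps the
  number of zeros equal to \<^term>\<open>d\<close> everywhere.\<close>
definition zpoly :: "nat \<Rightarrow> (('n::finite \<Rightarrow> nat) \<Rightarrow> complex) \<Rightarrow> (complex^'n) \<times> (complex^'n) \<Rightarrow> complex poly" where
  "zpoly d c ab = (if hpoly d c (fst ab) \<noteq> 0 then lpoly d c (fst ab) (snd ab) else monom 1 d)"

definition ztot :: "nat \<Rightarrow> (('n::finite \<Rightarrow> nat) \<Rightarrow> complex) \<Rightarrow> (complex^'n) \<times> (complex^'n) \<Rightarrow> (complex^'n^'n) multiset" where
  "ztot d c ab = image_mset (\<lambda>r. proj (r *s fst ab + snd ab)) (proots (zpoly d c ab))"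

lemma ztot_eq_zeroset: "hpoly d c (fst ab) \<noteq> 0 \<Longrightarrow> ztot d c ab = zeroset d c (fst ab) (snd ab)"
  by (simp add: ztot_def zpoly_def zeroset_def)

lemma continuous_coeff_wpoly:
  "continuous_on UNIV (\<lambda>ab :: (complex^'n::finite) \<times> (complex^'n). coeff (wpoly (fst ab) (snd ab) \<alpha>) j)"
proof -
  have mult: "(\<forall>j. continuous_on UNIV (\<lambda>x. coeff (f x * g x) j))"
    if "\<forall>j. continuous_on UNIV (\<lambda>x. coeff (f x) j)" "\<forall>j. continuous_on UNIV (\<lambda>x. coeff (g x) j)"
    for f g :: "(complex^'n) \<times> (complex^'n) \<Rightarrow> complex poly"
    using that unfolding coeff_mult by (auto intro!: continuous_intros)
  have power: "(\<forall>j. continuous_on UNIV (\<lambda>x. coeff (f x ^ n) j))"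
    if "\<forall>j. continuous_on UNIV (\<lambda>x. coeff (f x) j)"
    for n and f :: "(complex^'n) \<times> (complex^'n) \<Rightarrow> complex poly"
  proof (induction n)
    case (Suc n)
    show ?case unfolding power_Suc by (rule mult[OF that Suc.IH])
  qed simp
  have prod: "(\<forall>j. continuous_on UNIV (\<lambda>x. coeff (\<Prod>i\<in>S. f i x) j))"
    if "\<And>i. \<forall>j. continuous_on UNIV (\<lambda>x. coeff (f i x) j)" "finite S"
    for S :: "'n set" and f :: "'n \<Rightarrow> (complex^'n) \<times> (complex^'n) \<Rightarrow> complex poly"
    using that(2)
  proof (induction S)
    case (insert i S)
    show ?case unfolding prod.insert[OF insert.hyps] by (rule mult[OF that(1) insert.IH])
  qed simp
  have lin: "\<forall>j. continuous_on UNIV (\<lambda>ab :: (complex^'n) \<times> (complex^'n). coeff [:snd ab $ i, fst ab $ i:] j)" for i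
  proof
    fix j show "continuous_on UNIV (\<lambda>ab :: (complex^'n) \<times> (complex^'n). coeff [:snd ab $ i, fst ab $ i:] j)"
      by (cases j; cases "j - 1") (auto simp: coeff_pCons intro!: continuous_intros split: nat.split)
  qed
  show ?thesis unfolding wpoly_def using prod[OF power[OF lin], of UNIV] by simp
qed

lemma ztot_enumeration:
  "\<exists>X. (\<forall>i. X i \<in> borel_measurable frames) \<and> (\<forall>ab. ztot d c ab = mset (map (\<lambda>i. X i ab) [0..<d]))"
proof -
  have h: "(\<lambda>ab. hpoly d c (fst ab)) \<in> borel_measurable frames"
    by (rule continuous_imp_measurable_frames, rule continuous_on_compose2[OF continuous_hpoly]) (auto intro!: continuous_intros)
  have "(\<lambda>ab. coeff (zpoly d c ab) j) \<in> borel_measurable frames" for j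
  proof -
    have l: "(\<lambda>ab. coeff (lpoly d c (fst ab) (snd ab)) j) \<in> borel_measurable frames"
      unfolding coeff_lpoly by (intro continuous_imp_measurable_frames continuous_on_sum continuous_on_mult continuous_on_const continuous_coeff_wpoly)
    have "(\<lambda>ab. if hpoly d c (fst ab) \<noteq> 0 then coeff (lpoly d c (fst ab) (snd ab)) j else coeff (monom 1 d) j) \<in> borel_measurable frames"
      using h l by measurable
    then show ?thesis by (simp add: zpoly_def if_distrib[of "\<lambda>p. coeff p j"])
  qed
  moreover have "degree (zpoly d c ab) = d \<and> zpoly d c ab \<noteq> 0" for ab
    using lpoly_roots(3,4)[of d c "fst ab" "snd ab"] by (auto simp: zpoly_def degree_monom_eq)
  ultimately obtain r where r: "\<And>i. r i \<in> borel_measurable frames"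
    "\<And>ab. ab \<in> space frames \<Longrightarrow> proots (zpoly d c ab) = mset (map (\<lambda>i. r i ab) [0..<d])"
    using measurable_roots[of "zpoly d c" frames d] by blast
  show ?thesis
  proof (intro exI[of _ "\<lambda>i ab. proj (r i ab *s fst ab + snd ab)"] conjI allI)
    fix i
    have e: "r i ab *s fst ab + snd ab = (\<lambda>(z, a, b). z *s a + b) (r i ab, ab)" for ab by (simp add: case_prod_beta)
    have m: "(\<lambda>(z, a, b). z *s a + b) \<in> borel_measurable (borel :: (complex \<times> (complex^'a) \<times> (complex^'a)) measure)"
      unfolding case_prod_beta vector_scalar_mult_def by (intro borel_measurable_continuous_onI continuous_intros)
    have id: "(\<lambda>ab. ab) \<in> borel_measurable frames" by (rule continuous_imp_measurable_frames) (rule continuous_on_id)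
    have "(\<lambda>ab. (r i ab, ab)) \<in> borel_measurable frames" by (rule borel_measurable_Pair[OF r(1) id])
    from measurable_compose[OF measurable_compose[OF this m] measurable_proj]
    show "(\<lambda>ab. proj (r i ab *s fst ab + snd ab)) \<in> borel_measurable frames" unfolding e .
  qed (simp add: ztot_def r(2) space_frames image_mset.compositionality comp_def)
qed

lemma size_ztot: "size (ztot d c ab) = d"
  using ztot_enumeration[of d c] by (metis diff_zero length_map length_upt size_mset)

lemma matchd_ztot_le_2: "matchd (ztot d c ab) (ztot d c' ab) \<le> 2"
proof (rule matchd_le_all)
  fix x y assume "x \<in># ztot d c ab" "y \<in># ztot d c' ab"
  then obtain u v where "x = proj u" "y = proj v" by (auto simp: ztot_def)
  then show "dist x y \<le> 2" using norm_proj_le[of u] norm_proj_le[of v] norm_triangle_ineq4[of x y] by (simp add: dist_norm)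
qed (simp_all add: size_ztot)

text \<open>A uniform index makes the average over the \<open>d\<close> zeros of a line part of the
  randomness: \<open>mu_p\<close> becomes the law of the zero with random index on a random
  line.\<close>

definition uniform_index :: "nat \<Rightarrow> nat measure" where
  "uniform_index d = point_measure {..<d} (\<lambda>_. ennreal (1 / real d))"

lemma prob_space_uniform_index: "1 \<le> d \<Longrightarrow> prob_space (uniform_index d)"
  by (rule prob_spaceI)
    (simp add: uniform_index_def space_point_measure emeasure_point_measure_finite ennreal_of_nat_eq_real_of_nat flip: ennreal_mult)

lemma nn_integral_frames_index:
  assumes d: "1 \<le> d" and f: "f \<in> borel_measurable (M \<Otimes>\<^sub>M uniform_index d)"
  shows "(\<integral>\<^sup>+p. f p \<partial>(M \<Otimes>\<^sub>M uniform_index d)) = ennreal (1 / real d) * (\<integral>\<^sup>+x. (\<Sum>i<d. f (x, i)) \<partial>M)"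
proof -
  interpret prob_space "uniform_index d" by (rule prob_space_uniform_index[OF d])
  have m: "(\<lambda>x. f (x, i)) \<in> borel_measurable M" if "i < d" for i
    by (rule measurable_Pair1[OF f]) (use that in \<open>simp add: uniform_index_def space_point_measure\<close>)
  have "(\<integral>\<^sup>+p. f p \<partial>(M \<Otimes>\<^sub>M uniform_index d)) = (\<integral>\<^sup>+x. \<integral>\<^sup>+i. f (x, i) \<partial>uniform_index d \<partial>M)"
    by (rule nn_integral_fst[OF f, symmetric])
  also have "\<dots> = (\<integral>\<^sup>+x. ennreal (1 / real d) * (\<Sum>i<d. f (x, i)) \<partial>M)"
    by (simp add: uniform_index_def nn_integral_point_measure_finite sum_distrib_left)
  also have "\<dots> = ennreal (1 / real d) * (\<integral>\<^sup>+x. (\<Sum>i<d. f (x, i)) \<partial>M)"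
    by (rule nn_integral_cmult) (use m in auto)
  finally show ?thesis .
qed

lemma measurable_index:
  assumes "\<And>i. X i \<in> measurable M N"
  shows "(\<lambda>p. X (snd p) (fst p)) \<in> measurable (M \<Otimes>\<^sub>M uniform_index d) N"
proof (rule measurable_compose_countable'[where I = "{..<d}"])
  have "sets (uniform_index d) = sets (count_space {..<d})" by (simp add: uniform_index_def sets_point_measure)
  then show "snd \<in> measurable (M \<Otimes>\<^sub>M uniform_index d) (count_space {..<d})"
    using measurable_snd[of M "uniform_index d"] measurable_cong_sets by blast
qed (use assms in auto)

lemma zsum_eq:
  assumes nz: "hpoly d c (fst ab) \<noteq> 0" and X: "ztot d c ab = mset (map (\<lambda>i. X i) [0..<d])"
  shows "zsum d c (fst ab) (snd ab) f = (\<Sum>i<d. f (X i))"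
proof -
  let ?h = "lpoly d c (fst ab) (snd ab)"
  have h: "?h \<noteq> 0" "degree ?h = d" by (rule lpoly_roots(3)[OF nz], rule lpoly_roots(4)[OF nz])
  have "zsum d c (fst ab) (snd ab) f = (\<Sum>s\<in>{x. poly ?h x = 0}. of_nat (order s ?h) * f (proj (s *s fst ab + snd ab)))"
    using h by (simp add: zsum_def line_poly_eq Let_def)
  also have "\<dots> = (\<Sum>s\<in>#proots ?h. f (proj (s *s fst ab + snd ab)))"
    using h(1) by (simp add: sum_mset_count)
  also have "\<dots> = (\<Sum>x\<in>#ztot d c ab. f x)"
    using nz by (simp add: ztot_def zpoly_def image_mset.compositionality comp_def)
  also have "\<dots> = (\<Sum>i<d. f (X i))"
    unfolding X by (simp add: sum_mset_sum_list interv_sum_list_conv_sum_set_nat comp_def atLeast0LessThan flip: mset_map)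
  finally show ?thesis .
qed

text \<open>Shows in particular that the set function in \<open>mu_p\<close> is a measure. It holds
  for every measurable enumeration of the zeros, so a permutation varying with the line may be
  inserted later.\<close>

lemma mu_p_eq:
  fixes c :: "('n::finite \<Rightarrow> nat) \<Rightarrow> complex"
  assumes card: "CARD('n) \<ge> 2" and d: "1 \<le> d" and v: "hpoly d c v \<noteq> 0"
    and X: "\<And>i. X i \<in> borel_measurable frames" "\<And>ab. ztot d c ab = mset (map (\<lambda>i. X i ab) [0..<d])"
  shows "mu_p d c = distr (frames \<Otimes>\<^sub>M uniform_index d) borel (\<lambda>p. X (snd p) (fst p))"
proof -
  let ?N = "distr (frames \<Otimes>\<^sub>M uniform_index d) borel (\<lambda>p. X (snd p) (fst p))"
  note m = measurable_index[of X frames borel d, OF X(1)]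
  have "ennreal (1 / real d) * (\<integral>\<^sup>+ab. zsum d c (fst ab) (snd ab) (indicator A) \<partial>frames) = emeasure ?N A"
    if A: "A \<in> sets borel" for A
  proof -
    have "emeasure ?N A = (\<integral>\<^sup>+x. indicator A x \<partial>?N)" using A by simp
    also have "\<dots> = (\<integral>\<^sup>+p. indicator A (X (snd p) (fst p)) \<partial>(frames \<Otimes>\<^sub>M uniform_index d))"
      by (rule nn_integral_distr[OF m]) (use A in simp)
    also have "\<dots> = ennreal (1 / real d) * (\<integral>\<^sup>+ab. (\<Sum>i<d. indicator A (X (snd (ab, i)) (fst (ab, i)))) \<partial>frames)"
      by (rule nn_integral_frames_index[OF d]) (rule measurable_compose[OF m], use A in simp)
    also have "(\<integral>\<^sup>+ab. (\<Sum>i<d. indicator A (X (snd (ab, i)) (fst (ab, i)))) \<partial>frames)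
        = (\<integral>\<^sup>+ab. zsum d c (fst ab) (snd ab) (indicator A) \<partial>frames)"
    proof (rule nn_integral_cong_AE)
      show "AE ab in frames. (\<Sum>i<d. indicator A (X (snd (ab, i)) (fst (ab, i)))) = zsum d c (fst ab) (snd ab) (indicator A)"
        using AE_general_position[OF card d v]
      proof (rule eventually_mono)
        fix ab assume "hpoly d c (fst ab) \<noteq> 0 \<and> lin_indep2 (fst ab) (snd ab)"
        then show "(\<Sum>i<d. indicator A (X (snd (ab, i)) (fst (ab, i)))) = zsum d c (fst ab) (snd ab) (indicator A)"
          using zsum_eq[of d c ab "\<lambda>i. X i ab"] X(2) by simp
      qed
    qed
    finally show ?thesis ..
  qed
  then have "mu_p d c = measure_of UNIV (sets borel) (emeasure ?N)"
    unfolding mu_p_def by (intro measure_of_eq) (auto simp: sets.sigma_sets_eq[of borel, simplified])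
  also have "\<dots> = ?N" using measure_of_of_measure[of ?N] by simp
  finally show ?thesis .
qed

section \<open>The Wasserstein cost of a matching on random lines\<close>

lemma emeasure_frames_index:
  assumes "1 \<le> d"
  shows "emeasure (M \<Otimes>\<^sub>M uniform_index d) (space (M \<Otimes>\<^sub>M uniform_index d)) = emeasure M (space M)"
proof -
  interpret prob_space "uniform_index d" by (rule prob_space_uniform_index[OF assms])
  show ?thesis unfolding space_pair_measure[of M] by (subst emeasure_pair_measure_Times) (simp_all add: emeasure_space_1)
qed

text \<open>If the Gaussian law did not have mass 1 there would be no couplings and, as
  \<^term>\<open>enn2real top = 0\<close>, the distance would vanish. This junk case is cheaper to treat than the
  Gaussian integral is to evaluate.\<close>
lemma Wq_eq_0:
  fixes c :: "('n::finite \<Rightarrow> nat) \<Rightarrow> complex"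
  assumes card: "CARD('n) \<ge> 2" and d: "1 \<le> d" and v: "hpoly d c v \<noteq> 0" and q: "1 \<le> q"
    and mass: "emeasure (frames :: ((complex^'n) \<times> (complex^'n)) measure) (space frames) \<noteq> 1"
  shows "Wq q (mu_p d c) \<nu> = 0"
proof -
  obtain X where X: "\<And>i. X i \<in> borel_measurable frames" "\<And>ab. ztot d c ab = mset (map (\<lambda>i. X i ab) [0..<d])"
    using ztot_enumeration[of d c] by blast
  note m = measurable_index[of X frames borel d, OF X(1)]
  have "emeasure (mu_p d c) (space (mu_p d c)) = emeasure frames (space (frames :: ((complex^'n) \<times> (complex^'n)) measure))"
    unfolding mu_p_eq[OF card d v X] using emeasure_distr[OF m, of UNIV] by (simp add: emeasure_frames_index[OF d])
  with mass have ne: "emeasure (mu_p d c) (space (mu_p d c)) \<noteq> 1" by simp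
  have "couplings (mu_p d c) \<nu> = {}"
  proof (rule equals0I)
    fix \<gamma> assume "\<gamma> \<in> couplings (mu_p d c) \<nu>"
    then have \<gamma>: "prob_space \<gamma>" "sets \<gamma> = sets (borel \<Otimes>\<^sub>M borel)" "distr \<gamma> borel fst = mu_p d c" by (auto simp: couplings_def)
    interpret prob_space \<gamma> by (rule \<gamma>(1))
    have "fst \<in> borel_measurable \<gamma>" using measurable_cong_sets[OF \<gamma>(2) refl] measurable_fst by blast
    then have "prob_space (mu_p d c)" unfolding \<gamma>(3)[symmetric] by (rule prob_space_distr)
    then show False using ne prob_space.emeasure_space_1 by blast
  qed
  then show ?thesis using q by (simp add: Wq_def)
qed

text \<open>Off \<open>{-1..1}\<close> the definite description behind \<open>arccos\<close> is that
  of an unsatisfiable predicate, the same one for all arguments, so \<open>arccos\<close> is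
  constant there and Borel on the whole line.\<close>

lemma measurable_fs_dist:
  "(\<lambda>xy :: (complex^'n^'n) \<times> (complex^'n^'n). fs_dist (fst xy) (snd xy)) \<in> borel_measurable borel"
proof -
  have out: "arccos y = arccos 2" if "y \<notin> {-1..1}" for y :: real
  proof -
    have "(\<lambda>x. 0 \<le> x \<and> x \<le> pi \<and> cos x = y) = (\<lambda>x. False)"
      using that cos_ge_minus_one cos_le_one by (auto intro!: ext)
    moreover have "(\<lambda>x. 0 \<le> x \<and> x \<le> pi \<and> cos x = (2 :: real)) = (\<lambda>x. False)"
      using cos_le_one by (intro ext) (smt (verit))
    ultimately show ?thesis unfolding arccos_def by simp
  qed
  have "(\<lambda>y. if y \<in> {-1..1} then arccos y else arccos 2) \<in> borel_measurable borel"
    by (intro borel_measurable_continuous_on_if continuous_on_arccos' continuous_intros) auto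
  also have "(\<lambda>y. if y \<in> {-1..1} then arccos y else arccos 2) = arccos"
    by (rule ext) (metis out)
  finally have a: "arccos \<in> borel_measurable borel" .
  have "(\<lambda>xy :: (complex^'n^'n) \<times> (complex^'n^'n). sqrt (Re (\<Sum>i\<in>UNIV. \<Sum>j\<in>UNIV. fst xy $ i $ j * snd xy $ j $ i))) \<in> borel_measurable borel"
    by (intro borel_measurable_continuous_onI continuous_intros)
  from measurable_compose[OF this a] show ?thesis by (simp add: fs_dist_def)
qed

text \<open>Both measures are realised on the same random line with the same random index, the
  second enumeration being permuted by an optimal matching; this is an admissible coupling. The
  factor 4 compares the Fubini--Study and chordal distances.\<close>

lemma Wq_le:
  fixes c c' :: "('n::finite \<Rightarrow> nat) \<Rightarrow> complex"
  assumes card: "CARD('n) \<ge> 2" and d: "1 \<le> d" and v: "hpoly d c v \<noteq> 0" and v': "hpoly d c' v' \<noteq> 0" and q: "1 \<le> q"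
    and mass: "emeasure (frames :: ((complex^'n) \<times> (complex^'n)) measure) (space frames) = 1"
  shows "Wq q (mu_p d c) (mu_p d c') \<le> (\<integral>ab. (4 * matchd (ztot d c ab) (ztot d c' ab)) powr q \<partial>frames) powr (1 / q)"
proof -
  let ?F = "frames :: ((complex^'n) \<times> (complex^'n)) measure"
  let ?N = "?F \<Otimes>\<^sub>M uniform_index d"
  let ?m = "\<lambda>ab. matchd (ztot d c ab) (ztot d c' ab)"
  obtain X where X: "\<And>i. X i \<in> borel_measurable ?F" "\<And>ab. ztot d c ab = mset (map (\<lambda>i. X i ab) [0..<d])"
    using ztot_enumeration[of d c] by blast
  obtain Y where Y: "\<And>i. Y i \<in> borel_measurable ?F" "\<And>ab. ztot d c' ab = mset (map (\<lambda>i. Y i ab) [0..<d])"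
    using ztot_enumeration[of d c'] by blast
  obtain \<tau> where \<tau>: "\<And>i. (\<lambda>ab. Y (\<tau> ab i) ab) \<in> borel_measurable ?F" "\<And>ab. \<tau> ab permutes {..<d}"
    "\<And>ab i. i < d \<Longrightarrow> dist (X i ab) (Y (\<tau> ab i) ab) \<le> ?m ab"
    using measurable_optimal_permutation[of X ?F Y d, OF X(1) Y(1)] unfolding X(2) Y(2) by blast
  define Z where "Z i ab = Y (\<tau> ab i) ab" for i ab
  have Z: "Z i \<in> borel_measurable ?F" for i using \<tau>(1) by (simp add: Z_def[abs_def])
  have Z2: "ztot d c' ab = mset (map (\<lambda>i. Z i ab) [0..<d])" for ab
  proof -
    have p: "\<tau> ab permutes {..<length (map (\<lambda>i. Y i ab) [0..<d])}" using \<tau>(2) by simp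
    have "map (\<lambda>i. Z i ab) [0..<d] = permute_list (\<tau> ab) (map (\<lambda>i. Y i ab) [0..<d])"
      using permutes_in_image[OF \<tau>(2)[of ab]] by (intro nth_equalityI) (auto simp: Z_def permute_list_nth[OF p])
    then show ?thesis unfolding Y(2) using mset_permute_list[OF p] by simp
  qed
  have mm: "?m \<in> borel_measurable ?F" unfolding X(2) Y(2) by (rule borel_measurable_matchd[OF X(1) Y(1)])
  interpret F: prob_space ?F by (rule prob_spaceI[OF mass])
  interpret N: prob_space ?N by (rule prob_spaceI) (simp only: emeasure_frames_index[OF d] mass)
  note mX = measurable_index[of X ?F borel d, OF X(1)]
  note mZ = measurable_index[of Z ?F borel d, OF Z]
  \<comment> \<open>The joint law of the matched zeros is the coupling.\<close>
  define T where "T p = (X (snd p) (fst p), Z (snd p) (fst p))" for p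
  have T: "T \<in> measurable ?N (borel \<Otimes>\<^sub>M borel)" unfolding T_def[abs_def] by (rule measurable_Pair[OF mX mZ])
  define \<gamma> where "\<gamma> = distr ?N (borel \<Otimes>\<^sub>M borel) T"
  have \<gamma>: "\<gamma> \<in> couplings (mu_p d c) (mu_p d c')"
    unfolding couplings_def
  proof (intro CollectI conjI)
    show "prob_space \<gamma>" unfolding \<gamma>_def by (rule N.prob_space_distr[OF T])
    show "distr \<gamma> borel fst = mu_p d c"
      unfolding \<gamma>_def mu_p_eq[OF card d v X] by (subst distr_distr[OF measurable_fst T]) (simp add: comp_def T_def)
    show "distr \<gamma> borel snd = mu_p d c'"
      unfolding \<gamma>_def mu_p_eq[OF card d v' Z Z2] by (subst distr_distr[OF measurable_snd T]) (simp add: comp_def T_def)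
  qed (simp add: \<gamma>_def)
  have m0: "0 \<le> ?m ab" for ab by (intro matchd_nonneg) (simp add: size_ztot)
  let ?f = "\<lambda>xy. ennreal (fs_dist (fst xy) (snd xy) powr q)"
  have f: "?f \<in> borel_measurable (borel \<Otimes>\<^sub>M borel)" unfolding borel_prod using measurable_fs_dist by measurable
  have "(INF \<gamma>\<in>couplings (mu_p d c) (mu_p d c'). \<integral>\<^sup>+ xy. ?f xy \<partial>\<gamma>) \<le> (\<integral>\<^sup>+ xy. ?f xy \<partial>\<gamma>)"
    by (rule INF_lower[OF \<gamma>])
  also have "\<dots> = (\<integral>\<^sup>+ p. ?f (T p) \<partial>?N)" unfolding \<gamma>_def by (rule nn_integral_distr[OF T]) (simp add: f)
  also have "\<dots> = ennreal (1 / real d) * (\<integral>\<^sup>+ab. (\<Sum>i<d. ?f (T (ab, i))) \<partial>?F)"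
    by (rule nn_integral_frames_index[OF d measurable_compose[OF T f]])
  also have "\<dots> \<le> ennreal (1 / real d) * (\<integral>\<^sup>+ab. ennreal (real d) * ennreal ((4 * ?m ab) powr q) \<partial>?F)"
  proof (intro mult_left_mono nn_integral_mono_AE)
    have "AE ab in ?F. (hpoly d c (fst ab) \<noteq> 0 \<and> lin_indep2 (fst ab) (snd ab)) \<and> (hpoly d c' (fst ab) \<noteq> 0 \<and> lin_indep2 (fst ab) (snd ab))"
      using AE_general_position[OF card d v] AE_general_position[OF card d v'] by (rule AE_conjI)
    then show "AE ab in ?F. (\<Sum>i<d. ?f (T (ab, i))) \<le> ennreal (real d) * ennreal ((4 * ?m ab) powr q)"
    proof (rule eventually_mono)
      fix ab assume g: "(hpoly d c (fst ab) \<noteq> 0 \<and> lin_indep2 (fst ab) (snd ab)) \<and> (hpoly d c' (fst ab) \<noteq> 0 \<and> lin_indep2 (fst ab) (snd ab))"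
      have nz: "r *s fst ab + snd ab \<noteq> 0" for r
      proof
        assume "r *s fst ab + snd ab = 0"
        then have "r *s fst ab + 1 *s snd ab = 0" by simp
        then show False using g unfolding lin_indep2_def by fastforce
      qed
      have el: "\<exists>u. u \<noteq> 0 \<and> x = proj u" if "x \<in># ztot d c'' ab" for x c''
        using that nz by (auto simp: ztot_def)
      have "?f (T (ab, i)) \<le> ennreal ((4 * ?m ab) powr q)" if i: "i < d" for i
      proof -
        have "X i ab \<in># ztot d c ab" "Z i ab \<in># ztot d c' ab" unfolding X(2) Z2 using i by auto
        then obtain u w where u: "u \<noteq> 0" "X i ab = proj u" and w: "w \<noteq> 0" "Z i ab = proj w" using el by metis
        have "fs_dist (X i ab) (Z i ab) \<le> 4 * dist (X i ab) (Z i ab)" unfolding u w by (rule fs_dist_le[OF u(1) w(1)])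
        also have "\<dots> \<le> 4 * ?m ab" using \<tau>(3)[OF i, of ab] by (simp add: Z_def)
        finally have "fs_dist (X i ab) (Z i ab) powr q \<le> (4 * ?m ab) powr q"
          using fs_dist_le(1)[OF u(1) w(1)] q unfolding u w by (intro powr_mono2) auto
        then show ?thesis by (simp add: T_def ennreal_leI)
      qed
      then have "(\<Sum>i<d. ?f (T (ab, i))) \<le> (\<Sum>i<d. ennreal ((4 * ?m ab) powr q))" by (intro sum_mono) auto
      then show "(\<Sum>i<d. ?f (T (ab, i))) \<le> ennreal (real d) * ennreal ((4 * ?m ab) powr q)"
        by (simp add: ennreal_of_nat_eq_real_of_nat)
    qed
  qed simp
  also have "\<dots> = (\<integral>\<^sup>+ab. ennreal ((4 * ?m ab) powr q) \<partial>?F)"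
  proof -
    have "ennreal (1 / real d) * ennreal (real d) = 1" using d by (simp flip: ennreal_mult)
    moreover have "(\<integral>\<^sup>+ab. ennreal (real d) * ennreal ((4 * ?m ab) powr q) \<partial>?F) = ennreal (real d) * (\<integral>\<^sup>+ab. ennreal ((4 * ?m ab) powr q) \<partial>?F)"
      by (rule nn_integral_cmult) (use mm in measurable)
    ultimately show ?thesis by (simp add: mult.assoc[symmetric])
  qed
  also have "\<dots> = ennreal (\<integral>ab. (4 * ?m ab) powr q \<partial>?F)"
  proof (rule nn_integral_eq_integral)
    have m2: "?m ab \<le> 2" for ab by (rule matchd_ztot_le_2)
    have "\<bar>(4 * ?m ab) powr q\<bar> \<le> 8 powr q" for ab using m0[of ab] m2[of ab] q by (simp add: powr_mono2)
    then show "integrable ?F (\<lambda>ab. (4 * ?m ab) powr q)"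
      by (intro F.integrable_const_bound[where B = "8 powr q"]) (use mm in auto)
  qed simp
  finally have "enn2real (INF \<gamma>\<in>couplings (mu_p d c) (mu_p d c'). \<integral>\<^sup>+ xy. ?f xy \<partial>\<gamma>) \<le> (\<integral>ab. (4 * ?m ab) powr q \<partial>?F)"
    by (intro enn2real_leI) (auto intro: integral_nonneg_AE)
  then show ?thesis unfolding Wq_def using q by (intro powr_mono2) auto
qed

section \<open>Power means of bounded functions\<close>

lemma powr_convex_nonneg:
  fixes u v x y p :: real
  assumes p: "1 \<le> p" and uv: "0 \<le> u" "0 \<le> v" "u + v = 1" and xy: "0 \<le> x" "0 \<le> y"
  shows "(u * x + v * y) powr p \<le> u * x powr p + v * y powr p"
proof -
  have one: "(w * z) powr p \<le> w * z powr p" if w: "0 \<le> w" "w \<le> 1" and z: "0 \<le> z" for w z :: real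
  proof -
    have "w powr p \<le> w" using powr_mono'[of 1 p w] w p by simp
    then show ?thesis using w z by (simp add: powr_mult mult_right_mono)
  qed
  consider "x = 0" | "y = 0" | "0 < x" "0 < y" using xy by fastforce
  then show ?thesis
  proof cases
    case 1
    then show ?thesis using one[of v y] uv xy p by simp
  next
    case 2
    then show ?thesis using one[of u x] uv xy p by simp
  next
    case 3
    have u: "u = 1 - v" using uv by simp
    show ?thesis unfolding u using convex_onD[OF powr_convex[OF p], of v x y] 3 uv by simp
  qed
qed

context prob_space
begin

lemma integrable_powr:
  fixes f :: "'a \<Rightarrow> real" and p B :: real
  assumes "f \<in> borel_measurable M" "\<And>x. 0 \<le> f x" "\<And>x. f x \<le> B" "0 \<le> p"
  shows "integrable M (\<lambda>x. f x powr p)"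
  by (rule integrable_const_bound[where B = "B powr p"])
    (use assms in \<open>auto intro!: powr_mono2 AE_I2\<close>)

lemma powr_mean_lt:
  assumes J: "0 \<le> J" "J powr (1 / p) < t" and p: "1 \<le> (p::real)"
  shows "0 < t" "J < t powr p"
proof -
  show t: "0 < t" using J(2) powr_ge_zero[of J "1 / p"] by linarith
  have "(J powr (1 / p)) powr p < t powr p" using J p by (intro powr_less_mono2) auto
  then show "J < t powr p" using J(1) p by (simp add: powr_powr)
qed

lemma powr_mean_le:
  assumes J: "0 \<le> J" "J \<le> t powr p" "0 \<le> t" and p: "1 \<le> (p::real)"
  shows "J powr (1 / p) \<le> t"
proof -
  have "J powr (1 / p) \<le> (t powr p) powr (1 / p)" using J p by (intro powr_mono2) auto
  then show ?thesis using J(3) p by (simp add: powr_powr)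
qed

text \<open>Minkowski's inequality, by convexity of the power after normalising \<open>f\<close> and
  \<open>g\<close> by numbers slightly above their means.\<close>

lemma powr_mean_triangle:
  fixes f g :: "'a \<Rightarrow> real" and p B :: real
  assumes p: "1 \<le> p" and f: "f \<in> borel_measurable M" "\<And>x. 0 \<le> f x" "\<And>x. f x \<le> B"
    and g: "g \<in> borel_measurable M" "\<And>x. 0 \<le> g x" "\<And>x. g x \<le> B"
  shows "(\<integral>x. (f x + g x) powr p \<partial>M) powr (1 / p) \<le> (\<integral>x. f x powr p \<partial>M) powr (1 / p) + (\<integral>x. g x powr p \<partial>M) powr (1 / p)"
    (is "?L \<le> ?A + ?B")
proof (rule field_le_epsilon)
  fix e :: real assume e: "0 < e"
  \<comment> \<open>The excess \<open>e / 2\<close> makes \<open>a\<close> and \<open>b\<close>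
    positive even if a mean vanishes.\<close>
  define a b where "a = ?A + e / 2" and "b = ?B + e / 2"
  have If: "integrable M (\<lambda>x. f x powr p)" and Ig: "integrable M (\<lambda>x. g x powr p)"
    using integrable_powr[OF f] integrable_powr[OF g] p by auto
  have Ifg: "integrable M (\<lambda>x. (f x + g x) powr p)"
  proof (rule integrable_powr)
    show "f x + g x \<le> B + B" for x using f(3) g(3) by (intro add_mono)
  qed (use f g p in auto)
  have a: "0 < a" "(\<integral>x. f x powr p \<partial>M) < a powr p"
    using powr_mean_lt[OF _ _ p, of "\<integral>x. f x powr p \<partial>M" a] e by (auto simp: a_def)
  have b: "0 < b" "(\<integral>x. g x powr p \<partial>M) < b powr p"
    using powr_mean_lt[OF _ _ p, of "\<integral>x. g x powr p \<partial>M" b] e by (auto simp: b_def)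
  define u v where "u = a / (a + b)" and "v = b / (a + b)"
  have uv: "0 \<le> u" "0 \<le> v" "u + v = 1" using a b by (auto simp: u_def v_def simp flip: add_divide_distrib)
  have pt: "(f x + g x) powr p \<le> (a + b) powr p * (u * (f x powr p / a powr p) + v * (g x powr p / b powr p))" for x
  proof -
    have eq: "f x + g x = (a + b) * (u * (f x / a) + v * (g x / b))"
    proof -
      have "u * (f x / a) = f x / (a + b)" "v * (g x / b) = g x / (a + b)" "a + b \<noteq> 0"
        using a(1) b(1) by (auto simp: u_def v_def)
      then show ?thesis by (simp flip: add_divide_distrib)
    qed
    have "(u * (f x / a) + v * (g x / b)) powr p \<le> u * (f x / a) powr p + v * (g x / b) powr p"
      by (rule powr_convex_nonneg[OF p uv]) (use f g a b in auto)
    also have "\<dots> = u * (f x powr p / a powr p) + v * (g x powr p / b powr p)"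
      using f g a b by (simp add: powr_divide)
    finally show ?thesis unfolding eq using a b uv f g by (subst powr_mult) (auto intro!: mult_left_mono add_nonneg_nonneg)
  qed
  have "(\<integral>x. (f x + g x) powr p \<partial>M) \<le> (\<integral>x. (a + b) powr p * (u * (f x powr p / a powr p) + v * (g x powr p / b powr p)) \<partial>M)"
    by (rule integral_mono) (use If Ig Ifg pt in auto)
  also have "\<dots> = (a + b) powr p * (u * ((\<integral>x. f x powr p \<partial>M) / a powr p) + v * ((\<integral>x. g x powr p \<partial>M) / b powr p))"
    using If Ig by simp
  also have "\<dots> \<le> (a + b) powr p * (u * 1 + v * 1)"
    using a b uv by (intro mult_left_mono add_mono) auto
  also have "\<dots> = (a + b) powr p" using uv by simp
  finally have "?L \<le> a + b" using a b p by (intro powr_mean_le) (auto intro: integral_nonneg_AE)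
  then show "?L \<le> ?A + ?B + e" by (simp add: a_def b_def)
qed

text \<open>Monotonicity of power means, from Young's inequality applied pointwise to
  \<open>f\<close> divided by any \<open>t\<close> above the mean of order \<open>p\<close>.\<close>

lemma powr_mean_mono:
  fixes f :: "'a \<Rightarrow> real" and p q B :: real
  assumes q: "1 \<le> q" "q \<le> p" and f: "f \<in> borel_measurable M" "\<And>x. 0 \<le> f x" "\<And>x. f x \<le> B"
  shows "(\<integral>x. f x powr q \<partial>M) powr (1 / q) \<le> (\<integral>x. f x powr p \<partial>M) powr (1 / p)"
proof (rule dense_ge)
  fix t assume t: "(\<integral>x. f x powr p \<partial>M) powr (1 / p) < t"
  have p: "1 \<le> p" using q by simp
  have If: "integrable M (\<lambda>x. f x powr p)" and Iq: "integrable M (\<lambda>x. f x powr q)"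
    using integrable_powr[OF f] p q by auto
  have t0: "0 < t" "(\<integral>x. f x powr p \<partial>M) < t powr p" using powr_mean_lt[OF _ t p] by auto
  define \<theta> where "\<theta> = q / p"
  have \<theta>: "0 \<le> \<theta>" "\<theta> \<le> 1" using q by (auto simp: \<theta>_def)
  have pt: "f x powr q \<le> t powr q * (\<theta> * (f x powr p / t powr p) + (1 - \<theta>))" for x
  proof (cases "f x = 0")
    case True
    then show ?thesis using \<theta> p by simp
  next
    case False
    then have fx: "0 < f x" using f(2)[of x] by simp
    have "(f x powr p / t powr p) powr \<theta> * 1 powr (1 - \<theta>) \<le> \<theta> * (f x powr p / t powr p) + (1 - \<theta>) * 1"
      by (rule Youngs_inequality_0) (use \<theta> fx t0 in auto)
    moreover have "(f x powr p / t powr p) powr \<theta> = f x powr q / t powr q"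
      using fx t0 p by (simp add: powr_divide powr_powr \<theta>_def)
    ultimately show ?thesis using t0 by (simp add: field_simps)
  qed
  have "(\<integral>x. f x powr q \<partial>M) \<le> (\<integral>x. t powr q * (\<theta> * (f x powr p / t powr p) + (1 - \<theta>)) \<partial>M)"
    by (rule integral_mono) (use If Iq pt in auto)
  also have "\<dots> = t powr q * (\<theta> * ((\<integral>x. f x powr p \<partial>M) / t powr p) + (1 - \<theta>))"
    using If by (simp add: prob_space)
  also have "\<dots> \<le> t powr q * (\<theta> * 1 + (1 - \<theta>))"
    using t0 \<theta> by (intro mult_left_mono add_right_mono) auto
  finally show "(\<integral>x. f x powr q \<partial>M) powr (1 / q) \<le> t"
    using t0 q by (intro powr_mean_le) (auto intro: integral_nonneg_AE)
qed

end

section \<open>Absolute continuity\<close>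

lemma borel_measurable_matchd_ztot: "(\<lambda>ab. matchd (ztot d c ab) (ztot d c' ab)) \<in> borel_measurable frames"
proof -
  obtain X where X: "\<And>i. X i \<in> borel_measurable frames" "\<And>ab. ztot d c ab = mset (map (\<lambda>i. X i ab) [0..<d])"
    using ztot_enumeration[of d c] by blast
  obtain Y where Y: "\<And>i. Y i \<in> borel_measurable frames" "\<And>ab. ztot d c' ab = mset (map (\<lambda>i. Y i ab) [0..<d])"
    using ztot_enumeration[of d c'] by blast
  show ?thesis unfolding X(2) Y(2) by (rule borel_measurable_matchd[OF X(1) Y(1)])
qed

text \<open>The dyadic criterion is applied not to \<open>Wq\<close> but to the upper bound
  \<open>D\<close>, the mean of order \<open>q1\<close> over lines of the matching distance. Its
  triangle inequality is Minkowski's, so no couplings have to be glued; its energy is the integral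
  of the energies on lines; and it dominates \<open>Wq\<close> by monotonicity of means.\<close>

lemma (in form_curve) absolutely_continuous:
  assumes card: "CARD('n) \<ge> 2" and q: "1 \<le> q" "q < q1" "q1 * (real d - 1) < real d"
    and v: "\<And>t. t \<in> {0..1} \<Longrightarrow> hpoly d (P t) (v t) \<noteq> 0"
    and mass: "emeasure (frames :: ((complex^'n) \<times> (complex^'n)) measure) (space frames) = 1"
  shows "AC_q q (Wq q) (\<lambda>t. mu_p d (P t))"
proof -
  let ?F = "frames :: ((complex^'n) \<times> (complex^'n)) measure"
  interpret F: prob_space ?F by (rule prob_spaceI[OF mass])
  have q1: "1 \<le> q1" using q by simp
  define f where "f s t ab = 4 * matchd (ztot d (P s) ab) (ztot d (P t) ab)" for s t and ab :: "(complex^'n) \<times> (complex^'n)"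
  define D where "D s t = (\<integral>ab. f s t ab powr q1 \<partial>?F) powr (1 / q1)" for s t
  have f: "f s t \<in> borel_measurable ?F" "0 \<le> f s t ab" "f s t ab \<le> 8" for s t ab
    using borel_measurable_matchd_ztot[of d "P s" "P t"] matchd_ztot_le_2[of d "P s" ab "P t"]
    by (auto simp: f_def[abs_def] size_ztot intro!: matchd_nonneg)
  have If: "integrable ?F (\<lambda>ab. f s t ab powr q1)" for s t
    by (rule F.integrable_powr[OF f]) (use q1 in simp)
  have good: "AE ab in ?F. hpoly d (P t) (fst ab) \<noteq> 0 \<and> lin_indep2 (fst ab) (snd ab)" if "t \<in> {0..1}" for t
    by (rule AE_general_position[OF card d v[OF that]])
  obtain C where C: "0 \<le> C" "\<And>n a b. lin_indep2 a b \<Longrightarrow> (\<forall>i\<le>2^n. hpoly d (P (real i / 2 ^ n)) a \<noteq> 0) \<Longrightarrow>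
     RE q1 (2 ^ n) (\<lambda>i. zeroset d (P (real i / 2 ^ n)) a b) \<le> C * real (2 ^ n) powr (1 - q1)"
    using line_energy[OF q1 q(3)] by blast
  interpret E: dyadic_energy D q1 "4 powr q1 * C"
  proof
    show "1 \<le> q1" by (rule q1)
    show "0 \<le> D s t" for s t by (simp add: D_def)
    show "D s u \<le> D s t + D t u" for s t u
    proof -
      have "f s u ab \<le> f s t ab + f t u ab" for ab
        using matchd_triangle[of "ztot d (P s) ab" "ztot d (P t) ab" "ztot d (P u) ab"] by (simp add: f_def size_ztot)
      moreover have "f s t ab + f t u ab \<le> 16" for ab using f(3)[of s t ab] f(3)[of t u ab] by linarith
      ultimately have "(\<integral>ab. f s u ab powr q1 \<partial>?F) \<le> (\<integral>ab. (f s t ab + f t u ab) powr q1 \<partial>?F)"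
        by (intro integral_mono If F.integrable_powr[where B = 16] powr_mono2) (use f q1 in \<open>auto intro: add_nonneg_nonneg\<close>)
      then have "D s u \<le> (\<integral>ab. (f s t ab + f t u ab) powr q1 \<partial>?F) powr (1 / q1)"
        unfolding D_def using q1 by (intro powr_mono2) (auto intro: integral_nonneg_AE)
      also have "\<dots> \<le> D s t + D t u"
        unfolding D_def by (rule F.powr_mean_triangle[OF q1 f f])
      finally show ?thesis .
    qed
    fix e :: real assume e: "0 < e"
    obtain \<delta> where \<delta>: "0 < \<delta>" "\<And>s t a b. s \<in> {0..1} \<Longrightarrow> t \<in> {0..1} \<Longrightarrow> \<bar>t - s\<bar> < \<delta> \<Longrightarrow> lin_indep2 a b \<Longrightarrow>
       hpoly d (P s) a \<noteq> 0 \<Longrightarrow> hpoly d (P t) a \<noteq> 0 \<Longrightarrow> matchd (zeroset d (P s) a b) (zeroset d (P t) a b) \<le> e / 4"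
    proof -
      have "0 < e / 4" using e by simp
      from line_continuous[OF this] show ?thesis
        by (elim exE conjE, intro that) (assumption, blast)
    qed
    have "D s t \<le> e" if st: "0 \<le> s" "s \<le> t" "t \<le> 1" "t - s < \<delta>" for s t
    proof -
      have s1: "s \<in> {0..1}" and t1: "t \<in> {0..1}" and ts: "\<bar>t - s\<bar> < \<delta>" using st by auto
      have "AE ab in ?F. f s t ab powr q1 \<le> e powr q1"
        using AE_conjI[OF good[OF s1] good[OF t1]]
      proof (rule eventually_mono)
        fix ab assume g: "(hpoly d (P s) (fst ab) \<noteq> 0 \<and> lin_indep2 (fst ab) (snd ab)) \<and> (hpoly d (P t) (fst ab) \<noteq> 0 \<and> lin_indep2 (fst ab) (snd ab))"
        then have "f s t ab \<le> e" using \<delta>(2)[OF s1 t1 ts, of "fst ab" "snd ab"] by (simp add: f_def ztot_eq_zeroset)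
        then show "f s t ab powr q1 \<le> e powr q1" using f q1 by (intro powr_mono2) auto
      qed
      then have "(\<integral>ab. f s t ab powr q1 \<partial>?F) \<le> (\<integral>ab. e powr q1 \<partial>?F)" by (intro integral_mono_AE If) simp_all
      then show ?thesis unfolding D_def using e q1 by (intro F.powr_mean_le) (auto simp: F.prob_space intro: integral_nonneg_AE)
    qed
    then show "\<exists>\<delta>>0. \<forall>s t. 0 \<le> s \<longrightarrow> s \<le> t \<longrightarrow> t \<le> 1 \<longrightarrow> t - s < \<delta> \<longrightarrow> D s t \<le> e" using \<delta>(1) by blast
  next
    fix n :: nat
    let ?t = "\<lambda>i. real i / 2 ^ n"
    have tin: "?t i \<in> {0..1}" if "i \<le> 2 ^ n" for i
    proof -
      have "real i \<le> real (2 ^ n)" using that by (simp only: of_nat_le_iff)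
      then show ?thesis by simp
    qed
    have Dp: "D s t powr q1 = (\<integral>ab. f s t ab powr q1 \<partial>?F)" for s t
      using q1 by (simp add: D_def powr_powr integral_nonneg_AE)
    have "(\<Sum>i<2^n. D (?t i) (?t (Suc i)) powr q1) = (\<integral>ab. (\<Sum>i<2^n. f (?t i) (?t (Suc i)) ab powr q1) \<partial>?F)"
      unfolding Dp by (rule Bochner_Integration.integral_sum[symmetric]) (rule If)
    also have "\<dots> \<le> (\<integral>ab. 4 powr q1 * (C * real (2 ^ n) powr (1 - q1)) \<partial>?F)"
    proof (rule integral_mono_AE)
      \<comment> \<open>The exceptional null set of frames depends on the time, but at a fixed level
        only finitely many times occur.\<close>
      have "AE ab in ?F. \<forall>i\<in>{..2^n}. hpoly d (P (?t i)) (fst ab) \<noteq> 0 \<and> lin_indep2 (fst ab) (snd ab)"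
        by (rule AE_ball_countable', rule good, rule tin) simp_all
      then show "AE ab in ?F. (\<Sum>i<2^n. f (?t i) (?t (Suc i)) ab powr q1) \<le> 4 powr q1 * (C * real (2 ^ n) powr (1 - q1))"
      proof (rule eventually_mono)
        fix ab assume g: "\<forall>i\<in>{..2^n}. hpoly d (P (?t i)) (fst ab) \<noteq> 0 \<and> lin_indep2 (fst ab) (snd ab)"
        have z: "ztot d (P (?t i)) ab = zeroset d (P (?t i)) (fst ab) (snd ab)" if "i \<le> 2 ^ n" for i
          using g that by (intro ztot_eq_zeroset) auto
        have "(\<Sum>i<2^n. f (?t i) (?t (Suc i)) ab powr q1) = 4 powr q1 * RE q1 (2 ^ n) (\<lambda>i. zeroset d (P (?t i)) (fst ab) (snd ab))"
          unfolding RE_def sum_distrib_left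
        proof (rule sum.cong[OF refl])
          fix i :: nat assume "i \<in> {..<2 ^ n}"
          then have i: "i \<le> 2 ^ n" "Suc i \<le> 2 ^ n" by auto
          have "f (?t i) (?t (Suc i)) ab = 4 * matchd (zeroset d (P (?t i)) (fst ab) (snd ab)) (zeroset d (P (?t (Suc i))) (fst ab) (snd ab))"
            unfolding f_def z[OF i(1)] z[OF i(2)] ..
          moreover have "0 \<le> matchd (zeroset d (P (?t i)) (fst ab) (snd ab)) (zeroset d (P (?t (Suc i))) (fst ab) (snd ab))"
            unfolding z[OF i(1), symmetric] z[OF i(2), symmetric] by (intro matchd_nonneg) (simp add: size_ztot)
          ultimately show "f (?t i) (?t (Suc i)) ab powr q1 = 4 powr q1 *
             matchd (zeroset d (P (?t i)) (fst ab) (snd ab)) (zeroset d (P (?t (Suc i))) (fst ab) (snd ab)) powr q1"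
            by (simp only: powr_mult)
        qed
        also have "\<dots> \<le> 4 powr q1 * (C * real (2 ^ n) powr (1 - q1))"
          by (intro mult_left_mono C(2)) (use g in auto)
        finally show "(\<Sum>i<2^n. f (?t i) (?t (Suc i)) ab powr q1) \<le> 4 powr q1 * (C * real (2 ^ n) powr (1 - q1))" .
      qed
    qed (use If in auto)
    also have "\<dots> = 4 powr q1 * C * (2 ^ n) powr (1 - q1)" by (simp add: F.prob_space)
    finally show "(\<Sum>i<2^n. D (?t i) (?t (Suc i)) powr q1) \<le> 4 powr q1 * C * (2 ^ n) powr (1 - q1)" .
  qed
  show ?thesis
    unfolding AC_q_def
  proof (intro exI[of _ E.mm] conjI allI impI)
    show "E.mm \<in> borel_measurable lborel" using E.mm_measurable by simp
    show "set_integrable lborel {0..1} (\<lambda>t. \<bar>E.mm t\<bar> powr q)" by (rule E.mm_integrable(1)[OF q(1,2)])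
    fix s t :: real assume st: "0 \<le> s" "s \<le> t" "t \<le> 1"
    then have "s \<in> {0..1}" "t \<in> {0..1}" by auto
    then have "Wq q (mu_p d (P s)) (mu_p d (P t)) \<le> (\<integral>ab. f s t ab powr q \<partial>?F) powr (1 / q)"
      unfolding f_def by (intro Wq_le[OF card d v v q(1) mass])
    also have "\<dots> \<le> D s t" unfolding D_def by (rule F.powr_mean_mono[OF q(1) _ f]) (use q in simp)
    also have "\<dots> \<le> (LBINT \<tau>=s..t. E.mm \<tau>)" by (rule E.D_le_integral[OF q(1,2) st])
    finally show "Wq q (mu_p d (P s)) (mu_p d (P t)) \<le> (LBINT \<tau>=s..t. E.mm \<tau>)" .
  qed
qed

theorem mainTheorem16:
  fixes P :: "real \<Rightarrow> ('n::finite \<Rightarrow> nat) \<Rightarrow> complex" and d :: nat and q :: real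
  assumes "CARD('n) \<ge> 2"
    and "d \<ge> 1"
    and "int d > 2 * (int CARD('n) - 1) - 3"
    and "\<forall>\<alpha>\<in>monoms d. Ck1_on (d - 1) {0..1} (\<lambda>t. P t \<alpha>)"
    and "\<forall>t\<in>{0..1}. \<exists>\<alpha>\<in>(monoms d :: ('n \<Rightarrow> nat) set). P t \<alpha> \<noteq> 0"
    and "\<forall>t\<in>{0..1}. \<not> fano_disc d (P t)"
    and "1 \<le> q" and "q * (real d - 1) < real d"
  shows "AC_q q (Wq q) (\<lambda>t. mu_p d (P t))"
proof -
  note card = assms(1) and d = assms(2) and q = assms(7,8)
  have "\<forall>\<alpha>\<in>(monoms d :: ('n \<Rightarrow> nat) set). \<exists>M\<ge>0. locpoly d M (\<lambda>t. P t \<alpha>)"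
    using Ck1_locpoly[of "d - 1"] assms(4) d by simp
  then obtain m where m: "\<And>\<alpha>. \<alpha> \<in> (monoms d :: ('n \<Rightarrow> nat) set) \<Longrightarrow> 0 \<le> m \<alpha> \<and> locpoly d (m \<alpha>) (\<lambda>t. P t \<alpha>)"
    by metis
  define M where "M = (\<Sum>\<alpha>\<in>monoms d. m \<alpha>)"
  have M: "0 \<le> M" unfolding M_def using m by (intro sum_nonneg) auto
  have smooth: "locpoly d M (\<lambda>t. P t \<alpha>)" if "\<alpha> \<in> monoms d" for \<alpha>
  proof (rule locpoly_mono)
    show "locpoly d (m \<alpha>) (\<lambda>t. P t \<alpha>)" using m[OF that] ..
    show "m \<alpha> \<le> M" unfolding M_def using m that by (intro member_le_sum finite_monoms) auto
  qed
  have cont: "continuous_on {0..1} (\<lambda>t. P t \<alpha>)" if "\<alpha> \<in> monoms d" for \<alpha>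
  proof (rule lipschitz_on_continuous_on[of "2 * M"])
    show "(2 * M)-lipschitz_on {0..1} (\<lambda>t. P t \<alpha>)"
      using locpoly_lip[OF smooth[OF that] d] M by (intro lipschitz_onI) (auto simp: dist_norm)
  qed
  have nz: "\<exists>k\<le>d. hpoly d (P t) (a + of_nat k *s b) \<noteq> 0" if "t \<in> {0..1}" "lin_indep2 a b" for t a b
    using no_line_if_not_fano[OF assms(3) _ that(2)] assms(6) that(1) exists_nonzero_point by blast
  obtain c0 where c0: "0 < c0" "\<And>t a b. t \<in> {0..1} \<Longrightarrow> orthon a b \<Longrightarrow> \<exists>k\<le>d. c0 \<le> norm (hpoly d (P t) (a + of_nat k *s b))"
    using uniform_nonvanishing[of d P, OF cont nz] by blast
  interpret form_curve P d M c0 by unfold_locales (use d M c0 smooth in auto)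
  \<comment> \<open>Two distinct coordinates span a line, on which the form is nonzero at every
    time; this gives the points \<open>v t\<close> required by the almost-everywhere
    statements.\<close>
  obtain i :: 'n where True by blast
  have "UNIV \<noteq> {i}"
  proof
    assume "UNIV = {i}"
    then have "CARD('n) = card {i}" by simp
    then show False using card by simp
  qed
  then obtain j where j: "j \<noteq> i" by auto
  have "lin_indep2 (axis i 1 :: complex^'n) (axis j 1)"
    by (rule lin_indep2_minor[of _ i _ j]) (use j in \<open>auto simp: axis_def\<close>)
  then have "\<forall>t\<in>{0..1}. \<exists>v. hpoly d (P t) v \<noteq> 0" using nz by blast
  then obtain v where v: "\<And>t. t \<in> {0..1} \<Longrightarrow> hpoly d (P t) (v t) \<noteq> 0" by metis
  show ?thesis
  proof (cases "emeasure (frames :: ((complex^'n) \<times> (complex^'n)) measure) (space frames) = 1")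
    case True
    \<comment> \<open>The strict inequality for \<open>q\<close> leaves room for a larger exponent;
      for \<open>d = 1\<close> every exponent is admissible.\<close>
    obtain q1 where q1: "q < q1" "q1 * (real d - 1) < real d"
    proof (cases "d = 1")
      case True
      then show ?thesis using that[of "q + 1"] by simp
    next
      case False
      then have pos: "0 < real d - 1" using d by simp
      then have "q < real d / (real d - 1)" using q by (simp add: pos_less_divide_eq)
      then obtain q1 where "q < q1" "q1 < real d / (real d - 1)" using dense by blast
      then show ?thesis using that[of q1] pos by (simp add: pos_less_divide_eq)
    qed
    show ?thesis by (rule absolutely_continuous[where v = v, OF card q(1) q1 _ True]) (rule v)
  next
    case False
    show ?thesis unfolding AC_q_def
    \<comment> \<open>In this case the distance vanishes identically, so the speed 0 will
      do.\<close>
    proof (intro exI[of _ "\<lambda>_. 0"] conjI allI impI)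
      fix s t :: real assume "0 \<le> s" "s \<le> t" "t \<le> 1"
      then have "s \<in> {0..1}" by auto
      then show "Wq q (mu_p d (P s)) (mu_p d (P t)) \<le> (LBINT \<tau>=s..t. 0)"
        using Wq_eq_0[OF card d v q(1) False] by simp
    qed (use q in \<open>auto simp: set_integrable_def\<close>)
  qed
qed

end
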